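(* Let $\zeta=e^{2\pi i/3}$, $J=\begin{pmatrix}0&0&1\\0&1&0\\1&0&0\end{pmatrix}$, $\Gamma(1)=\{g\in\mathrm{SL}_3(\mathbb{Z}[\zeta]) : \bar g^tJg=J\}$, $\Gamma(\sqrt{-3})=\{g\in\Gamma(1): g\equiv I_3\bmod\sqrt{-3}\}$, $\Upsilon=\{(g_{i,j})\in\Gamma(\sqrt{-3}) : g_{1,1}\equiv 1\bmod 3\}$, and for $(a,b,c,d)\in\{0,1,2\}^4$ let $\Upsilon_{\mathrm{index}\,3}(a,b,c,d)=\{g\in\Upsilon : a g_{1,2}+b g_{1,3}+c g_{2,1}+d g_{3,1}\equiv 0\bmod 3\}$. For each of the twelve vectors \[v\in\{(0,0,1,0),(0,0,1,1),(0,0,1,2),(0,1,1,0),(0,1,2,0),(1,0,0,0),(1,0,0,1),(1,0,0,2),(1,1,0,0),(1,1,2,2),(1,2,0,0),(1,2,2,1)\}\] there exists a non-zero holomorphic modular form of weight $\frac13$ and level $\Upsilon_{\mathrm{index}\,3}(v)$, i.e. a non-zero holomorphic function $f:\mathcal H\to\mathbb{C}$ and a multiplier system $\ell$ of weight $\frac13$ on $\Upsilon_{\mathrm{index}\,3}(v)$ such that $f(\gamma*\tau)=\ell(\gamma,\tau)f(\tau)$ for all $\gamma\in\Upsilon_{\mathrm{index}\,3}(v)$ and $\tau\in\mathcal H$.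
   Context: $\mathrm{SU}(2,1)=\{g\in\mathrm{SL}_3(\mathbb{C}):\bar g^tJg=J\}$, $\mathcal{H}=\{\tau=(\tau_1,\tau_2)^t\in\mathbb{C}^2:2\mathrm{Re}\tau_1+|\tau_2|^2<0\}$; for $g=\begin{pmatrix}A&B\\ C&D\end{pmatrix}$ ($A$ a $2\times2$ block, $D$ scalar), $g*\tau=(C\tau+D)^{-1}(A\tau+B)$ and $j(g,\tau)=C\tau+D$. A multiplier system of weight $\frac ab$ ($b>0$) on an arithmetic subgroup $\Gamma$ is a map $\ell:\Gamma\times\mathcal H\to\mathbb{C}^\times$ with $\ell(gh,\tau)=\ell(g,h*\tau)\ell(h,\tau)$, $\ell(g,\tau)^b=\chi(g)j(g,\tau)^a$ for some function $\chi:\Gamma\to\mathbb{C}^\times$, and $\tau\mapsto\ell(g,\tau)$ continuous for each $g$. Congruences are in $\mathbb{Z}[\zeta]$. *)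

theory Defs
  imports "HOL-Analysis.Analysis"
begin

definition zeta3 :: complex where
  "zeta3 = exp (2 * of_real pi * \<i> / 3)"

definition eisenstein :: "complex set" where
  "eisenstein = {of_int m + of_int n * zeta3 | m n. True}"

definition eis_cong :: "complex \<Rightarrow> complex \<Rightarrow> complex \<Rightarrow> bool" where
  "eis_cong m x y \<longleftrightarrow> (\<exists>z\<in>eisenstein. x - y = m * z)"

definition sqrt_m3 :: complex where
  "sqrt_m3 = \<i> * of_real (sqrt 3)"

definition herm_J :: "complex^3^3" where
  "herm_J = vector [vector [0, 0, 1],
               vector [0, 1, 0],
               vector [1, 0, 0]]"

definition conj_mat :: "complex^'n^'m \<Rightarrow> complex^'n^'m" where
  "conj_mat g = (\<chi> i j. cnj (g $ i $ j))"

definition SU21 :: "(complex^3^3) set" where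
  "SU21 = {g. det g = 1 \<and> transpose (conj_mat g) ** herm_J ** g = herm_J}"

definition Gamma1 :: "(complex^3^3) set" where
  "Gamma1 = {g \<in> SU21. \<forall>i j. g $ i $ j \<in> eisenstein}"

definition Gamma_sqrt_m3 :: "(complex^3^3) set" where
  "Gamma_sqrt_m3 = {g \<in> Gamma1. \<forall>i j. eis_cong sqrt_m3 (g $ i $ j) (mat 1 $ i $ j)}"

definition Upsilon :: "(complex^3^3) set" where
  "Upsilon = {g \<in> Gamma_sqrt_m3. eis_cong 3 (g $ 1 $ 1) 1}"

definition Upsilon_index3 :: "nat \<Rightarrow> nat \<Rightarrow> nat \<Rightarrow> nat \<Rightarrow> (complex^3^3) set" where
  "Upsilon_index3 a b c d = {g \<in> Upsilon.
     eis_cong 3 (of_nat a * g $ 1 $ 2 + of_nat b * g $ 1 $ 3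
               + of_nat c * g $ 2 $ 1 + of_nat d * g $ 3 $ 1) 0}"

definition siegel_domain :: "(complex^2) set" where
  "siegel_domain = {\<tau>. 2 * Re (\<tau> $ 1) + (cmod (\<tau> $ 2))\<^sup>2 < 0}"

definition jfac :: "complex^3^3 \<Rightarrow> complex^2 \<Rightarrow> complex" where
  "jfac g \<tau> = g $ 3 $ 1 * \<tau> $ 1 + g $ 3 $ 2 * \<tau> $ 2 + g $ 3 $ 3"

definition act :: "complex^3^3 \<Rightarrow> complex^2 \<Rightarrow> complex^2" where
  "act g \<tau> = inverse (jfac g \<tau>) *s
     vector [g $ 1 $ 1 * \<tau> $ 1 + g $ 1 $ 2 * \<tau> $ 2 + g $ 1 $ 3,
             g $ 2 $ 1 * \<tau> $ 1 + g $ 2 $ 2 * \<tau> $ 2 + g $ 2 $ 3]"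

text \<open>The pair \<open>a\<close>, \<open>b\<close> encodes the rational weight \<open>a/b\<close>. The set \<open>\<Gamma>\<close> is meant to be an
  arithmetic subgroup of \<^term>\<open>SU21\<close>; the values of \<open>l\<close> off \<open>\<Gamma> \<times> siegel_domain\<close> are irrelevant.\<close>

definition multiplier_system ::
  "int \<Rightarrow> nat \<Rightarrow> (complex^3^3) set \<Rightarrow> (complex^3^3 \<Rightarrow> complex^2 \<Rightarrow> complex) \<Rightarrow> bool" where
  "multiplier_system a b \<Gamma> l \<longleftrightarrow>
     b > 0 \<and>
     (\<forall>g\<in>\<Gamma>. \<forall>\<tau>\<in>siegel_domain. l g \<tau> \<noteq> 0) \<and>
     (\<forall>g\<in>\<Gamma>. \<forall>h\<in>\<Gamma>. \<forall>\<tau>\<in>siegel_domain. l (g ** h) \<tau> = l g (act h \<tau>) * l h \<tau>) \<and>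
     (\<exists>chi :: complex^3^3 \<Rightarrow> complex. (\<forall>g\<in>\<Gamma>. chi g \<noteq> 0) \<and>
        (\<forall>g\<in>\<Gamma>. \<forall>\<tau>\<in>siegel_domain. l g \<tau> ^ b = chi g * jfac g \<tau> powi a)) \<and>
     (\<forall>g\<in>\<Gamma>. continuous_on siegel_domain (l g))"

text \<open>Holomorphy in two variables as Frechet differentiability with a complex-linear derivative;
  \<^const>\<open>has_derivative\<close> alone only gives real linearity.\<close>

definition holomorphic2_on :: "(complex^2 \<Rightarrow> complex) \<Rightarrow> (complex^2) set \<Rightarrow> bool" where
  "holomorphic2_on f S \<longleftrightarrow>
     (\<forall>\<tau>\<in>S. \<exists>f'. (f has_derivative f') (at \<tau> within S) \<and> (\<forall>c v. f' (c *s v) = c * f' v))"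

definition holomorphic_modular_form ::
  "int \<Rightarrow> nat \<Rightarrow> (complex^3^3) set \<Rightarrow> (complex^2 \<Rightarrow> complex) \<Rightarrow> bool" where
  "holomorphic_modular_form a b \<Gamma> f \<longleftrightarrow>
     holomorphic2_on f siegel_domain \<and>
     (\<exists>l. multiplier_system a b \<Gamma> l \<and>
        (\<forall>g\<in>\<Gamma>. \<forall>\<tau>\<in>siegel_domain. f (act g \<tau>) = l g \<tau> * f \<tau>))"

end

theory Submission
  imports Defs "HOL-Complex_Analysis.Complex_Analysis" "HOL-Probability.Distributions"
begin

(* Otherwise every component access of a vector is ambiguous and parsing takes exponential time. *)
no_notation fps_nth (infixl "$" 75)

text \<open>
  The forms are cube roots of linear combinations of weight one theta functions. Sum the translates
  of the sigma function of the lattice of Eisenstein integers against Gaussian weights to obtain a theta function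
  \<open>theta3 v\<close> on the domain for each characteristic \<open>v\<close>; Poisson summation shows that the integral
  unitary group permutes these functions up to constants and the factor \<open>j\<close>. On \<open>\<Gamma>(\<surd>-3)\<close> each
  \<open>u / \<surd>-3\<close> is fixed modulo the lattice, so \<open>theta3 (u / \<surd>-3)\<close> has weight one with a cubic character.

  For \<open>u\<close> among \<open>(0,1,1), (0,-1,1), (1,0,-1)\<close> the three functions satisfy \<open>f1^3 + f2^3 + f3^3 = 0\<close>,
  a consequence of a product identity for the sigma function, and have no common zero: by reduction theory it suffices to
  look where the leading terms dominate. Hence \<open>(f1 + w f2) * (f1 + w \<zeta> f2) * (f1 + w \<zeta>\<^sup>2 f2) = (-f3)^3\<close>
  with \<open>w^3 = 1\<close>, where the factors have no common zeros, so every zero of \<open>f1 + w f2\<close> has multiplicity divisible by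
  three and it has a holomorphic cube root on the convex domain. This root has weight \<open>1/3\<close> on the subgroup
  where the characters of \<open>f1\<close> and \<open>f2\<close> agree. Translating the triple by \<open>1\<close>, \<open>J\<close> and two more
  elements of the lattice group gives four triples, and the twelve pairs give the twelve subgroups.
\<close>

section \<open>Holomorphy of infinite sums\<close>

text \<open>The vectors \<open>u\<close> count only modulo \<open>sqrt_m3\<close> and up to sign.
  There the hermitian form becomes 2xz + y^2 over the field with three elements. It has six pairs of
  vectors of norm one and four isotropic lines, and a triple consists of the norm one vectors not
  orthogonal to a given line. On \<open>Upsilon\<close> the cubic character attached to u = (x, y,
  z) is \<open>rho\<close> of a combination of the entries 12, 13, 21, 31 of (g - 1) / sqrt (-3),
  with coefficients (2yz, z^2, 2xy, x^2). Differences of these coefficient vectors inside a triple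
  are, up to sign and modulo 3, the vectors of the theorem. The cubic relation alone is compatible
  with a common zero of its three members, so excluding one is an analytic matter: this is the
  origin of the numerical bounds for the sigma function and of the height 9/10. The sigma function
  is used both as a series over the integers, which is good for bounds, and as a sum over the whole
  lattice, which shows its symmetries and makes the theta function a double sum open to Poisson
  summation.\<close>

lemma holomorphic_on_infsum:
  fixes f :: "'i \<Rightarrow> complex \<Rightarrow> complex"
  assumes "open S" and hol: "\<And>i. i \<in> X \<Longrightarrow> f i holomorphic_on S"
    and loc: "\<And>z. z \<in> S \<Longrightarrow> \<exists>r>0. \<exists>M. cball z r \<subseteq> S \<and> M summable_on X \<and>
                 (\<forall>i\<in>X. \<forall>w\<in>cball z r. norm (f i w) \<le> M i)"
  shows "(\<lambda>z. \<Sum>\<^sub>\<infinity>i\<in>X. f i z) holomorphic_on S"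
proof -
  have "(\<lambda>z. \<Sum>\<^sub>\<infinity>i\<in>X. f i z) field_differentiable (at z)" if zS: "z \<in> S" for z
  proof -
    obtain r M where r: "r > 0" "cball z r \<subseteq> S" "M summable_on X"
      and M: "\<And>i w. i \<in> X \<Longrightarrow> w \<in> cball z r \<Longrightarrow> norm (f i w) \<le> M i"
      using loc[OF zS] by blast
    have u: "uniform_limit (cball z r) (\<lambda>F w. \<Sum>i\<in>F. f i w) (\<lambda>w. \<Sum>\<^sub>\<infinity>i\<in>X. f i w) (finite_subsets_at_top X)"
      by (rule Weierstrass_m_test_general[OF _ r(3)]) (use M in auto)
    have ev: "\<forall>\<^sub>F F in finite_subsets_at_top X. continuous_on (cball z r) (\<lambda>w. \<Sum>i\<in>F. f i w) \<and>
        (\<lambda>w. \<Sum>i\<in>F. f i w) holomorphic_on ball z r"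
    proof (rule eventually_finite_subsets_at_top_weakI)
      fix F assume "finite F" "F \<subseteq> X"
      hence "(\<lambda>w. \<Sum>i\<in>F. f i w) holomorphic_on S" by (intro holomorphic_on_sum hol) auto
      thus "continuous_on (cball z r) (\<lambda>w. \<Sum>i\<in>F. f i w) \<and> (\<lambda>w. \<Sum>i\<in>F. f i w) holomorphic_on ball z r"
        using r ball_subset_cball by (meson holomorphic_on_imp_continuous_on holomorphic_on_subset subset_trans)
    qed
    have "(\<lambda>w. \<Sum>\<^sub>\<infinity>i\<in>X. f i w) holomorphic_on ball z r"
      by (rule holomorphic_uniform_limit[OF ev u finite_subsets_at_top_neq_bot]) auto
    thus ?thesis using r(1) by (simp add: holomorphic_on_open field_differentiable_def)
  qed
  thus ?thesis using \<open>open S\<close> by (simp add: holomorphic_on_def field_differentiable_at_within)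
qed

text \<open>Cauchy's inequality bounds the second derivative on the disc of radius 1/2 by 8 * M, and
  Taylor's formula does the rest. Both constants depend only on the sup bound \<open>M\<close>, so
  the estimates can be added over a summable family of functions.\<close>

lemma first_order_remainder_bound:
  fixes g :: "complex \<Rightarrow> complex"
  assumes g: "g holomorphic_on ball 0 2" and M: "\<And>t. cmod t < 2 \<Longrightarrow> cmod (g t) \<le> M" and t: "cmod t \<le> 1/2"
  shows "cmod (g t - g 0 - t * deriv g 0) \<le> 8 * M * (cmod t)\<^sup>2" and "cmod (deriv g 0) \<le> M"
proof -
  have C: "norm ((deriv ^^ n) g w) \<le> fact n * M / r ^ n"
    if "cmod w + r < 2" "r > 0" for w r n
  proof (rule Cauchy_inequality)
    have "dist 0 x < 2" if "dist w x \<le> r" for x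
      using that \<open>cmod w + r < 2\<close> dist_triangle[of 0 x w] by simp
    hence sub: "cball w r \<subseteq> ball 0 2" by (auto simp: dist_commute)
    thus "g holomorphic_on ball w r" using g ball_subset_cball holomorphic_on_subset by blast
    show "continuous_on (cball w r) g"
      using sub g by (meson holomorphic_on_imp_continuous_on holomorphic_on_subset)
    show "norm (g x) \<le> M" if "norm (w - x) = r" for x
    proof -
      have "x \<in> cball w r" using that by (simp add: dist_norm)
      hence "x \<in> ball 0 2" using sub by blast
      thus ?thesis by (intro M) (simp add: dist_norm)
    qed
  qed (use that in auto)
  show "cmod (deriv g 0) \<le> M" using C[of 0 1 1] by simp
  have d: "(((deriv ^^ i) g) has_field_derivative (deriv ^^ Suc i) g x) (at x within ball 0 1)"
    if "x \<in> ball 0 1" for i x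
  proof -
    have "(deriv ^^ i) g holomorphic_on ball 0 2" by (intro holomorphic_higher_deriv g) auto
    moreover have "x \<in> ball 0 2" using that by auto
    ultimately show ?thesis
      using holomorphic_derivI[of "(deriv ^^ i) g" "ball 0 2" x] by (simp add: has_field_derivative_at_within)
  qed
  have "cmod ((deriv ^^ 0) g t - (\<Sum>i\<le>1. (deriv ^^ i) g 0 * (t - 0) ^ i / fact i)) \<le> (8 * M) * cmod (t - 0) ^ Suc 1 / fact 1"
  proof (rule complex_Taylor[where S = "cball 0 (1/2)"])
    show "((deriv ^^ i) g has_field_derivative (deriv ^^ Suc i) g x) (at x within cball 0 (1/2))"
      if "x \<in> cball 0 (1/2)" "i \<le> 1" for i x
      by (rule has_field_derivative_subset[OF d]) (use that in auto)
    show "cmod ((deriv ^^ Suc 1) g x) \<le> 8 * M" if "x \<in> cball 0 (1/2)" for x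
      using C[of x "1/2" 2] that by (simp add: power2_eq_square numeral_2_eq_2)
  qed (use t in auto)
  thus "cmod (g t - g 0 - t * deriv g 0) \<le> 8 * M * (cmod t)\<^sup>2"
    by (simp add: algebra_simps power2_eq_square)
qed

text \<open>On each complex line through \<open>z\<close> a term is a function of one variable, so
  its first order remainder is controlled by its sup bound \<open>M i\<close>. These bounds are
  summable, hence the sum of the derivatives is the derivative of the sum, and it inherits complex
  linearity.\<close>

lemma holomorphic2_on_infsum:
  fixes f :: "'i \<Rightarrow> complex^2 \<Rightarrow> complex"
  assumes "open S" and hol: "\<And>i. i \<in> X \<Longrightarrow> holomorphic2_on (f i) S"
    and loc: "\<And>z. z \<in> S \<Longrightarrow> \<exists>r>0. \<exists>M. cball z r \<subseteq> S \<and> M summable_on X \<and>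
                 (\<forall>i\<in>X. \<forall>w\<in>cball z r. norm (f i w) \<le> M i)"
  shows "holomorphic2_on (\<lambda>z. \<Sum>\<^sub>\<infinity>i\<in>X. f i z) S"
  unfolding holomorphic2_on_def
proof
  fix z assume z: "z \<in> S"
  obtain r M where r: "r > 0" "cball z r \<subseteq> S" "M summable_on X"
    and M: "\<And>i w. i \<in> X \<Longrightarrow> w \<in> cball z r \<Longrightarrow> norm (f i w) \<le> M i"
    using loc[OF z] by blast
  define D where "D = (\<lambda>i. SOME f'. (f i has_derivative f') (at z) \<and> (\<forall>c v. f' (c *s v) = c * f' v))"
  have at: "at w within S = at w" if "w \<in> S" for w using \<open>open S\<close> that by (rule at_within_open[rotated])
  have D: "(f i has_derivative D i) (at z)" "D i (c *s v) = c * D i v" if "i \<in> X" for i c v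
    using someI_ex[of "\<lambda>f'. (f i has_derivative f') (at z) \<and> (\<forall>c v. f' (c *s v) = c * f' v)"]
      hol[OF that] z at unfolding holomorphic2_on_def D_def by (metis (no_types, lifting))+
  have vs: "norm (t *s u) = cmod t * norm u" for t :: complex and u :: "complex^2"
    by (simp add: norm_vec_def L2_set_def norm_mult power_mult_distrib real_sqrt_mult distrib_left[symmetric] sum_2)
  have main: "cmod (f i (z + h) - f i z - D i h) \<le> (32 * M i / r\<^sup>2) * (norm h)\<^sup>2" 
     "cmod (D i h) \<le> (2 * M i / r) * norm h"
    if i: "i \<in> X" and h: "norm h \<le> r / 4" for i h
  proof (atomize (full), cases "h = 0")
    case True
    have "D i 0 = 0" using D(2)[OF i, of 0 0] by simp
    thus "cmod (f i (z + h) - f i z - D i h) \<le> (32 * M i / r\<^sup>2) * (norm h)\<^sup>2 \<and> 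
     cmod (D i h) \<le> (2 * M i / r) * norm h" using True by simp
  next
    case False
    \<comment> \<open>The increment is rescaled to length \<open>r / 2\<close>: for |t| < 2 the
      point \<open>z + t *s e\<close> stays in the ball of radius \<open>r\<close>, and
      \<open>h\<close> itself is reached at |t| = 2 |h| / r, at most 1/2.\<close>
    define e where "e = (of_real (r / (2 * norm h)) :: complex) *s h"
    have ne: "norm e = r / 2" using False r(1) by (simp add: e_def vs norm_mult norm_divide)
    define g where "g = (\<lambda>t. f i (z + t *s e))"
    have inb: "z + t *s e \<in> cball z r" if "cmod t < 2" for t
      using that r(1) by (simp add: dist_norm vs ne)
    have lin: "((\<lambda>t. z + t *s e) has_derivative (\<lambda>t. t *s e)) (at t)" for t
    proof -
      have "bounded_linear (\<lambda>t::complex. t *s e)"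
        by (intro bounded_linear_intro[where K = "norm e"]) (auto simp: vs vec_eq_iff algebra_simps)
      from bounded_linear_imp_has_derivative[OF this] show ?thesis by (auto intro!: derivative_eq_intros)
    qed
    have gd: "\<exists>L. (g has_derivative L) (at t) \<and> (\<forall>c v. L (c * v) = c * L v)" if "cmod t < 2" for t
    proof -
      have S: "z + t *s e \<in> S" using inb[OF that] r(2) by blast
      obtain L where L: "(f i has_derivative L) (at (z + t *s e))" "\<And>c v. L (c *s v) = c * L v"
        using hol[OF i] S at unfolding holomorphic2_on_def by metis
      have "(g has_derivative (\<lambda>t. L (t *s e))) (at t)"
        unfolding g_def using has_derivative_compose[OF lin L(1)] .
      thus ?thesis using L(2) by (intro exI[of _ "\<lambda>t. L (t *s e)"]) (metis vector_smult_assoc)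
    qed
    have "g field_differentiable at t" if ct: "cmod t < 2" for t
    proof -
      obtain L where L: "(g has_derivative L) (at t)" "\<And>c v. L (c * v) = c * L v" using gd[OF ct] by blast
      have "L x = L 1 * x" for x using L(2)[of x 1] by (simp add: mult.commute)
      hence "L = (*) (L 1)" by blast
      thus ?thesis using L(1) by (metis field_differentiable_def has_field_derivative_def)
    qed
    hence gh: "g holomorphic_on ball 0 2" by (auto simp: holomorphic_on_def field_differentiable_at_within)
    have "(g has_derivative (\<lambda>t. D i (t *s e))) (at 0)"
      unfolding g_def using has_derivative_compose[OF lin, of "f i" "D i" 0] D(1)[OF i] by simp
    moreover have "(\<lambda>t. D i (t *s e)) = (*) (D i e)" using D(2)[OF i] by (auto simp: mult.commute)
    ultimately have dg: "deriv g 0 = D i e" by (simp add: has_field_derivative_def DERIV_imp_deriv)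
    define t where "t = (of_real (2 * norm h / r) :: complex)"
    have t: "cmod t = 2 * norm h / r" using r(1) by (simp add: t_def norm_mult norm_divide)
    have te: "t *s e = h" using False r(1) by (simp add: t_def e_def vec_eq_iff field_simps)
    have b: "cmod t \<le> 1/2" unfolding t using h r(1) by (simp add: field_simps)
    have gM: "cmod (g t) \<le> M i" if "cmod t < 2" for t using M[OF i inb[OF that]] by (simp add: g_def)
    have gt: "g t = f i (z + h)" "g 0 = f i z" "t * D i e = D i h"
      using te D(2)[OF i, of t e] by (auto simp: g_def)
    have "cmod (g t - g 0 - t * deriv g 0) \<le> 8 * M i * (cmod t)\<^sup>2" "cmod (deriv g 0) \<le> M i"
      by (rule first_order_remainder_bound[OF gh gM b]; assumption)+
    note 1 = this
    have "cmod (D i h) = cmod t * cmod (D i e)" using gt(3) by (metis norm_mult)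
    also have "\<dots> \<le> cmod t * M i" using 1(2) dg by (simp add: mult_left_mono)
    finally show "cmod (f i (z + h) - f i z - D i h) \<le> (32 * M i / r\<^sup>2) * (norm h)\<^sup>2 \<and> 
     cmod (D i h) \<le> (2 * M i / r) * norm h" using 1(1) unfolding dg gt t by (simp add: power_divide mult_ac)
  qed
  \<comment> \<open>The bound on the derivatives is available for short increments; complex
    linearity carries the summability to every \<open>h\<close> by scaling.\<close>
  have Dsum: "(\<lambda>i. norm (D i h)) summable_on X" for h
  proof (cases "h = 0")
    case True
    have "D i h = 0" if "i \<in> X" for i using D(2)[OF that, of 0 0] True by simp
    thus ?thesis using summable_on_cong[of X "\<lambda>i. norm (D i h)" "\<lambda>_. 0"] by simp
  next
    case False
    define t where "t = (of_real (r / (4 * norm h)) :: complex)"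
    have t: "t \<noteq> 0" "norm (t *s h) \<le> r / 4" using False r(1) by (auto simp: t_def vs norm_mult norm_divide)
    have "(\<lambda>i. (2 * M i / r) * norm (t *s h)) summable_on X"
      using summable_on_cmult_left[OF r(3), of "2 / r * norm (t *s h)"] by (simp add: mult_ac)
    hence "(\<lambda>i. norm (D i (t *s h))) summable_on X"
      by (rule Infinite_Sum.abs_summable_on_comparison_test') (use main(2)[OF _ t(2)] in auto)
    hence "(\<lambda>i. cmod t * norm (D i h)) summable_on X"
      by (rule summable_on_cong[THEN iffD1, rotated]) (simp add: D(2) norm_mult)
    thus ?thesis using t(1) by (simp add: summable_on_cmult_right')
  qed
  have fsum: "(\<lambda>i. norm (f i w)) summable_on X" if "w \<in> cball z r" for w
    by (rule Infinite_Sum.abs_summable_on_comparison_test'[OF r(3)]) (use M that in auto)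
  define L where "L = (\<lambda>h. \<Sum>\<^sub>\<infinity>i\<in>X. D i h)"
  have Ds: "(\<lambda>i. D i h) summable_on X" for h by (rule Infinite_Sum.abs_summable_summable[OF Dsum])
  have Llin: "L (c *s v) = c * L v" for c v
    unfolding L_def infsum_cmult_right'[symmetric] by (rule infsum_cong) (simp add: D(2))
  have Ladd: "L (u + v) = L u + L v" for u v
  proof -
    have "L (u + v) = (\<Sum>\<^sub>\<infinity>i\<in>X. D i u + D i v)" unfolding L_def
      by (rule infsum_cong) (simp add: linear_add[OF has_derivative_linear[OF D(1)]])
    thus ?thesis unfolding L_def by (simp add: infsum_add Ds)
  qed
  define K where "K = (\<Sum>\<^sub>\<infinity>i\<in>X. M i)"
  have Mpos: "M i \<ge> 0" if "i \<in> X" for i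
    by (rule order_trans[OF norm_ge_zero M[OF that, of z]]) (use r(1) in simp)
  have rem: "cmod ((\<Sum>\<^sub>\<infinity>i\<in>X. f i (z + h)) - (\<Sum>\<^sub>\<infinity>i\<in>X. f i z) - L h) \<le> 32 * K / r\<^sup>2 * (norm h)\<^sup>2"
    if h: "norm h \<le> r / 4" for h
  proof -
    have 1: "z + h \<in> cball z r" "z \<in> cball z r" using h r(1) by (auto simp: dist_norm)
    have s: "(\<lambda>i. f i (z + h)) summable_on X" "(\<lambda>i. f i z) summable_on X" by (rule Infinite_Sum.abs_summable_summable[OF fsum]; rule 1)+
    have hs: "((\<lambda>i. f i (z + h) - f i z - D i h) has_sum ((\<Sum>\<^sub>\<infinity>i\<in>X. f i (z + h)) - (\<Sum>\<^sub>\<infinity>i\<in>X. f i z) - L h)) X"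
      unfolding L_def diff_conv_add_uminus by (intro has_sum_add has_sum_uminusI has_sum_infsum s Ds)
    have ms: "((\<lambda>i. 32 * M i / r\<^sup>2 * (norm h)\<^sup>2) has_sum (32 * K / r\<^sup>2 * (norm h)\<^sup>2)) X"
      using has_sum_cmult_left[OF has_sum_infsum[OF r(3)], of "32 / r\<^sup>2 * (norm h)\<^sup>2"] by (simp add: K_def mult_ac)
    show ?thesis by (rule norm_infsum_le[OF hs ms]) (use main(1)[OF _ h] in auto)
  qed
  have Lscale: "L (c *\<^sub>R v) = c *\<^sub>R L v" for c v
  proof -
    have "c *\<^sub>R v = of_real c *s v" by (simp add: vec_eq_iff) (simp add: scaleR_conv_of_real)
    thus ?thesis using Llin by (simp add: scaleR_conv_of_real)
  qed
  have bl: "bounded_linear L"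
  proof -
    have "linear L" by (rule linearI) (simp_all add: Ladd Lscale)
    thus ?thesis by (rule linear_conv_bounded_linear[THEN iffD1])
  qed
  have der: "((\<lambda>z. \<Sum>\<^sub>\<infinity>i\<in>X. f i z) has_derivative L) (at z)"
    unfolding has_derivative_at
  proof (intro conjI bl)
    have K0: "K \<ge> 0" unfolding K_def by (intro infsum_nonneg Mpos)
    have ev: "\<forall>\<^sub>F h in at 0. norm (h::complex^2) \<le> r / 4"
      unfolding eventually_at using r(1) by (intro exI[of _ "r/4"]) (auto simp: dist_norm)
    show "(\<lambda>h. norm ((\<Sum>\<^sub>\<infinity>i\<in>X. f i (z + h)) - (\<Sum>\<^sub>\<infinity>i\<in>X. f i z) - L h) / norm h) \<midarrow>0\<rightarrow> 0"
    proof (rule tendsto_sandwich[OF _ _ tendsto_const])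
      show "\<forall>\<^sub>F h in at 0. norm ((\<Sum>\<^sub>\<infinity>i\<in>X. f i (z + h)) - (\<Sum>\<^sub>\<infinity>i\<in>X. f i z) - L h) / norm h \<le> 32 * K / r\<^sup>2 * norm h"
        using ev
      proof eventually_elim
        case (elim h)
        thus ?case using rem[OF elim] by (cases "h = 0") (auto simp: divide_le_eq power2_eq_square mult_ac)
      qed
      show "(\<lambda>h. 32 * K / r\<^sup>2 * norm (h::complex^2)) \<midarrow>0\<rightarrow> 0"
        by (intro tendsto_mult_right_zero tendsto_norm_zero tendsto_ident_at)
    qed auto
  qed
  show "\<exists>f'. ((\<lambda>z. \<Sum>\<^sub>\<infinity>i\<in>X. f i z) has_derivative f') (at z within S) \<and> (\<forall>c v. f' (c *s v) = c * f' v)"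
    using der Llin at[OF z] by auto
qed

section \<open>Uniqueness for quasi-periodic entire functions\<close>

abbreviation unit_integral :: "(complex \<Rightarrow> complex) \<Rightarrow> complex" where
  "unit_integral \<equiv> contour_integral (linepath 0 1)"

lemma unit_integral_primitive:
  assumes "\<And>z. (P has_field_derivative h z) (at z)"
  shows "unit_integral h = P 1 - P 0"
  using contour_integral_primitive[of UNIV P h "linepath 0 1"] assms
  by (intro contour_integral_unique) auto

lemma entire_primitive:
  fixes h :: "complex \<Rightarrow> complex"
  assumes "h holomorphic_on UNIV"
  obtains P where "\<And>z. (P has_field_derivative h z) (at z)"
  using holomorphic_convex_primitive'[of UNIV h] assms by auto

lemma entire_integrable: "h holomorphic_on UNIV \<Longrightarrow> h contour_integrable_on linepath a b"
  by (rule contour_integrable_continuous_linepath)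
     (meson holomorphic_on_imp_continuous_on continuous_on_subset subset_UNIV)

lemma entire_shift:
  assumes "h holomorphic_on UNIV"
  shows "(\<lambda>z. h (z + a)) holomorphic_on UNIV"
proof -
  have "(\<lambda>z. z + a) holomorphic_on UNIV" by (intro holomorphic_intros)
  from holomorphic_on_compose[OF this, of h] show ?thesis
    using holomorphic_on_subset[OF assms] by (simp add: o_def)
qed

text \<open>A primitive of a periodic entire function grows by the same constant over every period.
  This is the contour shift for complex \<open>a\<close>, obtained without a rectangle.\<close>

lemma unit_integral_shift:
  assumes h: "h holomorphic_on UNIV" and per: "\<And>z. h (z + 1) = h z"
  shows "unit_integral (\<lambda>z. h (z + a)) = unit_integral h"
proof -
  obtain P where P: "\<And>z. (P has_field_derivative h z) (at z)" using entire_primitive[OF h] by blast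
  have sh: "((\<lambda>z. P (z + a)) has_field_derivative h (z + a)) (at z)" for z a
    using DERIV_shift[THEN iffD1, OF P] .
  have "((\<lambda>z. P (z + 1) - P z) has_field_derivative 0) (at z)" for z
    using DERIV_diff[OF sh[of 1 z] P[of z]] by (simp add: per)
  then obtain c where c: "\<And>z. P (z + 1) - P z = c"
    using has_field_derivative_zero_constant[of UNIV "\<lambda>z. P (z + 1) - P z"] by auto
  have "unit_integral (\<lambda>z. h (z + a)) = P (1 + a) - P (0 + a)"
    by (rule unit_integral_primitive) (rule sh)
  also have "\<dots> = P 1 - P 0" using c[of a] c[of 0] by (simp add: add.commute)
  finally show ?thesis using unit_integral_primitive[OF P] by simp
qed

lemma unit_integral_bound:
  assumes "h holomorphic_on UNIV" "\<And>z. z \<in> closed_segment 0 1 \<Longrightarrow> cmod (h z) \<le> B"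
  shows "cmod (unit_integral h) \<le> B"
proof -
  have "0 \<le> B" using assms(2)[of 0] norm_ge_zero order_trans by blast
  thus ?thesis using contour_integral_bound_linepath[OF entire_integrable[OF assms(1)], of B 0 1] assms(2) by simp
qed

lemma unit_integral_exp:
  "unit_integral (\<lambda>z. exp (2 * of_real pi * \<i> * of_int n * z)) = (if n = 0 then 1 else 0)"
proof (cases "n = 0")
  case True
  thus ?thesis using unit_integral_primitive[of "\<lambda>z. z" "\<lambda>_. 1"] by simp
next
  case False
  define k where "k = 2 * of_real pi * \<i> * (of_int n :: complex)"
  have k: "k \<noteq> 0" using False by (simp add: k_def)
  have "unit_integral (\<lambda>z. exp (k * z)) = exp (k * 1) / k - exp (k * 0) / k"
    by (rule unit_integral_primitive) (use k in \<open>auto intro!: derivative_eq_intros\<close>)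
  moreover have "exp k = 1" unfolding k_def by (subst exp_eq_1) (auto intro!: exI[of _ n])
  ultimately show ?thesis using False by (simp add: k_def)
qed

lemma periodic_of_int:
  assumes "\<And>z::complex. h (z + 1) = (h z :: 'b)"
  shows "h (z + of_int n) = h z"
proof (induction n rule: int_induct[where k = 0])
  case base show ?case by simp
next
  case (step1 i) thus ?case using assms[of "z + of_int i"] by (simp add: add.assoc)
next
  case (step2 i) thus ?case using assms[of "z + of_int (i - 1)"] by (simp add: add.assoc)
qed

text \<open>The divisor vanishes exactly at the points \<open>z0 + n\<close>, to first order, and
  \<open>h - h z0\<close> vanishes there by periodicity, so all singularities of the quotient are
  removable.\<close>

lemma periodic_quotient:
  assumes h: "h holomorphic_on UNIV" and per: "\<And>z. h (z + 1) = h z"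
  obtains k where "k holomorphic_on UNIV" "\<And>z. k (z + 1) = k z"
    "\<And>z. h z - h z0 = (exp (2 * of_real pi * \<i> * (z - z0)) - 1) * k z"
proof -
  define E where "E = (\<lambda>z. exp (2 * of_real pi * \<i> * (z - z0)))"
  have Eper: "E (z + 1) = E z" for z
    using exp_plus_2pin[of "2 * of_real pi * \<i> * (z - z0)" 1] by (simp add: E_def algebra_simps)
  define k where "k = (\<lambda>z. if E z = 1 then deriv h z / (2 * of_real pi * \<i>) else (h z - h z0) / (E z - 1))"
  have E1: "\<exists>n::int. z = z0 + of_int n" if "E z = 1" for z
  proof -
    have "Re (2 * of_real pi * \<i> * (z - z0)) = 0 \<and>
        (\<exists>n::int. Im (2 * of_real pi * \<i> * (z - z0)) = of_int (2 * n) * pi)"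
      using that unfolding E_def exp_eq_1 .
    then obtain n :: int where n: "2 * pi * (Im z - Im z0) = 0" "2 * pi * (Re z - Re z0) = of_int (2 * n) * pi"
      by auto
    have "pi * (2 * (Re z - Re z0 - of_int n)) = 0" using n(2) by (simp add: algebra_simps)
    hence "Re z = Re z0 + of_int n" by simp
    thus ?thesis using n(1) by (auto simp: complex_eq_iff)
  qed
  have hd: "h field_differentiable at z" for z using h by (auto simp: holomorphic_on_def)
  have hol1: "(\<lambda>z. (h z - h z0) / (E z - 1)) holomorphic_on A" if "\<And>z. z \<in> A \<Longrightarrow> E z \<noteq> 1" for A
    using that unfolding E_def by (intro holomorphic_intros holomorphic_on_subset[OF h]) auto
  have cE: "continuous_on UNIV E" unfolding E_def by (intro continuous_intros)
  have "k field_differentiable at z1" for z1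
  proof (cases "E z1 = 1")
    case False
    define A where "A = {z. E z \<noteq> 1}"
    have oA: "open A" unfolding A_def using cE by (intro open_Collect_neq) (auto)
    have "k holomorphic_on A \<longleftrightarrow> (\<lambda>z. (h z - h z0) / (E z - 1)) holomorphic_on A"
      by (rule holomorphic_cong) (auto simp: A_def k_def)
    hence "k holomorphic_on A" using hol1[of A] by (auto simp: A_def)
    thus ?thesis using oA False holomorphic_on_imp_differentiable_at[of k A z1] by (simp add: A_def)
  next
    case True
    obtain n :: int where n: "z1 = z0 + of_int n" using E1[OF True] by blast
    have h0: "h z1 = h z0" unfolding n by (rule periodic_of_int) (rule per)
    define c where "c = deriv h z1 / (2 * of_real pi * \<i>)"
    have uniq: "z = z1" if zb: "z \<in> ball z1 (1/2)" and Ez: "E z = 1" for z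
    proof -
      obtain m :: int where m: "z = z0 + of_int m" using E1[OF Ez] by blast
      have "dist z1 z < 1/2" using zb by simp
      hence "cmod (of_int (n - m)) < 1" unfolding n m by (simp add: dist_norm)
      hence "\<bar>n - m\<bar> < 1" unfolding norm_of_int by linarith
      thus ?thesis using n m by simp
    qed
    have "(E has_field_derivative 2 * of_real pi * \<i>) (at z1)"
      using True unfolding E_def by (auto intro!: derivative_eq_intros)
    hence lE: "(\<lambda>z. (E z - E z1) / (z - z1)) \<midarrow>z1\<rightarrow> 2 * of_real pi * \<i>" by (simp add: has_field_derivative_iff)
    have lh: "(\<lambda>z. (h z - h z1) / (z - z1)) \<midarrow>z1\<rightarrow> deriv h z1"
      using hd[of z1] by (simp add: field_differentiable_derivI has_field_derivative_iff[symmetric])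
    have "(\<lambda>z. ((h z - h z1) / (z - z1)) / ((E z - E z1) / (z - z1))) \<midarrow>z1\<rightarrow> c"
      unfolding c_def by (intro tendsto_divide lE lh) simp
    moreover have "\<forall>\<^sub>F z in at z1. ((h z - h z1) / (z - z1)) / ((E z - E z1) / (z - z1)) = (h z - h z0) / (E z - 1)"
    proof -
      have "(A / d) / (B / d) = A / B" if "d \<noteq> 0" for A B d :: complex using that by simp
      thus ?thesis unfolding eventually_at using h0 True by (intro exI[of _ 1]) auto
    qed
    ultimately have lim: "(\<lambda>z. (h z - h z0) / (E z - 1)) \<midarrow>z1\<rightarrow> c"
      by (rule Lim_transform_eventually)
    have "(\<lambda>y. if y = z1 then c else (h y - h z0) / (E y - 1)) holomorphic_on ball z1 (1/2)"
      by (rule removable_singularity[OF hol1 open_ball lim]) (use uniq in auto)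
    moreover have "(if y = z1 then c else (h y - h z0) / (E y - 1)) = k y" if "y \<in> ball z1 (1/2)" for y
    proof (cases "y = z1")
      case False
      hence "E y \<noteq> 1" using uniq[OF that] by blast
      thus ?thesis using False by (simp add: k_def)
    qed (simp add: k_def c_def True)
    ultimately have "k holomorphic_on ball z1 (1/2)" by (rule holomorphic_transform)
    thus ?thesis using holomorphic_on_imp_differentiable_at[of k "ball z1 (1/2)" z1] by simp
  qed
  hence kh: "k holomorphic_on UNIV" by (simp add: holomorphic_on_def)
  have dper: "deriv h (z + 1) = deriv h z" for z
  proof -
    have "((\<lambda>z. h (z + 1)) has_field_derivative deriv h (z + 1)) (at z)"
      by (rule DERIV_shift[THEN iffD1]) (simp add: field_differentiable_derivI hd)
    thus ?thesis unfolding per by (metis DERIV_imp_deriv)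
  qed
  have kper: "k (z + 1) = k z" for z unfolding k_def Eper per dper ..
  have "h z - h z0 = (E z - 1) * k z" for z
  proof (cases "E z = 1")
    case True
    obtain n :: int where n: "z = z0 + of_int n" using E1[OF True] by blast
    have "h z = h z0" unfolding n by (rule periodic_of_int) (rule per)
    thus ?thesis using True by simp
  qed (simp add: k_def)
  thus ?thesis using that[OF kh kper] unfolding E_def by blast
qed

text \<open>A holomorphic version of Chernoff's argument: with \<open>h z - h z0 = (e z - 1) * k z\<close>,
  vanishing of all Fourier coefficients of \<open>h\<close> except possibly for the contribution of the constant
  \<open>h z0\<close> makes the coefficients of \<open>k\<close> constant on both sides of \<open>0\<close>, whereas moving the contour
  shows that they decay.\<close>

lemma fourier_uniqueness:
  assumes h: "h holomorphic_on UNIV" and per: "\<And>z. h (z + 1) = h z"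
    and c0: "\<And>n::int. unit_integral (\<lambda>z. h z * exp (- (2 * of_real pi * \<i> * of_int n * z))) = 0"
  shows "h z0 = 0"
proof -
  obtain k where k: "k holomorphic_on UNIV" "\<And>z. k (z + 1) = k z"
    and hk: "\<And>z. h z - h z0 = (exp (2 * of_real pi * \<i> * (z - z0)) - 1) * k z"
    using periodic_quotient[OF h per] by metis
  define e where "e = (\<lambda>(n::int) z. exp (- (2 * of_real pi * \<i> * of_int n * (z - z0))) :: complex)"
  have eh: "e n holomorphic_on UNIV" for n unfolding e_def by (intro holomorphic_intros)
  have eper: "e n (z + 1) = e n z" for n z
    using exp_plus_2pin[of "- (2 * of_real pi * \<i> * of_int n * (z - z0))" "-n"] by (simp add: e_def algebra_simps)
  define d where "d = (\<lambda>n. unit_integral (\<lambda>z. k z * e n z))"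
  have int: "(\<lambda>z. f z * e n z) contour_integrable_on linepath 0 1" if "f holomorphic_on UNIV" for f n
    by (intro entire_integrable holomorphic_intros that eh)
  \<comment> \<open>Multiplication by the divisor shifts the index of a Fourier coefficient by one.
    The coefficients of \<open>h\<close> vanish, so only the constant \<open>h z0\<close>
    contributes, and only at \<open>n = 0\<close>.\<close>
  have rel: "d (n - 1) - d n = (if n = 0 then - h z0 else 0)" for n
  proof -
    define q where "q = exp (2 * of_real pi * \<i> * of_int n * z0)"
    have q: "e n z = q * exp (- (2 * of_real pi * \<i> * of_int n * z))" for z
      by (simp add: e_def q_def exp_add[symmetric] algebra_simps)
    have "unit_integral (\<lambda>z. h z * e n z) = unit_integral (\<lambda>z. q * (h z * exp (- (2 * of_real pi * \<i> * of_int n * z))))"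
      by (simp add: q mult_ac)
    also have "\<dots> = q * unit_integral (\<lambda>z. h z * exp (- (2 * of_real pi * \<i> * of_int n * z)))"
      by (intro contour_integral_lmul entire_integrable holomorphic_intros h)
    finally have 1: "unit_integral (\<lambda>z. h z * e n z) = 0" using c0 by simp
    have "unit_integral (\<lambda>z. h z0 * e n z) = unit_integral (\<lambda>z. (h z0 * q) * exp (2 * of_real pi * \<i> * of_int (-n) * z))"
      by (simp add: q mult_ac)
    also have "\<dots> = (h z0 * q) * unit_integral (\<lambda>z. exp (2 * of_real pi * \<i> * of_int (-n) * z))"
      by (intro contour_integral_lmul entire_integrable holomorphic_intros)
    also have "\<dots> = (if n = 0 then h z0 else 0)" by (subst unit_integral_exp) (auto simp: q_def)
    finally have 2: "unit_integral (\<lambda>z. h z0 * e n z) = (if n = 0 then h z0 else 0)" .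
    have "k z * e (n - 1) z - k z * e n z = h z * e n z - h z0 * e n z" for z
    proof -
      have "e (n - 1) z = exp (2 * of_real pi * \<i> * (z - z0)) * e n z"
        by (simp add: e_def exp_add[symmetric] algebra_simps)
      hence "k z * e (n - 1) z - k z * e n z = ((exp (2 * of_real pi * \<i> * (z - z0)) - 1) * k z) * e n z"
        by (simp add: algebra_simps)
      thus ?thesis using hk[of z] by (metis left_diff_distrib)
    qed
    hence "unit_integral (\<lambda>z. k z * e (n - 1) z - k z * e n z) = unit_integral (\<lambda>z. h z * e n z - h z0 * e n z)"
      by simp
    thus ?thesis unfolding d_def using 1 2 by (simp add: contour_integral_diff int h k(1) split: if_splits)
  qed
  have decay: "\<exists>B. \<forall>n. cmod (d n) \<le> B * exp (- 2 * pi * (s * of_int n))" for s :: real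
  proof -
    \<comment> \<open>On the line moved by \<open>s\<close> the exponential \<open>e n\<close> has
      constant modulus. The sign of \<open>s\<close> selects the direction of decay:
      \<open>s = 1\<close> serves nonnegative indices, \<open>s = -1\<close> negative ones.\<close>
    define a where "a = z0 - \<i> * of_real s"
    have "compact ((\<lambda>z. k (z + a)) ` closed_segment 0 1)"
      by (intro compact_continuous_image holomorphic_on_imp_continuous_on compact_segment)
         (rule holomorphic_on_subset[OF entire_shift[OF k(1)]], simp)
    then obtain B where B: "\<And>z. z \<in> closed_segment 0 1 \<Longrightarrow> cmod (k (z + a)) \<le> B"
      by (metis (no_types, lifting) bounded_iff compact_imp_bounded imageI)
    have "cmod (d n) \<le> B * exp (- 2 * pi * (s * of_int n))" for n
    proof -
      have hol: "(\<lambda>z. k z * e n z) holomorphic_on UNIV" by (intro holomorphic_intros k eh)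
      have "d n = unit_integral (\<lambda>z. k (z + a) * e n (z + a))"
        unfolding d_def by (rule unit_integral_shift[symmetric, OF hol]) (simp add: k(2) eper)
      also have "cmod \<dots> \<le> B * exp (- 2 * pi * (s * of_int n))"
      proof (rule unit_integral_bound)
        show "(\<lambda>z. k (z + a) * e n (z + a)) holomorphic_on UNIV"
          by (rule entire_shift[OF hol])
        fix z :: complex assume z: "z \<in> closed_segment 0 1"
        have "Im z = 0" using z by (auto simp: closed_segment_def)
        hence "cmod (e n (z + a)) = exp (- 2 * pi * (s * of_int n))"
          by (simp add: e_def a_def algebra_simps)
        thus "cmod (k (z + a) * e n (z + a)) \<le> B * exp (- 2 * pi * (s * of_int n))"
          using B[OF z] by (simp add: norm_mult mult_right_mono)
      qed
      finally show ?thesis .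
    qed
    thus ?thesis by blast
  qed
  have lim0: "(\<lambda>n::nat. B * exp (- 2 * pi * real n)) \<longlonglongrightarrow> 0" for B
  proof -
    have eq: "exp (- 2 * pi * real n) = exp (- 2 * pi) ^ n" for n
      by (simp add: exp_of_nat_mult[symmetric] mult.commute)
    show ?thesis unfolding eq by (intro tendsto_mult_right_zero LIMSEQ_realpow_zero) auto
  qed
  have pos: "d (int n) = d 0" for n
    by (induction n) (use rel[of "int (Suc _)"] in auto)
  have neg: "d (- 1 - int n) = d (-1)" for n
  proof (induction n)
    case (Suc n)
    have "d (- 1 - int n - 1) - d (- 1 - int n) = 0" using rel[of "-1 - int n"] by simp
    thus ?case using Suc by (simp add: algebra_simps)
  qed simp
  have "d 0 = 0"
  proof -
    obtain B where "\<And>n. cmod (d n) \<le> B * exp (- 2 * pi * (1 * of_int n))" using decay[of 1] by blast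
    hence "cmod (d 0) \<le> B * exp (- 2 * pi * real n)" for n using pos[of n] by (metis mult_1 of_int_of_nat_eq)
    hence "cmod (d 0) \<le> 0" by (intro LIMSEQ_le_const[OF lim0[of B]]) auto
    thus ?thesis by simp
  qed
  moreover have "d (-1) = 0"
  proof -
    obtain B where B: "\<And>n. cmod (d n) \<le> B * exp (- 2 * pi * ((-1) * of_int n))" using decay[of "-1"] by blast
    have "cmod (d (-1)) \<le> (B * exp (- 2 * pi)) * exp (- 2 * pi * real n)" for n 
      using B[of "-1 - int n"] unfolding neg by (simp add: exp_add[symmetric] algebra_simps)
    hence "cmod (d (-1)) \<le> 0" by (intro LIMSEQ_le_const[OF lim0]) auto
    thus ?thesis by simp
  qed
  ultimately show ?thesis using rel[of 0] by simp
qed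

text \<open>Quasi-periodicity under \<open>\<sigma>\<close> becomes a recursion between consecutive
  Fourier coefficients with nonzero factors, so all of them vanish together with the mean value.
  Theta functions of order one thus form a space of dimension at most one, detected by
  \<open>unit_integral\<close>.\<close>

lemma theta_uniqueness:
  assumes h: "h holomorphic_on UNIV" and per: "\<And>z. h (z + 1) = h z"
    and quasi: "\<And>z. h (z + \<sigma>) = K * exp (- (2 * of_real pi * \<i> * z)) * h z"
    and I0: "unit_integral h = 0"
  shows "h z0 = 0"
proof (cases "K = 0")
  case True
  thus ?thesis using quasi[of "z0 - \<sigma>"] by simp
next
  case False
  define e where "e = (\<lambda>(n::int) z. exp (- (2 * of_real pi * \<i> * of_int n * z)) :: complex)"
  have eper: "e n (z + 1) = e n z" for n z
    using exp_plus_2pin[of "- (2 * of_real pi * \<i> * of_int n * z)" "-n"] by (simp add: e_def algebra_simps)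
  have hol: "(\<lambda>z. h z * e n z) holomorphic_on UNIV" for n unfolding e_def by (intro holomorphic_intros h)
  define c where "c = (\<lambda>n. unit_integral (\<lambda>z. h z * e n z))"
  have rec: "c n = (K * e n \<sigma>) * c (n + 1)" for n
  proof -
    have "c n = unit_integral (\<lambda>z. h (z + \<sigma>) * e n (z + \<sigma>))"
      unfolding c_def by (rule unit_integral_shift[symmetric, OF hol]) (simp add: per eper)
    also have "(\<lambda>z. h (z + \<sigma>) * e n (z + \<sigma>)) = (\<lambda>z. (K * e n \<sigma>) * (h z * e (n + 1) z))"
      unfolding quasi by (simp add: e_def exp_add[symmetric] algebra_simps exp_diff exp_minus) (simp add: field_simps exp_add)
    also have "unit_integral \<dots> = (K * e n \<sigma>) * c (n + 1)"
      unfolding c_def by (intro contour_integral_lmul entire_integrable hol)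
    finally show ?thesis .
  qed
  have "c n = 0" for n
  proof (induction n rule: int_induct[where k = 0])
    case base thus ?case using I0 by (simp add: c_def e_def)
  next
    case (step1 i) thus ?case using rec[of i] False by (simp add: e_def)
  next
    case (step2 i) thus ?case using rec[of "i - 1"] by simp
  qed
  thus ?thesis using fourier_uniqueness[OF h per] unfolding c_def e_def by blast
qed

section \<open>One-dimensional theta inversion\<close>

lemma summable_on_exp_minus_abs: "(\<lambda>n::int. exp (- real_of_int \<bar>n\<bar>)) summable_on UNIV"
proof -
  have geo: "(\<lambda>n::nat. exp (- real n)) summable_on UNIV"
  proof (rule norm_summable_imp_summable_on)
    have "summable (\<lambda>n. exp (-1 :: real) ^ n)" by (rule summable_geometric) simp
    thus "summable (\<lambda>n. norm (exp (- real n)))" by (simp add: exp_of_nat_mult[symmetric])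
  qed
  have geo1: "(\<lambda>n::nat. exp (- real n - 1)) summable_on UNIV"
  proof -
    have "exp (- real n - 1) = exp (-1) * exp (- real n)" for n by (simp add: exp_add[symmetric])
    thus ?thesis using summable_on_cmult_right[OF geo, of "exp (-1)"] by simp
  qed
  have "(\<lambda>n::int. exp (- real_of_int \<bar>n\<bar>)) summable_on range int"
    using geo by (subst summable_on_reindex) (auto simp: o_def)
  moreover have "(\<lambda>n::int. exp (- real_of_int \<bar>n\<bar>)) summable_on range (\<lambda>n. - int (Suc n))"
    using geo1 by (subst summable_on_reindex) (auto simp: o_def inj_on_def)
  moreover have "range int \<union> range (\<lambda>n. - int (Suc n)) = UNIV"
  proof -
    have "x \<in> range int \<union> range (\<lambda>n. - int (Suc n))" for x
      by (cases x rule: int_cases) auto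
    thus ?thesis by blast
  qed
  ultimately show ?thesis using summable_on_union by metis
qed

lemma summable_on_gauss:
  fixes \<alpha> \<beta> :: real
  assumes "\<alpha> > 0"
  shows "(\<lambda>n::int. exp (- \<alpha> * (of_int n)\<^sup>2 + \<beta> * \<bar>of_int n\<bar>)) summable_on UNIV"
proof -
  define K where "K = (\<beta> + 1)\<^sup>2 / (4 * \<alpha>)"
  have le: "- \<alpha> * x\<^sup>2 + \<beta> * x \<le> K - x" for x :: real
  proof -
    have "0 \<le> \<alpha> * (x - (\<beta> + 1) / (2 * \<alpha>))\<^sup>2" using assms by simp
    also have "\<dots> = \<alpha> * x\<^sup>2 - (\<beta> + 1) * x + K"
      using assms by (simp add: K_def power2_eq_square field_simps)
    finally show ?thesis by (simp add: algebra_simps)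
  qed
  have "(\<lambda>n::int. exp K * exp (- real_of_int \<bar>n\<bar>)) summable_on UNIV"
    by (intro summable_on_cmult_right summable_on_exp_minus_abs)
  hence "(\<lambda>n::int. norm (exp (- \<alpha> * (of_int n)\<^sup>2 + \<beta> * \<bar>of_int n\<bar>))) summable_on UNIV"
  proof (rule Infinite_Sum.abs_summable_on_comparison_test')
    fix n :: int
    have "- \<alpha> * (of_int n)\<^sup>2 + \<beta> * \<bar>of_int n\<bar> \<le> K - \<bar>of_int n\<bar>" using le[of "\<bar>of_int n\<bar>"] by simp
    thus "norm (exp (- \<alpha> * (of_int n)\<^sup>2 + \<beta> * \<bar>of_int n\<bar>)) \<le> exp K * exp (- real_of_int \<bar>n\<bar>)"
      by (simp add: exp_add[symmetric])
  qed
  thus ?thesis by simp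
qed

lemma product_summable_on:
  fixes f :: "'a \<Rightarrow> complex" and g :: "'b \<Rightarrow> complex"
  assumes f: "f summable_on A" and g: "g summable_on B"
  shows "(\<lambda>(x, y). f x * g y) summable_on A \<times> B"
    and "(\<Sum>\<^sub>\<infinity>(x, y)\<in>A \<times> B. f x * g y) = infsum f A * infsum g B"
proof -
  have fn: "(\<lambda>x. norm (f x)) summable_on A" and gn: "(\<lambda>x. norm (g x)) summable_on B"
    using f g by (simp_all add: summable_on_iff_abs_summable_on_complex[symmetric])
  show 1: "(\<lambda>(x, y). f x * g y) summable_on A \<times> B"
    unfolding summable_on_iff_abs_summable_on_complex
  proof (subst Infinite_Sum.abs_summable_on_Sigma_iff, intro conjI ballI)
    fix x assume "x \<in> A"
    show "(\<lambda>y. norm (case (x, y) of (x, y) \<Rightarrow> f x * g y)) summable_on B"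
      using summable_on_cmult_right[OF gn, of "norm (f x)"] by (simp add: norm_mult)
  next
    show "(\<lambda>x. norm (\<Sum>\<^sub>\<infinity>y\<in>B. norm (case (x, y) of (x, y) \<Rightarrow> f x * g y))) summable_on A"
      using summable_on_cmult_left[OF fn, of "norm (\<Sum>\<^sub>\<infinity>y\<in>B. norm (g y))"]
      by (simp add: norm_mult infsum_cmult_right' abs_mult)
  qed
  show "(\<Sum>\<^sub>\<infinity>(x, y)\<in>A \<times> B. f x * g y) = infsum f A * infsum g B"
    using infsum_Sigma'_banach[OF 1] by (simp add: infsum_cmult_right' infsum_cmult_left')
qed

lemma product_summable_on_real:
  fixes f :: "'a \<Rightarrow> real" and g :: "'b \<Rightarrow> real"
  assumes "f summable_on A" "g summable_on B"
  shows "(\<lambda>(x, y). f x * g y) summable_on A \<times> B"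
    and "(\<Sum>\<^sub>\<infinity>(x, y)\<in>A \<times> B. f x * g y) = infsum f A * infsum g B"
proof -
  have *: "(\<lambda>x. complex_of_real (f x)) summable_on A" "(\<lambda>x. complex_of_real (g x)) summable_on B"
    using assms by (auto intro: summable_on_of_real)
  have "(\<lambda>z. complex_of_real (case z of (x, y) \<Rightarrow> f x * g y)) summable_on A \<times> B"
    using product_summable_on(1)[OF *] by (simp add: case_prod_unfold)
  from summable_on_Re[OF this] show 1: "(\<lambda>(x, y). f x * g y) summable_on A \<times> B" by simp
  show "(\<Sum>\<^sub>\<infinity>(x, y)\<in>A \<times> B. f x * g y) = infsum f A * infsum g B"
    using infsum_Sigma'_banach[OF 1] by (simp add: infsum_cmult_right' infsum_cmult_left')
qed

lemma unit_integral_infsum: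
  fixes f :: "'i \<Rightarrow> complex \<Rightarrow> complex"
  assumes hol: "\<And>i. i \<in> X \<Longrightarrow> f i holomorphic_on UNIV" and M: "M summable_on X"
    and bound: "\<And>i z. i \<in> X \<Longrightarrow> z \<in> closed_segment 0 1 \<Longrightarrow> cmod (f i z) \<le> M i"
    and holF: "(\<lambda>z. \<Sum>\<^sub>\<infinity>i\<in>X. f i z) holomorphic_on UNIV"
  shows "((\<lambda>i. unit_integral (f i)) has_sum unit_integral (\<lambda>z. \<Sum>\<^sub>\<infinity>i\<in>X. f i z)) X"
  unfolding has_sum_def
proof (rule tendstoI)
  fix e :: real assume "e > 0"
  have u: "uniform_limit (closed_segment 0 1) (\<lambda>F w. \<Sum>i\<in>F. f i w) (\<lambda>w. \<Sum>\<^sub>\<infinity>i\<in>X. f i w) (finite_subsets_at_top X)"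
    by (rule Weierstrass_m_test_general[OF _ M]) (use bound in auto)
  have "\<forall>\<^sub>F F in finite_subsets_at_top X. \<forall>w\<in>closed_segment 0 1. dist (\<Sum>i\<in>F. f i w) (\<Sum>\<^sub>\<infinity>i\<in>X. f i w) < e / 2"
    using uniform_limitD[OF u, of "e/2"] \<open>e > 0\<close> by simp
  moreover have "\<forall>\<^sub>F F in finite_subsets_at_top X. finite F \<and> F \<subseteq> X"
    by (rule eventually_finite_subsets_at_top_weakI) auto
  ultimately show "\<forall>\<^sub>F F in finite_subsets_at_top X. dist (\<Sum>i\<in>F. unit_integral (f i)) (unit_integral (\<lambda>z. \<Sum>\<^sub>\<infinity>i\<in>X. f i z)) < e"
  proof eventually_elim
    case (elim F)
    have hs: "(\<lambda>w. \<Sum>i\<in>F. f i w) holomorphic_on UNIV" using elim(2) by (intro holomorphic_on_sum hol) auto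
    have "(\<Sum>i\<in>F. unit_integral (f i)) = unit_integral (\<lambda>w. \<Sum>i\<in>F. f i w)"
      using elim(2) by (intro contour_integral_sum[symmetric] entire_integrable hol) auto
    hence "(\<Sum>i\<in>F. unit_integral (f i)) - unit_integral (\<lambda>z. \<Sum>\<^sub>\<infinity>i\<in>X. f i z) =
        unit_integral (\<lambda>w. (\<Sum>i\<in>F. f i w) - (\<Sum>\<^sub>\<infinity>i\<in>X. f i w))"
      by (simp add: contour_integral_diff entire_integrable hs holF)
    also have "cmod \<dots> \<le> e / 2"
      by (rule unit_integral_bound) (use elim(1) hs holF in \<open>auto intro!: holomorphic_intros simp: dist_norm less_imp_le\<close>)
    finally show ?case using \<open>e > 0\<close> by (simp add: dist_norm)
  qed
qed

lemma gaussian_integral_limit: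
  assumes "a > 0"
  shows "(\<lambda>N::nat. integral {- real N..real N} (\<lambda>x. exp (- pi * x\<^sup>2 / a))) \<longlonglongrightarrow> sqrt a"
proof -
  \<comment> \<open>With this standard deviation the integrand is \<open>sqrt a\<close> times a
    normal density of total mass one.\<close>
  define \<sigma> where "\<sigma> = sqrt (a / (2 * pi))"
  have s: "\<sigma> > 0" "2 * \<sigma>\<^sup>2 = a / pi" using assms by (simp_all add: \<sigma>_def)
  have eq: "exp (- pi * x\<^sup>2 / a) = sqrt a * normal_density 0 \<sigma> x" for x
  proof -
    have "2 * pi * \<sigma>\<^sup>2 = a" using s(2) by (simp add: field_simps)
    moreover have "- (x\<^sup>2) / (2 * \<sigma>\<^sup>2) = - pi * x\<^sup>2 / a" unfolding s(2) using assms by (simp add: field_simps)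
    ultimately show ?thesis using assms by (simp add: normal_density_def)
  qed
  have int: "integrable lborel (\<lambda>x. exp (- pi * x\<^sup>2 / a))" 
    unfolding eq using s(1) by (intro integrable_mult_right integrable_normal_density)
  have val: "(\<integral>x. exp (- pi * x\<^sup>2 / a) \<partial>lborel) = sqrt a"
    unfolding eq using s(1) by (simp add: integral_normal_density)
  have si: "set_integrable lborel S (\<lambda>x. exp (- pi * x\<^sup>2 / a))" if "S \<in> sets borel" for S
    unfolding set_integrable_def using int that by (intro integrable_mult_indicator) auto
  have un: "(\<Union>N::nat. {- real N..real N}) = UNIV"
  proof -
    have "\<exists>N::nat. - real N \<le> x \<and> x \<le> real N" for x
      using real_arch_simple[of "\<bar>x\<bar>"] by (auto simp: abs_le_iff) (metis neg_le_iff_le minus_minus)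
    thus ?thesis by auto
  qed
  have "(\<lambda>N::nat. LINT x:{- real N..real N}|lborel. exp (- pi * x\<^sup>2 / a)) \<longlonglongrightarrow>
      (LINT x:(\<Union>N::nat. {- real N..real N})|lborel. exp (- pi * x\<^sup>2 / a))"
    by (rule set_integral_cont_up) (auto simp: incseq_def un intro!: si[simplified])
  moreover have "(LINT x:{- real N..real N}|lborel. exp (- pi * x\<^sup>2 / a)) = integral {- real N..real N} (\<lambda>x. exp (- pi * x\<^sup>2 / a))" for N
    by (rule set_borel_integral_eq_integral(2)[OF si]) simp
  moreover have "(LINT x:UNIV|lborel. exp (- pi * x\<^sup>2 / a)) = sqrt a"
    using val by (simp add: set_lebesgue_integral_def)
  ultimately show ?thesis unfolding un by (simp only:)
qed

lemma telescope_int_interval: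
  fixes f :: "int \<Rightarrow> 'a :: ab_group_add"
  shows "(\<Sum>n\<in>{- int N..<int N}. f (n + 1) - f n) = f (int N) - f (- int N)"
proof (induction N)
  case (Suc N)
  have "{- int (Suc N)..<int (Suc N)} = insert (- int (Suc N)) (insert (int N) {- int N..<int N})" by auto
  thus ?case using Suc by (simp add: algebra_simps)
qed simp

text \<open>As functions of \<open>b\<close> both sides are entire, periodic, and quasi-periodic
  under \<open>\<i> * a\<close> with the same factor, so \<open>theta_uniqueness\<close> reduces the
  identity to mean values. The mean of the periodised Gaussian is the Gaussian integral, that of the
  Fourier series is its term at 0.\<close>

lemma theta_inversion:
  fixes a :: real and b :: complex
  assumes a: "a > 0"
  shows "(\<Sum>\<^sub>\<infinity>n::int. exp (- of_real pi * (b + of_int n)\<^sup>2 / of_real a)) =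
    of_real (sqrt a) * (\<Sum>\<^sub>\<infinity>n::int. exp (- of_real (pi * a) * (of_int n)\<^sup>2 + 2 * of_real pi * \<i> * of_int n * b))"
proof -
  define f where "f = (\<lambda>z. exp (- of_real pi * z\<^sup>2 / of_real a) :: complex)"
  define g where "g = (\<lambda>(n::int) z. exp (- of_real (pi * a) * (of_int n)\<^sup>2 + 2 * of_real pi * \<i> * of_int n * z) :: complex)"
  define F where "F = (\<lambda>z. \<Sum>\<^sub>\<infinity>n::int. f (z + of_int n))"
  define G where "G = (\<lambda>z. \<Sum>\<^sub>\<infinity>n. g n z)"
  have fh: "f holomorphic_on UNIV" unfolding f_def by (intro holomorphic_intros) (use a in auto)
  have gh: "g n holomorphic_on UNIV" for n unfolding g_def by (intro holomorphic_intros)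
  \<comment> \<open>Majorants uniform for \<open>cmod z \<le> R\<close>. In \<open>MF\<close> half
    of the quadratic decay pays for the mixed term \<open>2 * n * Re z\<close>.\<close>
  define MF where "MF = (\<lambda>R (n::int). exp (pi * R\<^sup>2 / a) * exp (- (pi / (2 * a)) * (of_int n)\<^sup>2 + 0 * \<bar>of_int n\<bar>))"
  define MG where "MG = (\<lambda>R (n::int). exp (- (pi * a) * (of_int n)\<^sup>2 + (2 * pi * R) * \<bar>of_int n\<bar>))"
  have MFs: "MF R summable_on UNIV" for R unfolding MF_def using a
    by (intro summable_on_cmult_right summable_on_gauss) auto
  have MGs: "MG R summable_on UNIV" for R unfolding MG_def using a by (intro summable_on_gauss) auto
  have fb: "cmod (f (z + of_int n)) \<le> MF R n" if "cmod z \<le> R" for z n R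
  proof -
    have 1: "(Re z)\<^sup>2 + (Im z)\<^sup>2 \<le> R\<^sup>2" using that by (metis cmod_power2 norm_ge_zero power_mono)
    have "0 \<le> (real_of_int n + 2 * Re z)\<^sup>2" by simp
    hence "(of_int n)\<^sup>2 / 2 - R\<^sup>2 \<le> (Re z + of_int n)\<^sup>2 - (Im z)\<^sup>2" using 1 by (simp add: power2_eq_square algebra_simps)
    hence "- pi * ((Re z + of_int n)\<^sup>2 - (Im z)\<^sup>2) / a \<le> - pi * ((of_int n)\<^sup>2 / 2 - R\<^sup>2) / a"
      using a by (intro divide_right_mono mult_left_mono_neg) auto
    also have "\<dots> = pi * R\<^sup>2 / a + (- (pi / (2 * a)) * (of_int n)\<^sup>2 + 0 * \<bar>of_int n\<bar>)"
      using a by (simp add: field_simps)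
    finally show ?thesis
      unfolding f_def MF_def by (simp add: exp_add[symmetric] norm_exp_eq_Re Re_power2 Re_divide_of_real)
  qed
  have gb: "cmod (g n z) \<le> MG R n" if "cmod z \<le> R" for z n R
  proof -
    have "\<bar>of_int n * Im z\<bar> \<le> \<bar>of_int n\<bar> * R"
      unfolding abs_mult using that abs_Im_le_cmod[of z] by (intro mult_left_mono) auto
    hence "- (of_int n * Im z) \<le> \<bar>of_int n\<bar> * R" by linarith
    hence "2 * pi * (- (of_int n * Im z)) \<le> 2 * pi * (\<bar>of_int n\<bar> * R)" by (intro mult_left_mono) auto
    thus ?thesis unfolding g_def MG_def by (simp add: norm_exp_eq_Re mult_ac power2_eq_square)
  qed
  have FH: "F holomorphic_on UNIV" unfolding F_def
  proof (rule holomorphic_on_infsum)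
    fix z :: complex
    show "\<exists>r>0. \<exists>M. cball z r \<subseteq> UNIV \<and> M summable_on UNIV \<and>
                 (\<forall>i\<in>UNIV. \<forall>w\<in>cball z r. norm (f (w + of_int i)) \<le> M i)"
    proof (intro exI[of _ 1] conjI exI[of _ "MF (cmod z + 1)"] MFs ballI)
      fix i :: int and w assume "w \<in> cball z 1"
      hence "cmod w \<le> cmod z + 1" using norm_triangle_sub[of w z] by (simp add: dist_norm norm_minus_commute)
      thus "cmod (f (w + of_int i)) \<le> MF (cmod z + 1) i" by (rule fb)
    qed auto
  qed (auto intro!: entire_shift fh)
  have GH: "G holomorphic_on UNIV" unfolding G_def
  proof (rule holomorphic_on_infsum)
    fix z :: complex
    show "\<exists>r>0. \<exists>M. cball z r \<subseteq> UNIV \<and> M summable_on UNIV \<and>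
                 (\<forall>i\<in>UNIV. \<forall>w\<in>cball z r. norm (g i w) \<le> M i)"
    proof (intro exI[of _ 1] conjI exI[of _ "MG (cmod z + 1)"] MGs ballI)
      fix i :: int and w assume "w \<in> cball z 1"
      hence "cmod w \<le> cmod z + 1" using norm_triangle_sub[of w z] by (simp add: dist_norm norm_minus_commute)
      thus "cmod (g i w) \<le> MG (cmod z + 1) i" by (rule gb)
    qed auto
  qed (auto intro!: gh)
  have seg: "cmod z \<le> 1" if "z \<in> closed_segment 0 1" for z
    using that by (auto simp: closed_segment_def norm_mult)
  have IG: "unit_integral G = 1"
  proof -
    have "((\<lambda>n. unit_integral (g n)) has_sum unit_integral G) UNIV"
      unfolding G_def by (rule unit_integral_infsum[OF gh MGs[of 1]]) (use gb seg GH in \<open>auto simp: G_def\<close>)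
    moreover have "unit_integral (g n) = (if n = 0 then 1 else 0)" for n
    proof -
      have "unit_integral (g n) = unit_integral (\<lambda>z. exp (- of_real (pi * a) * (of_int n)\<^sup>2) * exp (2 * of_real pi * \<i> * of_int n * z))"
        by (simp only: g_def exp_add)
      also have "\<dots> = exp (- of_real (pi * a) * (of_int n)\<^sup>2) * unit_integral (\<lambda>z. exp (2 * of_real pi * \<i> * of_int n * z))"
        by (intro contour_integral_lmul entire_integrable holomorphic_intros)
      finally show ?thesis by (simp add: unit_integral_exp)
    qed
    ultimately have "((\<lambda>n::int. if n = 0 then 1 else 0) has_sum unit_integral G) UNIV" by simp
    moreover have "((\<lambda>n::int. if n = 0 then 1 else 0 :: complex) has_sum 1) UNIV"
      by (rule has_sum_finite_neutralI[of "{0}"]) auto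
    ultimately show ?thesis using has_sum_unique by blast
  qed
  have IF: "unit_integral F = of_real (sqrt a)"
  proof -
    \<comment> \<open>Unfolding: the integrals over shifted unit intervals are increments of a
      primitive \<open>P\<close>; summed over symmetric ranges they telescope to the Gaussian
      integral over [-N, N].\<close>
    obtain P where P: "\<And>z. (P has_field_derivative f z) (at z)" using entire_primitive[OF fh] by blast
    have 1: "unit_integral (\<lambda>z. f (z + of_int n)) = P (of_int (n + 1)) - P (of_int n)" for n
      using unit_integral_primitive[of "\<lambda>z. P (z + of_int n)" "\<lambda>z. f (z + of_int n)"] DERIV_shift[THEN iffD1, OF P]
      by (simp add: add.commute)
    have hs: "((\<lambda>n. P (of_int (n + 1)) - P (of_int n)) has_sum unit_integral F) UNIV"
      unfolding F_def 1[symmetric]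
      by (rule unit_integral_infsum[OF entire_shift[OF fh] MFs[of 1]]) (use fb seg FH in \<open>auto simp: F_def\<close>)
    have fl: "filterlim (\<lambda>N. {- int N..<int N}) (finite_subsets_at_top UNIV) sequentially"
    proof (rule filterlim_finite_subsets_at_top[THEN iffD2], intro allI impI)
      fix X :: "int set" assume "finite X \<and> X \<subseteq> UNIV"
      hence "finite (abs ` X)" by simp
      then obtain B where B: "\<forall>x\<in>abs ` X. x \<le> B" using bdd_above_finite[of "abs ` X"] by (auto simp: bdd_above_def)
      have "X \<subseteq> {- int N..<int N}" if "N > nat B" for N
        using B that by (force simp: abs_le_iff)
      thus "\<forall>\<^sub>F N in sequentially. finite {- int N..<int N} \<and> X \<subseteq> {- int N..<int N} \<and> {- int N..<int N} \<subseteq> UNIV"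
        by (auto simp: eventually_at_top_dense)
    qed
    have "(\<lambda>N. \<Sum>n\<in>{- int N..<int N}. P (of_int (n + 1)) - P (of_int n)) \<longlonglongrightarrow> unit_integral F"
      using filterlim_compose[OF hs[unfolded has_sum_def] fl] by (simp add: o_def)
    hence L1: "(\<lambda>N. P (of_nat N) - P (- of_nat N)) \<longlonglongrightarrow> unit_integral F"
      using telescope_int_interval[of "\<lambda>n. P (of_int n)"] by simp
    have "P (of_nat N) - P (- of_nat N) = of_real (integral {- real N..real N} (\<lambda>x. exp (- pi * x\<^sup>2 / a)))" if "N > 0" for N
    proof -
      have "P (of_nat N) - P (- of_nat N) = contour_integral (linepath (- of_nat N) (of_nat N)) f"
        using contour_integral_primitive[of UNIV P f "linepath (- of_nat N) (of_nat N)"] P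
        by (intro contour_integral_unique[symmetric]) auto
      also have "\<dots> = integral {- real N..real N} (\<lambda>x. f (of_real x))"
        using contour_integral_linepath_Reals_eq[of "- of_nat N" "of_nat N" f] that by simp
      also have "\<dots> = integral {- real N..real N} (\<lambda>x. of_real (exp (- pi * x\<^sup>2 / a)))"
        unfolding f_def exp_of_real[symmetric] by simp
      also have "\<dots> = of_real (integral {- real N..real N} (\<lambda>x. exp (- pi * x\<^sup>2 / a)))"
      proof -
        have "(\<lambda>x. exp (- pi * x\<^sup>2 / a)) integrable_on {- real N..real N}"
          by (intro integrable_continuous_interval continuous_intros) (use a in auto)
        from integral_linear[OF this bounded_linear_of_real[where 'a = complex]] show ?thesis by (simp add: o_def)
      qed
      finally show ?thesis .
    qed
    hence ev: "\<forall>\<^sub>F N in sequentially. of_real (integral {- real N..real N} (\<lambda>x. exp (- pi * x\<^sup>2 / a))) = P (of_nat N) - P (- of_nat N)"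
      by (auto simp: eventually_at_top_dense intro!: exI[of _ 0])
    have "(\<lambda>N. P (of_nat N) - P (- of_nat N)) \<longlonglongrightarrow> of_real (sqrt a)"
      by (rule Lim_transform_eventually[OF tendsto_of_real[OF gaussian_integral_limit[OF a]] ev])
    thus ?thesis using L1 LIMSEQ_unique by blast
  qed
  have Fper: "F (z + 1) = F z" for z unfolding F_def
    by (rule infsum_reindex_bij_witness[of _ "\<lambda>n. n - 1" "\<lambda>n. n + 1"]) (auto simp: algebra_simps)
  have Gper: "G (z + 1) = G z" for z unfolding G_def
  proof (rule infsum_cong)
    fix n :: int
    show "g n (z + 1) = g n z"
      using exp_plus_2pin[of "- of_real (pi * a) * (of_int n)\<^sup>2 + 2 * of_real pi * \<i> * of_int n * z" n]
      by (simp add: g_def algebra_simps)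
  qed
  define \<sigma> where "\<sigma> = \<i> * complex_of_real a"
  define K where "K = exp (complex_of_real (pi * a))"
  have a0: "complex_of_real a \<noteq> 0" using a by simp
  have Fq: "F (z + \<sigma>) = K * exp (- (2 * of_real pi * \<i> * z)) * F z" for z
  proof -
    have "f (z + \<sigma> + of_int n) = K * exp (- (2 * of_real pi * \<i> * z)) * f (z + of_int n)" for n
    proof -
      have eq: "- of_real pi * (z + \<sigma> + of_int n)\<^sup>2 / of_real a =
          (of_real (pi * a) + - (2 * of_real pi * \<i> * z) + - of_real pi * (z + of_int n)\<^sup>2 / of_real a) +
          \<i> * (of_int (-n) * (of_real pi * 2))"
        using a0 by (simp add: \<sigma>_def power2_eq_square field_simps)
      show ?thesis unfolding f_def K_def eq exp_plus_2pin by (simp only: exp_add)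
    qed
    thus ?thesis unfolding F_def by (simp add: infsum_cmult_right')
  qed
  have Gq: "G (z + \<sigma>) = K * exp (- (2 * of_real pi * \<i> * z)) * G z" for z
  proof -
    have "g n (z + \<sigma>) = K * exp (- (2 * of_real pi * \<i> * z)) * g (n + 1) z" for n
      unfolding g_def K_def exp_add[symmetric]
      by (rule arg_cong[of _ _ exp]) (simp add: \<sigma>_def power2_eq_square algebra_simps)
    hence "G (z + \<sigma>) = K * exp (- (2 * of_real pi * \<i> * z)) * (\<Sum>\<^sub>\<infinity>n. g (n + 1) z)"
      unfolding G_def by (simp add: infsum_cmult_right')
    also have "(\<Sum>\<^sub>\<infinity>n. g (n + 1) z) = G z" unfolding G_def
      by (rule infsum_reindex_bij_witness[of _ "\<lambda>n. n - 1" "\<lambda>n. n + 1"]) auto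
    finally show ?thesis .
  qed
  have "F b - of_real (sqrt a) * G b = 0"
  proof (rule theta_uniqueness[where h = "\<lambda>z. F z - of_real (sqrt a) * G z" and \<sigma> = \<sigma> and K = K])
    show "unit_integral (\<lambda>z. F z - of_real (sqrt a) * G z) = 0"
    proof -
      have "unit_integral (\<lambda>z. F z - of_real (sqrt a) * G z) = unit_integral F - of_real (sqrt a) * unit_integral G"
        by (subst contour_integral_diff) (auto intro!: entire_integrable holomorphic_intros FH GH
            simp: contour_integral_lmul[OF entire_integrable[OF GH]])
      thus ?thesis by (simp add: IF IG)
    qed
  qed (auto intro!: holomorphic_intros FH GH simp: Fper Gper Fq Gq algebra_simps)
  thus ?thesis unfolding F_def G_def f_def g_def by simp
qed

section \<open>Eisenstein integers and Poisson summation\<close>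

lemma zeta3_eq: "zeta3 = Complex (- (1/2)) (sqrt 3 / 2)"
proof -
  have "zeta3 = cis (2 * pi / 3)" unfolding zeta3_def cis_conv_exp by (simp add: mult_ac)
  thus ?thesis using cos_120 sin_120 by (simp add: cis.ctr complex_eq_iff)
qed

lemma sqrt_m3_sq [simp]: "sqrt_m3 * sqrt_m3 = -3" and cnj_sqrt_m3 [simp]: "cnj sqrt_m3 = - sqrt_m3"
  and sqrt_m3_nz [simp]: "sqrt_m3 \<noteq> 0" and Re_sqrt_m3 [simp]: "Re sqrt_m3 = 0"
  and Im_sqrt_m3 [simp]: "Im sqrt_m3 = sqrt 3" and norm_sqrt_m3 [simp]: "cmod sqrt_m3 = sqrt 3"
  unfolding sqrt_m3_def by (auto simp: complex_eq_iff norm_mult)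

lemma zeta3_conv: "zeta3 = (sqrt_m3 - 1) / 2" and cnj_zeta3_conv: "cnj zeta3 = (- sqrt_m3 - 1) / 2"
  unfolding zeta3_eq by (auto simp: complex_eq_iff)

lemma zeta3_sq: "zeta3 * zeta3 = - 1 - zeta3"
  unfolding zeta3_conv by (simp add: field_simps)

lemma cnj_zeta3: "cnj zeta3 = - 1 - zeta3"
  unfolding zeta3_conv cnj_zeta3_conv by (simp add: field_simps)

lemma sqrt_m3_conv: "sqrt_m3 = 1 + 2 * zeta3"
  unfolding zeta3_conv by (simp add: field_simps)

lemma zeta3_cube: "zeta3 ^ 3 = 1"
  by (simp add: power3_eq_cube zeta3_sq algebra_simps)

definition eis :: "int \<Rightarrow> int \<Rightarrow> complex" where
  "eis m n = of_int m + of_int n * zeta3"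

lemma eisenstein_eq: "eisenstein = range (\<lambda>(m, n). eis m n)"
  unfolding eisenstein_def eis_def by auto

lemma eisE: assumes "x \<in> eisenstein" obtains m n where "x = eis m n"
  using assms unfolding eisenstein_eq by auto

lemma eis_in [simp, intro]: "eis m n \<in> eisenstein"
  unfolding eisenstein_eq by auto

lemma eis_inj: "eis m n = eis m' n' \<longleftrightarrow> m = m' \<and> n = n'"
  unfolding eis_def zeta3_eq by (auto simp: complex_eq_iff)

lemma eis_add: "eis m n + eis m' n' = eis (m + m') (n + n')"
  unfolding eis_def of_int_add distrib_right by (simp only: add_ac)

lemma eis_diff: "eis m n - eis m' n' = eis (m - m') (n - n')"
  unfolding eis_def of_int_diff left_diff_distrib by (simp only: diff_conv_add_uminus minus_add_distrib add_ac)

lemma eis_minus: "- eis m n = eis (- m) (- n)"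
  unfolding eis_def of_int_minus minus_add_distrib by (simp only: mult_minus_left)

lemma eis_mult: "eis m n * eis m' n' = eis (m * m' - n * n') (m * n' + n * m' - n * n')"
proof -
  have "eis m n * eis m' n' = of_int (m * m') + of_int (m * n' + n * m') * zeta3 + of_int (n * n') * (zeta3 * zeta3)"
    unfolding eis_def by (simp add: algebra_simps)
  thus ?thesis unfolding zeta3_sq eis_def by (simp add: algebra_simps)
qed

lemma eis_cnj: "cnj (eis m n) = eis (m - n) (- n)"
  unfolding eis_def by (simp add: cnj_zeta3 algebra_simps)

lemma eisenstein_closed [simp, intro]:
  "0 \<in> eisenstein" "1 \<in> eisenstein" "zeta3 \<in> eisenstein" "sqrt_m3 \<in> eisenstein"
  "of_int k \<in> eisenstein" "of_nat j \<in> eisenstein" "numeral w \<in> eisenstein"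
  "x \<in> eisenstein \<Longrightarrow> y \<in> eisenstein \<Longrightarrow> x + y \<in> eisenstein"
  "x \<in> eisenstein \<Longrightarrow> y \<in> eisenstein \<Longrightarrow> x - y \<in> eisenstein"
  "x \<in> eisenstein \<Longrightarrow> y \<in> eisenstein \<Longrightarrow> x * y \<in> eisenstein"
  "x \<in> eisenstein \<Longrightarrow> - x \<in> eisenstein"
  "x \<in> eisenstein \<Longrightarrow> cnj x \<in> eisenstein"
proof -
  show i: "of_int k \<in> eisenstein" for k using eis_in[of k 0] by (simp add: eis_def)
  show "0 \<in> eisenstein" "1 \<in> eisenstein" using i[of 0] i[of 1] by simp_all
  show "of_nat j \<in> eisenstein" using i[of "int j"] by simp
  show "numeral w \<in> eisenstein" using i[of "numeral w"] by simp
  show "zeta3 \<in> eisenstein" using eis_in[of 0 1] by (simp add: eis_def)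
  show "sqrt_m3 \<in> eisenstein" using eis_in[of 1 2] by (simp add: eis_def sqrt_m3_conv)
qed (auto elim!: eisE simp: eis_add eis_diff eis_mult eis_minus eis_cnj)

lemma eis_cnj_mult: "eis m n * cnj (eis m n) = of_int (m * m - m * n + n * n)"
  unfolding eis_cnj eis_mult by (simp add: eis_def algebra_simps)

lemma norm_eis: "(cmod (eis m n))\<^sup>2 = of_int (m * m - m * n + n * n)"
proof -
  have "complex_of_real ((cmod (eis m n))\<^sup>2) = of_real (of_int (m * m - m * n + n * n))"
    unfolding complex_norm_square eis_cnj_mult by simp
  thus ?thesis by (simp only: of_real_eq_iff)
qed

lemma eis_norm_int: assumes "x \<in> eisenstein" obtains k :: int where "k \<ge> 0" "(cmod x)\<^sup>2 = of_int k" "x * cnj x = of_int k"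
proof -
  obtain m n where x: "x = eis m n" using eisE[OF assms] .
  have "(0::real) \<le> of_int (m * m - m * n + n * n)" unfolding norm_eis[symmetric] by simp
  hence "0 \<le> m * m - m * n + n * n" by (simp only: of_int_0_le_iff)
  thus ?thesis using that[of "m * m - m * n + n * n"] x norm_eis[of m n] eis_cnj_mult[of m n] by simp
qed

lemma eis_norm_ge: "(cmod (eis m n))\<^sup>2 \<ge> ((of_int m)\<^sup>2 + (of_int n)\<^sup>2) / 2"
proof -
  have "(x * x + y * y) / 2 \<le> x * x - x * y + y * y" for x y :: real
  proof -
    have "x * x - x * y + y * y = (x * x + y * y) / 2 + (x - y) * (x - y) / 2" by (simp add: field_simps)
    thus ?thesis using zero_le_square[of "x - y"] by linarith
  qed
  thus ?thesis unfolding norm_eis unfolding power2_eq_square of_int_add of_int_diff of_int_mult .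
qed

lemma eis_norm_le: "cmod (eis m n) \<le> \<bar>of_int m\<bar> + \<bar>of_int n\<bar>"
proof -
  have z: "cmod zeta3 = 1" unfolding zeta3_def by (simp add: norm_exp_eq_Re)
  have "cmod (eis m n) \<le> cmod (of_int m) + cmod (of_int n * zeta3)" unfolding eis_def by (rule norm_triangle_ineq)
  thus ?thesis by (simp add: norm_mult z)
qed

lemma bij_eis: "bij_betw (\<lambda>(m, n). eis m n) (UNIV \<times> UNIV) eisenstein"
  unfolding bij_betw_def eisenstein_eq by (auto simp: inj_on_def eis_inj)

lemma infsum_eis: "(\<Sum>\<^sub>\<infinity>l\<in>eisenstein. f l) = (\<Sum>\<^sub>\<infinity>(m, n)\<in>UNIV \<times> UNIV. f (eis m n))"
  using infsum_reindex_bij_betw[OF bij_eis, of f] by (simp add: case_prod_unfold)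

lemma summable_eis: "f summable_on eisenstein \<longleftrightarrow> (\<lambda>(m, n). f (eis m n)) summable_on UNIV \<times> UNIV"
  using summable_on_reindex_bij_betw[OF bij_eis, of f] by (simp add: case_prod_unfold)

lemma summable_on_gauss2:
  fixes \<alpha> \<alpha>' \<beta> \<beta>' :: real
  assumes "\<alpha> > 0" "\<alpha>' > 0"
  shows "(\<lambda>(m::int, n::int). exp (- \<alpha> * (of_int m)\<^sup>2 + \<beta> * \<bar>of_int m\<bar>) * exp (- \<alpha>' * (of_int n)\<^sup>2 + \<beta>' * \<bar>of_int n\<bar>))
    summable_on UNIV \<times> UNIV"
  by (intro product_summable_on_real summable_on_gauss assms)

lemma summable_on_dominated:
  fixes f :: "'a \<Rightarrow> complex" and g :: "'a \<Rightarrow> real"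
  assumes "g summable_on A" "\<And>x. x \<in> A \<Longrightarrow> cmod (f x) \<le> g x"
  shows "f summable_on A"
  unfolding summable_on_iff_abs_summable_on_complex
  by (rule Infinite_Sum.abs_summable_on_comparison_test'[OF assms])

lemma summable_on_dominated_real:
  fixes f :: "'a \<Rightarrow> real" and g :: "'a \<Rightarrow> real"
  assumes "g summable_on A" "\<And>x. x \<in> A \<Longrightarrow> \<bar>f x\<bar> \<le> g x"
  shows "f summable_on A"
  by (rule iffD2[OF summable_on_iff_abs_summable_on_real],
      rule Infinite_Sum.abs_summable_on_comparison_test'[OF assms(1)]) (simp add: assms(2))

lemma summable_eis_gauss:
  assumes "\<delta> > 0"
  shows "(\<lambda>l. exp (- \<delta> * (cmod l)\<^sup>2 + \<beta> * cmod l)) summable_on eisenstein"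
  unfolding summable_eis
proof (rule summable_on_dominated_real[OF summable_on_gauss2[of "\<delta>/2" "\<delta>/2" "\<bar>\<beta>\<bar>" "\<bar>\<beta>\<bar>"]])
  fix p :: "int \<times> int"
  obtain m n where p: "p = (m, n)" by fastforce
  have "- \<delta> * (cmod (eis m n))\<^sup>2 \<le> - \<delta> * (((of_int m)\<^sup>2 + (of_int n)\<^sup>2) / 2)"
    using assms eis_norm_ge[of m n] by simp
  moreover have "\<beta> * cmod (eis m n) \<le> \<bar>\<beta>\<bar> * (\<bar>of_int m\<bar> + \<bar>of_int n\<bar>)"
    using eis_norm_le[of m n] by (intro mult_mono) auto
  ultimately have "- \<delta> * (cmod (eis m n))\<^sup>2 + \<beta> * cmod (eis m n) \<le>
     (- (\<delta>/2) * (of_int m)\<^sup>2 + \<bar>\<beta>\<bar> * \<bar>of_int m\<bar>) + (- (\<delta>/2) * (of_int n)\<^sup>2 + \<bar>\<beta>\<bar> * \<bar>of_int n\<bar>)"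
    by (simp add: algebra_simps)
  thus "\<bar>case p of (m, n) \<Rightarrow> exp (- \<delta> * (cmod (eis m n))\<^sup>2 + \<beta> * cmod (eis m n))\<bar> \<le>
     (case p of (m, n) \<Rightarrow> exp (- (\<delta>/2) * (of_int m)\<^sup>2 + \<bar>\<beta>\<bar> * \<bar>of_int m\<bar>) * exp (- (\<delta>/2) * (of_int n)\<^sup>2 + \<bar>\<beta>\<bar> * \<bar>of_int n\<bar>))"
    unfolding p by (simp only: prod.case exp_add[symmetric] abs_exp_cancel exp_le_cancel_iff)
qed (use assms in auto)

text \<open>The scale for which \<open>exp (cc * z)\<close> has period \<open>sqrt_m3\<close>. Since
  x - cnj x is an integral multiple of \<open>sqrt_m3\<close> for every Eisenstein integer x, the
  pairing exp (cc * (x * cnj y - cnj x * y)) is trivial on the lattice, and the lattice is its own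
  dual for it.\<close>

definition cc :: complex where "cc = of_real (2 * pi / sqrt 3)"

lemma cc_theta: "cc * sqrt_m3 = 2 * of_real pi * \<i>"
  unfolding cc_def sqrt_m3_def by simp

lemma cc_nz [simp]: "cc \<noteq> 0" unfolding cc_def by simp

lemma norm_exp_cc: "cmod (exp (cc * z)) = exp (2 * pi / sqrt 3 * Re z)"
  unfolding cc_def by (simp add: norm_exp_eq_Re)

lemma exp_cc_int: "exp (cc * (z + sqrt_m3 * of_int k)) = exp (cc * z)"
proof -
  have "cc * (z + sqrt_m3 * of_int k) = cc * z + (cc * sqrt_m3) * of_int k" by (simp add: algebra_simps)
  also have "\<dots> = cc * z + \<i> * (of_int k * (of_real pi * 2))" unfolding cc_theta by simp
  finally show ?thesis by (simp only: exp_plus_2pin)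
qed

lemma exp_cc_cong: "z - w = sqrt_m3 * of_int k \<Longrightarrow> exp (cc * z) = exp (cc * w)"
  using exp_cc_int[of w k] by (simp add: algebra_simps)

lemma theta_inversion_cc:
  fixes s :: real and b :: complex
  assumes s: "s > 0"
  shows "(\<Sum>\<^sub>\<infinity>n::int. exp (cc * (- of_real s * (of_int n)\<^sup>2 + sqrt_m3 * of_int n * b))) =
    of_real (1 / sqrt (2 * s / sqrt 3)) * (\<Sum>\<^sub>\<infinity>n::int. exp (cc * (- (3 / (4 * of_real s)) * (b + of_int n)\<^sup>2)))"
proof -
  define a where "a = 2 * s / sqrt 3"
  have a: "a > 0" using s by (simp add: a_def)
  have 1: "cc * (- of_real s * (of_int n)\<^sup>2 + sqrt_m3 * of_int n * b) =
      - of_real (pi * a) * (of_int n)\<^sup>2 + 2 * of_real pi * \<i> * of_int n * b" for n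
  proof -
    have "cc * of_real s = of_real (pi * a)" unfolding cc_def a_def by simp
    moreover have "cc * (- of_real s * (of_int n)\<^sup>2 + sqrt_m3 * of_int n * b) =
        - (cc * of_real s) * (of_int n)\<^sup>2 + (cc * sqrt_m3) * of_int n * b" by (simp add: algebra_simps)
    ultimately show ?thesis unfolding cc_theta by simp
  qed
  have 2: "cc * (- (3 / (4 * of_real s)) * (b + of_int n)\<^sup>2) = - of_real pi * (b + of_int n)\<^sup>2 / of_real a" for n
  proof -
    have "2 * pi / sqrt 3 * (3 / (4 * s)) = pi / a"
    proof -
      have "(3::real) = sqrt 3 * sqrt 3" by simp
      thus ?thesis using s unfolding a_def by (simp add: field_simps)
    qed
    hence "cc * (3 / (4 * of_real s)) = of_real pi / of_real a"
      unfolding cc_def by (metis of_real_divide of_real_mult of_real_numeral)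
    thus ?thesis by simp (metis (no_types, lifting) mult.assoc times_divide_eq_left times_divide_eq_right)
  qed
  show ?thesis unfolding 1 2 theta_inversion[OF a] a_def[symmetric] using a by simp
qed

text \<open>The norm form (m - n/2)^2 + 3 n^2 / 4 is treated one coordinate at a time: inversion in
  \<open>m\<close> for fixed \<open>n\<close>, exchange of the sums, inversion in \<open>n\<close>.
  The two dual indices assemble to a lattice point because the lattice is self-dual, and the two
  square root constants multiply to \<open>1 / t\<close>.\<close>

theorem poisson_eisenstein:
  fixes t :: real and A B :: complex
  assumes t: "t > 0"
  shows "(\<Sum>\<^sub>\<infinity>l\<in>eisenstein. exp (cc * (- of_real t * (l * cnj l) + A * cnj l + B * l))) =
    of_real (1 / t) * (\<Sum>\<^sub>\<infinity>\<nu>\<in>eisenstein. exp (cc * ((A + \<nu>) * (B - cnj \<nu>) / of_real t)))"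
proof -
  let ?t = "complex_of_real t"
  have t0: "?t \<noteq> 0" using t by simp
  define c where "c = 2 * pi / sqrt 3"
  have c: "c > 0" by (simp add: c_def)
  define L where "L = (\<lambda>l. exp (cc * (- ?t * (l * cnj l) + A * cnj l + B * l)))"
  have Ls: "L summable_on eisenstein"
  proof (rule summable_on_dominated[OF summable_eis_gauss[of "c * t" "c * (cmod A + cmod B)"]])
    fix l :: complex
    have "Re (A * cnj l) \<le> cmod A * cmod l" "Re (B * l) \<le> cmod B * cmod l"
      using complex_Re_le_cmod[of "A * cnj l"] complex_Re_le_cmod[of "B * l"] by (simp_all add: norm_mult)
    hence "Re (- ?t * (l * cnj l) + A * cnj l + B * l) \<le> - t * (cmod l)\<^sup>2 + (cmod A + cmod B) * cmod l"
      unfolding complex_norm_square[symmetric] by (simp add: algebra_simps)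
    hence "c * Re (- ?t * (l * cnj l) + A * cnj l + B * l) \<le> c * (- t * (cmod l)\<^sup>2 + (cmod A + cmod B) * cmod l)"
      using c by (intro mult_left_mono) auto
    thus "cmod (L l) \<le> exp (- (c * t) * (cmod l)\<^sup>2 + c * (cmod A + cmod B) * cmod l)"
      unfolding L_def norm_exp_cc c_def[symmetric] by (simp add: algebra_simps)
  qed (use t c in auto)
  \<comment> \<open>The state after the first inversion: Gaussian in the old index \<open>n\<close>
    and in the dual index \<open>k\<close>, which are coupled only by a phase. Hence the double
    family is absolutely summable and the sums may be exchanged.\<close>
  define E where "E = (\<lambda>(n::int) (k::int). exp (cc * (- (3 * ?t / 4) * (of_int n)\<^sup>2 + sqrt_m3 * of_int n * ((B - A + of_int k) / 2)
      - 3 * (of_int k)\<^sup>2 / (4 * ?t) + of_int k * sqrt_m3 * (A + B) / (2 * ?t) + (A + B)\<^sup>2 / (4 * ?t))))"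
  have inner1: "(\<Sum>\<^sub>\<infinity>m. L (eis m n)) = of_real (1 / sqrt (2 * t / sqrt 3)) * (\<Sum>\<^sub>\<infinity>k. E n k)" for n
  proof -
    define b where "b = (?t * of_int n + A + B) / sqrt_m3"
    define r where "r = - ?t * (of_int n)\<^sup>2 + of_int n * (A * cnj zeta3 + B * zeta3)"
    have b: "sqrt_m3 * b = ?t * of_int n + A + B" by (simp add: b_def)
    have "L (eis m n) = exp (cc * (- ?t * (of_int m)\<^sup>2 + sqrt_m3 * of_int m * b)) * exp (cc * r)" for m
    proof -
      have "- ?t * (eis m n * cnj (eis m n)) + A * cnj (eis m n) + B * eis m n =
         - ?t * (of_int m)\<^sup>2 + of_int m * (?t * of_int n + A + B) + r"
        unfolding eis_cnj_mult r_def by (simp add: eis_def power2_eq_square algebra_simps)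
      also have "\<dots> = - ?t * (of_int m)\<^sup>2 + sqrt_m3 * of_int m * b + r" unfolding b[symmetric] by (simp add: mult_ac)
      finally show ?thesis unfolding L_def by (simp only: distrib_left exp_add)
    qed
    hence "(\<Sum>\<^sub>\<infinity>m. L (eis m n)) = (\<Sum>\<^sub>\<infinity>m. exp (cc * (- ?t * (of_int m)\<^sup>2 + sqrt_m3 * of_int m * b))) * exp (cc * r)"
      by (simp add: infsum_cmult_left')
    also have "\<dots> = of_real (1 / sqrt (2 * t / sqrt 3)) * ((\<Sum>\<^sub>\<infinity>k. exp (cc * (- (3 / (4 * ?t)) * (b + of_int k)\<^sup>2))) * exp (cc * r))"
      unfolding theta_inversion_cc[OF t] by (simp only: mult.assoc)
    also have "(\<Sum>\<^sub>\<infinity>k. exp (cc * (- (3 / (4 * ?t)) * (b + of_int k)\<^sup>2))) * exp (cc * r) = (\<Sum>\<^sub>\<infinity>k. E n k)"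
    proof (subst infsum_cmult_left'[symmetric], rule infsum_cong)
      fix k :: int
      have b': "b = - sqrt_m3 * (?t * of_int n + A + B) / 3"
      proof -
        have "sqrt_m3 * (sqrt_m3 * b) = -3 * b" by (simp add: mult.assoc[symmetric])
        thus ?thesis unfolding b by (simp add: field_simps)
      qed
      have sq: "sqrt_m3 * (sqrt_m3 * x) = -3 * x" for x by (simp add: mult.assoc[symmetric])
      have "- (3 / (4 * ?t)) * (b + of_int k)\<^sup>2 + r =
        - (3 * ?t / 4) * (of_int n)\<^sup>2 + sqrt_m3 * of_int n * ((B - A + of_int k) / 2)
      - 3 * (of_int k)\<^sup>2 / (4 * ?t) + of_int k * sqrt_m3 * (A + B) / (2 * ?t) + (A + B)\<^sup>2 / (4 * ?t)"
        unfolding b' r_def zeta3_conv cnj_zeta3_conv using t0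
        by (simp add: power2_eq_square field_simps sq)
      thus "exp (cc * (- (3 / (4 * ?t)) * (b + of_int k)\<^sup>2)) * exp (cc * r) = E n k"
        unfolding E_def by (simp only: exp_add[symmetric] distrib_left[symmetric])
    qed
    finally show ?thesis .
  qed
  have inner2: "(\<Sum>\<^sub>\<infinity>n. E n k) = of_real (1 / sqrt (sqrt 3 * t / 2)) *
      (\<Sum>\<^sub>\<infinity>j. exp (cc * ((A + eis (-j) k) * (B - cnj (eis (-j) k)) / ?t)))" for k
  proof -
    define b where "b = (B - A + of_int k) / 2"
    define r where "r = - 3 * (of_int k)\<^sup>2 / (4 * ?t) + of_int k * sqrt_m3 * (A + B) / (2 * ?t) + (A + B)\<^sup>2 / (4 * ?t)"
    have s: "3 * t / 4 > 0" "sqrt (2 * (3 * t / 4) / sqrt 3) = sqrt (sqrt 3 * t / 2)"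
    proof -
      have "(3::real) = sqrt 3 * sqrt 3" by simp
      hence "2 * (3 * t / 4) / sqrt 3 = sqrt 3 * t / 2" by (simp add: field_simps)
      thus "sqrt (2 * (3 * t / 4) / sqrt 3) = sqrt (sqrt 3 * t / 2)" by simp
    qed (use t in simp)
    have "E n k = exp (cc * (- of_real (3 * t / 4) * (of_int n)\<^sup>2 + sqrt_m3 * of_int n * b)) * exp (cc * r)" for n
      unfolding E_def r_def b_def exp_add[symmetric] distrib_left[symmetric]
      by (rule arg_cong[of _ _ exp]) simp
    hence "(\<Sum>\<^sub>\<infinity>n. E n k) = (\<Sum>\<^sub>\<infinity>n. exp (cc * (- of_real (3 * t / 4) * (of_int n)\<^sup>2 + sqrt_m3 * of_int n * b))) * exp (cc * r)"
      by (simp add: infsum_cmult_left')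
    also have "\<dots> = of_real (1 / sqrt (sqrt 3 * t / 2)) *
        ((\<Sum>\<^sub>\<infinity>j. exp (cc * (- (3 / (4 * of_real (3 * t / 4))) * (b + of_int j)\<^sup>2))) * exp (cc * r))"
      unfolding theta_inversion_cc[OF s(1)] s(2) by (simp add: mult.assoc)
    also have "(\<Sum>\<^sub>\<infinity>j. exp (cc * (- (3 / (4 * of_real (3 * t / 4))) * (b + of_int j)\<^sup>2))) * exp (cc * r) =
        (\<Sum>\<^sub>\<infinity>j. exp (cc * ((A + eis (-j) k) * (B - cnj (eis (-j) k)) / ?t)))"
    proof (subst infsum_cmult_left'[symmetric], rule infsum_cong)
      fix j :: int
      have sq: "sqrt_m3 * (sqrt_m3 * x) = -3 * x" for x by (simp add: mult.assoc[symmetric])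
      have "- (3 / (4 * of_real (3 * t / 4))) * (b + of_int j)\<^sup>2 + r =
         (A + eis (-j) k) * (B - cnj (eis (-j) k)) / ?t"
        unfolding b_def r_def eis_def complex_cnj_add complex_cnj_mult complex_cnj_of_int zeta3_conv cnj_zeta3_conv using t0
        by (simp add: power2_eq_square field_simps sq)
      thus "exp (cc * (- (3 / (4 * of_real (3 * t / 4))) * (b + of_int j)\<^sup>2)) * exp (cc * r) =
         exp (cc * ((A + eis (-j) k) * (B - cnj (eis (-j) k)) / ?t))"
        by (simp only: exp_add[symmetric] distrib_left[symmetric])
    qed
    finally show ?thesis .
  qed
  have Es: "(\<lambda>(n, k). E n k) summable_on UNIV \<times> UNIV"
  proof -
    define X where "X = Re (sqrt_m3 * (B - A) / 2)"
    define Y where "Y = Re (sqrt_m3 * (A + B) / (2 * ?t))"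
    define Z where "Z = Re ((A + B)\<^sup>2 / (4 * ?t))"
    have "cmod (E n k) \<le> exp (c * Z) * (exp (- (c * (3 * t / 4)) * (of_int n)\<^sup>2 + c * \<bar>X\<bar> * \<bar>of_int n\<bar>) *
         exp (- (c * (3 / (4 * t))) * (of_int k)\<^sup>2 + c * \<bar>Y\<bar> * \<bar>of_int k\<bar>))" for n k
    proof -
      have 1: "Re (- (3 * ?t / 4) * (of_int n)\<^sup>2) = - (3 * t / 4) * (of_int n)\<^sup>2"
        "Re (3 * (of_int k)\<^sup>2 / (4 * ?t)) = 3 / (4 * t) * (of_int k)\<^sup>2"
      proof -
        have "- (3 * ?t / 4) * (of_int n)\<^sup>2 = of_real (- (3 * t / 4) * (of_int n)\<^sup>2)" by simp
        thus "Re (- (3 * ?t / 4) * (of_int n)\<^sup>2) = - (3 * t / 4) * (of_int n)\<^sup>2" by (metis Re_complex_of_real)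
        have "3 * (of_int k)\<^sup>2 / (4 * ?t) = of_real (3 / (4 * t) * (of_int k)\<^sup>2)" by simp
        thus "Re (3 * (of_int k)\<^sup>2 / (4 * ?t)) = 3 / (4 * t) * (of_int k)\<^sup>2" by (metis Re_complex_of_real)
      qed
      have 2: "Re (sqrt_m3 * of_int n * ((B - A + of_int k) / 2)) = of_int n * X"
        "Re (of_int k * sqrt_m3 * (A + B) / (2 * ?t)) = of_int k * Y"
      proof -
        have e1: "sqrt_m3 * of_int n * ((B - A + of_int k) / 2) = of_int n * (sqrt_m3 * (B - A) / 2) + of_int (n * k) * (sqrt_m3 / 2)"
          by (simp add: field_simps)
        have e2: "Re (of_int (n * k) * (sqrt_m3 / 2)) = 0" by (simp add: Re_divide_numeral)
        show "Re (sqrt_m3 * of_int n * ((B - A + of_int k) / 2)) = of_int n * X"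
          unfolding e1 plus_complex.simps e2 X_def by simp
        have "of_int k * sqrt_m3 * (A + B) / (2 * ?t) = of_int k * (sqrt_m3 * (A + B) / (2 * ?t))" by simp
        thus "Re (of_int k * sqrt_m3 * (A + B) / (2 * ?t)) = of_int k * Y" unfolding Y_def by simp
      qed
      have "of_int n * X \<le> \<bar>X\<bar> * \<bar>of_int n\<bar>" "of_int k * Y \<le> \<bar>Y\<bar> * \<bar>of_int k\<bar>"
        by (metis abs_ge_self abs_mult mult.commute)+
      hence "- (3 * t / 4) * (of_int n)\<^sup>2 + of_int n * X - 3 / (4 * t) * (of_int k)\<^sup>2 + of_int k * Y + Z \<le>
          Z + (- (3 * t / 4) * (of_int n)\<^sup>2 + \<bar>X\<bar> * \<bar>of_int n\<bar>) + (- (3 / (4 * t)) * (of_int k)\<^sup>2 + \<bar>Y\<bar> * \<bar>of_int k\<bar>)"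
        by simp
      hence "c * (- (3 * t / 4) * (of_int n)\<^sup>2 + of_int n * X - 3 / (4 * t) * (of_int k)\<^sup>2 + of_int k * Y + Z) \<le>
          c * (Z + (- (3 * t / 4) * (of_int n)\<^sup>2 + \<bar>X\<bar> * \<bar>of_int n\<bar>) + (- (3 / (4 * t)) * (of_int k)\<^sup>2 + \<bar>Y\<bar> * \<bar>of_int k\<bar>))"
        using c by (intro mult_left_mono) auto
      thus ?thesis unfolding E_def norm_exp_cc c_def[symmetric] plus_complex.simps minus_complex.simps 1 2 Z_def[symmetric] exp_add[symmetric]
        by (simp add: algebra_simps)
    qed
    moreover have "(\<lambda>p. exp (c * Z) * (case p of (n, k) \<Rightarrow>
         exp (- (c * (3 * t / 4)) * (of_int n)\<^sup>2 + c * \<bar>X\<bar> * \<bar>of_int n\<bar>) *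
         exp (- (c * (3 / (4 * t))) * (of_int k)\<^sup>2 + c * \<bar>Y\<bar> * \<bar>of_int k\<bar>))) summable_on UNIV \<times> UNIV"
      using c t by (intro summable_on_cmult_right summable_on_gauss2) auto
    ultimately show ?thesis by (elim summable_on_dominated) auto
  qed
  have "infsum L eisenstein = (\<Sum>\<^sub>\<infinity>n. \<Sum>\<^sub>\<infinity>m. L (eis m n))"
    unfolding infsum_eis using infsum_Sigma'_banach[of "\<lambda>m n. L (eis m n)" UNIV "\<lambda>_. UNIV"] Ls
    by (subst infsum_swap_banach[symmetric]) (simp_all add: summable_eis)
  also have "\<dots> = of_real (1 / sqrt (2 * t / sqrt 3)) * (\<Sum>\<^sub>\<infinity>n. \<Sum>\<^sub>\<infinity>k. E n k)"
    unfolding inner1 by (rule infsum_cmult_right')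
  also have "(\<Sum>\<^sub>\<infinity>n. \<Sum>\<^sub>\<infinity>k. E n k) = (\<Sum>\<^sub>\<infinity>k. \<Sum>\<^sub>\<infinity>n. E n k)"
    by (rule infsum_swap_banach[OF Es])
  also have "\<dots> = of_real (1 / sqrt (sqrt 3 * t / 2)) * (\<Sum>\<^sub>\<infinity>k. \<Sum>\<^sub>\<infinity>j. exp (cc * ((A + eis (-j) k) * (B - cnj (eis (-j) k)) / ?t)))"
    unfolding inner2 by (rule infsum_cmult_right')
  finally have 1: "infsum L eisenstein = of_real (1 / sqrt (2 * t / sqrt 3)) * (of_real (1 / sqrt (sqrt 3 * t / 2)) *
     (\<Sum>\<^sub>\<infinity>k. \<Sum>\<^sub>\<infinity>j. exp (cc * ((A + eis (-j) k) * (B - cnj (eis (-j) k)) / ?t))))" .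
  have 2: "1 / sqrt (2 * t / sqrt 3) * (1 / sqrt (sqrt 3 * t / 2)) = 1 / t"
    using t by (simp add: real_sqrt_mult[symmetric] power2_eq_square[symmetric])
  define R where "R = (\<lambda>\<nu>. exp (cc * ((A + \<nu>) * (B - cnj \<nu>) / ?t)))"
  have Rs: "R summable_on eisenstein"
  proof (rule summable_on_dominated[OF summable_on_cmult_right[OF summable_eis_gauss[of "c / t" "c * (cmod A + cmod B) / t"]]])
    fix \<nu> :: complex
    have "Re (B * \<nu> - A * cnj \<nu>) \<le> (cmod A + cmod B) * cmod \<nu>"
      using complex_Re_le_cmod[of "B * \<nu> - A * cnj \<nu>"] norm_triangle_ineq4[of "B * \<nu>" "A * cnj \<nu>"]
      by (simp add: norm_mult algebra_simps)
    hence "Re (A * B) + Re (B * \<nu> - A * cnj \<nu>) - (cmod \<nu>)\<^sup>2 \<le> Re (A * B) + (cmod A + cmod B) * cmod \<nu> - (cmod \<nu>)\<^sup>2" by simp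
    also have "Re (A * B) + Re (B * \<nu> - A * cnj \<nu>) - (cmod \<nu>)\<^sup>2 = Re ((A + \<nu>) * (B - cnj \<nu>))"
      unfolding cmod_power2 by (simp add: algebra_simps power2_eq_square)
    finally have "c * (Re ((A + \<nu>) * (B - cnj \<nu>)) / t) \<le> c * ((Re (A * B) + (cmod A + cmod B) * cmod \<nu> - (cmod \<nu>)\<^sup>2) / t)"
      using c t by (intro mult_left_mono divide_right_mono) auto
    thus "cmod (R \<nu>) \<le> exp (c * Re (A * B) / t) * exp (- (c / t) * (cmod \<nu>)\<^sup>2 + c * (cmod A + cmod B) / t * cmod \<nu>)"
      unfolding R_def norm_exp_cc c_def[symmetric] Re_divide_of_real exp_add[symmetric] exp_le_cancel_iff
      by (simp add: add_divide_distrib diff_divide_distrib distrib_left distrib_right right_diff_distrib mult.assoc)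
  qed (use c t in auto)
  have "(\<Sum>\<^sub>\<infinity>k. \<Sum>\<^sub>\<infinity>j. R (eis (-j) k)) = (\<Sum>\<^sub>\<infinity>k. \<Sum>\<^sub>\<infinity>j. R (eis j k))"
    by (rule infsum_cong, rule infsum_reindex_bij_witness[of _ uminus uminus]) auto
  also have "\<dots> = infsum R eisenstein"
    unfolding infsum_eis using infsum_Sigma'_banach[of "\<lambda>m n. R (eis m n)" UNIV "\<lambda>_. UNIV"] Rs
    by (subst infsum_swap_banach[symmetric]) (simp_all add: summable_eis)
  finally have 4: "(\<Sum>\<^sub>\<infinity>k. \<Sum>\<^sub>\<infinity>j. R (eis (-j) k)) = infsum R eisenstein" .
  have 3: "infsum L eisenstein = of_real (1 / sqrt (2 * t / sqrt 3) * (1 / sqrt (sqrt 3 * t / 2))) * infsum R eisenstein"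
    using 1 unfolding 4[symmetric] by (simp only: R_def mult.assoc of_real_mult)
  show ?thesis using 3 unfolding 2 L_def R_def .
qed

section \<open>The sigma function of the Eisenstein lattice\<close>

definition cr :: real where "cr = 2 * pi / sqrt 3"

lemma cr_pos: "cr > 0" by (simp add: cr_def)

lemma norm_exp_cr: "cmod (exp (cc * z)) = exp (cr * Re z)"
  unfolding norm_exp_cc cr_def ..

lemma sq_m3 [simp]: "sqrt_m3 * (sqrt_m3 * x) = - 3 * x"
  by (simp add: mult.assoc[symmetric])

lemma sqrt_m3_power2 [simp]: "sqrt_m3\<^sup>2 = -3"
  by (simp add: power2_eq_square)

text \<open>The exponents of the odd Jacobi theta series with period ratio \<open>zeta3\<close>:
  half-integral index, and an alternating sign from \<open>- of_int n\<close>. The summand w^2 / 2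
  brings the automorphy factor for a lattice vector b to the uniform shape of
  \<open>esigma_shift\<close>, a constant times exp (cc * (cnj b * w)).\<close>

definition sigma_exponent :: "complex \<Rightarrow> int \<Rightarrow> complex" where
  "sigma_exponent w n = w\<^sup>2 / 2 + (sqrt_m3 / 2) * (zeta3 * (of_int n + 1/2)\<^sup>2 + 2 * (of_int n + 1/2) * w - of_int n)"

text \<open>Up to a constant this is the Weierstrass sigma function of the lattice of Eisenstein integers,
  multiplied by the exponential of a quadratic form.\<close>

definition esigma :: "complex \<Rightarrow> complex" where
  "esigma w = (\<Sum>\<^sub>\<infinity>n. exp (cc * sigma_exponent w n))"

text \<open>Completing the square: after removal of exp (cr * |w|^2 / 2) the moduli of the terms
  form a Gaussian whose centre depends on \<open>Im w\<close> alone. This gives bounds uniform in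
  \<open>w\<close>.\<close>

lemma Re_sigma_exponent:
  "Re (sigma_exponent w n) = (cmod w)\<^sup>2 / 2 - (3 / 4) * (of_int n + 1/2 + 2 * Im w / sqrt 3)\<^sup>2"
proof -
  define \<beta> :: real where "\<beta> = of_int n + 1/2"
  have r3: "sqrt 3 * (sqrt 3 * x) = 3 * x" for x :: real by (simp add: mult.assoc[symmetric])
  have "sigma_exponent w n = w\<^sup>2 / 2 + (sqrt_m3 * zeta3 / 2) * of_real (\<beta>\<^sup>2) + (sqrt_m3 * w) * of_real \<beta> - (sqrt_m3 / 2) * of_real (of_int n)"
    unfolding sigma_exponent_def \<beta>_def by (simp add: field_simps power2_eq_square)
  also have "sqrt_m3 * zeta3 / 2 = - (3 + sqrt_m3) / 4"
    unfolding zeta3_conv by (simp add: field_simps)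
  finally have "Re (sigma_exponent w n) = Re (w\<^sup>2) / 2 - (3 / 4) * \<beta>\<^sup>2 - sqrt 3 * Im w * \<beta>"
    by (simp add: Re_divide_numeral)
  also have "Re (w\<^sup>2) = (cmod w)\<^sup>2 - 2 * (Im w)\<^sup>2" by (simp add: Re_power2 cmod_power2)
  also have "((cmod w)\<^sup>2 - 2 * (Im w)\<^sup>2) / 2 - (3 / 4) * \<beta>\<^sup>2 - sqrt 3 * Im w * \<beta> =
      (cmod w)\<^sup>2 / 2 - (3 / 4) * (\<beta> + 2 * Im w / sqrt 3)\<^sup>2"
  proof -
    have "Im w * sqrt 3 = 3 * (Im w / sqrt 3)" by (simp add: field_simps)
    moreover have "(Im w)\<^sup>2 = 3 * (Im w / sqrt 3)\<^sup>2" by (simp add: power_divide)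
    ultimately show ?thesis by (simp add: power2_eq_square field_simps)
  qed
  finally show ?thesis unfolding \<beta>_def .
qed

lemma norm_sigma_term:
  "cmod (exp (cc * sigma_exponent w n)) =
     exp (cr / 2 * (cmod w)\<^sup>2) * exp (- (3 * cr / 4) * (of_int n + (1/2 + 2 * Im w / sqrt 3))\<^sup>2)"
  unfolding norm_exp_cr Re_sigma_exponent exp_add[symmetric] by (simp add: algebra_simps)

lemma summable_gauss_shift:
  fixes \<alpha> t :: real assumes "\<alpha> > 0"
  shows "(\<lambda>n::int. exp (- \<alpha> * (of_int n + t)\<^sup>2)) summable_on UNIV"
proof (rule summable_on_dominated_real[OF summable_on_gauss[OF assms, of "2 * \<alpha> * \<bar>t\<bar>"]])
  fix n :: int
  have 1: "- (of_int n * t) \<le> \<bar>of_int n\<bar> * \<bar>t\<bar>" by (metis abs_ge_minus_self abs_mult)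
  have "(2 * \<alpha>) * (- (of_int n * t)) \<le> (2 * \<alpha>) * (\<bar>of_int n\<bar> * \<bar>t\<bar>)"
    by (rule mult_left_mono[OF 1]) (use assms in simp)
  moreover have "0 \<le> \<alpha> * t\<^sup>2" using assms by simp
  ultimately have "- \<alpha> * (of_int n + t)\<^sup>2 \<le> - \<alpha> * (of_int n)\<^sup>2 + 2 * \<alpha> * \<bar>t\<bar> * \<bar>of_int n\<bar>"
    by (simp add: power2_eq_square algebra_simps)
  thus "\<bar>exp (- \<alpha> * (of_int n + t)\<^sup>2)\<bar> \<le> exp (- \<alpha> * (of_int n)\<^sup>2 + 2 * \<alpha> * \<bar>t\<bar> * \<bar>of_int n\<bar>)"
    by simp
qed

lemma esigma_summable: "(\<lambda>n. exp (cc * sigma_exponent w n)) summable_on UNIV"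
proof (rule summable_on_dominated)
  show "(\<lambda>n::int. exp (cr / 2 * (cmod w)\<^sup>2) * exp (- (3 * cr / 4) * (of_int n + (1/2 + 2 * Im w / sqrt 3))\<^sup>2)) summable_on UNIV"
    by (intro summable_on_cmult_right summable_gauss_shift) (simp add: cr_pos)
qed (simp only: norm_sigma_term order.refl)

lemma esigma_holomorphic: "esigma holomorphic_on UNIV"
proof -
  have "(\<lambda>w. \<Sum>\<^sub>\<infinity>n. exp (cc * sigma_exponent w n)) holomorphic_on UNIV"
  proof (rule holomorphic_on_infsum)
    show "(\<lambda>w. exp (cc * sigma_exponent w n)) holomorphic_on UNIV" for n
      unfolding sigma_exponent_def by (intro holomorphic_intros) auto
    fix z :: complex
    define R where "R = cmod z + 1"
    have R: "R \<ge> 0" by (simp add: R_def)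
    define M where "M = (\<lambda>n::int. exp (cr / 2 * R\<^sup>2) * exp (- (3 * cr / 4) * (of_int n)\<^sup>2 + (3 * cr / 4) * (2 * (1/2 + 2 * R)) * \<bar>of_int n\<bar>))"
    show "\<exists>r>0. \<exists>M. cball z r \<subseteq> UNIV \<and> M summable_on UNIV \<and>
                 (\<forall>n\<in>UNIV. \<forall>w\<in>cball z r. cmod (exp (cc * sigma_exponent w n)) \<le> M n)"
    proof (intro exI[of _ 1] exI[of _ M] conjI ballI)
      show "M summable_on UNIV" unfolding M_def by (intro summable_on_cmult_right summable_on_gauss) (simp add: cr_pos)
      fix n :: int and w assume "w \<in> cball z 1"
      hence w: "cmod w \<le> R" using norm_triangle_sub[of w z] by (simp add: R_def dist_norm norm_minus_commute)
      define t where "t = 1/2 + 2 * Im w / sqrt 3"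
      have s3: "sqrt 3 \<ge> (1::real)" by simp
      have "\<bar>2 * Im w / sqrt 3\<bar> \<le> 2 * R"
      proof -
        have "\<bar>2 * Im w / sqrt 3\<bar> \<le> \<bar>2 * Im w\<bar> / 1" unfolding abs_divide using s3 by (intro divide_left_mono) auto
        thus ?thesis using w abs_Im_le_cmod[of w] by simp
      qed
      hence t: "\<bar>t\<bar> \<le> 1/2 + 2 * R" unfolding t_def by linarith
      have "- (of_int n * t) \<le> \<bar>of_int n\<bar> * (1/2 + 2 * R)"
        by (rule order_trans[of _ "\<bar>of_int n\<bar> * \<bar>t\<bar>"]) (metis abs_ge_minus_self abs_mult, use t in \<open>simp add: mult_left_mono\<close>)
      hence "- (of_int n + t)\<^sup>2 \<le> - (of_int n)\<^sup>2 + 2 * (1/2 + 2 * R) * \<bar>of_int n\<bar>"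
      proof -
        have "- (of_int n + t)\<^sup>2 = - (of_int n)\<^sup>2 - 2 * (of_int n * t) - t\<^sup>2" by (simp add: power2_sum)
        moreover have "2 * (1/2 + 2 * R) * \<bar>of_int n\<bar> = 2 * (\<bar>of_int n\<bar> * (1/2 + 2 * R))" by simp
        ultimately show ?thesis using zero_le_power2[of t] \<open>- (of_int n * t) \<le> \<bar>of_int n\<bar> * (1/2 + 2 * R)\<close> by linarith
      qed
      hence "(3 * cr / 4) * (- (of_int n + t)\<^sup>2) \<le> (3 * cr / 4) * (- (of_int n)\<^sup>2 + 2 * (1/2 + 2 * R) * \<bar>of_int n\<bar>)"
        using cr_pos by (intro mult_left_mono) auto
      moreover have "cr / 2 * (cmod w)\<^sup>2 \<le> cr / 2 * R\<^sup>2"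
        using w cr_pos by (intro mult_left_mono power_mono) auto
      ultimately show "cmod (exp (cc * sigma_exponent w n)) \<le> M n"
        unfolding norm_sigma_term M_def t_def[symmetric]
        by (intro mult_mono) (simp_all add: algebra_simps)
    qed auto
  qed auto
  thus ?thesis unfolding esigma_def[abs_def] .
qed

section \<open>Numerical bounds for Gaussian sums and for the modulus of the sigma function\<close>

lemma infsum_complex_of_real:
  "f summable_on A \<Longrightarrow> (\<Sum>\<^sub>\<infinity>x\<in>A. complex_of_real (f x)) = of_real (\<Sum>\<^sub>\<infinity>x\<in>A. f x)"
  by (rule infsumI[OF has_sum_of_real[OF has_sum_infsum]])

text \<open>By \<open>theta_inversion\<close> the shifted sum is a Fourier series in
  \<open>t\<close> with positive coefficients, so it is largest at \<open>t = 0\<close>.\<close>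

lemma gauss_sum_le:
  fixes \<alpha> t :: real assumes \<alpha>: "\<alpha> > 0"
  shows "(\<Sum>\<^sub>\<infinity>n::int. exp (- \<alpha> * (of_int n + t)\<^sup>2)) \<le> (\<Sum>\<^sub>\<infinity>n::int. exp (- \<alpha> * (of_int n)\<^sup>2))"
proof -
  define a where "a = pi / \<alpha>"
  have a: "a > 0" using \<alpha> by (simp add: a_def)
  have e: "exp (- of_real pi * (of_real u + of_int n)\<^sup>2 / of_real a) = complex_of_real (exp (- \<alpha> * (of_int n + u)\<^sup>2))" for u n
    using \<alpha> unfolding exp_of_real[symmetric] a_def by (simp add: field_simps)
  define g where "g = (\<lambda>u n. exp (- of_real (pi * a) * (of_int n)\<^sup>2 + 2 * of_real pi * \<i> * of_int n * of_real u) :: complex)"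
  define h where "h = (\<lambda>n::int. exp (- (pi * a) * (of_int n)\<^sup>2))"
  have ng: "cmod (g u n) = h n" for u n unfolding g_def h_def by (simp add: norm_exp_eq_Re power2_eq_square)
  have hs: "h summable_on UNIV" unfolding h_def using summable_gauss_shift[of "pi * a" 0] a by simp
  have gs: "g u summable_on UNIV" for u by (rule summable_on_dominated[OF hs]) (simp add: ng)
  have inv: "complex_of_real (\<Sum>\<^sub>\<infinity>n::int. exp (- \<alpha> * (of_int n + u)\<^sup>2)) = of_real (sqrt a) * (\<Sum>\<^sub>\<infinity>n. g u n)" for u
    using theta_inversion[OF a, of "of_real u"] infsum_complex_of_real[OF summable_gauss_shift[OF \<alpha>, of u]]
    unfolding e g_def by simp
  have "(\<Sum>\<^sub>\<infinity>n::int. exp (- \<alpha> * (of_int n + t)\<^sup>2)) \<le> cmod (complex_of_real (\<Sum>\<^sub>\<infinity>n::int. exp (- \<alpha> * (of_int n + t)\<^sup>2)))"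
    by simp
  also have "\<dots> = sqrt a * cmod (\<Sum>\<^sub>\<infinity>n. g t n)" unfolding inv using a by (simp add: norm_mult)
  also have "\<dots> \<le> sqrt a * (\<Sum>\<^sub>\<infinity>n. h n)"
    using a by (intro mult_left_mono norm_infsum_le[OF has_sum_infsum[OF gs] has_sum_infsum[OF hs]]) (auto simp: ng)
  also have "\<dots> = (\<Sum>\<^sub>\<infinity>n::int. exp (- \<alpha> * (of_int n)\<^sup>2))"
  proof -
    have "(\<Sum>\<^sub>\<infinity>n. g 0 n) = complex_of_real (\<Sum>\<^sub>\<infinity>n. h n)"
      unfolding infsum_complex_of_real[OF hs, symmetric] unfolding g_def h_def
      by (rule infsum_cong) (simp add: exp_of_real[symmetric])
    hence "complex_of_real (\<Sum>\<^sub>\<infinity>n::int. exp (- \<alpha> * (of_int n)\<^sup>2)) = of_real (sqrt a * (\<Sum>\<^sub>\<infinity>n. h n))"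
      using inv[of 0] by simp
    thus ?thesis by (simp only: of_real_eq_iff)
  qed
  finally show ?thesis .
qed

lemma has_sum_power_abs:
  fixes x :: real assumes "0 \<le> x" "x < 1"
  shows "((\<lambda>n::int. x ^ nat \<bar>n\<bar>) has_sum (1 + x) / (1 - x)) UNIV"
proof -
  have geo: "((\<lambda>n::nat. x ^ n) has_sum 1 / (1 - x)) UNIV"
    using assms by (intro norm_summable_imp_has_sum geometric_sums) (auto simp: summable_geometric)
  have "((\<lambda>n::int. x ^ nat \<bar>n\<bar>) has_sum 1 / (1 - x)) (range int)"
    using geo by (subst has_sum_reindex) (auto simp: o_def)
  moreover have "((\<lambda>n::int. x ^ nat \<bar>n\<bar>) has_sum x * (1 / (1 - x))) (range (\<lambda>n. - int (Suc n)))"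
  proof (subst has_sum_reindex)
    have "((\<lambda>n. x * x ^ n) has_sum x * (1 / (1 - x))) UNIV" by (rule has_sum_cmult_right[OF geo])
    moreover have "((\<lambda>n::int. x ^ nat \<bar>n\<bar>) \<circ> (\<lambda>n. - int (Suc n))) = (\<lambda>n. x * x ^ n)"
      by (auto simp: fun_eq_iff nat_add_distrib)
    ultimately show "((\<lambda>n::int. x ^ nat \<bar>n\<bar>) \<circ> (\<lambda>n. - int (Suc n)) has_sum x * (1 / (1 - x))) UNIV" by simp
  qed (auto simp: inj_on_def)
  ultimately have "((\<lambda>n::int. x ^ nat \<bar>n\<bar>) has_sum (1 / (1 - x) + x * (1 / (1 - x)))) (range int \<union> range (\<lambda>n. - int (Suc n)))"
    by (rule has_sum_Un_disjoint) auto
  moreover have "range int \<union> range (\<lambda>n. - int (Suc n)) = UNIV"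
  proof -
    have "y \<in> range int \<union> range (\<lambda>n. - int (Suc n))" for y
      by (cases y rule: int_cases) auto
    thus ?thesis by blast
  qed
  moreover have "1 / (1 - x) + x * (1 / (1 - x)) = (1 + x) / (1 - x)" by (simp add: add_divide_distrib)
  ultimately show ?thesis by simp
qed

text \<open>For |n| >= 2 one has n^2 >= |n| + 2, so the tail is dominated by a geometric series; the
  terms with |n| <= 1 are kept.\<close>

lemma theta_null_le:
  fixes x :: real assumes x: "0 \<le> x" "x < 1" and \<alpha>: "\<alpha> > 0" "exp (- \<alpha>) \<le> x"
  shows "(\<Sum>\<^sub>\<infinity>n::int. exp (- \<alpha> * (of_int n)\<^sup>2)) \<le> 1 + 2 * x + 2 * x ^ 4 / (1 - x)"
proof -
  define h where "h = (\<lambda>n::int. x ^ 2 * x ^ nat \<bar>n\<bar> + (if n = 0 then 1 - x\<^sup>2 else 0) +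
     ((if n = 1 then x - x ^ 3 else 0) + (if n = -1 then x - x ^ 3 else 0)))"
  have d: "((\<lambda>n::int. if n = k then y else 0) has_sum y) UNIV" for k and y :: real
    by (rule has_sum_finite_neutralI[of "{k}"]) auto
  have hs: "(h has_sum (x ^ 2 * ((1 + x) / (1 - x)) + (1 - x\<^sup>2) + ((x - x ^ 3) + (x - x ^ 3)))) UNIV"
    unfolding h_def by (intro has_sum_add has_sum_cmult_right has_sum_power_abs x d)
  have val: "x ^ 2 * ((1 + x) / (1 - x)) + (1 - x\<^sup>2) + ((x - x ^ 3) + (x - x ^ 3)) = 1 + 2 * x + 2 * x ^ 4 / (1 - x)"
    using x by (simp add: field_simps power2_eq_square power3_eq_cube power4_eq_xxxx)
  have le: "exp (- \<alpha> * (of_int n)\<^sup>2) \<le> h n" for n :: int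
  proof -
    have e: "exp (- \<alpha> * (of_int n)\<^sup>2) = exp (- \<alpha>) ^ nat (n\<^sup>2)"
      by (simp add: exp_of_nat_mult[symmetric] mult.commute)
    have le1: "exp (- \<alpha> * (of_int n)\<^sup>2) \<le> x ^ nat (n\<^sup>2)" unfolding e by (rule power_mono[OF \<alpha>(2)]) simp
    show ?thesis
    proof (cases "\<bar>n\<bar> \<le> 1")
      case True
      hence "n = 0 \<or> n = 1 \<or> n = -1" by auto
      thus ?thesis using le1 by (auto simp: h_def power2_eq_square power3_eq_cube)
    next
      case False
      hence n: "\<bar>n\<bar> \<ge> 2" by simp
      have "2 * \<bar>n\<bar> \<le> \<bar>n\<bar> * \<bar>n\<bar>" using n by (intro mult_right_mono) auto
      hence "\<bar>n\<bar> + 2 \<le> n\<^sup>2" using n unfolding power2_eq_square abs_mult_self_eq by linarith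
      hence "2 + nat \<bar>n\<bar> \<le> nat (n\<^sup>2)" by linarith
      hence "x ^ nat (n\<^sup>2) \<le> x ^ (2 + nat \<bar>n\<bar>)" using x by (intro power_decreasing) auto
      also have "\<dots> = h n" using False by (auto simp: h_def power_add power2_eq_square)
      finally show ?thesis using le1 by simp
    qed
  qed
  have "(\<lambda>n::int. exp (- \<alpha> * (of_int n)\<^sup>2)) summable_on UNIV" using summable_gauss_shift[OF \<alpha>(1), of 0] by simp
  from has_sum_mono[OF has_sum_infsum[OF this] hs le] show ?thesis unfolding val by simp
qed

lemma pi_sqrt3_bounds: "3627/1000 \<le> cr" "cr \<le> 3628/1000"
proof -
  have s: "1732/1000 \<le> sqrt (3::real)" "sqrt (3::real) \<le> 17321/10000"
    by (rule real_le_rsqrt, simp add: power2_eq_square) (rule real_le_lsqrt, simp_all add: power2_eq_square)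
  have p: "31415/10000 \<le> pi" "pi \<le> 31416/10000" using pi_approx by simp_all
  have "3627/1000 * sqrt 3 \<le> 2 * pi" using s p by linarith
  thus "3627/1000 \<le> cr" unfolding cr_def by (simp add: pos_le_divide_eq)
  have "2 * pi \<le> 3628/1000 * sqrt 3" using s p by linarith
  thus "cr \<le> 3628/1000" unfolding cr_def by (simp add: pos_divide_le_eq)
qed

text \<open>exp (- 3 * cr / 4) is about 0.066 and the sum about 1.13 at its maximum; 23/20 leaves
  room for rounding and is the basic constant of all later estimates.\<close>

lemma gauss_sigma_le: "(\<Sum>\<^sub>\<infinity>n::int. exp (- (3 * cr / 4) * (of_int n + t)\<^sup>2)) \<le> (23/20)"
proof -
  have e: "exp (- (3 * cr / 4)) \<le> (7/100::real)"
  proof -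
    have "(269/200::real) \<le> exp (3/10)" using exp_lower_Taylor_quadratic[of "3/10"] by (simp add: power2_eq_square)
    hence "(269/200) ^ 9 \<le> exp (3/10::real) ^ 9" by (intro power_mono) auto
    also have "\<dots> = exp (27/10::real)" by (simp add: exp_of_nat_mult[symmetric])
    also have "\<dots> \<le> exp (3 * cr / 4)" using pi_sqrt3_bounds by simp
    finally have "100 / 7 \<le> exp (3 * cr / 4)" by (simp add: power_numeral_reduce)
    hence "inverse (exp (3 * cr / 4)) \<le> inverse (100 / 7)" by (intro le_imp_inverse_le) auto
    thus ?thesis by (simp add: exp_minus)
  qed
  have "(\<Sum>\<^sub>\<infinity>n::int. exp (- (3 * cr / 4) * (of_int n + t)\<^sup>2)) \<le> (\<Sum>\<^sub>\<infinity>n::int. exp (- (3 * cr / 4) * (of_int n)\<^sup>2))"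
    by (rule gauss_sum_le) (simp add: cr_pos)
  also have "\<dots> \<le> 1 + 2 * (7/100) + 2 * (7/100) ^ 4 / (1 - 7/100)"
    by (rule theta_null_le[OF _ _ _ e]) (simp_all add: cr_pos)
  also have "\<dots> \<le> (23/20)" by (simp add: power_numeral_reduce)
  finally show ?thesis .
qed

text \<open>The size of \<open>esigma\<close> in the natural hermitian metric. Every estimate of a
  theta term passes through this bounded quantity, see \<open>norm_theta_term\<close>.\<close>

definition esigma_abs :: "complex \<Rightarrow> real" where
  "esigma_abs w = exp (- (cr / 2) * (cmod w)\<^sup>2) * cmod (esigma w)"

lemma esigma_abs_le: "esigma_abs w \<le> (23/20)"
proof -
  define t where "t = 1/2 + 2 * Im w / sqrt 3"
  have "cmod (esigma w) \<le> (\<Sum>\<^sub>\<infinity>n. exp (cr / 2 * (cmod w)\<^sup>2) * exp (- (3 * cr / 4) * (of_int n + t)\<^sup>2))"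
    unfolding esigma_def
    by (rule norm_infsum_le[OF has_sum_infsum[OF esigma_summable] has_sum_infsum])
       (auto simp only: norm_sigma_term t_def intro!: summable_on_cmult_right summable_gauss_shift, simp add: cr_pos)
  also have "\<dots> = exp (cr / 2 * (cmod w)\<^sup>2) * (\<Sum>\<^sub>\<infinity>n. exp (- (3 * cr / 4) * (of_int n + t)\<^sup>2))"
    by (rule infsum_cmult_right')
  also have "\<dots> \<le> exp (cr / 2 * (cmod w)\<^sup>2) * (23/20)"
    by (intro mult_left_mono gauss_sigma_le) auto
  finally have "exp (- (cr / 2) * (cmod w)\<^sup>2) * cmod (esigma w) \<le>
      exp (- (cr / 2) * (cmod w)\<^sup>2) * (exp (cr / 2 * (cmod w)\<^sup>2) * (23/20))" by (intro mult_left_mono) auto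
  also have "\<dots> = (23/20)" by (simp add: exp_minus)
  finally show ?thesis unfolding esigma_abs_def .
qed

text \<open>The terms with index in \<open>F\<close> are bounded from below by the total mass of the absolute values.\<close>

lemma esigma_abs_ge:
  assumes "finite F"
  shows "esigma_abs w \<ge> exp (- (cr / 2) * (cmod w)\<^sup>2) * cmod (\<Sum>n\<in>F. exp (cc * sigma_exponent w n)) +
      (\<Sum>n\<in>F. exp (- (3 * cr / 4) * (of_int n + (1/2 + 2 * Im w / sqrt 3))\<^sup>2)) - (23/20)"
proof -
  define t where "t = 1/2 + 2 * Im w / sqrt 3"
  define T where "T = (\<lambda>n. exp (cc * sigma_exponent w n))"
  define g where "g = (\<lambda>n::int. exp (- (3 * cr / 4) * (of_int n + t)\<^sup>2))"
  define C where "C = exp (cr / 2 * (cmod w)\<^sup>2)"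
  have nT: "cmod (T n) = C * g n" for n unfolding T_def g_def C_def t_def norm_sigma_term ..
  have gs: "g summable_on UNIV" unfolding g_def by (rule summable_gauss_shift) (simp add: cr_pos)
  have gF: "g summable_on (UNIV - F)" using gs by (rule summable_on_subset_banach) auto
  have Ts: "T summable_on UNIV" unfolding T_def by (rule esigma_summable)
  have TF: "T summable_on (UNIV - F)" using Ts by (rule summable_on_subset_banach) auto
  have "infsum T UNIV = infsum T F + infsum T (UNIV - F)"
    using infsum_Un_disjoint[OF summable_on_finite[OF assms] TF] by simp
  hence e1: "esigma w = sum T F + infsum T (UNIV - F)" using assms by (simp add: esigma_def T_def)
  have "infsum g UNIV = infsum g F + infsum g (UNIV - F)"
    using infsum_Un_disjoint[OF summable_on_finite[OF assms] gF] by simp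
  hence e2: "infsum g (UNIV - F) \<le> (23/20) - sum g F" using assms gauss_sigma_le[of t] by (simp add: g_def)
  have "cmod (infsum T (UNIV - F)) \<le> C * infsum g (UNIV - F)"
    by (rule norm_infsum_le[OF has_sum_infsum[OF TF] has_sum_cmult_right[OF has_sum_infsum[OF gF]]]) (simp add: nT)
  also have "\<dots> \<le> C * ((23/20) - sum g F)" using e2 by (intro mult_left_mono) (simp_all add: C_def)
  finally have "cmod (esigma w) \<ge> cmod (sum T F) - C * ((23/20) - sum g F)"
    unfolding e1 using norm_diff_ineq[of "sum T F" "infsum T (UNIV - F)"] by linarith
  define D where "D = exp (- (cr / 2) * (cmod w)\<^sup>2)"
  have DC: "D * C = 1" unfolding D_def C_def exp_add[symmetric] by simp
  have "D * (cmod (sum T F) - C * (23/20 - sum g F)) \<le> D * cmod (esigma w)"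
    by (rule mult_left_mono) (use \<open>cmod (esigma w) \<ge> _\<close> in \<open>auto simp: D_def\<close>)
  moreover have "D * (cmod (sum T F) - C * (23/20 - sum g F)) = D * cmod (sum T F) - (D * C) * (23/20 - sum g F)"
    by (simp add: algebra_simps)
  ultimately have "D * cmod (sum T F) + sum g F - 23/20 \<le> D * cmod (esigma w)" unfolding DC mult_1_left by linarith
  thus ?thesis unfolding esigma_abs_def T_def g_def t_def D_def .
qed

text \<open>At \<open>1 / sqrt (-3)\<close> the two dominant terms have the same argument.\<close>

lemma esigma_abs_torsion: "esigma_abs (1 / sqrt_m3) \<ge> 19/20"
proof -
  define s where "s = 1 / sqrt_m3"
  have s: "s = - sqrt_m3 / 3" by (simp add: s_def field_simps)
  have ns: "(cmod s)\<^sup>2 = 1/3" "Im s = - (sqrt 3 / 3)" unfolding s by (simp_all add: norm_divide power_divide)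
  have t: "1/2 + 2 * Im s / sqrt 3 = - (1/6)" unfolding ns by simp
  have E0: "sigma_exponent s 0 = of_real (7/48) - sqrt_m3 / 16"
    unfolding sigma_exponent_def s zeta3_conv by (simp add: power2_eq_square field_simps)
  have E1: "sigma_exponent s 1 = of_real (- 17/48) - sqrt_m3 / 16 + sqrt_m3 * of_int (-1)"
    unfolding sigma_exponent_def s zeta3_conv by (simp add: power2_eq_square field_simps)
  define u where "u = exp (cc * (- sqrt_m3 / 16))"
  have nu: "cmod u = 1" unfolding u_def norm_exp_cr by simp
  have x0: "exp (cc * sigma_exponent s 0) = of_real (exp (cr * (7/48))) * u"
    unfolding E0 u_def exp_of_real[symmetric] exp_add[symmetric]
    by (rule arg_cong[of _ _ exp]) (simp add: cc_def cr_def algebra_simps)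
  have x1: "exp (cc * sigma_exponent s 1) = of_real (exp (cr * (-17/48))) * u"
    unfolding E1 exp_cc_int unfolding u_def exp_of_real[symmetric] exp_add[symmetric]
    by (rule arg_cong[of _ _ exp]) (simp add: cc_def cr_def algebra_simps)
  have "(\<Sum>n\<in>{0,1}. exp (cc * sigma_exponent s n)) = of_real (exp (cr * (7/48)) + exp (cr * (-17/48))) * u"
    by (simp add: x0 x1 algebra_simps)
  hence c1: "cmod (\<Sum>n\<in>{0,1}. exp (cc * sigma_exponent s n)) = exp (cr * (7/48)) + exp (cr * (-17/48))"
    by (simp only: norm_mult nu norm_of_real) simp
  have "exp (- (cr / 2) * (1/3)) * (exp (cr * (7/48)) + exp (cr * (-17/48))) = exp (- cr / 48) + exp (- 25 * cr / 48)"
    unfolding distrib_left exp_add[symmetric] by (simp add: algebra_simps)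
  moreover have "(\<Sum>n\<in>{0,1::int}. exp (- (3 * cr / 4) * (of_int n + - (1/6))\<^sup>2)) = exp (- cr / 48) + exp (- 25 * cr / 48)"
    by (simp add: power2_eq_square algebra_simps)
  ultimately have "esigma_abs s \<ge> 2 * (exp (- cr / 48) + exp (- 25 * cr / 48)) - (23/20)"
    using esigma_abs_ge[of "{0,1}" s] unfolding c1 ns t by simp
  moreover have "exp (- cr / 48) \<ge> 23/25" using exp_ge_add_one_self[of "- cr / 48"] pi_sqrt3_bounds by linarith
  moreover have "exp (- 25 * cr / 48) \<ge> 27/200"
  proof -
    have "exp (2::real) = exp 1 * exp 1" by (simp add: exp_add[symmetric])
    also have "\<dots> \<le> (272/100) * (272/100)" using e_less_272 by (intro mult_mono) auto
    finally have "inverse (37/5::real) \<le> inverse (exp 2)" by (intro le_imp_inverse_le) auto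
    also have "\<dots> = exp (-2)" by (simp add: exp_minus)
    also have "\<dots> \<le> exp (- 25 * cr / 48)" using pi_sqrt3_bounds by simp
    finally show ?thesis by simp
  qed
  ultimately show ?thesis unfolding s_def by simp
qed

text \<open>A term within 1/3 of the centre of the Gaussian has weight at least 0.69, more than half
  of the total mass 23/20, so it outweighs all others together: 2 * 0.69 - 1.15 exceeds 1/5.\<close>

lemma esigma_abs_ge_quarter:
  assumes "\<bar>of_int n + (1/2 + 2 * Im w / sqrt 3)\<bar> \<le> 1/3"
  shows "esigma_abs w \<ge> 1/5"
proof -
  define x where "x = of_int n + (1/2 + 2 * Im w / sqrt 3)"
  define g where "g = exp (- (3 * cr / 4) * x\<^sup>2)"
  have "x\<^sup>2 \<le> (1/3)\<^sup>2" using assms unfolding x_def[symmetric] by (rule power2_le_iff_abs_le[THEN iffD2, rotated]) simp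
  hence x: "x\<^sup>2 \<le> 1/9" by (simp add: power2_eq_square)
  have "(3 * cr / 4) * x\<^sup>2 \<le> (3 * 3628/1000 / 4) * (1/9)"
    using x pi_sqrt3_bounds cr_pos by (intro mult_mono) auto
  hence "g \<ge> 69/100" unfolding g_def using exp_ge_add_one_self[of "- (3 * cr / 4) * x\<^sup>2"] by simp
  moreover have "exp (- (cr / 2) * (cmod w)\<^sup>2) * cmod (exp (cc * sigma_exponent w n)) = g"
    unfolding norm_sigma_term g_def x_def mult.assoc[symmetric] exp_add[symmetric] by simp
  hence "esigma_abs w \<ge> 2 * g - (23/20)"
    using esigma_abs_ge[of "{n}" w, unfolded x_def[symmetric]] by (simp add: g_def x_def)
  ultimately show ?thesis by simp
qed

lemma esigma_torsion_nz: "esigma (1 / sqrt_m3) \<noteq> 0"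
  using esigma_abs_torsion unfolding esigma_abs_def by auto

section \<open>Lattice translations and unit rotations of the sigma function\<close>

lemma cnj_cc [simp]: "cnj cc = cc" by (simp add: cc_def)

lemma exp_cc_half: "exp (cc * (sqrt_m3 / 2)) = -1"
proof -
  have "cc * (sqrt_m3 / 2) = \<i> * of_real pi" using cc_theta by simp
  thus ?thesis by (simp add: exp_pi_i')
qed

lemma exp_cc_third: "exp (cc * (sqrt_m3 / 3)) = zeta3"
proof -
  have "cc * (sqrt_m3 / 3) = 2 * of_real pi * \<i> / 3" using cc_theta by simp
  thus ?thesis by (simp add: zeta3_def)
qed

text \<open>The first summand supplies the sign (-1)^(|l|^2), the last one the Gaussian decay.
  Summed over the whole lattice the kernel exhibits the translations and rotations that the series
  over the integers hides; \<open>B\<close> is a free parameter.\<close>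

definition kernel_exponent :: "complex \<Rightarrow> complex \<Rightarrow> complex \<Rightarrow> complex" where
  "kernel_exponent B w l = (sqrt_m3 / 2) * (l * cnj l) + cnj l * w + B * (l - w) - l * cnj l / 2"

lemma norm_kernel_le:
  "cmod (exp (cc * kernel_exponent B w l)) \<le>
     exp (cr * Re (- B * w)) * exp (- (cr / 2) * (cmod l)\<^sup>2 + cr * (cmod w + cmod B) * cmod l)"
proof -
  have "Re (kernel_exponent B w l) = Re (cnj l * w + B * l) + Re (- B * w) - (cmod l)\<^sup>2 / 2"
    unfolding kernel_exponent_def complex_norm_square[symmetric] by (simp add: algebra_simps)
  moreover have "Re (cnj l * w + B * l) \<le> (cmod w + cmod B) * cmod l"
    using complex_Re_le_cmod[of "cnj l * w + B * l"] norm_triangle_ineq[of "cnj l * w" "B * l"]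
    by (simp add: norm_mult algebra_simps)
  ultimately have "cr * Re (kernel_exponent B w l) \<le> cr * ((cmod w + cmod B) * cmod l + Re (- B * w) - (cmod l)\<^sup>2 / 2)"
    using cr_pos by (intro mult_left_mono) auto
  thus ?thesis unfolding norm_exp_cr exp_add[symmetric] by (simp add: algebra_simps)
qed

lemma summable_kernel: "(\<lambda>l. exp (cc * kernel_exponent B w l)) summable_on eisenstein"
  by (rule summable_on_dominated[OF summable_on_cmult_right[OF summable_eis_gauss] norm_kernel_le])
     (simp add: cr_pos)

lemma infsum_eis_iterated:
  assumes "f summable_on eisenstein"
  shows "(\<Sum>\<^sub>\<infinity>l\<in>eisenstein. f l) = (\<Sum>\<^sub>\<infinity>n. \<Sum>\<^sub>\<infinity>m. (f (eis m n) :: complex))"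
proof -
  have "(\<lambda>(m, n). f (eis m n)) summable_on UNIV \<times> UNIV" using assms by (simp only: summable_eis)
  from infsum_Sigma'_banach[OF this] infsum_swap_banach[OF this] show ?thesis unfolding infsum_eis by simp
qed

text \<open>The factorisation comes from Poisson summation in one of the two coordinates of \<open>l\<close>:
  the resulting quadratic form diagonalises in the indices \<open>k\<close> and \<open>p = k + n\<close>.\<close>

lemma esigma_lattice:
  "(\<Sum>\<^sub>\<infinity>l\<in>eisenstein. exp (cc * kernel_exponent B w l)) =
     of_real (1 / sqrt (1 / sqrt 3)) * (esigma w * cnj (esigma (- cnj B)))"
proof -
  define T where "T = (\<lambda>k. exp (cc * sigma_exponent w k))"
  define U where "U = (\<lambda>p. cnj (exp (cc * sigma_exponent (- cnj B) p)))"
  have Ts: "T summable_on UNIV" "U summable_on UNIV"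
    unfolding T_def U_def by (simp_all only: summable_on_cnj_iff esigma_summable)
  have inner: "(\<Sum>\<^sub>\<infinity>m. exp (cc * kernel_exponent B w (eis m n))) = of_real (1 / sqrt (1 / sqrt 3)) * (\<Sum>\<^sub>\<infinity>k. T k * U (k + n))" for n
  proof -
    define b where "b = (1 + of_int n) / 2 - sqrt_m3 * (of_int n / 2 + w + B) / 3"
    define r where "r = - (of_int n)\<^sup>2 / 2 + of_int n * (cnj zeta3 * w + zeta3 * B) - B * w + (sqrt_m3 / 2) * of_int n"
    have 1: "exp (cc * kernel_exponent B w (eis m n)) =
        exp (cc * (- of_real (1/2) * (of_int m)\<^sup>2 + sqrt_m3 * of_int m * b)) * exp (cc * r)" for m
    proof -
      \<comment> \<open>The quadratic phases with coefficient \<open>sqrt_m3 / 2\<close> are linear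
        modulo the period \<open>sqrt_m3\<close>, since m^2 - m and n^2 - n are even.\<close>
      have "even (k * k - k)" for k :: int by simp
      then obtain i j where i: "m * m - m = 2 * i" and j: "n * n - n = 2 * j" by (meson evenE)
      have ij: "of_int m * of_int m = 2 * of_int i + (of_int m :: complex)" "of_int n * of_int n = 2 * of_int j + (of_int n :: complex)"
        using arg_cong[OF i, of "of_int :: int \<Rightarrow> complex"] arg_cong[OF j, of "of_int :: int \<Rightarrow> complex"]
        by (simp_all add: algebra_simps)
      have "kernel_exponent B w (eis m n) - ((- of_real (1/2) * (of_int m)\<^sup>2 + sqrt_m3 * of_int m * b) + r) =
          (sqrt_m3 / 2) * (of_int m * of_int m - of_int m * of_int n + of_int n * of_int n - of_int m * (1 + of_int n) - of_int n)"
        unfolding kernel_exponent_def b_def r_def eis_cnj_mult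
        by (simp add: eis_def zeta3_conv cnj_zeta3_conv power2_eq_square field_simps)
      also have "\<dots> = sqrt_m3 * of_int (i + j - m * n)" unfolding ij by (simp add: algebra_simps)
      finally show ?thesis unfolding exp_add[symmetric] distrib_left[symmetric] by (rule exp_cc_cong)
    qed
    have 2: "exp (cc * (- (3 / (4 * of_real (1/2))) * (b + of_int k)\<^sup>2)) * exp (cc * r) = T k * U (k + n)" for k
      unfolding T_def U_def exp_cnj exp_add[symmetric]
    proof (rule arg_cong[of _ _ exp])
      show "cc * (- (3 / (4 * of_real (1/2))) * (b + of_int k)\<^sup>2) + cc * r =
        cc * sigma_exponent w k + cnj (cc * sigma_exponent (- cnj B) (k + n))"
        unfolding sigma_exponent_def b_def r_def
        by (simp add: zeta3_conv cnj_zeta3_conv power2_eq_square field_simps)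
    qed
    have "(\<Sum>\<^sub>\<infinity>m. exp (cc * kernel_exponent B w (eis m n))) =
        (\<Sum>\<^sub>\<infinity>m. exp (cc * (- of_real (1/2) * (of_int m)\<^sup>2 + sqrt_m3 * of_int m * b))) * exp (cc * r)"
      unfolding 1 by (rule infsum_cmult_left')
    also have "\<dots> = of_real (1 / sqrt (2 * (1/2) / sqrt 3)) * (\<Sum>\<^sub>\<infinity>k. T k * U (k + n))"
      unfolding 2[symmetric] infsum_cmult_left' by (subst theta_inversion_cc) simp_all
    finally show ?thesis by simp
  qed
  have "(\<lambda>(k, p). T k * U p) summable_on UNIV \<times> UNIV" using product_summable_on(1)[OF Ts] .
  hence s: "(\<lambda>(n, k). T k * U (k + n)) summable_on UNIV \<times> UNIV"
    by (rule summable_on_reindex_bij_witness[of _ "\<lambda>(n, k). (k, k + n)" "\<lambda>(k, p). (p - k, k)", THEN iffD1, rotated -1]) auto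
  have "(\<Sum>\<^sub>\<infinity>n. \<Sum>\<^sub>\<infinity>k. T k * U (k + n)) = (\<Sum>\<^sub>\<infinity>k. \<Sum>\<^sub>\<infinity>n. T k * U (k + n))"
    by (rule infsum_swap_banach[OF s])
  also have "\<dots> = (\<Sum>\<^sub>\<infinity>k. T k * infsum U UNIV)"
  proof (rule infsum_cong)
    fix k :: int
    have "(\<Sum>\<^sub>\<infinity>n. U (k + n)) = infsum U UNIV"
      by (rule infsum_reindex_bij_witness[of _ "\<lambda>p. p - k" "\<lambda>n. k + n"]) auto
    thus "(\<Sum>\<^sub>\<infinity>n. T k * U (k + n)) = T k * infsum U UNIV" by (simp add: infsum_cmult_right')
  qed
  also have "\<dots> = esigma w * cnj (esigma (- cnj B))"
    unfolding infsum_cmult_left' unfolding T_def U_def infsum_cnj esigma_def ..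
  finally show ?thesis unfolding infsum_eis_iterated[OF summable_kernel] inner infsum_cmult_right' by simp
qed

abbreviation tors :: complex where "tors \<equiv> 1 / sqrt_m3"

lemma tors_conv: "tors = - sqrt_m3 / 3" by (simp add: field_simps)

lemma cnj_tors: "cnj tors = - tors" by simp

definition kernel_const :: complex where
  "kernel_const = of_real (1 / sqrt (1 / sqrt 3)) * cnj (esigma tors)"

lemma kernel_const_nz: "kernel_const \<noteq> 0"
  using esigma_torsion_nz by (simp add: kernel_const_def)

text \<open>At \<open>B = tors\<close> the second factor in \<open>esigma_lattice\<close> is the
  nonzero constant \<open>cnj (esigma tors)\<close>, so the kernel sum represents
  \<open>esigma\<close> itself.\<close>

lemma esigma_kernel: "kernel_const * esigma w = (\<Sum>\<^sub>\<infinity>l\<in>eisenstein. exp (cc * kernel_exponent tors w l))"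
  unfolding esigma_lattice kernel_const_def by simp

lemma eis_pair_integral:
  assumes "x \<in> eisenstein"
  obtains p :: int where "(sqrt_m3 / 2) * (x + cnj x) + (x - cnj x) / 2 = sqrt_m3 * of_int p"
proof -
  obtain p q where x: "x = eis p q" using eisE[OF assms] .
  have "(sqrt_m3 / 2) * (x + cnj x) + (x - cnj x) / 2 = sqrt_m3 * of_int p"
    unfolding x eis_def by (simp add: zeta3_conv cnj_zeta3_conv field_simps)
  thus ?thesis using that by blast
qed

text \<open>The summation index of the kernel sum is shifted by \<open>b\<close> along with
  \<open>w\<close>; the cross terms between \<open>l\<close> and \<open>b\<close> are integral
  multiples of the period by \<open>eis_pair_integral\<close>.\<close>

lemma esigma_shift:
  assumes b: "b \<in> eisenstein"
  shows "esigma (w + b) = exp (cc * ((sqrt_m3 / 2) * (b * cnj b) + cnj b * w + b * cnj b / 2)) * esigma w"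
proof -
  define F where "F = exp (cc * ((sqrt_m3 / 2) * (b * cnj b) + cnj b * w + b * cnj b / 2))"
  have "kernel_const * esigma (w + b) = (\<Sum>\<^sub>\<infinity>l\<in>eisenstein. exp (cc * kernel_exponent tors (w + b) (l + b)))"
    unfolding esigma_kernel using b
    by (intro infsum_reindex_bij_witness[of _ "\<lambda>l. l + b" "\<lambda>l. l - b"]) auto
  also have "\<dots> = (\<Sum>\<^sub>\<infinity>l\<in>eisenstein. F * exp (cc * kernel_exponent tors w l))"
  proof (rule infsum_cong)
    fix l assume l: "l \<in> eisenstein"
    obtain p :: int where p: "(sqrt_m3 / 2) * (cnj l * b + cnj (cnj l * b)) + (cnj l * b - cnj (cnj l * b)) / 2 = sqrt_m3 * of_int p"
      using eis_pair_integral[of "cnj l * b"] l b by auto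
    show "exp (cc * kernel_exponent tors (w + b) (l + b)) = F * exp (cc * kernel_exponent tors w l)"
      unfolding F_def exp_add[symmetric] distrib_left[symmetric]
    proof (rule exp_cc_cong[where k = p])
      show "kernel_exponent tors (w + b) (l + b) -
          ((sqrt_m3 / 2) * (b * cnj b) + cnj b * w + b * cnj b / 2 + kernel_exponent tors w l) = sqrt_m3 * of_int p"
        unfolding p[symmetric] kernel_exponent_def by (simp add: algebra_simps add_divide_distrib diff_divide_distrib)
    qed
  qed
  also have "\<dots> = F * (kernel_const * esigma w)" unfolding esigma_kernel by (rule infsum_cmult_right')
  finally show ?thesis using kernel_const_nz unfolding F_def[symmetric] by simp
qed

lemma esigma_minus: "esigma (- w) = - esigma w"
proof -
  have "esigma (- w) = (\<Sum>\<^sub>\<infinity>n. exp (cc * sigma_exponent (- w) (- n - 1)))"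
    unfolding esigma_def by (rule infsum_reindex_bij_witness[of _ "\<lambda>n. - n - 1" "\<lambda>n. - n - 1"]) auto
  also have "\<dots> = (\<Sum>\<^sub>\<infinity>n. (-1) * exp (cc * sigma_exponent w n))"
  proof (rule infsum_cong)
    fix n :: int
    have "sigma_exponent (- w) (- n - 1) - (sqrt_m3 / 2 + sigma_exponent w n) = sqrt_m3 * of_int n"
      unfolding sigma_exponent_def by (simp add: power2_eq_square field_simps)
    hence "exp (cc * sigma_exponent (- w) (- n - 1)) = exp (cc * (sqrt_m3 / 2 + sigma_exponent w n))"
      by (rule exp_cc_cong)
    thus "exp (cc * sigma_exponent (- w) (- n - 1)) = (-1) * exp (cc * sigma_exponent w n)"
      unfolding distrib_left exp_add exp_cc_half .
  qed
  finally show ?thesis unfolding infsum_cmult_right' esigma_def by simp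
qed

text \<open>Rotating the kernel sum by \<open>zeta3\<close> merely rotates the parameter
  \<open>B\<close>, so \<open>esigma (zeta3 * w)\<close> is a constant multiple of
  \<open>esigma w\<close>. The constant is read off at \<open>tors\<close>, where the rotation
  amounts to translation by the lattice vector \<open>1 + zeta3\<close>.\<close>

lemma esigma_zeta: "esigma (zeta3 * w) = zeta3 * esigma w"
proof -
  have zz: "zeta3 * cnj zeta3 = 1" unfolding cnj_zeta3 by (simp add: algebra_simps zeta3_sq)
  define \<mu> where "\<mu> = of_real (1 / sqrt (1 / sqrt 3)) * cnj (esigma (- cnj (tors * zeta3))) / kernel_const"
  have ke: "kernel_exponent B (zeta3 * w) (zeta3 * l) = kernel_exponent (B * zeta3) w l" for B w l
  proof -
    have e1: "zeta3 * l * cnj (zeta3 * l) = (zeta3 * cnj zeta3) * (l * cnj l)"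
      and e2: "cnj (zeta3 * l) * (zeta3 * w) = (zeta3 * cnj zeta3) * (cnj l * w)"
      by (simp_all add: mult_ac)
    show ?thesis unfolding kernel_exponent_def e1 e2 zz mult_1_left by (simp add: algebra_simps)
  qed
  have l: "esigma (zeta3 * w) = \<mu> * esigma w" for w
  proof -
    have "kernel_const * esigma (zeta3 * w) = (\<Sum>\<^sub>\<infinity>l\<in>eisenstein. exp (cc * kernel_exponent tors (zeta3 * w) (zeta3 * l)))"
      unfolding esigma_kernel
    proof (rule infsum_reindex_bij_witness[of _ "\<lambda>l. zeta3 * l" "\<lambda>l. cnj zeta3 * l"])
      show "zeta3 * (cnj zeta3 * a) = a" "cnj zeta3 * (zeta3 * a) = a" for a
        using zz by (metis mult.assoc mult.commute mult_1)+
    qed (use zz in \<open>auto simp: mult.assoc[symmetric]\<close>)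
    also have "\<dots> = (\<Sum>\<^sub>\<infinity>l\<in>eisenstein. exp (cc * kernel_exponent (tors * zeta3) w l))"
      by (simp only: ke)
    finally have "kernel_const * esigma (zeta3 * w) = (\<mu> * kernel_const) * esigma w"
      unfolding esigma_lattice \<mu>_def using kernel_const_nz by simp
    thus ?thesis using kernel_const_nz by (simp add: mult_ac)
  qed
  have "esigma (zeta3 * tors) = esigma (tors + (1 + zeta3))"
  proof (rule arg_cong[of _ _ esigma])
    have "zeta3 * tors = (3 + sqrt_m3) / 6" unfolding tors_conv zeta3_conv by (simp add: left_diff_distrib diff_divide_distrib)
    thus "zeta3 * tors = tors + (1 + zeta3)" unfolding tors_conv zeta3_conv by (simp add: field_simps)
  qed
  also have "\<dots> = exp (cc * (sqrt_m3 / 3)) * esigma tors"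
  proof (subst esigma_shift)
    have "(sqrt_m3 / 2) * ((1 + zeta3) * cnj (1 + zeta3)) + cnj (1 + zeta3) * tors + (1 + zeta3) * cnj (1 + zeta3) / 2 = sqrt_m3 / 3"
      unfolding complex_cnj_add zeta3_conv cnj_zeta3_conv tors_conv by (simp add: field_simps)
    thus "exp (cc * ((sqrt_m3 / 2) * ((1 + zeta3) * cnj (1 + zeta3)) + cnj (1 + zeta3) * tors + (1 + zeta3) * cnj (1 + zeta3) / 2)) *
        esigma tors = exp (cc * (sqrt_m3 / 3)) * esigma tors" by (simp only:)
  qed auto
  finally have "\<mu> * esigma tors = zeta3 * esigma tors" unfolding l exp_cc_third .
  hence "\<mu> = zeta3" using esigma_torsion_nz by simp
  thus ?thesis using l by simp
qed

lemma eis_units: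
  assumes "u \<in> eisenstein" "cmod u = 1"
  shows "u \<in> {1, -1, zeta3, - zeta3, zeta3 * zeta3, - (zeta3 * zeta3)}"
proof -
  obtain m n where u: "u = eis m n" using eisE[OF assms(1)] .
  have "real_of_int (m * m - m * n + n * n) = of_int 1" using assms(2) norm_eis[of m n] u by simp
  hence N: "m * m - m * n + n * n = 1" by (simp only: of_int_eq_iff)
  have "(2 * m - n) * (2 * m - n) + 3 * (n * n) = 4" "(2 * n - m) * (2 * n - m) + 3 * (m * m) = 4"
    using N by (simp_all add: algebra_simps)
  moreover have "(2 * m - n) * (2 * m - n) \<ge> 0" "(2 * n - m) * (2 * n - m) \<ge> 0" by simp_all
  ultimately have nm: "n * n < 4" "m * m < 4" by linarith+
  have "\<bar>k\<bar> < 2" if "k * k < 4" for k :: int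
  proof (rule ccontr)
    assume "\<not> \<bar>k\<bar> < 2"
    hence "2 * 2 \<le> \<bar>k\<bar> * \<bar>k\<bar>" by (intro mult_mono) auto
    thus False using that by simp
  qed
  from this[OF nm(1)] this[OF nm(2)] have "\<bar>n\<bar> < 2" "\<bar>m\<bar> < 2" .
  hence "m \<in> {-1, 0, 1}" "n \<in> {-1, 0, 1}" by auto
  thus ?thesis using N unfolding u eis_def zeta3_sq by auto
qed

lemma esigma_unit:
  assumes "u \<in> eisenstein" "cmod u = 1"
  shows "esigma (u * w) = u * esigma w"
  using eis_units[OF assms] esigma_zeta[of w] esigma_zeta[of "zeta3 * w"] esigma_minus[of w]
    esigma_minus[of "zeta3 * w"] esigma_minus[of "zeta3 * (zeta3 * w)"]
  by (auto simp: mult.assoc)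

lemma esigma_abs_minus: "esigma_abs (- w) = esigma_abs w"
  unfolding esigma_abs_def esigma_minus by simp

text \<open>The Gaussian factor \<open>e\<close> turns both functions into theta functions of order
  one with the same factor \<open>K\<close>, and \<open>theta_uniqueness\<close> kills the
  combination whose mean value is zero. The mean value belonging to \<open>esigma\<close> is nonzero
  because \<open>esigma tors\<close> is.\<close>

lemma esigma_unique:
  assumes \<phi>: "\<phi> holomorphic_on UNIV"
    and p1: "\<And>w. \<phi> (w + 1) = - exp (cc * (w + 1/2)) * \<phi> w"
    and p2: "\<And>w. \<phi> (w + zeta3) = - exp (cc * (cnj zeta3 * w + 1/2)) * \<phi> w"
  shows "\<phi> w * esigma tors = \<phi> tors * esigma w"
proof -
  define e where "e = (\<lambda>w. exp (cc * (- (w\<^sup>2) / 2 + (sqrt_m3 / 2) * w)))"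
  define K where "K = - exp (cc * (1/2 - zeta3\<^sup>2 / 2 + (sqrt_m3 / 2) * zeta3))"
  have e: "e holomorphic_on UNIV" unfolding e_def by (intro holomorphic_intros) auto
  have per: "\<psi> (w + 1) * e (w + 1) = \<psi> w * e w"
    if "\<And>w. \<psi> (w + 1) = - exp (cc * (w + 1/2)) * \<psi> w" for \<psi> w
  proof -
    have "\<psi> (w + 1) * e (w + 1) = - (exp (cc * (w + 1/2)) * e (w + 1)) * \<psi> w" unfolding that by (simp add: mult_ac)
    also have "exp (cc * (w + 1/2)) * e (w + 1) = exp (cc * (sqrt_m3 / 2)) * e w"
      unfolding e_def exp_add[symmetric] by (rule arg_cong[of _ _ exp]) (simp add: power2_eq_square field_simps)
    finally show ?thesis unfolding exp_cc_half by simp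
  qed
  have quasi: "\<psi> (w + zeta3) * e (w + zeta3) = K * exp (- (2 * of_real pi * \<i> * w)) * (\<psi> w * e w)"
    if "\<And>w. \<psi> (w + zeta3) = - exp (cc * (cnj zeta3 * w + 1/2)) * \<psi> w" for \<psi> w
  proof -
    have "\<psi> (w + zeta3) * e (w + zeta3) = - (exp (cc * (cnj zeta3 * w + 1/2)) * e (w + zeta3)) * \<psi> w" unfolding that by (simp add: mult_ac)
    also have "exp (cc * (cnj zeta3 * w + 1/2)) * e (w + zeta3) = - K * exp (- (cc * sqrt_m3) * w) * e w"
      unfolding e_def K_def minus_minus exp_add[symmetric]
      by (rule arg_cong[of _ _ exp]) (simp add: zeta3_conv cnj_zeta3_conv power2_eq_square field_simps)
    finally show ?thesis unfolding cc_theta by (simp add: mult_ac)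
  qed
  have s1: "esigma (w + 1) = - exp (cc * (w + 1/2)) * esigma w" for w
  proof -
    have "cc * ((sqrt_m3 / 2) * (1 * cnj 1) + cnj 1 * w + 1 * cnj 1 / 2) = cc * (sqrt_m3 / 2) + cc * (w + 1/2)"
      by (simp add: algebra_simps)
    thus ?thesis using esigma_shift[of 1 w] by (simp only: exp_add exp_cc_half) simp
  qed
  have zz: "zeta3 * cnj zeta3 = 1" unfolding cnj_zeta3 by (simp add: algebra_simps zeta3_sq)
  have s2: "esigma (w + zeta3) = - exp (cc * (cnj zeta3 * w + 1/2)) * esigma w" for w
  proof -
    have "cc * ((sqrt_m3 / 2) * (zeta3 * cnj zeta3) + cnj zeta3 * w + zeta3 * cnj zeta3 / 2) = cc * (sqrt_m3 / 2) + cc * (cnj zeta3 * w + 1/2)"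
      unfolding zz by (simp add: algebra_simps)
    thus ?thesis using esigma_shift[of zeta3 w] by (simp only: exp_add exp_cc_half) simp
  qed
  define I\<phi> where "I\<phi> = unit_integral (\<lambda>w. \<phi> w * e w)"
  define I\<sigma> where "I\<sigma> = unit_integral (\<lambda>w. esigma w * e w)"
  have hol: "(\<lambda>w. \<phi> w * e w) holomorphic_on UNIV" "(\<lambda>w. esigma w * e w) holomorphic_on UNIV"
    by (intro holomorphic_intros \<phi> e esigma_holomorphic)+
  have enz: "e w \<noteq> 0" for w by (simp add: e_def)
  have I\<sigma>: "I\<sigma> \<noteq> 0"
  proof
    assume "I\<sigma> = 0"
    hence "esigma tors * e tors = 0" unfolding I\<sigma>_def
      by (intro theta_uniqueness[where h = "\<lambda>w. esigma w * e w", OF hol(2) per[of esigma, OF s1] quasi[of esigma, OF s2]])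
    thus False using esigma_torsion_nz enz by simp
  qed
  have "I\<sigma> * (\<phi> w * e w) - I\<phi> * (esigma w * e w) = 0" for w
  proof (rule theta_uniqueness[where h = "\<lambda>w. I\<sigma> * (\<phi> w * e w) - I\<phi> * (esigma w * e w)" and \<sigma> = zeta3 and K = K])
    show "(\<lambda>w. I\<sigma> * (\<phi> w * e w) - I\<phi> * (esigma w * e w)) holomorphic_on UNIV"
      by (intro holomorphic_on_diff holomorphic_on_mult holomorphic_on_const hol \<phi> e esigma_holomorphic)
    show "I\<sigma> * (\<phi> (z + 1) * e (z + 1)) - I\<phi> * (esigma (z + 1) * e (z + 1)) = I\<sigma> * (\<phi> z * e z) - I\<phi> * (esigma z * e z)" for z
      using per[of \<phi>, OF p1] per[of esigma, OF s1] by simp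
    show "I\<sigma> * (\<phi> (z + zeta3) * e (z + zeta3)) - I\<phi> * (esigma (z + zeta3) * e (z + zeta3)) =
        K * exp (- (2 * of_real pi * \<i> * z)) * (I\<sigma> * (\<phi> z * e z) - I\<phi> * (esigma z * e z))" for z
      unfolding quasi[of \<phi>, OF p2] quasi[of esigma, OF s2] by (simp add: algebra_simps)
    have "unit_integral (\<lambda>w. I\<sigma> * (\<phi> w * e w) - I\<phi> * (esigma w * e w)) = I\<sigma> * I\<phi> - I\<phi> * I\<sigma>"
      unfolding I\<phi>_def I\<sigma>_def
      by (subst contour_integral_diff)
         (auto simp: contour_integral_lmul[OF entire_integrable[OF hol(1)]] contour_integral_lmul[OF entire_integrable[OF hol(2)]]
               intro!: entire_integrable holomorphic_on_mult holomorphic_on_const hol \<phi> e esigma_holomorphic)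
    thus "unit_integral (\<lambda>w. I\<sigma> * (\<phi> w * e w) - I\<phi> * (esigma w * e w)) = 0" by simp
  qed
  hence "(I\<sigma> * \<phi> w - I\<phi> * esigma w) * e w = 0" for w by (simp add: algebra_simps)
  hence *: "I\<sigma> * \<phi> w = I\<phi> * esigma w" for w using enz by (metis eq_iff_diff_eq_0 mult_eq_0_iff)
  have "I\<sigma> * (\<phi> w * esigma tors) = I\<sigma> * (\<phi> tors * esigma w)"
    using arg_cong[OF *[of w], of "\<lambda>x. x * esigma tors"] arg_cong[OF *[of tors], of "\<lambda>x. x * esigma w"]
    by (simp only: mult_ac)
  thus ?thesis using I\<sigma> by simp
qed

section \<open>Translates of the sigma function\<close>

text \<open>Translation by \<open>v\<close> with its Heisenberg cocycle: owing to the exponential, a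
  lattice vector added to \<open>v\<close> changes the function by a constant only
  (\<open>dsig_lattice\<close>).\<close>

definition dsig :: "complex \<Rightarrow> complex \<Rightarrow> complex" where
  "dsig v w = exp (cc * (cnj v * w - v * cnj v / 2)) * esigma (w - v)"

lemma dsig_0: "dsig 0 w = esigma w" by (simp add: dsig_def)

lemma dsig_translate:
  "dsig v (w + a) = exp (cc * (cnj a * w + a * cnj a / 2 + (cnj v * a - cnj a * v) / 2)) * dsig (v - a) w"
proof -
  have "cnj v * (w + a) - v * cnj v / 2 =
     (cnj a * w + a * cnj a / 2 + (cnj v * a - cnj a * v) / 2) + (cnj (v - a) * w - (v - a) * cnj (v - a) / 2)"
    by (simp add: field_simps)
  moreover have "w + a - v = w - (v - a)" by simp
  ultimately show ?thesis unfolding dsig_def by (simp only: distrib_left[of cc] exp_add mult.assoc)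
qed

lemma dsig_lattice:
  assumes "b \<in> eisenstein"
  shows "dsig (v + b) w = exp (cc * ((sqrt_m3 / 2) * (b * cnj b) + (cnj b * v - b * cnj v) / 2)) * dsig v w"
proof -
  have 1: "w - (v + b) = (w - v) + (- b)" by simp
  have "(cnj (v + b) * w - (v + b) * cnj (v + b) / 2) +
      ((sqrt_m3 / 2) * ((- b) * cnj (- b)) + cnj (- b) * (w - v) + (- b) * cnj (- b) / 2) =
      ((sqrt_m3 / 2) * (b * cnj b) + (cnj b * v - b * cnj v) / 2) + (cnj v * w - v * cnj v / 2)"
    by (simp add: field_simps)
  hence "exp (cc * (cnj (v + b) * w - (v + b) * cnj (v + b) / 2)) *
      exp (cc * ((sqrt_m3 / 2) * ((- b) * cnj (- b)) + cnj (- b) * (w - v) + (- b) * cnj (- b) / 2)) =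
      exp (cc * ((sqrt_m3 / 2) * (b * cnj b) + (cnj b * v - b * cnj v) / 2)) * exp (cc * (cnj v * w - v * cnj v / 2))"
    unfolding exp_add[symmetric] distrib_left[symmetric] by (simp only:)
  thus ?thesis unfolding dsig_def 1 using assms by (subst esigma_shift) (auto simp only: mult.assoc[symmetric] eisenstein_closed)
qed

lemma dsig_unit:
  assumes "u \<in> eisenstein" "cmod u = 1"
  shows "dsig (u * v) (u * w) = u * dsig v w"
proof -
  have uu: "u * cnj u = 1" using assms(2) complex_norm_square[of u] by simp
  have e: "cnj (u * v) * (u * w) - u * v * cnj (u * v) / 2 = (u * cnj u) * (cnj v * w) - (u * cnj u) * (v * cnj v) / 2"
    by (simp add: algebra_simps)
  have "u * w - u * v = u * (w - v)" by (simp add: algebra_simps)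
  thus ?thesis unfolding dsig_def e uu using esigma_unit[OF assms, of "w - v"] by simp
qed

lemma cmod_zeta3 [simp]: "cmod zeta3 = 1"
  unfolding zeta3_def by (simp add: norm_exp_eq_Re)

lemma zeta3_cnj: "zeta3 * cnj zeta3 = 1"
  unfolding complex_norm_square[symmetric] by simp

lemma dsig_minus: "dsig (- v) (- w) = - dsig v w"
  using dsig_unit[of "-1" v w] by simp

text \<open>\<open>tors\<close> is fixed by \<open>zeta3\<close> modulo the lattice, so the rotation
  acts by a cube root of unity. The factor \<open>zeta3\<close> from \<open>dsig_unit\<close>
  cancels against the factor from \<open>dsig_lattice\<close>; for \<open>v = 0\<close> it survives,
  see \<open>esigma_zeta\<close>.\<close>

lemma dsig_tors_zeta: "dsig tors (zeta3 * w) = dsig tors w"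
proof -
  have 1: "tors = zeta3 * (tors + zeta3)"
  proof -
    have "tors + zeta3 = (sqrt_m3 - 3) / 6" unfolding tors_conv zeta3_conv by (simp add: field_simps)
    thus ?thesis unfolding tors_conv zeta3_conv by (simp add: field_simps)
  qed
  have "dsig tors (zeta3 * w) = zeta3 * dsig (tors + zeta3) w"
    by (subst (1) 1) (rule dsig_unit, auto)
  also have "dsig (tors + zeta3) w = exp (cc * (sqrt_m3 / 3) + cc * (sqrt_m3 / 3)) * dsig tors w"
  proof -
    have "(sqrt_m3 / 2) * (zeta3 * cnj zeta3) + (cnj zeta3 * tors - zeta3 * cnj tors) / 2 = sqrt_m3 / 3 + sqrt_m3 / 3"
      unfolding zeta3_cnj cnj_tors unfolding cnj_zeta3_conv zeta3_conv tors_conv by (simp add: field_simps)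
    thus ?thesis using dsig_lattice[of zeta3 tors w] by (simp only: distrib_left[of cc] eisenstein_closed)
  qed
  also have "exp (cc * (sqrt_m3 / 3) + cc * (sqrt_m3 / 3)) = zeta3 * zeta3" by (simp only: exp_add exp_cc_third)
  also have "zeta3 * (zeta3 * zeta3 * dsig tors w) = zeta3 ^ 3 * dsig tors w" by (simp add: power3_eq_cube)
  finally show ?thesis by (simp add: zeta3_cube)
qed

lemma dsig_minus_tors_zeta: "dsig (- tors) (zeta3 * w) = dsig (- tors) w"
  using dsig_tors_zeta[of "- w"] dsig_minus[of tors "- w"] dsig_minus[of tors "- (zeta3 * w)"] by simp

section \<open>Triple products of translates and their product identity\<close>

definition tri :: "complex \<Rightarrow> complex \<Rightarrow> complex \<Rightarrow> complex \<Rightarrow> complex" where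
  "tri v w1 w2 w3 = dsig v w1 * dsig v w2 * dsig v w3"

lemma tri_translate:
  "tri v (w1 + a) (w2 + a) (w3 + a) =
     exp (cc * (cnj a * (w1 + w2 + w3) + 3 * (a * cnj a) / 2 + 3 * (cnj v * a - cnj a * v) / 2)) * tri (v - a) w1 w2 w3"
proof -
  have e: "cnj a * (w1 + w2 + w3) + 3 * (a * cnj a) / 2 + 3 * (cnj v * a - cnj a * v) / 2 =
     (cnj a * w1 + a * cnj a / 2 + (cnj v * a - cnj a * v) / 2) + (cnj a * w2 + a * cnj a / 2 + (cnj v * a - cnj a * v) / 2)
     + (cnj a * w3 + a * cnj a / 2 + (cnj v * a - cnj a * v) / 2)" by (simp add: field_simps)
  show ?thesis unfolding tri_def dsig_translate e distrib_left[of cc "_ + _ + _"] distrib_left[of cc "_ + _ + _ + _"] 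
    by (simp only: distrib_left[of cc] exp_add mult_ac)
qed

lemma tri_lattice:
  assumes "b \<in> eisenstein"
  shows "tri (v + b) w1 w2 w3 = exp (cc * (3 * ((sqrt_m3 / 2) * (b * cnj b) + (cnj b * v - b * cnj v) / 2))) * tri v w1 w2 w3"
proof -
  define X where "X = (sqrt_m3 / 2) * (b * cnj b) + (cnj b * v - b * cnj v) / 2"
  have "cc * (3 * X) = cc * X + cc * X + cc * X" by simp
  thus ?thesis unfolding tri_def dsig_lattice[OF assms] X_def[symmetric] by (simp only: exp_add mult_ac)
qed

text \<open>With these signs the sum is an eigenvector of the translations by \<open>tors\<close>
  and \<open>zeta3 * tors\<close>, each of which permutes the three summands cyclically up to
  constants and a common factor.\<close>

definition qsum :: "complex \<Rightarrow> complex \<Rightarrow> complex \<Rightarrow> complex" where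
  "qsum w1 w2 w3 = tri tors w1 w2 w3 + tri (- tors) w1 w2 w3 - tri 0 w1 w2 w3"

lemma exp_cc_zero: "exp (cc * (sqrt_m3 * of_int k)) = 1"
  using exp_cc_int[of 0 k] by simp

lemma exp_cc_half_odd: "exp (cc * (sqrt_m3 / 2 + sqrt_m3 * of_int k)) = - 1"
  using exp_cc_int[of "sqrt_m3 / 2" k] exp_cc_half by simp

lemma qsum_shift1:
  "qsum (w1 - tors) (w2 - tors) (w3 - tors) = - exp (cc * (tors * (w1 + w2 + w3) + 1/2)) * qsum w1 w2 w3"
proof -
  define E where "E = exp (cc * (tors * (w1 + w2 + w3) + 1/2))"
  have tr: "tri v (w1 - tors) (w2 - tors) (w3 - tors) = E * tri (v + tors) w1 w2 w3" if "cnj v = - v" for v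
  proof -
    have "cnj (- tors) * (w1 + w2 + w3) + 3 * ((- tors) * cnj (- tors)) / 2 + 3 * (cnj v * (- tors) - cnj (- tors) * v) / 2 =
       tors * (w1 + w2 + w3) + 1/2" unfolding that by (simp add: field_simps)
    thus ?thesis using tri_translate[of v w1 "- tors" w2 w3] unfolding E_def by simp
  qed
  have t2: "tri (tors + tors) w1 w2 w3 = - tri (- tors) w1 w2 w3"
  proof -
    have a: "tors + tors = - tors + (- sqrt_m3)" unfolding tors_conv by (simp add: field_simps)
    have e: "3 * ((sqrt_m3 / 2) * ((- sqrt_m3) * cnj (- sqrt_m3)) + (cnj (- sqrt_m3) * (- tors) - (- sqrt_m3) * cnj (- tors)) / 2) = sqrt_m3 / 2 + sqrt_m3 * of_int 4"
      by (simp add: field_simps)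
    show ?thesis using tri_lattice[of "- sqrt_m3" "- tors" w1 w2 w3] unfolding a e exp_cc_half_odd by simp
  qed
  have "qsum (w1 - tors) (w2 - tors) (w3 - tors) = E * (tri (tors + tors) w1 w2 w3 + tri (- tors + tors) w1 w2 w3 - tri (0 + tors) w1 w2 w3)"
    unfolding qsum_def by (subst tr, simp)+ (simp add: algebra_simps)
  thus ?thesis unfolding t2 E_def[symmetric] qsum_def by (simp add: algebra_simps)
qed

lemma qsum_shift2:
  "qsum (w1 - zeta3 * tors) (w2 - zeta3 * tors) (w3 - zeta3 * tors) =
     - exp (cc * (cnj zeta3 * (tors * (w1 + w2 + w3)) + 1/2)) * qsum w1 w2 w3"
proof -
  define E where "E = exp (cc * (cnj zeta3 * (tors * (w1 + w2 + w3)) + 1/2))"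
  have tr: "tri v (w1 - zeta3 * tors) (w2 - zeta3 * tors) (w3 - zeta3 * tors) =
     E * (exp (cc * X) * tri (v + zeta3 * tors) w1 w2 w3)" if "cnj v = - v" "X = 3 * (v * tors * (zeta3 - cnj zeta3)) / 2" for v X
  proof -
    have aa: "(- (zeta3 * tors)) * cnj (- (zeta3 * tors)) = 1/3"
      using zeta3_cnj by (simp add: mult_ac)
    have "cnj (- (zeta3 * tors)) * (w1 + w2 + w3) + 3 * ((- (zeta3 * tors)) * cnj (- (zeta3 * tors))) / 2 + 3 * (cnj v * (- (zeta3 * tors)) - cnj (- (zeta3 * tors)) * v) / 2 =
       (cnj zeta3 * (tors * (w1 + w2 + w3)) + 1/2) + X" unfolding aa that by (simp add: field_simps)
    thus ?thesis using tri_translate[of v w1 "- (zeta3 * tors)" w2 w3] unfolding E_def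
      by (simp only: distrib_left[of cc] exp_add) simp
  qed
  have t1: "exp (cc * (- sqrt_m3 / 2)) * tri (tors + zeta3 * tors) w1 w2 w3 = - tri (- tors) w1 w2 w3"
  proof -
    have a: "tors + zeta3 * tors = - tors + (- zeta3)" unfolding tors_conv zeta3_conv by (simp add: field_simps)
    have e: "- sqrt_m3 / 2 + 3 * ((sqrt_m3 / 2) * ((- zeta3) * cnj (- zeta3)) + (cnj (- zeta3) * (- tors) - (- zeta3) * cnj (- tors)) / 2) = sqrt_m3 / 2 + sqrt_m3 * of_int 1"
    proof -
      have "(- zeta3) * cnj (- zeta3) = 1" using zeta3_cnj by simp
      thus ?thesis unfolding tors_conv by (simp add: cnj_zeta3_conv) (simp add: zeta3_conv field_simps)
    qed
    have "exp (cc * (- sqrt_m3 / 2)) * tri (tors + zeta3 * tors) w1 w2 w3 = exp (cc * (sqrt_m3 / 2 + sqrt_m3 * of_int 1)) * tri (- tors) w1 w2 w3"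
      unfolding a e[symmetric] by (subst tri_lattice) (simp_all only: distrib_left[of cc] exp_add mult.assoc eisenstein_closed)
    thus ?thesis unfolding exp_cc_half_odd by simp
  qed
  have b1: "(1 + zeta3) * cnj (1 + zeta3) = 1"
    using zeta3_cnj by (simp add: cnj_zeta3 algebra_simps zeta3_sq)
  have t2: "exp (cc * (sqrt_m3 / 2)) * tri (- tors + zeta3 * tors) w1 w2 w3 = tri 0 w1 w2 w3"
  proof -
    have a: "- tors + zeta3 * tors = 0 + (1 + zeta3)" unfolding tors_conv zeta3_conv by (simp add: field_simps)
    have e: "sqrt_m3 / 2 + 3 * ((sqrt_m3 / 2) * ((1 + zeta3) * cnj (1 + zeta3)) + (cnj (1 + zeta3) * 0 - (1 + zeta3) * cnj 0) / 2) = sqrt_m3 * of_int 2"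
      unfolding b1 by (simp add: field_simps)
    have "exp (cc * (sqrt_m3 / 2)) * tri (- tors + zeta3 * tors) w1 w2 w3 = exp (cc * (sqrt_m3 * of_int 2)) * tri 0 w1 w2 w3"
      unfolding a e[symmetric] by (subst tri_lattice) (simp_all only: distrib_left[of cc] exp_add mult.assoc eisenstein_closed)
    thus ?thesis unfolding exp_cc_zero by simp
  qed
  have t3: "tri (0 + zeta3 * tors) w1 w2 w3 = tri tors w1 w2 w3"
  proof -
    have a: "0 + zeta3 * tors = tors + (1 + zeta3)" unfolding tors_conv zeta3_conv by (simp add: field_simps)
    have e: "3 * ((sqrt_m3 / 2) * ((1 + zeta3) * cnj (1 + zeta3)) + (cnj (1 + zeta3) * tors - (1 + zeta3) * cnj tors) / 2) = sqrt_m3 * of_int 1"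
      unfolding b1 cnj_tors by (simp add: cnj_zeta3_conv zeta3_conv) (simp add: field_simps)
    show ?thesis using tri_lattice[of "1 + zeta3" tors w1 w2 w3] unfolding a e exp_cc_zero by simp
  qed
  have x1: "- sqrt_m3 / 2 = 3 * (tors * tors * (zeta3 - cnj zeta3)) / 2" 
    and x2: "sqrt_m3 / 2 = 3 * (- tors * tors * (zeta3 - cnj zeta3)) / 2"
    unfolding tors_conv cnj_zeta3_conv zeta3_conv by (simp_all add: field_simps)
  have "qsum (w1 - zeta3 * tors) (w2 - zeta3 * tors) (w3 - zeta3 * tors) =
      E * (- tri (- tors) w1 w2 w3) + E * tri 0 w1 w2 w3 - E * tri tors w1 w2 w3"
    unfolding qsum_def using tr[of tors, OF _ x1] tr[of "- tors", OF _ x2] tr[of 0 0] unfolding t1 t2 t3 by simp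
  thus ?thesis unfolding E_def[symmetric] qsum_def by (simp add: algebra_simps)
qed

lemma qsum_zeta: "qsum w1 (zeta3 * w2) (zeta3 * (zeta3 * w3)) = qsum w1 w2 w3"
proof -
  have "tri 0 w1 (zeta3 * w2) (zeta3 * (zeta3 * w3)) = zeta3 ^ 3 * tri 0 w1 w2 w3"
    unfolding tri_def dsig_0 by (simp add: esigma_zeta power3_eq_cube)
  thus ?thesis unfolding qsum_def zeta3_cube unfolding tri_def dsig_tors_zeta dsig_minus_tors_zeta by simp
qed

lemma dsig_holomorphic: "dsig v holomorphic_on UNIV"
proof -
  have "(\<lambda>w. esigma (w - v)) holomorphic_on UNIV"
    using entire_shift[OF esigma_holomorphic, of "- v"] by simp
  thus ?thesis unfolding dsig_def[abs_def] by (intro holomorphic_intros) auto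
qed

text \<open>In the coordinates \<open>w\<close> times the unitary matrix with entries \<open>zeta3^(i j) / sqrt (-3)\<close>, the
  function \<open>qsum\<close> has in each variable the quasi-periodicity that characterises \<open>esigma\<close>.\<close>

theorem sigma_product_identity:
  "\<exists>C. \<forall>w1 w2 w3. qsum w1 w2 w3 = C * (esigma ((w1 + w2 + w3) / sqrt_m3) *
     esigma ((w1 + zeta3 * w2 + zeta3 * zeta3 * w3) / sqrt_m3) *
     esigma ((w1 + zeta3 * zeta3 * w2 + zeta3 * w3) / sqrt_m3))"
proof -
  \<comment> \<open>Adding 1 or \<open>zeta3\<close> to \<open>x\<close> subtracts
    \<open>tors\<close> or \<open>zeta3 * tors\<close> from all three arguments of
    \<open>qsum\<close>, which is the translation of \<open>qsum_shift1\<close> or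
    \<open>qsum_shift2\<close>. The diagonal symmetry \<open>qsum_zeta\<close> becomes the cyclic
    permutation of x, y, z.\<close>
  define G where "G = (\<lambda>x y z. qsum (- tors * (x + y + z)) (- tors * (x + zeta3 * zeta3 * y + zeta3 * z))
      (- tors * (x + zeta3 * y + zeta3 * zeta3 * z)))"
  define a where "a = tors"
  have a: "esigma a \<noteq> 0" unfolding a_def by (rule esigma_torsion_nz)
  have z4: "zeta3 * (zeta3 * zeta3) = 1" using zeta3_cube by (simp add: power3_eq_cube mult.assoc)
  have z4': "zeta3 * (zeta3 * (zeta3 * x)) = x" for x using z4 by (metis mult.assoc mult_1)
  have cyc: "G y z x = G x y z" for x y z
  proof -
    have "qsum (- tors * (x + y + z)) (zeta3 * (- tors * (x + zeta3 * zeta3 * y + zeta3 * z)))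
        (zeta3 * (zeta3 * (- tors * (x + zeta3 * y + zeta3 * zeta3 * z)))) = G x y z"
      unfolding G_def by (rule qsum_zeta)
    moreover have "zeta3 * (- tors * (x + zeta3 * zeta3 * y + zeta3 * z)) = - tors * (y + zeta3 * zeta3 * z + zeta3 * x)"
      "zeta3 * (zeta3 * (- tors * (x + zeta3 * y + zeta3 * zeta3 * z))) = - tors * (y + zeta3 * z + zeta3 * zeta3 * x)"
      by (simp_all add: algebra_simps z4' add_divide_distrib)
    moreover have "- tors * (x + y + z) = - tors * (y + z + x)" by (simp add: add_ac)
    ultimately show ?thesis unfolding G_def by (simp only:)
  qed
  have hol: "(\<lambda>x. G x y z) holomorphic_on UNIV" for y z
  proof -
    have "(\<lambda>x. dsig v (p * (x + q + r))) holomorphic_on UNIV" for v p q r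
    proof -
      have "(\<lambda>x. p * (x + q + r)) holomorphic_on UNIV" by (intro holomorphic_intros)
      from holomorphic_on_compose[OF this, of "dsig v"] show ?thesis
        using holomorphic_on_subset[OF dsig_holomorphic] by (simp add: o_def)
    qed
    thus ?thesis unfolding G_def qsum_def tri_def by (intro holomorphic_intros)
  qed
  have uni: "G x y z * esigma a = G a y z * esigma x" for x y z
    unfolding a_def
  proof (rule esigma_unique[OF hol])
    fix w
    have s: "tors * (- tors * (w + y + z) + - tors * (w + zeta3 * zeta3 * y + zeta3 * z) + - tors * (w + zeta3 * y + zeta3 * zeta3 * z)) = w"
      unfolding zeta3_sq tors_conv by (simp add: field_simps)
    show "G (w + 1) y z = - exp (cc * (w + 1/2)) * G w y z"
    proof -
      have "- tors * (w + 1 + p + q) = - tors * (w + p + q) - tors" for p q by (simp add: algebra_simps)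
      thus ?thesis unfolding G_def using qsum_shift1 s by (simp only:)
    qed
    show "G (w + zeta3) y z = - exp (cc * (cnj zeta3 * w + 1/2)) * G w y z"
    proof -
      have "- tors * (w + zeta3 + p + q) = - tors * (w + p + q) - zeta3 * tors" for p q by (simp add: algebra_simps)
      thus ?thesis unfolding G_def using qsum_shift2 s by (simp only:)
    qed
  qed
  define C where "C = G a a a / esigma a ^ 3"
  have G: "G x y z = C * (esigma x * esigma y * esigma z)" for x y z
  proof -
    have 1: "G x y z * esigma a = G a y z * esigma x" by (rule uni)
    have 2: "G a y z * esigma a = G a a z * esigma y"
      using uni[of y z a] cyc[of y z a] cyc[of a z a] cyc[of z a a] cyc[of a a z] by (metis cyc)
    have 3: "G a a z * esigma a = G a a a * esigma z"
      using uni[of z a a] cyc by metis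
    have "G x y z * esigma a ^ 3 = (G x y z * esigma a) * esigma a * esigma a" by (simp add: power3_eq_cube)
    also have "\<dots> = (G a y z * esigma a) * esigma a * esigma x" unfolding 1 by (simp add: mult_ac)
    also have "\<dots> = (G a a z * esigma a) * esigma x * esigma y" unfolding 2 by (simp add: mult_ac)
    also have "\<dots> = G a a a * (esigma x * esigma y * esigma z)" unfolding 3 by (simp add: mult_ac)
    finally show ?thesis using a unfolding C_def by (simp add: field_simps)
  qed
  have "qsum w1 w2 w3 = C * (esigma ((w1 + w2 + w3) / sqrt_m3) * esigma ((w1 + zeta3 * w2 + zeta3 * zeta3 * w3) / sqrt_m3) *
     esigma ((w1 + zeta3 * zeta3 * w2 + zeta3 * w3) / sqrt_m3))" for w1 w2 w3
  proof -
    define x where "x = (w1 + w2 + w3) / sqrt_m3"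
    define y where "y = (w1 + zeta3 * w2 + zeta3 * zeta3 * w3) / sqrt_m3"
    define z where "z = (w1 + zeta3 * zeta3 * w2 + zeta3 * w3) / sqrt_m3"
    have tt: "x / sqrt_m3 = - (x * sqrt_m3) / 3" for x by (simp add: field_simps)
    have zz: "zeta3 * (zeta3 * u) = - u - zeta3 * u" for u
      unfolding mult.assoc[symmetric] zeta3_sq by (simp add: left_diff_distrib)
    have "- tors * (x + y + z) = w1" "- tors * (x + zeta3 * zeta3 * y + zeta3 * z) = w2"
      "- tors * (x + zeta3 * y + zeta3 * zeta3 * z) = w3"
      unfolding x_def y_def z_def tt tors_conv zeta3_sq by (simp_all add: field_simps zz)
    thus ?thesis using G[of x y z] unfolding G_def x_def y_def z_def by simp
  qed
  thus ?thesis by blast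
qed

section \<open>The theta functions with characteristic\<close>

definition theta_term :: "complex \<Rightarrow> complex \<Rightarrow> complex \<Rightarrow> complex \<Rightarrow> complex \<Rightarrow> complex \<Rightarrow> complex" where
  "theta_term v1 v2 v3 t1 t2 m =
     exp (cc * ((m * cnj v1 - cnj m * v1) + (v3 * cnj v1 - cnj v3 * v1) / 2 + t1 * ((m + v3) * cnj (m + v3)))) *
     dsig v2 ((m + v3) * t2)"

text \<open>The theta function with characteristic \<open>v\<close>. The characteristic enters real-analytically; this
  normalisation makes the transformation behaviour under the unitary group free of exponential factors.\<close>

definition theta3 :: "complex \<Rightarrow> complex \<Rightarrow> complex \<Rightarrow> complex \<Rightarrow> complex \<Rightarrow> complex" where
  "theta3 v1 v2 v3 t1 t2 = (\<Sum>\<^sub>\<infinity>m\<in>eisenstein. theta_term v1 v2 v3 t1 t2 m)"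

text \<open>The defining function of the domain with reversed sign. It is the Gaussian rate of the
  theta terms (\<open>norm_theta_term\<close>) and is scaled by |j|^-2 under the group
  (\<open>unitary_height\<close>).\<close>

definition height :: "complex \<Rightarrow> complex \<Rightarrow> real" where
  "height t1 t2 = - (2 * Re t1 + (cmod t2)\<^sup>2)"

lemma norm_dsig: "cmod (dsig v w) = exp (cr / 2 * (cmod w)\<^sup>2) * esigma_abs (w - v)"
proof -
  have N: "(cmod (w - v))\<^sup>2 = (cmod w)\<^sup>2 - 2 * Re (cnj v * w) + (cmod v)\<^sup>2"
    unfolding cmod_power2 by (simp add: power2_eq_square algebra_simps)
  have "exp (cr * Re (cnj v * w - v * cnj v / 2)) = exp (cr / 2 * (cmod w)\<^sup>2) * exp (- (cr / 2) * (cmod (w - v))\<^sup>2)"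
    unfolding exp_add[symmetric] complex_norm_square[symmetric] N by (simp add: algebra_simps)
  thus ?thesis unfolding dsig_def esigma_abs_def norm_mult norm_exp_cr by simp
qed

lemma norm_theta_term:
  "cmod (theta_term v1 v2 v3 t1 t2 m) =
     exp (- (cr / 2) * height t1 t2 * (cmod (m + v3))\<^sup>2) * esigma_abs ((m + v3) * t2 - v2)"
proof -
  have "Re ((m * cnj v1 - cnj m * v1) + (v3 * cnj v1 - cnj v3 * v1) / 2 + t1 * of_real ((cmod (m + v3))\<^sup>2)) = Re t1 * (cmod (m + v3))\<^sup>2"
    by (simp add: algebra_simps)
  hence "cmod (theta_term v1 v2 v3 t1 t2 m) =
    (exp (cr * (Re t1 * (cmod (m + v3))\<^sup>2)) * exp (cr / 2 * (cmod ((m + v3) * t2))\<^sup>2)) * esigma_abs ((m + v3) * t2 - v2)"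
    unfolding theta_term_def norm_mult norm_dsig norm_exp_cr complex_norm_square[symmetric] by simp
  also have "exp (cr * (Re t1 * (cmod (m + v3))\<^sup>2)) * exp (cr / 2 * (cmod ((m + v3) * t2))\<^sup>2) =
     exp (- (cr / 2) * height t1 t2 * (cmod (m + v3))\<^sup>2)"
    unfolding exp_add[symmetric] height_def norm_mult by (simp add: algebra_simps)
  finally show ?thesis .
qed

lemma summable_gauss_eis_shift:
  assumes "\<delta> > 0"
  shows "(\<lambda>m. exp (- \<delta> * (cmod (m + v))\<^sup>2)) summable_on eisenstein"
proof (rule summable_on_dominated_real[OF summable_eis_gauss[OF assms, of "2 * \<delta> * cmod v"]])
  fix m :: complex
  have "cmod m - cmod v \<le> cmod (m + v)" by (rule norm_diff_ineq)
  hence "(cmod m)\<^sup>2 - 2 * cmod m * cmod v \<le> (cmod (m + v))\<^sup>2"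
  proof (cases "cmod m \<ge> cmod v")
    case True
    hence "(cmod m - cmod v)\<^sup>2 \<le> (cmod (m + v))\<^sup>2" using norm_diff_ineq[of m v] by (intro power_mono) auto
    thus ?thesis using zero_le_power2[of "cmod v"] unfolding power2_diff by linarith
  next
    case False
    hence "cmod m * cmod m \<le> cmod m * cmod v" by (intro mult_left_mono) auto
    moreover have "0 \<le> cmod m * cmod v" "0 \<le> (cmod (m + v))\<^sup>2" by simp_all
    ultimately show ?thesis unfolding power2_eq_square by linarith
  qed
  hence "\<delta> * ((cmod m)\<^sup>2 - 2 * cmod m * cmod v) \<le> \<delta> * (cmod (m + v))\<^sup>2" using assms by (intro mult_left_mono) auto
  thus "\<bar>exp (- \<delta> * (cmod (m + v))\<^sup>2)\<bar> \<le> exp (- \<delta> * (cmod m)\<^sup>2 + 2 * \<delta> * cmod v * cmod m)"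
    by (simp add: algebra_simps)
qed

lemma theta_term_le:
  "cmod (theta_term v1 v2 v3 t1 t2 m) \<le> 23/20 * exp (- (cr / 2 * height t1 t2) * (cmod (m + v3))\<^sup>2)"
  using mult_left_mono[OF esigma_abs_le, of "exp (- (cr / 2 * height t1 t2) * (cmod (m + v3))\<^sup>2)" "(m + v3) * t2 - v2"]
  unfolding norm_theta_term by (simp add: mult.commute)

lemma theta_summable:
  assumes "height t1 t2 > 0"
  shows "(\<lambda>m. theta_term v1 v2 v3 t1 t2 m) summable_on eisenstein"
  by (rule summable_on_dominated[OF summable_on_cmult_right[OF summable_gauss_eis_shift] theta_term_le])
     (use assms cr_pos in simp)

lemma holomorphic2_on_mult:
  assumes "holomorphic2_on f S" "holomorphic2_on g S"
  shows "holomorphic2_on (\<lambda>\<tau>. f \<tau> * g \<tau>) S"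
  unfolding holomorphic2_on_def
proof
  fix \<tau> assume "\<tau> \<in> S"
  then obtain f' g' where f: "(f has_derivative f') (at \<tau> within S)" "\<And>c v. f' (c *s v) = c * f' v"
    and g: "(g has_derivative g') (at \<tau> within S)" "\<And>c v. g' (c *s v) = c * g' v"
    using assms unfolding holomorphic2_on_def by metis
  show "\<exists>f'. ((\<lambda>\<tau>. f \<tau> * g \<tau>) has_derivative f') (at \<tau> within S) \<and> (\<forall>c v. f' (c *s v) = c * f' v)"
    by (rule exI, rule conjI, rule has_derivative_mult[OF f(1) g(1)]) (simp add: f(2) g(2) algebra_simps)
qed

lemma holomorphic2_on_compose_affine:
  assumes "f holomorphic_on UNIV"
  shows "holomorphic2_on (\<lambda>\<tau>. f (a * \<tau> $ 1 + b * \<tau> $ 2 + c)) S"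
  unfolding holomorphic2_on_def
proof
  fix \<tau> assume "\<tau> \<in> S"
  define z where "z = a * \<tau> $ 1 + b * \<tau> $ 2 + c"
  have "bounded_linear (\<lambda>\<tau>::complex^2. a * \<tau> $ 1 + b * \<tau> $ 2)"
    by (intro bounded_linear_add bounded_linear_const_mult bounded_linear_vec_nth)
  from bounded_linear_imp_has_derivative[OF this]
  have 1: "((\<lambda>\<tau>. a * \<tau> $ 1 + b * \<tau> $ 2 + c) has_derivative (\<lambda>h. a * h $ 1 + b * h $ 2)) (at \<tau> within S)"
    using has_derivative_add_const by blast
  have "(f has_derivative (*) (deriv f z)) (at z)"
    using assms holomorphic_derivI[of f UNIV z] by (simp add: has_field_derivative_def)
  from has_derivative_compose[OF 1 this[unfolded z_def]]
  show "\<exists>f'. ((\<lambda>\<tau>. f (a * \<tau> $ 1 + b * \<tau> $ 2 + c)) has_derivative f') (at \<tau> within S) \<and> (\<forall>c v. f' (c *s v) = c * f' v)"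
    by (intro exI conjI, assumption) (simp add: algebra_simps)
qed

lemma open_siegel_domain: "open siegel_domain"
proof -
  have "continuous_on UNIV (\<lambda>\<tau>::complex^2. 2 * Re (\<tau> $ 1) + (cmod (\<tau> $ 2))\<^sup>2)" by (intro continuous_intros)
  thus ?thesis unfolding siegel_domain_def by (intro open_Collect_less) auto
qed

lemma siegel_height: "\<tau> \<in> siegel_domain \<longleftrightarrow> height (\<tau> $ 1) (\<tau> $ 2) > 0"
  unfolding siegel_domain_def height_def by auto

lemma theta3_holomorphic2: "holomorphic2_on (\<lambda>\<tau>. theta3 v1 v2 v3 (\<tau> $ 1) (\<tau> $ 2)) siegel_domain"
  unfolding theta3_def
proof (rule holomorphic2_on_infsum[OF open_siegel_domain])
  fix m :: complex
  define k where "k = (m * cnj v1 - cnj m * v1) + (v3 * cnj v1 - cnj v3 * v1) / 2"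
  have "(\<lambda>z. exp (cc * z)) holomorphic_on UNIV" by (intro holomorphic_intros)
  from holomorphic2_on_compose_affine[OF this, of "(m + v3) * cnj (m + v3)" 0 k]
  have 1: "holomorphic2_on (\<lambda>\<tau>. exp (cc * (k + \<tau> $ 1 * ((m + v3) * cnj (m + v3))))) siegel_domain"
    by (simp add: mult_ac add_ac)
  have 2: "holomorphic2_on (\<lambda>\<tau>. dsig v2 ((m + v3) * \<tau> $ 2)) siegel_domain"
    using holomorphic2_on_compose_affine[OF dsig_holomorphic, of v2 0 "m + v3" 0] by simp
  show "holomorphic2_on (\<lambda>\<tau>. theta_term v1 v2 v3 (\<tau> $ 1) (\<tau> $ 2) m) siegel_domain"
    unfolding theta_term_def k_def[symmetric] by (rule holomorphic2_on_mult[OF 1 2])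
next
  fix z :: "complex^2" assume z: "z \<in> siegel_domain"
  define h where "h = height (z $ 1) (z $ 2) / 2"
  have h: "h > 0" using z by (simp add: siegel_height h_def)
  have "continuous_on UNIV (\<lambda>\<tau>::complex^2. height (\<tau> $ 1) (\<tau> $ 2))" unfolding height_def by (intro continuous_intros)
  hence "open {\<tau>::complex^2. h < height (\<tau> $ 1) (\<tau> $ 2)}" by (intro open_Collect_less) auto
  moreover have "z \<in> {\<tau>::complex^2. h < height (\<tau> $ 1) (\<tau> $ 2)}" using h by (simp add: h_def)
  ultimately obtain r where r: "r > 0" "cball z r \<subseteq> {\<tau>. h < height (\<tau> $ 1) (\<tau> $ 2)}" using open_contains_cball by blast
  show "\<exists>r>0. \<exists>M. cball z r \<subseteq> siegel_domain \<and> M summable_on eisenstein \<and>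
                 (\<forall>m\<in>eisenstein. \<forall>w\<in>cball z r. cmod (theta_term v1 v2 v3 (w $ 1) (w $ 2) m) \<le> M m)"
  proof (intro exI conjI ballI)
    show "cball z r \<subseteq> siegel_domain" using r(2) h by (force simp: siegel_height)
    show "(\<lambda>m. 23/20 * exp (- (cr / 2 * h) * (cmod (m + v3))\<^sup>2)) summable_on eisenstein"
      by (intro summable_on_cmult_right summable_gauss_eis_shift) (use h cr_pos in simp)
    fix m w assume "w \<in> cball z r"
    hence "h < height (w $ 1) (w $ 2)" using r(2) by blast
    hence "cr / 2 * h \<le> cr / 2 * height (w $ 1) (w $ 2)" using cr_pos by (intro mult_left_mono) auto
    hence "- (cr / 2 * height (w $ 1) (w $ 2)) * (cmod (m + v3))\<^sup>2 \<le> - (cr / 2 * h) * (cmod (m + v3))\<^sup>2"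
      by (intro mult_right_mono) auto
    thus "cmod (theta_term v1 v2 v3 (w $ 1) (w $ 2) m) \<le> 23/20 * exp (- (cr / 2 * h) * (cmod (m + v3))\<^sup>2)"
      by (intro order_trans[OF theta_term_le]) simp
  qed (rule r(1))
qed

text \<open>The equality holds term by term: the translation moves the argument of the sigma
  function by the lattice vector \<open>\<beta> * m\<close>, and the factor from
  \<open>esigma_shift\<close> cancels the change of the exponent up to an integral multiple of the
  period.\<close>

lemma theta3_upper:
  assumes \<beta>: "\<beta> \<in> eisenstein" and \<gamma>: "\<gamma> \<in> eisenstein" and rel: "\<gamma> + cnj \<gamma> + \<beta> * cnj \<beta> = 0"
  shows "theta3 (v1 - cnj \<beta> * v2 + \<gamma> * v3) (v2 + \<beta> * v3) v3 (t1 - cnj \<beta> * t2 + \<gamma>) (t2 + \<beta>) = theta3 v1 v2 v3 t1 t2"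
  unfolding theta3_def
proof (rule infsum_cong)
  fix m assume m: "m \<in> eisenstein"
  define b where "b = \<beta> * m"
  have b: "b \<in> eisenstein" using m \<beta> by (simp add: b_def)
  define x where "x = m + v3"
  have cg: "cnj \<gamma> = - \<gamma> - \<beta> * cnj \<beta>" using rel by (simp add: algebra_simps eq_neg_iff_add_eq_0)
  obtain p q where pq: "\<gamma> = eis p q" using eisE[OF \<gamma>] .
  obtain N :: int where N: "\<beta> * cnj \<beta> = of_int N" using eis_norm_int[OF \<beta>] by metis
  obtain M :: int where M: "m * cnj m = of_int M" using eis_norm_int[OF m] by metis
  have "\<gamma> + cnj \<gamma> = of_int (2 * p - q)" "\<gamma> - cnj \<gamma> = sqrt_m3 * of_int q"
    unfolding pq eis_def by (simp_all add: zeta3_conv cnj_zeta3_conv field_simps)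
  hence "of_int (2 * p - q + N) = (0::complex)" using rel N by simp
  hence qN: "q = 2 * p + N" by (simp only: of_int_eq_0_iff)
  have g: "\<gamma> = - of_int N / 2 + sqrt_m3 * (of_int p + of_int N / 2)"
    unfolding pq eis_def qN zeta3_conv by (simp add: field_simps)
  \<comment> \<open>The condition on \<open>\<gamma> + cnj \<gamma>\<close> ties the second
    coordinate of \<open>\<gamma>\<close> to the norm of \<open>\<beta>\<close>; this parity is what
    makes the leftover exponent an integral multiple of \<open>sqrt_m3\<close>.\<close>
  have par: "m * cnj m * (\<gamma> + \<beta> * cnj \<beta> / 2 + sqrt_m3 * (\<beta> * cnj \<beta>) / 2) = sqrt_m3 * of_int (M * (p + N))"
    unfolding N M g by (simp add: field_simps)
  define e where "e = (\<lambda>v1 v2 t1 t2. (m * cnj v1 - cnj m * v1) + (v3 * cnj v1 - cnj v3 * v1) / 2 + t1 * (x * cnj x) + (cnj v2 * (x * t2) - v2 * cnj v2 / 2))"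
  have tt: "theta_term v1 v2 v3 t1 t2 m = exp (cc * e v1 v2 t1 t2) * esigma (x * t2 - v2)" for v1 v2 t1 t2
    unfolding theta_term_def dsig_def e_def x_def[symmetric] by (simp only: distrib_left[of cc] exp_add mult.assoc)
  define k where "k = (sqrt_m3 / 2) * (b * cnj b) + cnj b * (x * t2 - v2) + b * cnj b / 2"
  have arg: "x * (t2 + \<beta>) - (v2 + \<beta> * v3) = (x * t2 - v2) + b" by (simp add: x_def b_def algebra_simps)
  have key: "e (v1 - cnj \<beta> * v2 + \<gamma> * v3) (v2 + \<beta> * v3) (t1 - cnj \<beta> * t2 + \<gamma>) (t2 + \<beta>) + k - e v1 v2 t1 t2 =
    m * cnj m * (\<gamma> + \<beta> * cnj \<beta> / 2 + sqrt_m3 * (\<beta> * cnj \<beta>) / 2)"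
    unfolding e_def k_def b_def x_def by (simp add: cg field_simps)
  have "theta_term (v1 - cnj \<beta> * v2 + \<gamma> * v3) (v2 + \<beta> * v3) v3 (t1 - cnj \<beta> * t2 + \<gamma>) (t2 + \<beta>) m =
     exp (cc * (e (v1 - cnj \<beta> * v2 + \<gamma> * v3) (v2 + \<beta> * v3) (t1 - cnj \<beta> * t2 + \<gamma>) (t2 + \<beta>) + k)) * esigma (x * t2 - v2)"
    unfolding tt arg esigma_shift[OF b] k_def[symmetric] by (simp only: distrib_left[of cc] exp_add mult.assoc)
  also have "\<dots> = theta_term v1 v2 v3 t1 t2 m"
    unfolding tt using exp_cc_cong[OF key[unfolded par]] by (simp only:)
  finally show "theta_term (v1 - cnj \<beta> * v2 + \<gamma> * v3) (v2 + \<beta> * v3) v3 (t1 - cnj \<beta> * t2 + \<gamma>) (t2 + \<beta>) m = theta_term v1 v2 v3 t1 t2 m" .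
qed

text \<open>The unit \<open>a\<close> only reindexes the sum over \<open>m\<close>; the factor
  \<open>b\<close> comes from \<open>dsig_unit\<close>.\<close>

lemma theta3_diag:
  assumes a: "a \<in> eisenstein" "cmod a = 1" and b: "b \<in> eisenstein" "cmod b = 1"
  shows "theta3 (a * v1) (b * v2) (a * v3) t1 (b * cnj a * t2) = b * theta3 v1 v2 v3 t1 t2"
proof -
  have aa: "a * cnj a = 1" using a(2) complex_norm_square[of a] by simp
  have aa': "cnj a * (a * z) = z" "a * (cnj a * z) = z" for z using aa by (simp_all add: mult.assoc[symmetric] mult.commute[of "cnj a"])
  have "theta3 (a * v1) (b * v2) (a * v3) t1 (b * cnj a * t2) =
     (\<Sum>\<^sub>\<infinity>m\<in>eisenstein. theta_term (a * v1) (b * v2) (a * v3) t1 (b * cnj a * t2) (a * m))"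
    unfolding theta3_def
    by (rule infsum_reindex_bij_witness[of _ "\<lambda>m. a * m" "\<lambda>m. cnj a * m"]) (use a in \<open>auto simp: aa'\<close>)
  also have "\<dots> = (\<Sum>\<^sub>\<infinity>m\<in>eisenstein. b * theta_term v1 v2 v3 t1 t2 m)"
  proof (rule infsum_cong)
    fix m :: complex
    have e: "(a * m) * cnj (a * v1) = m * cnj v1" "cnj (a * m) * (a * v1) = cnj m * v1"
      "(a * v3) * cnj (a * v1) = v3 * cnj v1" "cnj (a * v3) * (a * v1) = cnj v3 * v1"
      using aa by (simp_all add: algebra_simps aa')
    have "(a * m + a * v3) * cnj (a * m + a * v3) = (a * cnj a) * ((m + v3) * cnj (m + v3))"
      by (simp add: algebra_simps)
    hence e5: "(a * m + a * v3) * cnj (a * m + a * v3) = (m + v3) * cnj (m + v3)" unfolding aa by simp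
    have "(a * m + a * v3) * (b * cnj a * t2) = (a * cnj a) * (b * ((m + v3) * t2))"
      by (simp add: algebra_simps)
    hence w: "(a * m + a * v3) * (b * cnj a * t2) = b * ((m + v3) * t2)" unfolding aa by simp
    show "theta_term (a * v1) (b * v2) (a * v3) t1 (b * cnj a * t2) (a * m) = b * theta_term v1 v2 v3 t1 t2 m"
      unfolding theta_term_def e e5 w dsig_unit[OF b] by (simp only: mult_ac)
  qed
  finally show ?thesis unfolding theta3_def by (simp add: infsum_cmult_right')
qed

lemma quadratic_form_bound:
  fixes t r :: real assumes "r\<^sup>2 < 2 * t"
  obtains \<delta> where "\<delta> > 0" "\<And>M L. - t * M\<^sup>2 + r * M * L - L\<^sup>2 / 2 \<le> - \<delta> * M\<^sup>2 - \<delta> * L\<^sup>2"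
proof -
  have t: "t > 0" using assms zero_le_power2[of r] by linarith
  \<comment> \<open>Any \<open>k\<close> strictly between r^2 / (2 * t) and 1 serves: splitting the
    mixed term with weight \<open>k\<close> leaves a positive multiple of both squares.\<close>
  define k where "k = (1 + r\<^sup>2 / (2 * t)) / 2"
  have k: "0 < k" "k < 1" "r\<^sup>2 / (2 * t) < k"
    using assms t by (simp_all add: k_def field_simps add_pos_nonneg)
  have k2: "r\<^sup>2 / (2 * k) < t" using k t by (simp add: field_simps)
  define \<delta> where "\<delta> = min (t - r\<^sup>2 / (2 * k)) ((1 - k) / 2)"
  have d: "\<delta> > 0" using k k2 by (simp add: \<delta>_def)
  have d': "\<delta> \<le> t - r\<^sup>2 / (2 * k)" "\<delta> \<le> (1 - k) / 2"
    unfolding \<delta>_def by (rule min.cobounded1, rule min.cobounded2)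
  have "- t * M\<^sup>2 + r * M * L - L\<^sup>2 / 2 \<le> - \<delta> * M\<^sup>2 - \<delta> * L\<^sup>2" for M L
  proof -
    have "0 \<le> (r * M - k * L)\<^sup>2 / (2 * k)" using k by simp
    also have "\<dots> = r\<^sup>2 / (2 * k) * M\<^sup>2 - r * M * L + k / 2 * L\<^sup>2"
      using k by (simp add: power2_eq_square field_simps)
    finally have "r * M * L \<le> r\<^sup>2 / (2 * k) * M\<^sup>2 + k / 2 * L\<^sup>2" by simp
    moreover have "\<delta> * M\<^sup>2 \<le> (t - r\<^sup>2 / (2 * k)) * M\<^sup>2" "\<delta> * L\<^sup>2 \<le> ((1 - k) / 2) * L\<^sup>2"
      using d' by (intro mult_right_mono; simp)+
    ultimately show ?thesis by (simp add: left_diff_distrib diff_divide_distrib)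
  qed
  thus ?thesis using that d by blast
qed

section \<open>The inversion formula\<close>

text \<open>The theta term with its sigma function expanded by \<open>esigma_kernel\<close>. In the
  double sum over \<open>m\<close> and \<open>l\<close> the order can be exchanged, and for fixed
  \<open>l\<close> the sum over \<open>m\<close> has the form treated by
  \<open>poisson_eisenstein\<close>.\<close>

definition pair_term :: "complex \<Rightarrow> complex \<Rightarrow> complex \<Rightarrow> complex \<Rightarrow> complex \<Rightarrow> complex \<Rightarrow> complex \<Rightarrow> complex" where
  "pair_term v1 v2 v3 t1 t2 m l =
     exp (cc * ((m * cnj v1 - cnj m * v1) + (v3 * cnj v1 - cnj v3 * v1) / 2 + t1 * ((m + v3) * cnj (m + v3)) +
       (cnj v2 * ((m + v3) * t2) - v2 * cnj v2 / 2) + kernel_exponent tors ((m + v3) * t2 - v2) l))"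

lemma pair_term_infsum:
  "(\<Sum>\<^sub>\<infinity>l\<in>eisenstein. pair_term v1 v2 v3 t1 t2 m l) = kernel_const * theta_term v1 v2 v3 t1 t2 m"
proof -
  define E where "E = (m * cnj v1 - cnj m * v1) + (v3 * cnj v1 - cnj v3 * v1) / 2 + t1 * ((m + v3) * cnj (m + v3))"
  define E' where "E' = cnj v2 * ((m + v3) * t2) - v2 * cnj v2 / 2"
  have "(\<Sum>\<^sub>\<infinity>l\<in>eisenstein. pair_term v1 v2 v3 t1 t2 m l) =
     (exp (cc * E) * exp (cc * E')) * (\<Sum>\<^sub>\<infinity>l\<in>eisenstein. exp (cc * kernel_exponent tors ((m + v3) * t2 - v2) l))"
    unfolding infsum_cmult_right'[symmetric] pair_term_def E_def[symmetric] E'_def[symmetric]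
    by (simp only: distrib_left[of cc] exp_add)
  thus ?thesis unfolding esigma_kernel[symmetric] theta_term_def dsig_def E_def[symmetric] E'_def[symmetric]
    by (simp only: mult_ac)
qed

lemma pair_term_summable:
  assumes "height t1 t2 > 0"
  shows "(\<lambda>(m, l). pair_term v1 v2 v3 t1 t2 m l) summable_on eisenstein \<times> eisenstein"
proof -
  define r where "r = cmod t2"
  obtain \<delta> where d: "\<delta> > 0" "\<And>M L. - (- Re t1) * M\<^sup>2 + r * M * L - L\<^sup>2 / 2 \<le> - \<delta> * M\<^sup>2 - \<delta> * L\<^sup>2"
    using quadratic_form_bound[of r "- Re t1"] assms unfolding height_def r_def by (metis (no_types, lifting) add.commute diff_gt_0_iff_gt minus_add_distrib mult_minus_right uminus_add_conv_diff)
  define C where "C = (cmod v2 + cmod tors) * r"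
  define C' where "C' = cmod v2 + cmod tors"
  define K where "K = C\<^sup>2 / (2 * \<delta>) + C'\<^sup>2 / (2 * \<delta>) + cmod tors * cmod v2"
  have lin: "- \<delta> * M\<^sup>2 + c * M \<le> - (\<delta> / 2) * M\<^sup>2 + c\<^sup>2 / (2 * \<delta>)" for M c
  proof -
    have "0 \<le> (\<delta> * M - c)\<^sup>2 / (2 * \<delta>)" using d(1) by simp
    also have "\<dots> = \<delta> / 2 * M\<^sup>2 - c * M + c\<^sup>2 / (2 * \<delta>)" using d(1) by (simp add: power2_eq_square field_simps)
    finally show ?thesis by simp
  qed
  have bound: "cmod (pair_term v1 v2 v3 t1 t2 m l) \<le>
     exp (cr * K) * (exp (- (cr * \<delta> / 2) * (cmod (m + v3))\<^sup>2) * exp (- (cr * \<delta> / 2) * (cmod (l + 0))\<^sup>2))" for m l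
  proof -
    define x where "x = m + v3"
    have 1: "Re (cnj v2 * (x * t2)) \<le> cmod v2 * r * cmod x" "Re (cnj l * (x * t2)) \<le> r * cmod x * cmod l"
      "Re (- (cnj l * v2)) \<le> cmod v2 * cmod l" "Re (tors * l) \<le> cmod tors * cmod l"
      "Re (- (tors * (x * t2))) \<le> cmod tors * r * cmod x" "Re (tors * v2) \<le> cmod tors * cmod v2"
      by (rule order_trans[OF complex_Re_le_cmod], simp add: norm_mult norm_divide r_def mult_ac)+
    have "Re ((m * cnj v1 - cnj m * v1) + (v3 * cnj v1 - cnj v3 * v1) / 2 + t1 * (x * cnj x) +
       (cnj v2 * (x * t2) - v2 * cnj v2 / 2) + kernel_exponent tors (x * t2 - v2) l) =
      Re t1 * (cmod x)\<^sup>2 + Re (cnj v2 * (x * t2)) - (cmod v2)\<^sup>2 / 2 + Re (cnj l * (x * t2)) + Re (- (cnj l * v2))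
        + Re (tors * l) + Re (- (tors * (x * t2))) + Re (tors * v2) - (cmod l)\<^sup>2 / 2"
      unfolding kernel_exponent_def complex_norm_square[symmetric] by (simp add: algebra_simps add_divide_distrib diff_divide_distrib)
    also have "\<dots> \<le> (- (- Re t1) * (cmod x)\<^sup>2 + r * cmod x * cmod l - (cmod l)\<^sup>2 / 2) + C * cmod x + C' * cmod l + cmod tors * cmod v2"
      using 1 zero_le_power2[of "cmod v2"] unfolding C_def C'_def distrib_right by linarith
    also have "\<dots> \<le> (- \<delta> * (cmod x)\<^sup>2 + C * cmod x) + (- \<delta> * (cmod l)\<^sup>2 + C' * cmod l) + cmod tors * cmod v2"
      using d(2)[of "cmod x" "cmod l"] by linarith
    also have "\<dots> \<le> K + (- (\<delta> / 2) * (cmod x)\<^sup>2) + (- (\<delta> / 2) * (cmod l)\<^sup>2)"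
      using lin[of "cmod x" C] lin[of "cmod l" C'] unfolding K_def by linarith
    finally have "cr * Re ((m * cnj v1 - cnj m * v1) + (v3 * cnj v1 - cnj v3 * v1) / 2 + t1 * (x * cnj x) +
       (cnj v2 * (x * t2) - v2 * cnj v2 / 2) + kernel_exponent tors (x * t2 - v2) l) \<le>
       cr * (K + (- (\<delta> / 2) * (cmod x)\<^sup>2) + (- (\<delta> / 2) * (cmod l)\<^sup>2))" using cr_pos by (intro mult_left_mono) auto
    also have "\<dots> = cr * K + (- (cr * \<delta> / 2) * (cmod x)\<^sup>2 + - (cr * \<delta> / 2) * (cmod (l + 0))\<^sup>2)" by (simp add: algebra_simps)
    finally show ?thesis unfolding pair_term_def x_def[symmetric] norm_exp_cr exp_add[symmetric] exp_le_cancel_iff .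
  qed
  have "(\<lambda>p. exp (cr * K) * (case p of (m, l) \<Rightarrow> exp (- (cr * \<delta> / 2) * (cmod (m + v3))\<^sup>2) * exp (- (cr * \<delta> / 2) * (cmod (l + 0))\<^sup>2)))
      summable_on eisenstein \<times> eisenstein"
    by (intro summable_on_cmult_right product_summable_on_real summable_gauss_eis_shift) (use d(1) cr_pos in auto)
  thus ?thesis by (rule summable_on_dominated) (use bound in auto)
qed

text \<open>For fixed \<open>l\<close>, Poisson summation in \<open>m\<close> produces the inner sum
  of the transformed theta function with the same \<open>l\<close>; the dual variable
  \<open>\<nu>\<close> takes the place of \<open>m\<close>, and \<open>v1\<close> that of
  \<open>v3\<close>. The restriction to \<open>t1 = - t\<close> comes from the real parameter in
  \<open>poisson_eisenstein\<close>.\<close>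

lemma theta3_J_real:
  fixes t :: real
  assumes t: "(cmod t2)\<^sup>2 < 2 * t"
  shows "theta3 v3 v2 v1 (1 / (- of_real t)) (t2 / (- of_real t)) = of_real t * theta3 v1 v2 v3 (- of_real t) t2"
proof -
  let ?t = "complex_of_real t"
  have tp: "t > 0" using t zero_le_power2[of "cmod t2"] by linarith
  have h: "height (- ?t) t2 > 0" using t by (simp add: height_def)
  have h': "height (1 / (- ?t)) (t2 / (- ?t)) > 0"
  proof -
    have "height (1 / (- ?t)) (t2 / (- ?t)) = (2 * t - (cmod t2)\<^sup>2) / t\<^sup>2"
      using tp by (simp add: height_def norm_divide power_divide power2_eq_square field_simps Re_divide_of_real)
    thus ?thesis using t tp by simp
  qed
  define A where "A = - v1 - ?t * v3"
  define B where "B = (\<lambda>l. cnj v1 - ?t * cnj v3 + cnj v2 * t2 + cnj l * t2 - tors * t2)"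
  define c where "c = (\<lambda>l. (v3 * cnj v1 - cnj v3 * v1) / 2 - ?t * (v3 * cnj v3) + cnj v2 * v3 * t2 - v2 * cnj v2 / 2 +
     kernel_exponent tors (v3 * t2 - v2) l)"
  have 1: "pair_term v1 v2 v3 (- ?t) t2 m l = exp (cc * c l) * exp (cc * (- ?t * (m * cnj m) + A * cnj m + B l * m))" for m l
    unfolding pair_term_def exp_add[symmetric] distrib_left[symmetric]
    by (rule arg_cong[of _ _ "\<lambda>z. exp (cc * z)"])
       (simp add: c_def A_def B_def kernel_exponent_def algebra_simps)
  have 2: "exp (cc * c l) * exp (cc * ((A - \<nu>) * (B l + cnj \<nu>) / ?t)) = pair_term v3 v2 v1 (1 / (- ?t)) (t2 / (- ?t)) \<nu> l" for \<nu> l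
  proof -
    have "c l + (A - \<nu>) * (B l + cnj \<nu>) / ?t =
      (\<nu> * cnj v3 - cnj \<nu> * v3) + (v1 * cnj v3 - cnj v1 * v3) / 2 + 1 / (- ?t) * ((\<nu> + v1) * cnj (\<nu> + v1)) +
       (cnj v2 * ((\<nu> + v1) * (t2 / (- ?t))) - v2 * cnj v2 / 2) + kernel_exponent tors ((\<nu> + v1) * (t2 / (- ?t)) - v2) l"
    proof -
      \<comment> \<open>The identity holds for every value of the kernel parameter, so
        \<open>tors\<close> is treated as an indeterminate.\<close>
      have "tors = T \<Longrightarrow> ?thesis" for T
        unfolding c_def A_def B_def kernel_exponent_def using tp by (simp add: field_simps)
      thus ?thesis by blast
    qed
    thus ?thesis unfolding pair_term_def exp_add[symmetric] distrib_left[symmetric] by (simp only:)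
  qed
  have inner: "(\<Sum>\<^sub>\<infinity>m\<in>eisenstein. pair_term v1 v2 v3 (- ?t) t2 m l) =
     of_real (1 / t) * (\<Sum>\<^sub>\<infinity>\<nu>\<in>eisenstein. pair_term v3 v2 v1 (1 / (- ?t)) (t2 / (- ?t)) \<nu> l)" for l
  proof -
    have "(\<Sum>\<^sub>\<infinity>m\<in>eisenstein. pair_term v1 v2 v3 (- ?t) t2 m l) =
       exp (cc * c l) * (\<Sum>\<^sub>\<infinity>m\<in>eisenstein. exp (cc * (- ?t * (m * cnj m) + A * cnj m + B l * m)))"
      unfolding 1 by (rule infsum_cmult_right')
    also have "(\<Sum>\<^sub>\<infinity>m\<in>eisenstein. exp (cc * (- ?t * (m * cnj m) + A * cnj m + B l * m))) =
       of_real (1 / t) * (\<Sum>\<^sub>\<infinity>\<nu>\<in>eisenstein. exp (cc * ((A + \<nu>) * (B l - cnj \<nu>) / ?t)))"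
      by (rule poisson_eisenstein[OF tp])
    also have "(\<Sum>\<^sub>\<infinity>\<nu>\<in>eisenstein. exp (cc * ((A + \<nu>) * (B l - cnj \<nu>) / ?t))) =
       (\<Sum>\<^sub>\<infinity>\<nu>\<in>eisenstein. exp (cc * ((A - \<nu>) * (B l + cnj \<nu>) / ?t)))"
      by (rule infsum_reindex_bij_witness[of _ uminus uminus]) auto
    finally show ?thesis unfolding 2[symmetric] infsum_cmult_right' by (simp only: mult_ac)
  qed
  have iter: "kernel_const * theta3 u1 u2 u3 s1 s2 = (\<Sum>\<^sub>\<infinity>l\<in>eisenstein. \<Sum>\<^sub>\<infinity>m\<in>eisenstein. pair_term u1 u2 u3 s1 s2 m l)"
    if "height s1 s2 > 0" for u1 u2 u3 s1 s2
    unfolding theta3_def infsum_cmult_right'[symmetric] pair_term_infsum[symmetric]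
    by (rule infsum_swap_banach[OF pair_term_summable[OF that]])
  have "kernel_const * theta3 v1 v2 v3 (- ?t) t2 = of_real (1 / t) * (kernel_const * theta3 v3 v2 v1 (1 / (- ?t)) (t2 / (- ?t)))"
    unfolding iter[OF h] iter[OF h'] inner by (rule infsum_cmult_right')
  thus ?thesis using kernel_const_nz tp by (simp add: field_simps)
qed

lemma vector2_eq: "(vector [a, b] :: complex^2) = a *s axis 1 1 + b *s axis 2 1"
  unfolding vec_eq_iff forall_2 by (auto simp: axis_def)

lemma holomorphic2_curve:
  assumes F: "holomorphic2_on F S" and "open S" "open A" and g1: "g1 holomorphic_on A" and g2: "g2 holomorphic_on A"
    and S: "\<And>z. z \<in> A \<Longrightarrow> vector [g1 z, g2 z] \<in> S"
  shows "(\<lambda>z. F (vector [g1 z, g2 z])) holomorphic_on A"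
proof -
  have "(\<lambda>z. F (vector [g1 z, g2 z])) field_differentiable at z" if z: "z \<in> A" for z
  proof -
    have vs: "norm (t *s u) = cmod t * norm u" for t and u :: "complex^2"
      by (simp add: norm_vec_def L2_set_def norm_mult power_mult_distrib real_sqrt_mult distrib_left[symmetric] sum_2)
    have bl: "bounded_linear (\<lambda>t::complex. t *s (axis k 1 :: complex^2))" for k
      by (rule bounded_linear_intro[where K = "norm (axis k 1 :: complex^2)"])
         (auto simp: vs vec_eq_iff algebra_simps)
    have d: "(g has_derivative (*) (deriv g z)) (at z)" if "g holomorphic_on A" for g
      using holomorphic_derivI[OF that \<open>open A\<close> z] by (simp add: has_field_derivative_def)
    have c: "((\<lambda>z. g z *s (axis k 1 :: complex^2)) has_derivative (\<lambda>h. (deriv g z * h) *s axis k 1)) (at z)"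
      if "g holomorphic_on A" for g k
      using has_derivative_compose[OF d[OF that] bounded_linear_imp_has_derivative[OF bl]] .
    have v: "((\<lambda>z. vector [g1 z, g2 z] :: complex^2) has_derivative (\<lambda>h. (deriv g1 z * h) *s axis 1 1 + (deriv g2 z * h) *s axis 2 1)) (at z)"
      unfolding vector2_eq by (intro has_derivative_add c g1 g2)
    obtain F' where F': "(F has_derivative F') (at (vector [g1 z, g2 z]))" "\<And>c v. F' (c *s v) = c * F' v"
      using F S[OF z] at_within_open[OF S[OF z] \<open>open S\<close>] unfolding holomorphic2_on_def by metis
    define D where "D = deriv g1 z *s axis 1 1 + deriv g2 z *s (axis 2 1 :: complex^2)"
    have "(deriv g1 z * h) *s axis 1 1 + (deriv g2 z * h) *s axis 2 1 = h *s D" for h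
      by (simp add: D_def vec_eq_iff algebra_simps)
    hence "((\<lambda>z. F (vector [g1 z, g2 z])) has_derivative (\<lambda>h. h * F' D)) (at z)"
      using has_derivative_compose[OF v F'(1)] F'(2) by simp
    moreover have "(\<lambda>h. h * F' D) = (*) (F' D)" by (auto simp: mult.commute)
    ultimately have "((\<lambda>z. F (vector [g1 z, g2 z])) has_field_derivative F' D) (at z)"
      unfolding has_field_derivative_def by (simp only:)
    thus ?thesis unfolding field_differentiable_def by blast
  qed
  thus ?thesis by (simp add: holomorphic_on_def field_differentiable_at_within)
qed

lemma height_J:
  assumes "t1 \<noteq> 0" shows "height (1 / t1) (t2 / t1) = height t1 t2 / (cmod t1)\<^sup>2"
proof -
  have "Re (1 / t1) = Re t1 / (cmod t1)\<^sup>2" by (simp add: Re_divide cmod_power2)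
  thus ?thesis using assms unfolding height_def norm_divide power_divide by (simp add: divide_simps)
qed

lemma height_pos_nz: "height t1 t2 > 0 \<Longrightarrow> t1 \<noteq> 0"
  by (auto simp: height_def)

text \<open>Analytic continuation in \<open>t1\<close> for fixed \<open>t2\<close>: the admissible
  \<open>t1\<close> form a half-plane, and \<open>theta3_J_real\<close> settles the part of the real
  axis in it.\<close>

lemma theta3_J:
  assumes h: "height t1 t2 > 0"
  shows "theta3 v3 v2 v1 (1 / t1) (t2 / t1) = - t1 * theta3 v1 v2 v3 t1 t2"
proof -
  define A where "A = {z. Re z < - (cmod t2)\<^sup>2 / 2}"
  have A: "z \<in> A \<longleftrightarrow> height z t2 > 0" for z by (auto simp: A_def height_def)
  have oA: "open A" unfolding A_def by (intro open_Collect_less continuous_intros)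
  have cA: "connected A" unfolding A_def by (intro convex_connected convex_halfspace_Re_lt)
  define f where "f = (\<lambda>z. theta3 v3 v2 v1 (1 / z) (t2 / z) - (- z * theta3 v1 v2 v3 z t2))"
  have in1: "vector [1 / z, t2 / z] \<in> siegel_domain" if "z \<in> A" for z
    using that height_J[OF height_pos_nz, of z t2 t2] height_pos_nz[of z t2] by (simp add: siegel_height A)
  have in2: "vector [z, t2] \<in> siegel_domain" if "z \<in> A" for z using that by (simp add: siegel_height A)
  have h1: "(\<lambda>z. 1 / z) holomorphic_on A" "(\<lambda>z. t2 / z) holomorphic_on A"
    using height_pos_nz A by (auto intro!: holomorphic_intros)
  have "(\<lambda>z. theta3 v3 v2 v1 (1 / z) (t2 / z)) holomorphic_on A"
    using holomorphic2_curve[OF theta3_holomorphic2 open_siegel_domain oA h1 in1] by simp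
  moreover have "(\<lambda>z. theta3 v1 v2 v3 z t2) holomorphic_on A"
    using holomorphic2_curve[OF theta3_holomorphic2 open_siegel_domain oA _ _ in2] by (simp add: holomorphic_on_const holomorphic_on_ident)
  ultimately have fh: "f holomorphic_on A" unfolding f_def by (intro holomorphic_intros)
  define U where "U = (\<lambda>t. - complex_of_real t) ` {(cmod t2)\<^sup>2 / 2<..}"
  define \<xi> where "\<xi> = - complex_of_real ((cmod t2)\<^sup>2 / 2 + 1)"
  have "\<xi> islimpt U"
    unfolding islimpt_approachable
  proof (intro allI impI)
    fix e :: real assume e: "e > 0"
    define t where "t = (cmod t2)\<^sup>2 / 2 + 1 + e / 2"
    have "- complex_of_real t \<in> U" using e unfolding U_def by (intro imageI) (simp add: t_def)
    moreover have "- complex_of_real t \<noteq> \<xi>" using e unfolding \<xi>_def t_def by (simp add: complex_eq_iff)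
    moreover have "dist (- complex_of_real t) \<xi> < e"
    proof -
      have "- complex_of_real t - \<xi> = of_real (- e / 2)" by (simp add: \<xi>_def t_def)
      hence "dist (- complex_of_real t) \<xi> = e / 2" unfolding dist_norm using e by (simp only: norm_of_real)
      thus ?thesis using e by simp
    qed
    ultimately show "\<exists>x'\<in>U. x' \<noteq> \<xi> \<and> dist x' \<xi> < e" by blast
  qed
  moreover have "U \<subseteq> A" by (auto simp: U_def A_def)
  moreover have "\<xi> \<in> A" by (simp add: \<xi>_def A_def)
  moreover have "f z = 0" if zU: "z \<in> U" for z
  proof -
    obtain t where "z = - complex_of_real t" "(cmod t2)\<^sup>2 / 2 < t" using zU unfolding U_def by blast
    thus ?thesis using theta3_J_real[of t2 t v3 v2 v1] by (simp add: f_def)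
  qed
  ultimately have "f t1 = 0"
    using analytic_continuation[OF fh oA cA, of U \<xi> t1] h A by blast
  hence "theta3 v3 v2 v1 (1 / t1) (t2 / t1) - - t1 * theta3 v1 v2 v3 t1 t2 = 0" unfolding f_def .
  thus ?thesis by (simp only: right_minus_eq)
qed

section \<open>The cubic relation\<close>

text \<open>A nontrivial additive character of the field with three elements, pulled back along
  reduction modulo \<open>sqrt_m3\<close>: the residues 0, 1, -1 go to 1, \<open>zeta3\<close>,
  zeta3^2.\<close>

definition rho :: "complex \<Rightarrow> complex" where
  "rho m = exp (cc * (tors * (m + cnj m)))"

lemma rho_add: "rho (m + n) = rho m * rho n"
  unfolding rho_def exp_add[symmetric] by (simp add: algebra_simps add_divide_distrib)

lemma rho_0 [simp]: "rho 0 = 1" by (simp add: rho_def)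

lemma rho_minus: "rho (- m) * rho m = 1"
  unfolding rho_add[symmetric] by simp

lemma norm_rho: "cmod (rho m) = 1"
  unfolding rho_def norm_exp_cr tors_conv by simp

lemma eis_diff_cnj:
  assumes "x \<in> eisenstein" obtains q :: int where "x - cnj x = sqrt_m3 * of_int q"
proof -
  obtain p q where x: "x = eis p q" using eisE[OF assms] .
  have "x - cnj x = sqrt_m3 * of_int q" unfolding x eis_cnj by (simp add: eis_def sqrt_m3_conv algebra_simps)
  thus ?thesis using that by blast
qed

lemma rho_eq_1: assumes "tors * m \<in> eisenstein" shows "rho m = 1"
proof -
  obtain q :: int where q: "tors * m - cnj (tors * m) = sqrt_m3 * of_int q" using eis_diff_cnj[OF assms] .
  have "tors * (m + cnj m) - 0 = sqrt_m3 * of_int q" using q by (simp add: field_simps)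
  from exp_cc_cong[OF this] show ?thesis by (simp add: rho_def)
qed

lemma rho_1: "rho 1 = zeta3"
proof -
  have "tors * (1 + cnj 1) - sqrt_m3 / 3 = sqrt_m3 * of_int (- 1)" unfolding tors_conv by simp
  from exp_cc_cong[OF this] show ?thesis unfolding rho_def exp_cc_third .
qed

lemma zeta3_ne_1: "zeta3 \<noteq> 1"
  unfolding zeta3_eq by (simp add: complex_eq_iff)

lemma zeta3_sq_ne_1: "zeta3 * zeta3 \<noteq> 1"
  unfolding zeta3_sq unfolding zeta3_eq by (simp add: complex_eq_iff)

lemma rho_minus_1: "rho (- 1) = zeta3 * zeta3"
proof -
  have "rho (-1) * zeta3 = 1" using rho_minus[of 1] unfolding rho_1 .
  moreover have "rho (-1) = rho (-1) * zeta3 ^ 3" unfolding zeta3_cube by simp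
  moreover have "rho (-1) * zeta3 ^ 3 = (rho (-1) * zeta3) * (zeta3 * zeta3)" by (simp only: power3_eq_cube mult.assoc)
  ultimately show ?thesis by simp
qed

lemma eis_residue:
  assumes "m \<in> eisenstein"
  shows "\<exists>j\<in>{0, 1, -1}. tors * (m - j) \<in> eisenstein"
proof -
  obtain p q where m: "m = eis p q" using eisE[OF assms] .
  \<comment> \<open>\<open>zeta3\<close> is congruent to 1, so \<open>m\<close> has the residue of
    \<open>p + q\<close>; adding and subtracting 1 centres it in {-1, 0, 1}.\<close>
  define n where "n = (p + q + 1) mod 3 - 1"
  define k where "k = (p + q + 1) div 3"
  have n: "p + q = 3 * k + n" unfolding n_def k_def by presburger
  have nn: "n \<in> {0, 1, -1}" unfolding n_def by auto
  have "tors * (m - of_int n) = - sqrt_m3 * of_int k + of_int q * (1 + zeta3)"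
  proof -
    have "m - of_int n = of_int (3 * k) + of_int q * (zeta3 - 1)"
    proof -
      have p: "p = 3 * k + n - q" using n by simp
      show ?thesis unfolding m eis_def p by (simp add: algebra_simps)
    qed
    hence "tors * (m - of_int n) = tors * (of_int (3 * k) + of_int q * (zeta3 - 1))" by (simp only:)
    also have "\<dots> = - sqrt_m3 * of_int k + of_int q * (1 + zeta3)"
      unfolding zeta3_conv tors_conv by (simp add: field_simps)
    finally show ?thesis .
  qed
  hence "tors * (m - of_int n) \<in> eisenstein" by simp
  thus ?thesis using nn by auto
qed

lemma rho_residue: "tors * (m - j) \<in> eisenstein \<Longrightarrow> rho m = rho j"
  using rho_add[of "m - j" j] rho_eq_1[of "m - j"] by simp

lemma rho_values:
  assumes "m \<in> eisenstein"
  shows "rho m ^ 3 = 1" "rho m = 1 \<longleftrightarrow> tors * m \<in> eisenstein"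
proof -
  obtain j where j: "j \<in> {0, 1, -1}" "tors * (m - j) \<in> eisenstein" using eis_residue[OF assms] by blast
  have r: "rho m = rho j" by (rule rho_residue[OF j(2)])
  have "(zeta3 * zeta3) ^ 3 = 1" using zeta3_cube by (simp add: power_mult_distrib)
  thus "rho m ^ 3 = 1" unfolding r using j(1) zeta3_cube by (auto simp: rho_1 rho_minus_1)
  show "rho m = 1 \<longleftrightarrow> tors * m \<in> eisenstein"
  proof
    assume "rho m = 1"
    hence "j = 0" using j(1) zeta3_ne_1 zeta3_sq_ne_1 unfolding r by (auto simp: rho_1 rho_minus_1)
    thus "tors * m \<in> eisenstein" using j(2) by simp
  qed (rule rho_eq_1)
qed

lemma rho_zeta:
  assumes "m \<in> eisenstein" shows "rho (zeta3 * m) = rho m"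
proof (rule rho_residue)
  have "tors * (zeta3 * m - m) = (1 + zeta3) * m" unfolding zeta3_conv tors_conv by (simp add: field_simps)
  thus "tors * (zeta3 * m - m) \<in> eisenstein" using assms by simp
qed

text \<open>Three effects combine: \<open>l3\<close> shifts the summation index, \<open>l2\<close>
  enters through \<open>dsig_lattice\<close>, and the character contributed by \<open>l1\<close> is
  trivial on the lattice. Together they yield the hermitian form of \<open>herm_J\<close>, which is
  why the constant is compatible with the unitary group.\<close>

lemma theta3_lattice:
  assumes l: "l1 \<in> eisenstein" "l2 \<in> eisenstein" "l3 \<in> eisenstein"
  shows "theta3 (v1 + l1) (v2 + l2) (v3 + l3) t1 t2 =
    exp (cc * ((sqrt_m3 / 2) * (l1 * cnj l3 + l2 * cnj l2 + l3 * cnj l1) +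
      ((v1 * cnj l3 + v2 * cnj l2 + v3 * cnj l1) - (l1 * cnj v3 + l2 * cnj v2 + l3 * cnj v1)) / 2)) * theta3 v1 v2 v3 t1 t2"
proof -
  define E where "E = (sqrt_m3 / 2) * (l1 * cnj l3 + l2 * cnj l2 + l3 * cnj l1) +
      ((v1 * cnj l3 + v2 * cnj l2 + v3 * cnj l1) - (l1 * cnj v3 + l2 * cnj v2 + l3 * cnj v1)) / 2"
  have "theta3 (v1 + l1) (v2 + l2) (v3 + l3) t1 t2 = (\<Sum>\<^sub>\<infinity>m\<in>eisenstein. theta_term (v1 + l1) (v2 + l2) (v3 + l3) t1 t2 (m - l3))"
    unfolding theta3_def
    by (rule infsum_reindex_bij_witness[of _ "\<lambda>m. m - l3" "\<lambda>m. m + l3"]) (use l in auto)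
  also have "\<dots> = (\<Sum>\<^sub>\<infinity>m\<in>eisenstein. exp (cc * E) * theta_term v1 v2 v3 t1 t2 m)"
  proof (rule infsum_cong)
    fix m assume m: "m \<in> eisenstein"
    obtain q :: int where q: "m * cnj l1 - cnj m * l1 = sqrt_m3 * of_int q"
      using eis_diff_cnj[of "m * cnj l1"] m l by auto
    obtain p :: int where p: "(sqrt_m3 / 2) * (l1 * cnj l3 + l3 * cnj l1) + (l1 * cnj l3 - l3 * cnj l1) / 2 = sqrt_m3 * of_int p"
      using eis_pair_integral[of "l1 * cnj l3"] l by (auto simp: mult.commute)
    obtain r :: int where r: "l3 * cnj l1 - cnj l3 * l1 = sqrt_m3 * of_int r"
      using eis_diff_cnj[of "l3 * cnj l1"] l by auto
    define X where "X = m + v3"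
    have X: "m - l3 + (v3 + l3) = X" by (simp add: X_def)
    define A where "A = ((m - l3) * cnj (v1 + l1) - cnj (m - l3) * (v1 + l1)) + ((v3 + l3) * cnj (v1 + l1) - cnj (v3 + l3) * (v1 + l1)) / 2 + t1 * (X * cnj X)"
    define B where "B = (sqrt_m3 / 2) * (l2 * cnj l2) + (cnj l2 * v2 - l2 * cnj v2) / 2"
    define D where "D = (m * cnj v1 - cnj m * v1) + (v3 * cnj v1 - cnj v3 * v1) / 2 + t1 * (X * cnj X)"
    have e1: "(A + B) - (E + D) = (m * cnj l1 - cnj m * l1) -
       ((sqrt_m3 / 2) * (l1 * cnj l3 + l3 * cnj l1) + (l1 * cnj l3 - l3 * cnj l1) / 2) - (l3 * cnj l1 - cnj l3 * l1)"
      unfolding A_def B_def D_def E_def by (simp add: field_simps)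
    have "(A + B) - (E + D) = sqrt_m3 * of_int (q - p - r)"
      using e1 unfolding q p r by (simp add: algebra_simps)
    from exp_cc_cong[OF this] have "exp (cc * A) * exp (cc * B) = exp (cc * E) * exp (cc * D)"
      unfolding distrib_left[of cc A] distrib_left[of cc E] exp_add .
    moreover have "theta_term (v1 + l1) (v2 + l2) (v3 + l3) t1 t2 (m - l3) = exp (cc * A) * (exp (cc * B) * dsig v2 (X * t2))"
      unfolding theta_term_def X A_def B_def dsig_lattice[OF l(2)] ..
    moreover have "theta_term v1 v2 v3 t1 t2 m = exp (cc * D) * dsig v2 (X * t2)"
      unfolding theta_term_def D_def X_def ..
    ultimately show "theta_term (v1 + l1) (v2 + l2) (v3 + l3) t1 t2 (m - l3) = exp (cc * E) * theta_term v1 v2 v3 t1 t2 m"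
      by (simp only: mult.assoc[symmetric])
  qed
  finally show ?thesis unfolding E_def[symmetric] infsum_cmult_right' theta3_def .
qed

section \<open>Cubes of theta functions as sums over triples of lattice points\<close>

lemma triple_product_infsum:
  fixes f g h :: "'a \<Rightarrow> complex"
  assumes "f summable_on A" "g summable_on A" "h summable_on A"
  shows "(\<lambda>(x, y, z). f x * (g y * h z)) summable_on A \<times> A \<times> A"
    "(\<Sum>\<^sub>\<infinity>(x, y, z)\<in>A \<times> A \<times> A. f x * (g y * h z)) = infsum f A * (infsum g A * infsum h A)"
proof -
  have gh: "(\<lambda>(y, z). g y * h z) summable_on A \<times> A" by (rule product_summable_on(1)[OF assms(2,3)])
  show "(\<lambda>(x, y, z). f x * (g y * h z)) summable_on A \<times> A \<times> A"
    using product_summable_on(1)[OF assms(1) gh] by (simp add: case_prod_unfold)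
  show "(\<Sum>\<^sub>\<infinity>(x, y, z)\<in>A \<times> A \<times> A. f x * (g y * h z)) = infsum f A * (infsum g A * infsum h A)"
    using product_summable_on(2)[OF assms(1) gh] product_summable_on(2)[OF assms(2,3)] by (simp add: case_prod_unfold)
qed

definition gterm :: "complex \<Rightarrow> complex \<Rightarrow> complex \<Rightarrow> complex" where
  "gterm t1 t2 x = exp (cc * (t1 * (x * cnj x))) * esigma (x * t2)"

lemma gterm_zeta: "gterm t1 t2 (zeta3 * x) = zeta3 * gterm t1 t2 x"
proof -
  have "zeta3 * x * cnj (zeta3 * x) = (zeta3 * cnj zeta3) * (x * cnj x)" by (simp only: complex_cnj_mult mult_ac)
  hence "zeta3 * x * cnj (zeta3 * x) = x * cnj x" unfolding zeta3_cnj by simp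
  thus ?thesis unfolding gterm_def mult.assoc[of zeta3 x t2] esigma_zeta by (simp only: mult_ac)
qed

lemma gterm_minus: "gterm t1 t2 (- x) = - gterm t1 t2 x"
  unfolding gterm_def by (simp add: esigma_minus)

lemma gterm_summable:
  assumes "height t1 t2 > 0"
  shows "(\<lambda>m. rho m ^ k * gterm t1 t2 (m + v)) summable_on eisenstein"
proof (rule summable_on_dominated)
  show "(\<lambda>m. cmod (theta_term 0 0 v t1 t2 m)) summable_on eisenstein"
    using theta_summable[OF assms, of 0 0 v] unfolding summable_on_iff_abs_summable_on_complex .
  fix m
  have "theta_term 0 0 v t1 t2 m = gterm t1 t2 (m + v)" unfolding theta_term_def gterm_def dsig_0 by simp
  thus "cmod (rho m ^ k * gterm t1 t2 (m + v)) \<le> cmod (theta_term 0 0 v t1 t2 m)"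
    unfolding norm_mult norm_power norm_rho by simp
qed

definition twisted :: "complex \<Rightarrow> complex \<Rightarrow> complex \<Rightarrow> nat \<Rightarrow> complex" where
  "twisted t1 t2 v k = (\<Sum>\<^sub>\<infinity>m\<in>eisenstein. rho m ^ k * gterm t1 t2 (m + v))"

text \<open>The index change m -> zeta3 * m + l rotates \<open>m + v\<close> by \<open>zeta3\<close>
  and alters the character only by \<open>rho l\<close>. Unless \<open>rho l ^ k * zeta3\<close> is
  1, the sum has to vanish.\<close>

lemma twisted_rotate:
  assumes l: "(zeta3 - 1) * v = l" "l \<in> eisenstein"
  shows "twisted t1 t2 v k = rho l ^ k * zeta3 * twisted t1 t2 v k"
proof -
  have z: "cnj zeta3 * (zeta3 * x) = x" "zeta3 * (cnj zeta3 * x) = x" for x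
    using zeta3_cnj by (simp_all add: mult.assoc[symmetric] mult.commute[of "cnj zeta3"])
  have "twisted t1 t2 v k = (\<Sum>\<^sub>\<infinity>m\<in>eisenstein. rho (zeta3 * m + l) ^ k * gterm t1 t2 ((zeta3 * m + l) + v))"
    unfolding twisted_def
    by (rule infsum_reindex_bij_witness[of _ "\<lambda>m. zeta3 * m + l" "\<lambda>m. cnj zeta3 * (m - l)"]) (use l(2) in \<open>auto simp: z\<close>)
  also have "\<dots> = (\<Sum>\<^sub>\<infinity>m\<in>eisenstein. (rho l ^ k * zeta3) * (rho m ^ k * gterm t1 t2 (m + v)))"
  proof (rule infsum_cong)
    fix m assume m: "m \<in> eisenstein"
    have "(zeta3 * m + l) + v = zeta3 * (m + v)" unfolding l(1)[symmetric] by (simp add: algebra_simps)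
    thus "rho (zeta3 * m + l) ^ k * gterm t1 t2 ((zeta3 * m + l) + v) = (rho l ^ k * zeta3) * (rho m ^ k * gterm t1 t2 (m + v))"
      by (simp only: gterm_zeta rho_add rho_zeta[OF m] power_mult_distrib mult_ac)
  qed
  finally show ?thesis unfolding infsum_cmult_right' twisted_def .
qed

lemma twisted_0: "twisted t1 t2 0 k = 0"
  using twisted_rotate[of 0 0 t1 t2 k] zeta3_ne_1 by simp

lemma zeta_tors: "(zeta3 - 1) * tors = 1 + zeta3"
  unfolding zeta3_conv tors_conv by (simp add: field_simps)

lemma rho_one_zeta: "rho (1 + zeta3) = zeta3 * zeta3"
  unfolding rho_add using rho_zeta[of 1] by (simp add: rho_1)

text \<open>For \<open>l = 1 + zeta3\<close> the eigenvalue is zeta3^(2k + 1), which equals 1 only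
  for k = 1 modulo 3.\<close>

lemma twisted_tors: "twisted t1 t2 tors 0 = 0" "twisted t1 t2 tors 2 = 0"
proof -
  have r: "twisted t1 t2 tors k = (zeta3 * zeta3) ^ k * zeta3 * twisted t1 t2 tors k" for k
    using twisted_rotate[OF zeta_tors, of t1 t2 k] unfolding rho_one_zeta by simp
  show "twisted t1 t2 tors 0 = 0" using r[of 0] zeta3_ne_1 by simp
  have "(zeta3 * zeta3) ^ 2 * zeta3 = zeta3 ^ 3 * (zeta3 * zeta3)" by (simp add: power2_eq_square power3_eq_cube)
  hence "twisted t1 t2 tors 2 = (zeta3 * zeta3) * twisted t1 t2 tors 2" using r[of 2] unfolding zeta3_cube by (simp only: mult_1)
  thus "twisted t1 t2 tors 2 = 0" using zeta3_sq_ne_1 by (metis mult_cancel_right1)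
qed

lemma twisted_minus_tors:
  "twisted t1 t2 (- tors) 0 = 0" "twisted t1 t2 (- tors) 1 = 0" "twisted t1 t2 (- tors) 2 = - twisted t1 t2 tors 1"
proof -
  have r: "twisted t1 t2 (- tors) k = - twisted t1 t2 tors (2 * k)" for k
  proof -
    have "twisted t1 t2 (- tors) k = (\<Sum>\<^sub>\<infinity>m\<in>eisenstein. rho (- m) ^ k * gterm t1 t2 (- m + - tors))"
      unfolding twisted_def by (rule infsum_reindex_bij_witness[of _ uminus uminus]) auto
    also have "\<dots> = (\<Sum>\<^sub>\<infinity>m\<in>eisenstein. - (rho m ^ (2 * k) * gterm t1 t2 (m + tors)))"
    proof (rule infsum_cong)
      fix m assume m: "m \<in> eisenstein"
      have "rho (- m) = rho (- m) * rho m ^ 3" using rho_values(1)[OF m] by simp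
      also have "\<dots> = (rho (- m) * rho m) * rho m ^ 2" by (simp add: power2_eq_square power3_eq_cube)
      finally have "rho (- m) = rho m ^ 2" unfolding rho_minus by simp
      moreover have "- m + - tors = - (m + tors)" by simp
      ultimately show "rho (- m) ^ k * gterm t1 t2 (- m + - tors) = - (rho m ^ (2 * k) * gterm t1 t2 (m + tors))"
        by (simp only: gterm_minus power_mult mult_minus_right)
    qed
    finally show ?thesis unfolding infsum_uminus twisted_def .
  qed
  have "twisted t1 t2 tors (2 * 2) = twisted t1 t2 tors 1"
    unfolding twisted_def
  proof (rule infsum_cong)
    fix m assume m: "m \<in> eisenstein"
    have "rho m ^ (2 * 2) = rho m ^ 3 * rho m ^ 1" using power_add[of "rho m" 3 1] by simp
    thus "rho m ^ (2 * 2) * gterm t1 t2 (m + tors) = rho m ^ 1 * gterm t1 t2 (m + tors)" using rho_values(1)[OF m] by simp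
  qed
  thus "twisted t1 t2 (- tors) 0 = 0" "twisted t1 t2 (- tors) 1 = 0" "twisted t1 t2 (- tors) 2 = - twisted t1 t2 tors 1"
    using r[of 0] r[of 1] r[of 2] twisted_tors by simp_all
qed

lemma theta_c_twisted: "theta3 (- tors) 0 tors t1 t2 = twisted t1 t2 tors 1"
  unfolding theta3_def twisted_def
proof (rule infsum_cong)
  fix m
  have "(m * cnj (- tors) - cnj m * (- tors)) + (tors * cnj (- tors) - cnj tors * (- tors)) / 2 = tors * (m + cnj m)"
    by (simp add: field_simps)
  thus "theta_term (- tors) 0 tors t1 t2 m = rho m ^ 1 * gterm t1 t2 (m + tors)"
    unfolding theta_term_def dsig_0 gterm_def rho_def by (simp only: distrib_left[of cc] exp_add mult.assoc power_one_right)
qed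

lemma theta_0_tors: "theta3 0 0 tors t1 t2 = 0"
  using twisted_tors(1)[of t1 t2] unfolding theta3_def twisted_def theta_term_def gterm_def dsig_0 by simp

definition residue_block :: "complex \<Rightarrow> (complex \<times> complex \<times> complex) set" where
  "residue_block j = {(a, b, c). a \<in> eisenstein \<and> b \<in> eisenstein \<and> c \<in> eisenstein \<and> tors * (a + b + c - j) \<in> eisenstein}"

text \<open>Orthogonality of characters: the average over k = 0, 1, 2 of the powers of
  \<open>zeta3 * rho (a + b + c)\<close> is the indicator of a + b + c = -1 modulo
  \<open>sqrt_m3\<close>. For each k the sum over all triples factors into a cube.\<close>

lemma block_sum:
  assumes h: "height t1 t2 > 0"
  shows "(\<Sum>\<^sub>\<infinity>(a, b, c)\<in>residue_block (- 1). gterm t1 t2 (a + v) * (gterm t1 t2 (b + v) * gterm t1 t2 (c + v))) =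
     (twisted t1 t2 v 0 ^ 3 + zeta3 * twisted t1 t2 v 1 ^ 3 + zeta3 * zeta3 * twisted t1 t2 v 2 ^ 3) / 3"
    and "(\<lambda>(a, b, c). gterm t1 t2 (a + v) * (gterm t1 t2 (b + v) * gterm t1 t2 (c + v))) summable_on residue_block j"
proof -
  define O3 where "O3 = eisenstein \<times> eisenstein \<times> eisenstein"
  define g where "g = (\<lambda>k m. rho m ^ k * gterm t1 t2 (m + v))"
  define G where "G = (\<lambda>k (a, b, c). g k a * (g k b * g k c))"
  have s: "g k summable_on eisenstein" for k unfolding g_def by (rule gterm_summable[OF h])
  have Gs: "G k summable_on O3" and Gi: "infsum (G k) O3 = twisted t1 t2 v k ^ 3" for k
    using triple_product_infsum[OF s s s, of k k k] unfolding G_def O3_def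
    by (simp_all add: twisted_def g_def power3_eq_cube)
  have G0: "G 0 = (\<lambda>(a, b, c). gterm t1 t2 (a + v) * (gterm t1 t2 (b + v) * gterm t1 t2 (c + v)))"
    unfolding G_def g_def by simp
  show "(\<lambda>(a, b, c). gterm t1 t2 (a + v) * (gterm t1 t2 (b + v) * gterm t1 t2 (c + v))) summable_on residue_block j"
    unfolding G0[symmetric] by (rule summable_on_subset_banach[OF Gs]) (auto simp: O3_def residue_block_def)
  have "infsum (G 0) (residue_block (- 1)) = (\<Sum>\<^sub>\<infinity>x\<in>O3. (G 0 x + zeta3 * G 1 x + zeta3 * zeta3 * G 2 x) / 3)"
  proof (rule infsum_cong_neutral)
    show "\<And>x. x \<in> residue_block (- 1) - O3 \<Longrightarrow> G 0 x = 0" by (auto simp: O3_def residue_block_def)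
    fix x assume x: "x \<in> O3 - residue_block (- 1)"
    obtain a b c where abc: "x = (a, b, c)" by (cases x) auto
    have in3: "a + b + c + 1 \<in> eisenstein" using x unfolding abc O3_def by auto
    define r where "r = rho (a + b + c + 1)"
    have "\<not> tors * (a + b + c + 1) \<in> eisenstein" using x unfolding abc O3_def residue_block_def by auto
    hence "r \<noteq> 1" "r ^ 3 = 1" using rho_values[OF in3] unfolding r_def by auto
    moreover have "(r - 1) * (1 + r + r * r) = r ^ 3 - 1" by (simp add: power3_eq_cube algebra_simps)
    ultimately have r0: "1 + r + r * r = 0" by simp
    have r: "r = zeta3 * (rho a * rho b * rho c)" unfolding r_def rho_add rho_1 by simp
    have "G 0 x + zeta3 * G 1 x + zeta3 * zeta3 * G 2 x = (1 + r + r * r) * G 0 x"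
      unfolding abc G_def g_def r by (simp add: power2_eq_square algebra_simps)
    thus "(G 0 x + zeta3 * G 1 x + zeta3 * zeta3 * G 2 x) / 3 = 0" unfolding r0 by simp
  next
    fix x assume x: "x \<in> residue_block (- 1) \<inter> O3"
    obtain a b c where abc: "x = (a, b, c)" by (cases x) auto
    define r where "r = rho (a + b + c + 1)"
    have "tors * (a + b + c + 1) \<in> eisenstein" using x unfolding abc residue_block_def by auto
    hence r1: "r = 1" unfolding r_def by (rule rho_eq_1)
    have r: "r = zeta3 * (rho a * rho b * rho c)" unfolding r_def rho_add rho_1 by simp
    have "G 0 x + zeta3 * G 1 x + zeta3 * zeta3 * G 2 x = (1 + r + r * r) * G 0 x"
      unfolding abc G_def g_def r by (simp add: power2_eq_square algebra_simps)
    thus "G 0 x = (G 0 x + zeta3 * G 1 x + zeta3 * zeta3 * G 2 x) / 3" unfolding r1 by simp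
  qed
  also have "\<dots> = (\<Sum>\<^sub>\<infinity>x\<in>O3. (1/3) * (G 0 x + zeta3 * G 1 x + zeta3 * zeta3 * G 2 x))" by simp
  also have "\<dots> = (1/3) * (infsum (G 0) O3 + zeta3 * infsum (G 1) O3 + zeta3 * zeta3 * infsum (G 2) O3)"
    unfolding infsum_cmult_right' 
    by (subst infsum_add, (intro summable_on_add summable_on_cmult_right Gs)+, subst infsum_add,
        (intro summable_on_add summable_on_cmult_right Gs)+) (simp only: infsum_cmult_right')
  finally show "(\<Sum>\<^sub>\<infinity>(a, b, c)\<in>residue_block (- 1). gterm t1 t2 (a + v) * (gterm t1 t2 (b + v) * gterm t1 t2 (c + v))) =
     (twisted t1 t2 v 0 ^ 3 + zeta3 * twisted t1 t2 v 1 ^ 3 + zeta3 * zeta3 * twisted t1 t2 v 2 ^ 3) / 3"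
    unfolding G0[symmetric] Gi by simp
qed

text \<open>The unitary matrix with entries zeta3^(ij) / sqrt (-3) does not preserve the integral
  triples. It does map the triples with coordinate sum congruent to \<open>j\<close> onto a
  translate of those with sum congruent to -1, the translation being by \<open>j * tors\<close> in
  each coordinate and by 1 more in the first.\<close>

lemma block_transform:
  fixes F :: "complex \<Rightarrow> complex \<Rightarrow> complex \<Rightarrow> complex"
  assumes j: "j \<in> eisenstein"
  shows "(\<Sum>\<^sub>\<infinity>(a, b, c)\<in>residue_block j. F ((a + b + c) * tors - 1) ((a + zeta3 * b + zeta3 * zeta3 * c) * tors) ((a + zeta3 * zeta3 * b + zeta3 * c) * tors)) =
    (\<Sum>\<^sub>\<infinity>(a, b, c)\<in>residue_block (- 1). F (a + j * tors) (b + j * tors) (c + j * tors))" (is "?thesis1")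
   and "(\<lambda>(a, b, c). F ((a + b + c) * tors - 1) ((a + zeta3 * b + zeta3 * zeta3 * c) * tors) ((a + zeta3 * zeta3 * b + zeta3 * c) * tors)) summable_on residue_block j
    \<longleftrightarrow> (\<lambda>(a, b, c). F (a + j * tors) (b + j * tors) (c + j * tors)) summable_on residue_block (- 1)" (is "?thesis2")
proof -
  define s where "s = tors"
  define z where "z = zeta3"
  have ss: "s * s = - (1/3)" unfolding s_def by simp
  have ss': "s * (s * x) = - x / 3" for x
  proof -
    have "s * (s * x) = (s * s) * x" by (simp only: mult.assoc)
    thus ?thesis unfolding ss by simp
  qed
  have zz: "z * z = - 1 - z" unfolding z_def by (rule zeta3_sq)
  have zz': "z * (z * x) = - x - z * x" for x
  proof -
    have "z * (z * x) = (z * z) * x" by (simp only: mult.assoc)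
    thus ?thesis unfolding zz by (simp add: algebra_simps)
  qed
  have sz: "s * z = (1 - s) / 2" unfolding s_def z_def zeta3_conv tors_conv by (simp add: field_simps)
  have sz': "s * (z * x) = (x - s * x) / 2" for x
  proof -
    have "s * (z * x) = (s * z) * x" by (simp only: mult.assoc)
    thus ?thesis unfolding sz by (simp add: algebra_simps)
  qed
  have zs: "z = (- 1 - 3 * s) / 2" unfolding s_def z_def zeta3_conv tors_conv by (simp add: field_simps)
  have zin: "z \<in> eisenstein" by (simp add: z_def)
  define f where "f = (\<lambda>(a, b, c). ((a + b + c) * s - 1 - j * s, (a + z * b + z * z * c) * s - j * s, (a + z * z * b + z * c) * s - j * s))"
  define g where "g = (\<lambda>(a, b, c). (- (a + b + c) * s + j - s, - (a + z * z * b + z * c) * s - s, - (a + z * b + z * z * c) * s - s))"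
  have fg: "g (f x) = x" "f (g x) = x" for x
    by (cases x; simp add: f_def g_def algebra_simps zz zz' ss ss' sz sz' add_divide_distrib diff_divide_distrib)+
  have fin: "f x \<in> residue_block (- 1)" if "x \<in> residue_block j" for x
  proof -
    obtain a b c where x: "x = (a, b, c)" by (cases x) auto
    have abc: "a \<in> eisenstein" "b \<in> eisenstein" "c \<in> eisenstein" "s * (a + b + c - j) \<in> eisenstein"
      using that unfolding x residue_block_def s_def by auto
    have 1: "(a + b + c) * s - 1 - j * s = s * (a + b + c - j) - 1" by (simp add: algebra_simps)
    have 2: "(a + z * b + z * z * c) * s - j * s = s * (a + b + c - j) + (1 + z) * b + z * c"
      unfolding zs by (simp add: field_simps ss ss')
    have 3: "(a + z * z * b + z * c) * s - j * s = s * (a + b + c - j) + (1 + z) * c + z * b"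
      unfolding zs by (simp add: field_simps ss ss')
    have 4: "s * (((a + b + c) * s - 1 - j * s) + ((a + z * b + z * z * c) * s - j * s) + ((a + z * z * b + z * c) * s - j * s) - - 1) = j - a"
      unfolding zs by (simp add: field_simps ss ss')
    show ?thesis unfolding f_def residue_block_def x s_def[symmetric] prod.case mem_Collect_eq 4 unfolding 1 2 3
      using abc j zin by auto
  qed
  have gin: "g x \<in> residue_block j" if "x \<in> residue_block (- 1)" for x
  proof -
    obtain a b c where x: "x = (a, b, c)" by (cases x) auto
    have abc: "a \<in> eisenstein" "b \<in> eisenstein" "c \<in> eisenstein" "s * (a + b + c - - 1) \<in> eisenstein"
      using that unfolding x residue_block_def s_def by auto
    have 1: "- (a + b + c) * s + j - s = - (s * (a + b + c - - 1)) + j" by (simp add: algebra_simps)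
    have 2: "- (a + z * z * b + z * c) * s - s = - (s * (a + b + c - - 1)) - (1 + z) * c - z * b"
      unfolding zs by (simp add: field_simps ss ss')
    have 3: "- (a + z * b + z * z * c) * s - s = - (s * (a + b + c - - 1)) - (1 + z) * b - z * c"
      unfolding zs by (simp add: field_simps ss ss')
    have 4: "s * ((- (a + b + c) * s + j - s) + (- (a + z * z * b + z * c) * s - s) + (- (a + z * b + z * z * c) * s - s) - j) = a + 1"
      unfolding zs by (simp add: field_simps ss ss')
    show ?thesis unfolding g_def residue_block_def x s_def[symmetric] prod.case mem_Collect_eq 4 unfolding 1 2 3
      using abc j zin by auto
  qed
  have cmp: "(case f x of (a, b, c) \<Rightarrow> F (a + j * s) (b + j * s) (c + j * s)) =
     (case x of (a, b, c) \<Rightarrow> F ((a + b + c) * s - 1) ((a + z * b + z * z * c) * s) ((a + z * z * b + z * c) * s))" for x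
    unfolding f_def by (cases x) simp
  show ?thesis1 unfolding s_def[symmetric] z_def[symmetric]
    by (rule infsum_reindex_bij_witness[of _ g f]) (simp_all only: fg fin gin cmp)
  show ?thesis2 unfolding s_def[symmetric] z_def[symmetric]
    by (rule summable_on_reindex_bij_witness[of _ g f]) (simp_all only: fg fin gin cmp)
qed

text \<open>A unitary change of variables preserves the sum of the three norms, hence the
  exponential factors. The \<open>- 1\<close> in the first argument is
  \<open>3 * tors * tors\<close>: it arises because \<open>tors\<close> is added to all three
  coordinates.\<close>

lemma gterm_unitary:
  "gterm t1 t2 ((a + b + c) * tors - 1) * (gterm t1 t2 ((a + zeta3 * b + zeta3 * zeta3 * c) * tors) * gterm t1 t2 ((a + zeta3 * zeta3 * b + zeta3 * c) * tors)) =
   exp (cc * (t1 * ((a + tors) * cnj (a + tors)))) * exp (cc * (t1 * ((b + tors) * cnj (b + tors)))) * exp (cc * (t1 * ((c + tors) * cnj (c + tors)))) *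
   (esigma (((a + tors) * t2 + (b + tors) * t2 + (c + tors) * t2) / sqrt_m3) *
     esigma (((a + tors) * t2 + zeta3 * ((b + tors) * t2) + zeta3 * zeta3 * ((c + tors) * t2)) / sqrt_m3) *
     esigma (((a + tors) * t2 + zeta3 * zeta3 * ((b + tors) * t2) + zeta3 * ((c + tors) * t2)) / sqrt_m3))"
proof -
  define s where "s = tors"
  have ss: "s * s = - (1/3)" unfolding s_def by simp
  define x y z where xyz: "x = a + s" "y = b + s" "z = c + s"
  have 1: "(a + b + c) * s - 1 = (x + y + z) * s" 
  proof -
    have "s * (s * 3) = - 1" unfolding s_def by simp
    thus ?thesis unfolding xyz by (simp add: algebra_simps)
  qed
  have z0: "(1 + zeta3 + zeta3 * zeta3) * s = 0" "(1 + zeta3 * zeta3 + zeta3) * s = 0" unfolding zeta3_sq by simp_all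
  have 2: "(a + zeta3 * b + zeta3 * zeta3 * c) * s = (x + zeta3 * y + zeta3 * zeta3 * z) * s"
    using z0(1) unfolding xyz by (simp add: algebra_simps zeta3_sq)
  have 3: "(a + zeta3 * zeta3 * b + zeta3 * c) * s = (x + zeta3 * zeta3 * y + zeta3 * z) * s"
    using z0(2) unfolding xyz by (simp add: algebra_simps zeta3_sq)
  have d: "u / sqrt_m3 = u * s" for u unfolding s_def by simp
  have cs: "cnj s = - s" unfolding s_def by simp
  have zc: "cnj zeta3 = zeta3 * zeta3" unfolding cnj_zeta3 zeta3_sq ..
  have uni: "(p + q + r) * (p' + q' + r') + (p + w * q + w * w * r) * (p' + w * w * q' + (w * w) * (w * w) * r') +
     (p + w * w * q + w * r) * (p' + (w * w) * (w * w) * q' + w * w * r') = 3 * (p * p' + q * q' + r * r')"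
    if w: "w * w = - 1 - w" for p q r p' q' r' w :: complex using w by algebra
  have sx: "(u * s) * cnj (u * s) = (1/3) * (u * cnj u)" for u
  proof -
    have "(u * s) * cnj (u * s) = - (s * s) * (u * cnj u)" by (simp add: cs)
    thus ?thesis unfolding ss by simp
  qed
  have N: "((x + y + z) * s) * cnj ((x + y + z) * s) + ((x + zeta3 * y + zeta3 * zeta3 * z) * s) * cnj ((x + zeta3 * y + zeta3 * zeta3 * z) * s) +
     ((x + zeta3 * zeta3 * y + zeta3 * z) * s) * cnj ((x + zeta3 * zeta3 * y + zeta3 * z) * s) = x * cnj x + y * cnj y + z * cnj z"
    unfolding sx distrib_left[of "1/3", symmetric] unfolding complex_cnj_add complex_cnj_mult zc uni[OF zeta3_sq] by simp
  have E: "exp (cc * (t1 * A)) * exp (cc * (t1 * B)) * exp (cc * (t1 * D)) = exp (cc * (t1 * (A + B + D)))" for A B D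
    by (simp only: exp_add[symmetric] distrib_left)
  have "gterm t1 t2 A * (gterm t1 t2 B * gterm t1 t2 D) =
     (exp (cc * (t1 * (A * cnj A))) * exp (cc * (t1 * (B * cnj B))) * exp (cc * (t1 * (D * cnj D)))) *
     (esigma (A * t2) * esigma (B * t2) * esigma (D * t2))" for A B D
    unfolding gterm_def by (simp only: mult_ac)
  note g = this[of "(x + y + z) * s" "(x + zeta3 * y + zeta3 * zeta3 * z) * s" "(x + zeta3 * zeta3 * y + zeta3 * z) * s", unfolded E N]
  have e: "(x + y + z) * s * t2 = (x * t2 + y * t2 + z * t2) * s"
    "(x + zeta3 * y + zeta3 * zeta3 * z) * s * t2 = (x * t2 + zeta3 * (y * t2) + zeta3 * zeta3 * (z * t2)) * s"
    "(x + zeta3 * zeta3 * y + zeta3 * z) * s * t2 = (x * t2 + zeta3 * zeta3 * (y * t2) + zeta3 * (z * t2)) * s"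
    by (simp_all add: algebra_simps)
  show ?thesis
    unfolding s_def[symmetric] unfolding d 1 2 3 g xyz[symmetric] E e ..
qed

lemma residue_blocks:
  "eisenstein \<times> eisenstein \<times> eisenstein = residue_block 0 \<union> (residue_block 1 \<union> residue_block (- 1))"
  "residue_block 0 \<inter> (residue_block 1 \<union> residue_block (- 1)) = {}" "residue_block 1 \<inter> residue_block (- 1) = {}"
proof -
  show "eisenstein \<times> eisenstein \<times> eisenstein = residue_block 0 \<union> (residue_block 1 \<union> residue_block (- 1))"
    using eis_residue[OF eisenstein_closed(8)[OF eisenstein_closed(8)]] unfolding residue_block_def by fastforce
  have r: "rho (fst x + fst (snd x) + snd (snd x)) = rho j" if "x \<in> residue_block j" for x j
    using that unfolding residue_block_def by (auto intro!: rho_residue)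
  have "zeta3 \<noteq> zeta3 * zeta3" using zeta3_ne_1 zeta3_cube by auto
  thus "residue_block 0 \<inter> (residue_block 1 \<union> residue_block (- 1)) = {}" "residue_block 1 \<inter> residue_block (- 1) = {}"
    using r[of _ 0] r[of _ 1] r[of _ "-1"] zeta3_ne_1 zeta3_sq_ne_1 unfolding rho_0 rho_1 rho_minus_1 by fastforce+
qed

text \<open>With the cubes multiplied out over triples, \<open>sigma_product_identity\<close>
  applies to each term. The summand with \<open>v2 = 0\<close> drops out by
  \<open>theta_0_tors\<close>; on the product side only the blocks \<open>j = 1\<close> and
  \<open>j = -1\<close> contribute, each a multiple of the third cube.\<close>

lemma cubic_relation_const:
  "\<exists>C. \<forall>t1 t2. height t1 t2 > 0 \<longrightarrow> theta3 0 tors tors t1 t2 ^ 3 + theta3 0 (- tors) tors t1 t2 ^ 3 = C * theta3 (- tors) 0 tors t1 t2 ^ 3"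
proof -
  obtain C where C: "\<And>w1 w2 w3. qsum w1 w2 w3 = C * (esigma ((w1 + w2 + w3) / sqrt_m3) *
     esigma ((w1 + zeta3 * w2 + zeta3 * zeta3 * w3) / sqrt_m3) * esigma ((w1 + zeta3 * zeta3 * w2 + zeta3 * w3) / sqrt_m3))"
    using sigma_product_identity by blast
  define O3 where "O3 = eisenstein \<times> eisenstein \<times> eisenstein"
  have "theta3 0 tors tors t1 t2 ^ 3 + theta3 0 (- tors) tors t1 t2 ^ 3 = C * (zeta3 - zeta3 * zeta3) / 3 * theta3 (- tors) 0 tors t1 t2 ^ 3"
    if h: "height t1 t2 > 0" for t1 t2
  proof -
    define T where "T = (\<lambda>v (a, b, c). theta_term 0 v tors t1 t2 a * (theta_term 0 v tors t1 t2 b * theta_term 0 v tors t1 t2 c))"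
    have Ts: "T v summable_on O3" and Ti: "infsum (T v) O3 = theta3 0 v tors t1 t2 ^ 3" for v
      using triple_product_infsum[OF theta_summable[OF h] theta_summable[OF h] theta_summable[OF h], of 0 v tors 0 v tors 0 v tors]
      unfolding T_def O3_def theta3_def by (simp_all add: power3_eq_cube)
    define F where "F = (\<lambda>x y z. gterm t1 t2 x * (gterm t1 t2 y * gterm t1 t2 z))"
    define H where "H = (\<lambda>(a, b, c). F ((a + b + c) * tors - 1) ((a + zeta3 * b + zeta3 * zeta3 * c) * tors) ((a + zeta3 * zeta3 * b + zeta3 * c) * tors))"
    have TH: "T tors x + (T (- tors) x - T 0 x) = C * H x" for x
    proof -
      obtain a b c where x: "x = (a, b, c)" by (cases x) auto
      define e where "e = (\<lambda>a. exp (cc * (t1 * ((a + tors) * cnj (a + tors)))))"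
      have t: "theta_term 0 v tors t1 t2 a = e a * dsig v ((a + tors) * t2)" for v a unfolding theta_term_def e_def by simp
      have "T tors x + (T (- tors) x - T 0 x) = e a * e b * e c * qsum ((a + tors) * t2) ((b + tors) * t2) ((c + tors) * t2)"
        unfolding T_def x prod.case t qsum_def tri_def by (simp add: algebra_simps)
      thus ?thesis unfolding C H_def F_def x prod.case gterm_unitary e_def by (simp only: mult_ac)
    qed
    have Hs: "H summable_on residue_block j" and
      Hi: "infsum H (residue_block j) = (twisted t1 t2 (j * tors) 0 ^ 3 + zeta3 * twisted t1 t2 (j * tors) 1 ^ 3 + zeta3 * zeta3 * twisted t1 t2 (j * tors) 2 ^ 3) / 3"
      if j: "j \<in> eisenstein" for j
    proof -
      show "H summable_on residue_block j"
        using block_sum(2)[OF h, of "j * tors" "-1"] block_transform(2)[OF j, of F] unfolding H_def F_def by blast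
      show "infsum H (residue_block j) = (twisted t1 t2 (j * tors) 0 ^ 3 + zeta3 * twisted t1 t2 (j * tors) 1 ^ 3 + zeta3 * zeta3 * twisted t1 t2 (j * tors) 2 ^ 3) / 3"
        using block_sum(1)[OF h, of "j * tors"] block_transform(1)[OF j, of F] unfolding H_def F_def by (simp only:)
    qed
    have jj: "0 * tors = 0" "1 * tors = tors" "- 1 * tors = - tors" by simp_all
    have "infsum H O3 = infsum H (residue_block 0) + (infsum H (residue_block 1) + infsum H (residue_block (- 1)))"
      unfolding O3_def residue_blocks(1)
      by (subst infsum_Un_disjoint, (intro summable_on_Un_disjoint Hs residue_blocks; simp)+,
          subst infsum_Un_disjoint, (intro Hs residue_blocks; simp)+) (rule refl)
    also have "\<dots> = (zeta3 - zeta3 * zeta3) / 3 * twisted t1 t2 tors 1 ^ 3"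
      unfolding Hi[OF eisenstein_closed(1)] Hi[OF eisenstein_closed(2)] Hi[OF eisenstein_closed(11)[OF eisenstein_closed(2)]] jj
        twisted_0 twisted_tors twisted_minus_tors
      by (simp add: field_simps power3_eq_cube)
    finally have HO: "infsum H O3 = (zeta3 - zeta3 * zeta3) / 3 * theta3 (- tors) 0 tors t1 t2 ^ 3" unfolding theta_c_twisted .
    have "theta3 0 tors tors t1 t2 ^ 3 + (theta3 0 (- tors) tors t1 t2 ^ 3 - theta3 0 0 tors t1 t2 ^ 3) =
       (\<Sum>\<^sub>\<infinity>x\<in>O3. T tors x + (T (- tors) x + (- 1) * T 0 x))"
      unfolding Ti[symmetric]
      by (subst infsum_add, rule Ts, (intro summable_on_add summable_on_cmult_right Ts), subst infsum_add, rule Ts,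
        (intro summable_on_cmult_right Ts)) (simp add: infsum_uminus)
    also have "\<dots> = (\<Sum>\<^sub>\<infinity>x\<in>O3. T tors x + (T (- tors) x - T 0 x))" by simp
    also have "\<dots> = C * infsum H O3" unfolding TH by (rule infsum_cmult_right')
    finally show ?thesis unfolding theta_0_tors HO by simp
  qed
  thus ?thesis by blast
qed

section \<open>Determination of the constant in the cubic relation\<close>

lemma exp_cc_cubed:
  "3 * E = sqrt_m3 * of_int k \<Longrightarrow> (exp (cc * E) * x) ^ 3 = x ^ 3"
  "3 * E = sqrt_m3 / 2 + sqrt_m3 * of_int k \<Longrightarrow> (exp (cc * E) * x) ^ 3 = - (x ^ 3)"
proof -
  have e: "(exp (cc * E) * x) ^ 3 = exp (cc * (3 * E)) * x ^ 3"
    unfolding power_mult_distrib exp_of_nat_mult[symmetric] by (simp add: mult_ac)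
  show "3 * E = sqrt_m3 * of_int k \<Longrightarrow> (exp (cc * E) * x) ^ 3 = x ^ 3"
    using e exp_cc_zero[of k] by simp
  show "3 * E = sqrt_m3 / 2 + sqrt_m3 * of_int k \<Longrightarrow> (exp (cc * E) * x) ^ 3 = - (x ^ 3)"
    using e exp_cc_half_odd[of k] by simp
qed

lemma theta3_lattice_cubed:
  assumes l: "l1 \<in> eisenstein" "l2 \<in> eisenstein" "l3 \<in> eisenstein"
  shows "3 * ((sqrt_m3 / 2) * (l1 * cnj l3 + l2 * cnj l2 + l3 * cnj l1) +
      ((v1 * cnj l3 + v2 * cnj l2 + v3 * cnj l1) - (l1 * cnj v3 + l2 * cnj v2 + l3 * cnj v1)) / 2) = sqrt_m3 * of_int k \<Longrightarrow>
      theta3 (v1 + l1) (v2 + l2) (v3 + l3) t1 t2 ^ 3 = theta3 v1 v2 v3 t1 t2 ^ 3"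
    and "3 * ((sqrt_m3 / 2) * (l1 * cnj l3 + l2 * cnj l2 + l3 * cnj l1) +
      ((v1 * cnj l3 + v2 * cnj l2 + v3 * cnj l1) - (l1 * cnj v3 + l2 * cnj v2 + l3 * cnj v1)) / 2) = sqrt_m3 / 2 + sqrt_m3 * of_int k \<Longrightarrow>
      theta3 (v1 + l1) (v2 + l2) (v3 + l3) t1 t2 ^ 3 = - (theta3 v1 v2 v3 t1 t2 ^ 3)"
  unfolding theta3_lattice[OF l] by (rule exp_cc_cubed(1), assumption) (rule exp_cc_cubed(2), assumption)

text \<open>For real \<open>t1\<close> and \<open>t2 = 0\<close> every term is a positive multiple
  of the nonzero number \<open>dsig tors 0\<close>, so nothing can cancel.\<close>

lemma theta_at_zero:
  assumes "height t1 0 > 0" "Im t1 = 0"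
  shows "theta3 0 tors tors t1 0 \<noteq> 0"
proof -
  define f where "f = (\<lambda>m. exp (cr * (Re t1 * (cmod (m + tors))\<^sup>2)))"
  have t: "theta_term 0 tors tors t1 0 m = dsig tors 0 * complex_of_real (f m)" for m
  proof -
    have "t1 = of_real (Re t1)" using assms(2) by (simp add: complex_eq_iff)
    hence "cc * (t1 * ((m + tors) * cnj (m + tors))) = of_real (cr * (Re t1 * (cmod (m + tors))\<^sup>2))"
      unfolding complex_norm_square[symmetric] cr_def cc_def by (metis of_real_mult)
    moreover have "(m * cnj 0 - cnj m * 0) + (tors * cnj 0 - cnj tors * 0) / 2 + X = X" for X by simp
    moreover have "(m + tors) * 0 = 0" by simp
    ultimately show ?thesis unfolding theta_term_def f_def by (simp only: exp_of_real mult.commute)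
  qed
  have nt: "cmod (theta_term 0 tors tors t1 0 m) = cmod (dsig tors 0) * f m" for m
    unfolding t norm_mult norm_of_real by (simp add: f_def)
  have nz: "dsig tors 0 \<noteq> 0"
    unfolding dsig_def using esigma_torsion_nz esigma_minus[of tors] by simp
  have "(\<lambda>m. cmod (theta_term 0 tors tors t1 0 m)) summable_on eisenstein"
    using theta_summable[OF assms(1), of 0 tors tors] unfolding summable_on_iff_abs_summable_on_complex .
  from summable_on_cmult_right[OF this[unfolded nt], of "inverse (cmod (dsig tors 0))"]
  have fs: "f summable_on eisenstein" using nz by (simp add: mult.assoc[symmetric])
  have "(\<Sum>\<^sub>\<infinity>m\<in>eisenstein. f m) \<noteq> 0"
  proof
    assume "(\<Sum>\<^sub>\<infinity>m\<in>eisenstein. f m) = 0"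
    hence "f 0 = 0" by (intro nonneg_infsum_le_0D[OF _ fs]) (auto simp: f_def)
    thus False by (simp add: f_def)
  qed
  thus ?thesis unfolding theta3_def t infsum_cmult_right' infsum_complex_of_real[OF fs] using nz by simp
qed

text \<open>A Heisenberg translation permutes the three cubes cyclically up to sign, so the relation
  with constant \<open>C\<close> holds in further versions. At (-1, 0) the first two cubes are
  opposite and nonzero, and two of the versions together give
  \<open>A - B = C * (A - B)\<close>.\<close>

theorem cubic_relation:
  assumes h: "height t1 t2 > 0"
  shows "theta3 0 tors tors t1 t2 ^ 3 + theta3 0 (- tors) tors t1 t2 ^ 3 = theta3 (- tors) 0 tors t1 t2 ^ 3"
proof -
  obtain C where C: "\<And>t1 t2. height t1 t2 > 0 \<Longrightarrow> theta3 0 tors tors t1 t2 ^ 3 + theta3 0 (- tors) tors t1 t2 ^ 3 = C * theta3 (- tors) 0 tors t1 t2 ^ 3"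
    using cubic_relation_const by blast
  have rel: "zeta3 + cnj zeta3 + 1 * cnj 1 = 0" unfolding cnj_zeta3 by simp
  note up = theta3_upper[OF eisenstein_closed(2) eisenstein_closed(3) rel]
  have shift: "theta3 0 (- tors) tors (t1 - t2 + zeta3) (t2 + 1) ^ 3 = theta3 0 tors tors t1 t2 ^ 3"
    "theta3 (- tors) 0 tors (t1 - t2 + zeta3) (t2 + 1) ^ 3 = - (theta3 0 (- tors) tors t1 t2 ^ 3)"
    "theta3 0 tors tors (t1 - t2 + zeta3) (t2 + 1) ^ 3 = - (theta3 (- tors) 0 tors t1 t2 ^ 3)" for t1 t2
  proof -
    define n1 n2 where n: "n1 = t1 - t2 + zeta3" "n2 = t2 + 1"
    have "theta3 0 tors tors t1 t2 = theta3 (0 + (1 + zeta3)) (- tors + - sqrt_m3) (tors + 0) n1 n2"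
    proof -
      have e: "0 - cnj 1 * tors + zeta3 * tors = 0 + (1 + zeta3)" "tors + 1 * tors = - tors + - sqrt_m3"
        unfolding zeta3_conv tors_conv by (simp_all add: field_simps)
      from up[of 0 tors tors t1 t2, unfolded e] show ?thesis unfolding n by simp
    qed
    also have "\<dots> ^ 3 = theta3 0 (- tors) tors n1 n2 ^ 3"
      by (rule theta3_lattice_cubed(1)[where k = "4"], simp, simp, simp, simp add: zeta3_conv cnj_zeta3_conv field_simps)
    finally show "theta3 0 (- tors) tors (t1 - t2 + zeta3) (t2 + 1) ^ 3 = theta3 0 tors tors t1 t2 ^ 3" unfolding n by simp
    have "theta3 0 (- tors) tors t1 t2 = theta3 (- tors + - zeta3) (0 + 0) (tors + 0) n1 n2"
    proof -
      have "0 - cnj 1 * (- tors) + zeta3 * tors = - tors + - zeta3" unfolding zeta3_conv tors_conv by (simp add: field_simps)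
      from up[of 0 "- tors" tors t1 t2, unfolded this] show ?thesis unfolding n by simp
    qed
    also have "\<dots> ^ 3 = - (theta3 (- tors) 0 tors n1 n2 ^ 3)"
      by (rule theta3_lattice_cubed(2)[where k = "-1"], simp, simp, simp, simp add: zeta3_conv cnj_zeta3_conv field_simps)
    finally show "theta3 (- tors) 0 tors (t1 - t2 + zeta3) (t2 + 1) ^ 3 = - (theta3 0 (- tors) tors t1 t2 ^ 3)" unfolding n by simp
    have "theta3 (- tors) 0 tors t1 t2 = theta3 (0 + (1 + zeta3)) (tors + 0) (tors + 0) n1 n2"
    proof -
      have "- tors - cnj 1 * 0 + zeta3 * tors = 0 + (1 + zeta3)" unfolding zeta3_conv tors_conv by (simp add: field_simps)
      from up[of "- tors" 0 tors t1 t2, unfolded this] show ?thesis unfolding n by simp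
    qed
    also have "\<dots> ^ 3 = - (theta3 0 tors tors n1 n2 ^ 3)"
      by (rule theta3_lattice_cubed(2)[where k = "-1"], simp, simp, simp, simp add: zeta3_conv cnj_zeta3_conv field_simps)
    finally show "theta3 0 tors tors (t1 - t2 + zeta3) (t2 + 1) ^ 3 = - (theta3 (- tors) 0 tors t1 t2 ^ 3)" unfolding n by simp
  qed
  have hn: "height (t1 - t2 + zeta3) (t2 + 1) = height t1 t2" for t1 t2
    unfolding height_def cmod_power2 zeta3_eq by (simp add: power2_eq_square algebra_simps)
  have 2: "theta3 0 tors tors t1 t2 ^ 3 - theta3 (- tors) 0 tors t1 t2 ^ 3 = - C * theta3 0 (- tors) tors t1 t2 ^ 3"
    if "height t1 t2 > 0" for t1 t2
    using C[of "t1 - t2 + zeta3" "t2 + 1"] that unfolding hn shift by simp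
  have 3: "- (theta3 (- tors) 0 tors t1 t2 ^ 3) + theta3 0 (- tors) tors t1 t2 ^ 3 = - C * theta3 0 tors tors t1 t2 ^ 3"
    if "height t1 t2 > 0" for t1 t2
    using 2[of "t1 - t2 + zeta3" "t2 + 1"] that unfolding hn shift by simp
  define A B where AB: "A = theta3 0 tors tors (- 1) 0 ^ 3" "B = theta3 0 (- tors) tors (- 1) 0 ^ 3"
  have h1: "height (- 1) 0 > 0" by (simp add: height_def)
  have "theta3 0 (- tors) tors (- 1) 0 = - theta3 0 tors tors (- 1) 0"
    using dsig_minus[of tors 0] unfolding theta3_def infsum_uminus[symmetric] theta_term_def by (intro infsum_cong) simp
  hence "B = - A" unfolding AB by simp
  moreover have "A \<noteq> 0" unfolding AB using theta_at_zero[OF h1] by simp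
  moreover have "A - B = C * (A - B)"
    using 2[OF h1] 3[OF h1] unfolding AB[symmetric] by (simp add: algebra_simps)
  ultimately have "C = 1" by simp
  thus ?thesis using C[OF h] by simp
qed

section \<open>The unitary group of the lattice\<close>

text \<open>The determinant is left free, so that \<open>herm_J\<close>, of determinant -1, and
  diagonal matrices of units belong to the group.\<close>

definition lat_unitary :: "(complex^3^3) set" where
  "lat_unitary = {g. (\<forall>i j. g $ i $ j \<in> eisenstein) \<and> transpose (conj_mat g) ** herm_J ** g = herm_J}"

definition theta_vec :: "complex^3 \<Rightarrow> complex^2 \<Rightarrow> complex" where
  "theta_vec v \<tau> = theta3 (v $ 1) (v $ 2) (v $ 3) (\<tau> $ 1) (\<tau> $ 2)"

lemma herm_J_entries:
  "herm_J $ 1 $ 1 = 0" "herm_J $ 1 $ 2 = 0" "herm_J $ 1 $ 3 = 1"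
  "herm_J $ 2 $ 1 = 0" "herm_J $ 2 $ 2 = 1" "herm_J $ 2 $ 3 = 0"
  "herm_J $ 3 $ 1 = 1" "herm_J $ 3 $ 2 = 0" "herm_J $ 3 $ 3 = 0"
  by (simp_all add: herm_J_def)

lemma unitary_iff:
  "transpose (conj_mat g) ** herm_J ** g = herm_J \<longleftrightarrow>
    (\<forall>i j. cnj (g $ 1 $ i) * g $ 3 $ j + cnj (g $ 2 $ i) * g $ 2 $ j + cnj (g $ 3 $ i) * g $ 1 $ j = herm_J $ i $ j)"
proof -
  have "(transpose (conj_mat g) ** herm_J ** g) $ i $ j =
     cnj (g $ 1 $ i) * g $ 3 $ j + cnj (g $ 2 $ i) * g $ 2 $ j + cnj (g $ 3 $ i) * g $ 1 $ j" for i j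
    unfolding matrix_matrix_mult_def transpose_def conj_mat_def sum_3 by (simp add: sum_3 herm_J_entries)
  thus ?thesis unfolding vec_eq_iff by simp
qed

lemma mat3_mult: "(g ** h) $ i $ j = g $ i $ 1 * h $ 1 $ j + g $ i $ 2 * h $ 2 $ j + (g :: complex^3^3) $ i $ 3 * (h :: complex^3^3) $ 3 $ j"
  by (simp add: matrix_matrix_mult_def sum_3)

lemma mat3_vec: "(g *v v) $ i = g $ i $ 1 * v $ 1 + g $ i $ 2 * v $ 2 + (g :: complex^3^3) $ i $ 3 * v $ 3"
  by (simp add: matrix_vector_mult_def sum_3)

lemma lat_unitary_mult:
  assumes "g \<in> lat_unitary" "h \<in> lat_unitary" shows "g ** h \<in> lat_unitary"
proof -
  have c: "transpose (conj_mat (g ** h)) = transpose (conj_mat h) ** transpose (conj_mat g)"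
    by (simp add: vec_eq_iff transpose_def conj_mat_def matrix_matrix_mult_def sum_3 mult.commute)
  have "transpose (conj_mat (g ** h)) ** herm_J ** (g ** h) =
      transpose (conj_mat h) ** (transpose (conj_mat g) ** herm_J ** g) ** h"
    unfolding c by (simp only: matrix_mul_assoc)
  thus ?thesis using assms unfolding lat_unitary_def by (simp add: mat3_mult)
qed

lemma act_components:
  "act g \<tau> $ 1 = (g $ 1 $ 1 * \<tau> $ 1 + g $ 1 $ 2 * \<tau> $ 2 + g $ 1 $ 3) / jfac g \<tau>"
  "act g \<tau> $ 2 = (g $ 2 $ 1 * \<tau> $ 1 + g $ 2 $ 2 * \<tau> $ 2 + g $ 2 $ 3) / jfac g \<tau>"
  by (simp_all add: act_def divide_inverse mult.commute)

lemma jfac_mult: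
  assumes "jfac h \<tau> \<noteq> 0" shows "jfac (g ** h) \<tau> = jfac g (act h \<tau>) * jfac h \<tau>"
proof -
  have "act h \<tau> $ 1 * jfac h \<tau> = h $ 1 $ 1 * \<tau> $ 1 + h $ 1 $ 2 * \<tau> $ 2 + h $ 1 $ 3"
    "act h \<tau> $ 2 * jfac h \<tau> = h $ 2 $ 1 * \<tau> $ 1 + h $ 2 $ 2 * \<tau> $ 2 + h $ 2 $ 3"
    using assms by (simp_all add: act_components)
  note 1 = this
  have "jfac g (act h \<tau>) * jfac h \<tau> = g $ 3 $ 1 * (act h \<tau> $ 1 * jfac h \<tau>) + g $ 3 $ 2 * (act h \<tau> $ 2 * jfac h \<tau>) + g $ 3 $ 3 * jfac h \<tau>"
    unfolding jfac_def[of g] by (simp only: distrib_right mult.assoc)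
  also have "\<dots> = jfac (g ** h) \<tau>"
    unfolding 1 unfolding jfac_def mat3_mult by (simp add: algebra_simps)
  finally show ?thesis ..
qed

lemma act_mult:
  assumes h: "jfac h \<tau> \<noteq> 0" and g: "jfac g (act h \<tau>) \<noteq> 0" shows "act (g ** h) \<tau> = act g (act h \<tau>)"
proof -
  have 1: "act h \<tau> $ 1 * jfac h \<tau> = h $ 1 $ 1 * \<tau> $ 1 + h $ 1 $ 2 * \<tau> $ 2 + h $ 1 $ 3"
    "act h \<tau> $ 2 * jfac h \<tau> = h $ 2 $ 1 * \<tau> $ 1 + h $ 2 $ 2 * \<tau> $ 2 + h $ 2 $ 3"
    using h by (simp_all add: act_components)
  have 2: "(g ** h) $ i $ 1 * \<tau> $ 1 + (g ** h) $ i $ 2 * \<tau> $ 2 + (g ** h) $ i $ 3 =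
      (g $ i $ 1 * act h \<tau> $ 1 + g $ i $ 2 * act h \<tau> $ 2 + g $ i $ 3) * jfac h \<tau>" for i
  proof -
    have "(g $ i $ 1 * act h \<tau> $ 1 + g $ i $ 2 * act h \<tau> $ 2 + g $ i $ 3) * jfac h \<tau> =
       g $ i $ 1 * (act h \<tau> $ 1 * jfac h \<tau>) + g $ i $ 2 * (act h \<tau> $ 2 * jfac h \<tau>) + g $ i $ 3 * jfac h \<tau>"
      by (simp only: distrib_right mult.assoc)
    also have "\<dots> = (g ** h) $ i $ 1 * \<tau> $ 1 + (g ** h) $ i $ 2 * \<tau> $ 2 + (g ** h) $ i $ 3"
      unfolding 1 unfolding mat3_mult jfac_def by (simp add: algebra_simps)
    finally show ?thesis ..
  qed
  show ?thesis unfolding vec_eq_iff forall_2 act_components[of "g ** h"] act_components[of g] 2 jfac_mult[OF h] using h g by simp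
qed

text \<open>\<open>g\<close> maps the column (\<tau>, 1) to \<open>jfac g \<tau>\<close> times the
  column (act g \<tau>, 1) and preserves the hermitian form, whose value on such a column is minus
  the height.\<close>

lemma unitary_height:
  assumes g: "transpose (conj_mat g) ** herm_J ** g = herm_J" and \<tau>: "\<tau> \<in> siegel_domain"
  shows "jfac g \<tau> \<noteq> 0" "height (act g \<tau> $ 1) (act g \<tau> $ 2) = height (\<tau> $ 1) (\<tau> $ 2) / (cmod (jfac g \<tau>))\<^sup>2" "act g \<tau> \<in> siegel_domain"
proof -
  note e = g[unfolded unitary_iff, rule_format]
  define x where "x = g $ 1 $ 1 * \<tau> $ 1 + g $ 1 $ 2 * \<tau> $ 2 + g $ 1 $ 3"
  define y where "y = g $ 2 $ 1 * \<tau> $ 1 + g $ 2 $ 2 * \<tau> $ 2 + g $ 2 $ 3"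
  define z where "z = jfac g \<tau>"
  have z: "z = g $ 3 $ 1 * \<tau> $ 1 + g $ 3 $ 2 * \<tau> $ 2 + g $ 3 $ 3" unfolding z_def jfac_def ..
  define p q where pq: "p = \<tau> $ 1" "q = \<tau> $ 2"
  define f where "f = (\<lambda>i j. cnj (g $ 1 $ i) * g $ 3 $ j + cnj (g $ 2 $ i) * g $ 2 $ j + cnj (g $ 3 $ i) * g $ 1 $ j)"
  have "cnj x * z + cnj y * y + cnj z * x = cnj p * (p * f 1 1 + q * f 1 2 + f 1 3) + cnj q * (p * f 2 1 + q * f 2 2 + f 2 3) + (p * f 3 1 + q * f 3 2 + f 3 3)"
    unfolding x_def y_def z f_def pq by (simp add: algebra_simps)
  also have "\<dots> = cnj p + p + q * cnj q" unfolding f_def e herm_J_entries by simp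
  finally have "cnj x * z + cnj z * x + y * cnj y = cnj p + p + q * cnj q" by (simp add: mult.commute add_ac)
  hence "Re (cnj x * z + cnj z * x + of_real ((cmod y)\<^sup>2)) = Re (cnj p + p + of_real ((cmod q)\<^sup>2))"
    unfolding complex_norm_square by (simp only:)
  hence F: "2 * Re (cnj z * x) + (cmod y)\<^sup>2 = - height p q" unfolding height_def by (simp add: algebra_simps)
  have hp: "height p q > 0" using \<tau> unfolding siegel_height pq .
  show z0: "jfac g \<tau> \<noteq> 0"
  proof
    assume "jfac g \<tau> = 0"
    hence "(cmod y)\<^sup>2 = - height p q" using F unfolding z_def by simp
    thus False using hp zero_le_power2[of "cmod y"] by linarith
  qed
  have a: "act g \<tau> $ 1 = x / z" "act g \<tau> $ 2 = y / z" unfolding act_components x_def y_def z_def by simp_all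
  have "x / z = (cnj z * x) / of_real ((cmod z)\<^sup>2)" using z0 unfolding complex_norm_square z_def by simp
  hence Rx: "Re (x / z) = Re (cnj z * x) / (cmod z)\<^sup>2" by (simp only: Re_divide_of_real)
  have gen: "- (2 * (R / N) + Y / N) = - (2 * R + Y) / N" for R Y N :: real
    by (cases "N = 0") (auto simp: field_simps)
  have "height (x / z) (y / z) = - (2 * Re (cnj z * x) + (cmod y)\<^sup>2) / (cmod z)\<^sup>2"
    unfolding height_def norm_divide power_divide by (simp only: Rx gen)
  thus h: "height (act g \<tau> $ 1) (act g \<tau> $ 2) = height (\<tau> $ 1) (\<tau> $ 2) / (cmod (jfac g \<tau>))\<^sup>2"
    unfolding F unfolding a z_def pq by (simp only: minus_minus)
  show "act g \<tau> \<in> siegel_domain" unfolding siegel_height h using hp z0 by (simp add: pq)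
qed

text \<open>One constant \<open>k\<close> serves all characteristics \<open>v\<close>. This
  uniformity later allows the characters belonging to different \<open>v\<close> to be compared on
  the same group element.\<close>

definition theta_covariant :: "complex^3^3 \<Rightarrow> bool" where
  "theta_covariant g \<longleftrightarrow> (\<exists>k. k \<noteq> 0 \<and> (\<forall>v. \<forall>\<tau>\<in>siegel_domain. theta_vec (g *v v) (act g \<tau>) = k * jfac g \<tau> * theta_vec v \<tau>))"

lemma theta_covariant_mult:
  assumes g: "theta_covariant g" and h: "theta_covariant h" and U: "g \<in> lat_unitary" "h \<in> lat_unitary"
  shows "theta_covariant (g ** h)"
proof -
  obtain k where k: "k \<noteq> 0" "\<And>v \<tau>. \<tau> \<in> siegel_domain \<Longrightarrow> theta_vec (g *v v) (act g \<tau>) = k * jfac g \<tau> * theta_vec v \<tau>"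
    using g unfolding theta_covariant_def by blast
  obtain l where l: "l \<noteq> 0" "\<And>v \<tau>. \<tau> \<in> siegel_domain \<Longrightarrow> theta_vec (h *v v) (act h \<tau>) = l * jfac h \<tau> * theta_vec v \<tau>"
    using h unfolding theta_covariant_def by blast
  have ug: "transpose (conj_mat g) ** herm_J ** g = herm_J" and uh: "transpose (conj_mat h) ** herm_J ** h = herm_J"
    using U unfolding lat_unitary_def by auto
  have "theta_vec ((g ** h) *v v) (act (g ** h) \<tau>) = (k * l) * jfac (g ** h) \<tau> * theta_vec v \<tau>" if t: "\<tau> \<in> siegel_domain" for v \<tau>
  proof -
    note t' = unitary_height[OF uh t]
    note t'' = unitary_height[OF ug t'(3)]
    show ?thesis unfolding act_mult[OF t'(1) t''(1)] matrix_vector_mul_assoc[symmetric] k(2)[OF t'(3)] l(2)[OF t] jfac_mult[OF t'(1)]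
      by (simp only: mult_ac)
  qed
  thus ?thesis unfolding theta_covariant_def using k(1) l(1) by (intro exI[of _ "k * l"]) auto
qed

section \<open>Generators of the lattice group and Euclidean descent\<close>

definition heis :: "complex \<Rightarrow> complex \<Rightarrow> complex^3^3" where
  "heis \<beta> \<gamma> = vector [vector [1, - cnj \<beta>, \<gamma>], vector [0, 1, \<beta>], vector [0, 0, 1]]"

lemma heis_entries:
  "heis \<beta> \<gamma> $ 1 $ 1 = 1" "heis \<beta> \<gamma> $ 1 $ 2 = - cnj \<beta>" "heis \<beta> \<gamma> $ 1 $ 3 = \<gamma>"
  "heis \<beta> \<gamma> $ 2 $ 1 = 0" "heis \<beta> \<gamma> $ 2 $ 2 = 1" "heis \<beta> \<gamma> $ 2 $ 3 = \<beta>"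
  "heis \<beta> \<gamma> $ 3 $ 1 = 0" "heis \<beta> \<gamma> $ 3 $ 2 = 0" "heis \<beta> \<gamma> $ 3 $ 3 = 1"
  by (simp_all add: heis_def)

lemma heis_act: "jfac (heis \<beta> \<gamma>) \<tau> = 1" "act (heis \<beta> \<gamma>) \<tau> $ 1 = \<tau> $ 1 - cnj \<beta> * \<tau> $ 2 + \<gamma>" "act (heis \<beta> \<gamma>) \<tau> $ 2 = \<tau> $ 2 + \<beta>"
  unfolding act_components unfolding jfac_def heis_entries by simp_all

lemma heis_unitary:
  assumes "\<beta> \<in> eisenstein" "\<gamma> \<in> eisenstein" "\<gamma> + cnj \<gamma> + \<beta> * cnj \<beta> = 0"
  shows "heis \<beta> \<gamma> \<in> lat_unitary"
proof -
  have "cnj \<gamma> + cnj \<beta> * \<beta> + \<gamma> = 0" using assms(3) by (simp add: algebra_simps)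
  thus ?thesis using assms unfolding lat_unitary_def mem_Collect_eq unitary_iff forall_3 herm_J_entries heis_entries
    by simp
qed

lemma heis_covariant:
  assumes "\<beta> \<in> eisenstein" "\<gamma> \<in> eisenstein" "\<gamma> + cnj \<gamma> + \<beta> * cnj \<beta> = 0"
  shows "theta_vec (heis \<beta> \<gamma> *v v) (act (heis \<beta> \<gamma>) \<tau>) = theta_vec v \<tau>" "theta_covariant (heis \<beta> \<gamma>)"
proof -
  show "theta_vec (heis \<beta> \<gamma> *v v) (act (heis \<beta> \<gamma>) \<tau>) = theta_vec v \<tau>" for v \<tau>
    using theta3_upper[OF assms, of "v $ 1" "v $ 2" "v $ 3" "\<tau> $ 1" "\<tau> $ 2"]
    unfolding theta_vec_def mat3_vec heis_act heis_entries by simp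
  thus "theta_covariant (heis \<beta> \<gamma>)" unfolding theta_covariant_def by (intro exI[of _ 1]) (simp add: heis_act)
qed

lemma herm_J_unitary: "herm_J \<in> lat_unitary"
  unfolding lat_unitary_def mem_Collect_eq unitary_iff forall_3 herm_J_entries by simp

lemma herm_J_act: "jfac herm_J \<tau> = \<tau> $ 1" "act herm_J \<tau> $ 1 = 1 / \<tau> $ 1" "act herm_J \<tau> $ 2 = \<tau> $ 2 / \<tau> $ 1"
  unfolding act_components unfolding jfac_def herm_J_entries by simp_all

lemma herm_J_covariant:
  shows "\<tau> \<in> siegel_domain \<Longrightarrow> theta_vec (herm_J *v v) (act herm_J \<tau>) = - \<tau> $ 1 * theta_vec v \<tau>" "theta_covariant herm_J"
proof -
  show 1: "\<tau> \<in> siegel_domain \<Longrightarrow> theta_vec (herm_J *v v) (act herm_J \<tau>) = - \<tau> $ 1 * theta_vec v \<tau>" for v \<tau>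
    using theta3_J[of "\<tau> $ 1" "\<tau> $ 2" "v $ 3" "v $ 2" "v $ 1"]
    unfolding theta_vec_def mat3_vec herm_J_act herm_J_entries siegel_height by simp
  show "theta_covariant herm_J" unfolding theta_covariant_def using 1 by (intro exI[of _ "-1"]) (simp add: herm_J_act)
qed

lemma herm_J_sq: "herm_J ** herm_J = mat 1"
  unfolding vec_eq_iff forall_3 mat3_mult herm_J_entries by (simp add: mat_def)

lemma heis_inverse:
  assumes "\<gamma> + cnj \<gamma> + \<beta> * cnj \<beta> = 0" shows "heis (- \<beta>) (cnj \<gamma>) ** heis \<beta> \<gamma> = mat 1"
proof -
  have "\<gamma> + cnj \<beta> * \<beta> + cnj \<gamma> = 0" using assms by (simp add: algebra_simps)
  thus ?thesis unfolding vec_eq_iff forall_3 mat3_mult heis_entries by (simp add: mat_def)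
qed

text \<open>The two coordinates are rounded separately, each with error at most 1/2, which gives 1/4
  + (3/4) * (1/4) = 7/16.\<close>

lemma eis_round:
  obtains \<beta> where "\<beta> \<in> eisenstein" "(cmod (w + \<beta>))\<^sup>2 \<le> 7/16"
proof -
  define n where "n = - round (2 * Im w / sqrt 3)"
  define m where "m = - round (Re w - of_int n / 2)"
  have n: "\<bar>2 * Im w / sqrt 3 + of_int n\<bar> \<le> 1/2"
    using of_int_round_abs_le[of "2 * Im w / sqrt 3"] unfolding n_def by (simp add: abs_minus_commute)
  have m: "\<bar>Re w - of_int n / 2 + of_int m\<bar> \<le> 1/2"
    using of_int_round_abs_le[of "Re w - of_int n / 2"] unfolding m_def by (simp add: abs_minus_commute)
  have re: "Re (w + eis m n) = Re w - of_int n / 2 + of_int m" unfolding eis_def zeta3_eq by simp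
  have im: "Im (w + eis m n) = sqrt 3 / 2 * (2 * Im w / sqrt 3 + of_int n)"
    unfolding eis_def zeta3_eq by (simp add: field_simps)
  have a: "(Re w - of_int n / 2 + of_int m)\<^sup>2 \<le> 1/4" "(2 * Im w / sqrt 3 + of_int n)\<^sup>2 \<le> 1/4"
    using power_mono[OF m, of 2] power_mono[OF n, of 2] by (simp_all add: power_divide)
  have "(cmod (w + eis m n))\<^sup>2 \<le> 7/16"
    unfolding cmod_power2 re im power_mult_distrib using a by (simp add: power_divide)
  thus ?thesis using that[of "eis m n"] by simp
qed

lemma heis_reduce:
  obtains \<beta> \<gamma> where "\<beta> \<in> eisenstein" "\<gamma> \<in> eisenstein" "\<gamma> + cnj \<gamma> + \<beta> * cnj \<beta> = 0"
    "(cmod (y + \<beta>))\<^sup>2 \<le> 7/16" "\<bar>Im (x - cnj \<beta> * y + \<gamma>)\<bar> \<le> sqrt 3 / 2"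
proof -
  obtain \<beta> where b: "\<beta> \<in> eisenstein" "(cmod (y + \<beta>))\<^sup>2 \<le> 7/16" using eis_round .
  define t where "t = Im (x - cnj \<beta> * y + \<beta> * cnj \<beta> * zeta3)"
  define k where "k = - round (t / sqrt 3)"
  \<comment> \<open>\<open>\<beta> * cnj \<beta> * zeta3\<close> has the prescribed trace; integral
    multiples of \<open>sqrt_m3\<close> may be added freely and move the imaginary part in steps of
    \<open>sqrt 3\<close>.\<close>
  define \<gamma> where "\<gamma> = \<beta> * cnj \<beta> * zeta3 + of_int k * sqrt_m3"
  have "\<bar>t / sqrt 3 + of_int k\<bar> \<le> 1/2"
    using of_int_round_abs_le[of "t / sqrt 3"] unfolding k_def by (simp add: abs_minus_commute)
  hence "sqrt 3 * \<bar>t / sqrt 3 + of_int k\<bar> \<le> sqrt 3 * (1/2)" by (intro mult_left_mono) auto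
  moreover have "Im (x - cnj \<beta> * y + \<gamma>) = sqrt 3 * (t / sqrt 3 + of_int k)"
  proof -
    have "sqrt 3 * (t / sqrt 3 + of_int k) = t + sqrt 3 * of_int k" by (simp add: field_simps)
    thus ?thesis unfolding \<gamma>_def t_def by (simp add: algebra_simps)
  qed
  ultimately have "\<bar>Im (x - cnj \<beta> * y + \<gamma>)\<bar> \<le> sqrt 3 / 2" by (simp add: abs_mult)
  moreover have "\<gamma> \<in> eisenstein" using b(1) by (simp add: \<gamma>_def)
  moreover have "\<gamma> + cnj \<gamma> + \<beta> * cnj \<beta> = 0" unfolding \<gamma>_def by (simp add: cnj_zeta3 algebra_simps)
  ultimately show ?thesis using b that by blast
qed

lemma unit_product:
  assumes "a \<in> eisenstein" "b \<in> eisenstein" "cnj a * b = 1" shows "cmod a = 1" "b = a"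
proof -
  obtain k :: int where k: "k \<ge> 0" "(cmod a)\<^sup>2 = of_int k" "a * cnj a = of_int k" using eis_norm_int[OF assms(1)] .
  obtain l :: int where l: "l \<ge> 0" "(cmod b)\<^sup>2 = of_int l" using eis_norm_int[OF assms(2)] .
  have "cmod (cnj a * b) = 1" unfolding assms(3) by simp
  hence "(cmod a)\<^sup>2 * (cmod b)\<^sup>2 = 1" unfolding norm_mult by (simp add: power_mult_distrib[symmetric])
  hence "real_of_int (k * l) = of_int 1" unfolding k l by simp
  hence "k * l = 1" by (simp only: of_int_eq_iff)
  hence k1: "k = 1" using k(1) pos_zmult_eq_1_iff_lemma[of k l] by auto
  hence "(cmod a)\<^sup>2 = 1\<^sup>2" using k(2) by simp
  thus "cmod a = 1" by (rule power2_eq_imp_eq) auto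
  have "b = (a * cnj a) * b" unfolding k(3) k1 by simp
  also have "\<dots> = a * (cnj a * b)" by (simp only: mult.assoc)
  finally show "b = a" unfolding assms(3) by simp
qed

text \<open>Unitarity forces such a \<open>g\<close> to be upper triangular with units on the
  diagonal, that is, a Heisenberg matrix times diag (a, b, a). The cases \<open>theta3_upper\<close>
  and \<open>theta3_diag\<close> then combine.\<close>

lemma borel_covariant:
  assumes g: "g \<in> lat_unitary" and z: "g $ 3 $ 1 = 0" shows "theta_covariant g"
proof -
  have O: "g $ i $ j \<in> eisenstein" for i j using g unfolding lat_unitary_def by auto
  have e: "cnj (g $ 1 $ i) * g $ 3 $ j + cnj (g $ 2 $ i) * g $ 2 $ j + cnj (g $ 3 $ i) * g $ 1 $ j = herm_J $ i $ j" for i j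
    using g unfolding lat_unitary_def mem_Collect_eq unitary_iff by blast
  define a b where ab: "a = g $ 1 $ 1" "b = g $ 2 $ 2"
  have y: "g $ 2 $ 1 = 0" using e[of 1 1] z by (simp add: herm_J_entries)
  have "cnj a * g $ 3 $ 3 = 1" using e[of 1 3] z y by (simp add: herm_J_entries ab)
  note a = unit_product[OF _ O this, unfolded ab(1), OF O, folded ab(1)]
  have a0: "a \<noteq> 0" using a(1) by auto
  have g32: "g $ 3 $ 2 = 0" using e[of 1 2] z y a0 by (simp add: herm_J_entries ab)
  have "cnj b * b = 1" using e[of 2 2] g32 by (simp add: herm_J_entries ab)
  note b = unit_product[OF _ _ this, unfolded ab(2), OF O O, folded ab(2)]
  have aa: "a * cnj a = 1" using a(1) complex_norm_square[of a] by simp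
  have bb: "b * cnj b = 1" using b(1) complex_norm_square[of b] by simp
  define \<beta> where "\<beta> = g $ 2 $ 3 * cnj a"
  define \<gamma> where "\<gamma> = g $ 1 $ 3 * cnj a"
  have aO: "a \<in> eisenstein" "b \<in> eisenstein" using O unfolding ab by auto
  have bO: "\<beta> \<in> eisenstein" "\<gamma> \<in> eisenstein" unfolding \<beta>_def \<gamma>_def using O aO by auto
  have g23: "g $ 2 $ 3 = \<beta> * a" unfolding \<beta>_def using aa by (simp add: mult.assoc mult.commute[of "cnj a"])
  have g13: "g $ 1 $ 3 = \<gamma> * a" unfolding \<gamma>_def using aa by (simp add: mult.assoc mult.commute[of "cnj a"])
  have "cnj (g $ 1 $ 3) * a + cnj (g $ 2 $ 3) * g $ 2 $ 3 + cnj a * g $ 1 $ 3 = 0" using e[of 3 3] by (simp add: herm_J_entries a)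
  hence "(cnj \<gamma> + cnj \<beta> * \<beta> + \<gamma>) * (a * cnj a) = 0" unfolding g23 g13 by (simp add: algebra_simps)
  hence rel: "\<gamma> + cnj \<gamma> + \<beta> * cnj \<beta> = 0" unfolding aa by (simp add: algebra_simps)
  have "cnj (g $ 1 $ 2) * a + cnj b * (\<beta> * a) = 0" using e[of 2 3] g32 by (simp add: herm_J_entries a ab[symmetric] g23)
  hence "(cnj (g $ 1 $ 2) + cnj b * \<beta>) * a = 0" by (simp add: algebra_simps)
  hence "cnj (g $ 1 $ 2) = - (cnj b * \<beta>)" using a0 by (simp add: eq_neg_iff_add_eq_0)
  hence "cnj (cnj (g $ 1 $ 2)) = cnj (- (cnj b * \<beta>))" by (rule arg_cong)
  hence g12: "g $ 1 $ 2 = - (cnj \<beta> * b)" by (simp add: mult.commute)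
  have 1: "(g *v v) $ 1 = a * v $ 1 - cnj \<beta> * (b * v $ 2) + \<gamma> * (a * v $ 3)"
      "(g *v v) $ 2 = b * v $ 2 + \<beta> * (a * v $ 3)" "(g *v v) $ 3 = a * v $ 3" for v
    unfolding mat3_vec g12 g13 g23 y z g32 ab[symmetric] a(2) by (simp_all add: algebra_simps)
  have j: "jfac g \<tau> = a" for \<tau> unfolding jfac_def z g32 a(2) by simp
  have ia: "u / a = cnj a * u" for u using aa a0 by (simp add: field_simps)
  have 2: "act g \<tau> $ 1 = \<tau> $ 1 - cnj \<beta> * (b * cnj a * \<tau> $ 2) + \<gamma>" "act g \<tau> $ 2 = b * cnj a * \<tau> $ 2 + \<beta>" for \<tau>
    unfolding act_components j g12 g13 g23 y z g32 ab[symmetric] ia using aa by (simp_all add: algebra_simps)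
  have "theta_vec (g *v v) (act g \<tau>) = b * theta_vec v \<tau>" for v \<tau>
    using theta3_upper[OF bO rel, of "a * v $ 1" "b * v $ 2" "a * v $ 3" "\<tau> $ 1" "b * cnj a * \<tau> $ 2"]
      theta3_diag[OF aO(1) a(1) aO(2) b(1), of "v $ 1" "v $ 2" "v $ 3" "\<tau> $ 1" "\<tau> $ 2"]
    unfolding theta_vec_def 1 2 by simp
  moreover have "b = (b * cnj a) * a" using aa by (simp add: mult.assoc mult.commute)
  moreover have "b * cnj a \<noteq> 0" using a(1) b(1) by auto
  ultimately show ?thesis unfolding theta_covariant_def j by metis
qed

text \<open>A division with remainder, \<open>w\<close> being the translated quotient by
  \<open>z\<close>. Isotropy makes its real part -|y/z + \<beta>|^2 / 2, at most 7/32 in absolute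
  value, and the imaginary part is at most sqrt 3 / 2; since (7/32)^2 + 3/4 < 1, the entry
  shrinks.\<close>

lemma isotropic_descent:
  assumes iso: "2 * Re (cnj z * x) + (cmod y)\<^sup>2 = 0" and z: "z \<noteq> 0"
  obtains \<beta> \<gamma> where "\<beta> \<in> eisenstein" "\<gamma> \<in> eisenstein" "\<gamma> + cnj \<gamma> + \<beta> * cnj \<beta> = 0"
    "cmod (x - cnj \<beta> * y + \<gamma> * z) < cmod z"
proof -
  obtain \<beta> \<gamma> where bg: "\<beta> \<in> eisenstein" "\<gamma> \<in> eisenstein" "\<gamma> + cnj \<gamma> + \<beta> * cnj \<beta> = 0"
    "(cmod (y / z + \<beta>))\<^sup>2 \<le> 7/16" "\<bar>Im (x / z - cnj \<beta> * (y / z) + \<gamma>)\<bar> \<le> sqrt 3 / 2"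
    using heis_reduce[of "y / z" "x / z"] .
  define w where "w = x / z - cnj \<beta> * (y / z) + \<gamma>"
  have "x / z = (cnj z * x) / of_real ((cmod z)\<^sup>2)" using z unfolding complex_norm_square by simp
  hence "Re (x / z) = Re (cnj z * x) / (cmod z)\<^sup>2" by (simp only: Re_divide_of_real)
  moreover have "Re (cnj z * x) = - (cmod y)\<^sup>2 / 2" using iso by linarith
  ultimately have "2 * Re (x / z) = - (cmod (y / z))\<^sup>2" by (simp add: norm_divide power_divide)
  moreover have "2 * Re \<gamma> = - (cmod \<beta>)\<^sup>2"
  proof -
    have "Re (\<gamma> + cnj \<gamma> + of_real ((cmod \<beta>)\<^sup>2)) = 0" unfolding complex_norm_square bg(3) by simp
    thus ?thesis by simp
  qed
  moreover have "2 * Re (X - cnj \<beta> * Y + \<gamma>) = - (cmod (Y + \<beta>))\<^sup>2"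
    if "2 * Re X = - (cmod Y)\<^sup>2" "2 * Re \<gamma> = - (cmod \<beta>)\<^sup>2" for X Y
    using that unfolding cmod_power2 by (simp add: power2_eq_square algebra_simps)
  ultimately have "2 * Re w = - (cmod (y / z + \<beta>))\<^sup>2" unfolding w_def by blast
  hence "\<bar>Re w\<bar> \<le> 7/32" using bg(4) zero_le_power2[of "cmod (y / z + \<beta>)"] by linarith
  hence "(Re w)\<^sup>2 \<le> (7/32)\<^sup>2" using power_mono[of "\<bar>Re w\<bar>" "7/32" 2] by simp
  moreover have "(Im w)\<^sup>2 \<le> (sqrt 3 / 2)\<^sup>2"
    using power_mono[OF bg(5)[folded w_def], of 2] by simp
  ultimately have "(cmod w)\<^sup>2 < 1\<^sup>2" unfolding cmod_power2 by (simp add: power_divide)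
  hence "cmod w < 1" by (rule power2_less_imp_less) simp
  hence "cmod w * cmod z < 1 * cmod z" using z by (intro mult_strict_right_mono) auto
  moreover have "x - cnj \<beta> * y + \<gamma> * z = w * z" unfolding w_def using z by (simp add: field_simps)
  ultimately have "cmod (x - cnj \<beta> * y + \<gamma> * z) < cmod z" by (simp add: norm_mult)
  thus ?thesis using that bg by blast
qed

text \<open>Descent on the integer |g31|^2: the first column is isotropic, so a Heisenberg matrix
  followed by \<open>herm_J\<close> puts a smaller entry at the bottom. When this entry is zero, the
  matrix is triangular.\<close>

theorem lat_unitary_covariant:
  assumes "g \<in> lat_unitary" shows "theta_covariant g"
proof -
  have "\<forall>g \<in> lat_unitary. (cmod (g $ 3 $ 1))\<^sup>2 = real n \<longrightarrow> theta_covariant g" for n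
  proof (induction n rule: less_induct)
    case (less n)
    show ?case
    proof (intro ballI impI)
      fix g assume g: "g \<in> lat_unitary" and n: "(cmod (g $ 3 $ 1))\<^sup>2 = real n"
      show "theta_covariant g"
      proof (cases "g $ 3 $ 1 = 0")
        case False
        have O: "g $ i $ j \<in> eisenstein" for i j using g unfolding lat_unitary_def by auto
        have "cnj (g $ 1 $ 1) * g $ 3 $ 1 + cnj (g $ 2 $ 1) * g $ 2 $ 1 + cnj (g $ 3 $ 1) * g $ 1 $ 1 = 0"
          using g unfolding lat_unitary_def mem_Collect_eq unitary_iff using herm_J_entries(1) by metis
        hence "Re (cnj (g $ 1 $ 1) * g $ 3 $ 1 + of_real ((cmod (g $ 2 $ 1))\<^sup>2) + cnj (g $ 3 $ 1) * g $ 1 $ 1) = 0"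
          unfolding complex_norm_square by (simp add: mult.commute)
        hence "2 * Re (cnj (g $ 3 $ 1) * g $ 1 $ 1) + (cmod (g $ 2 $ 1))\<^sup>2 = 0" by (simp add: algebra_simps)
        from isotropic_descent[OF this False] obtain \<beta> \<gamma> where bg: "\<beta> \<in> eisenstein" "\<gamma> \<in> eisenstein" "\<gamma> + cnj \<gamma> + \<beta> * cnj \<beta> = 0"
          and lt: "cmod (g $ 1 $ 1 - cnj \<beta> * g $ 2 $ 1 + \<gamma> * g $ 3 $ 1) < cmod (g $ 3 $ 1)" .
        define h where "h = herm_J ** (heis \<beta> \<gamma> ** g)"
        have hU: "h \<in> lat_unitary" unfolding h_def by (intro lat_unitary_mult herm_J_unitary heis_unitary bg g)
        have h31: "h $ 3 $ 1 = g $ 1 $ 1 - cnj \<beta> * g $ 2 $ 1 + \<gamma> * g $ 3 $ 1"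
          unfolding h_def mat3_mult herm_J_entries heis_entries by simp
        obtain k :: int where k: "k \<ge> 0" "(cmod (h $ 3 $ 1))\<^sup>2 = of_int k"
          using eis_norm_int[of "h $ 3 $ 1"] hU unfolding lat_unitary_def by blast
        have "(cmod (h $ 3 $ 1))\<^sup>2 < (cmod (g $ 3 $ 1))\<^sup>2" using lt unfolding h31 by (intro power_strict_mono) auto
        hence "nat k < n" "(cmod (h $ 3 $ 1))\<^sup>2 = real (nat k)" using k n by auto
        hence hc: "theta_covariant h" using less.IH[of "nat k"] hU by blast
        have bg': "- \<beta> \<in> eisenstein" "cnj \<gamma> \<in> eisenstein" "cnj \<gamma> + cnj (cnj \<gamma>) + - \<beta> * cnj (- \<beta>) = 0"
          using bg by (simp_all add: add.commute)
        have "herm_J ** h = heis \<beta> \<gamma> ** g" unfolding h_def matrix_mul_assoc[of herm_J herm_J] herm_J_sq by simp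
        hence "heis (- \<beta>) (cnj \<gamma>) ** (herm_J ** h) = g"
          unfolding matrix_mul_assoc[of "heis (- \<beta>) (cnj \<gamma>)" "heis \<beta> \<gamma>", symmetric] by (simp add: heis_inverse[OF bg(3)] matrix_mul_assoc)
        moreover have "theta_covariant (heis (- \<beta>) (cnj \<gamma>) ** (herm_J ** h))"
          by (intro theta_covariant_mult heis_covariant(2) herm_J_covariant(2) heis_unitary herm_J_unitary lat_unitary_mult bg' hc hU)
        ultimately show ?thesis by simp
      qed (rule borel_covariant[OF g])
    qed
  qed
  note step = this
  have "g $ 3 $ 1 \<in> eisenstein" using assms unfolding lat_unitary_def by blast
  then obtain k :: int where k: "k \<ge> 0" "(cmod (g $ 3 $ 1))\<^sup>2 = of_int k" using eis_norm_int by metis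
  have "(cmod (g $ 3 $ 1))\<^sup>2 = real (nat k)" unfolding k(2) of_nat_nat[OF k(1)] ..
  thus ?thesis using step[rule_format, OF assms] by blast
qed

section \<open>Characters of the congruence subgroup\<close>

lemma unitary_herm:
  assumes g: "transpose (conj_mat g) ** herm_J ** g = herm_J"
  shows "(g *v v) $ 1 * cnj ((g *v v) $ 3) + (g *v v) $ 2 * cnj ((g *v v) $ 2) + (g *v v) $ 3 * cnj ((g *v v) $ 1) =
    v $ 1 * cnj (v $ 3) + v $ 2 * cnj (v $ 2) + v $ 3 * cnj (v $ 1)"
proof -
  note e = g[unfolded unitary_iff, rule_format]
  define f where "f = (\<lambda>i j. cnj (g $ 1 $ i) * g $ 3 $ j + cnj (g $ 2 $ i) * g $ 2 $ j + cnj (g $ 3 $ i) * g $ 1 $ j)"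
  have "(g *v v) $ 1 * cnj ((g *v v) $ 3) + (g *v v) $ 2 * cnj ((g *v v) $ 2) + (g *v v) $ 3 * cnj ((g *v v) $ 1) =
    cnj (v $ 1) * (v $ 1 * f 1 1 + v $ 2 * f 1 2 + v $ 3 * f 1 3) + cnj (v $ 2) * (v $ 1 * f 2 1 + v $ 2 * f 2 2 + v $ 3 * f 2 3)
     + cnj (v $ 3) * (v $ 1 * f 3 1 + v $ 2 * f 3 2 + v $ 3 * f 3 3)"
    unfolding f_def mat3_vec by (simp add: algebra_simps)
  thus ?thesis unfolding f_def e herm_J_entries by (simp add: algebra_simps)
qed

definition eis_vec :: "complex^3 \<Rightarrow> bool" where
  "eis_vec u \<longleftrightarrow> u $ 1 \<in> eisenstein \<and> u $ 2 \<in> eisenstein \<and> u $ 3 \<in> eisenstein"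

definition gamma_part :: "complex^3^3 \<Rightarrow> 3 \<Rightarrow> 3 \<Rightarrow> complex" where
  "gamma_part g i j = tors * (g $ i $ j - mat 1 $ i $ j)"

lemma gamma_partD:
  assumes "g \<in> Gamma_sqrt_m3"
  shows "gamma_part g i j \<in> eisenstein" "g $ i $ j = mat 1 $ i $ j + sqrt_m3 * gamma_part g i j"
    "g \<in> lat_unitary" "det g = 1" "transpose (conj_mat g) ** herm_J ** g = herm_J"
proof -
  obtain z where z: "z \<in> eisenstein" "g $ i $ j - mat 1 $ i $ j = sqrt_m3 * z"
    using assms unfolding Gamma_sqrt_m3_def eis_cong_def by blast
  have "gamma_part g i j = z" unfolding gamma_part_def z(2) by simp
  thus "gamma_part g i j \<in> eisenstein" "g $ i $ j = mat 1 $ i $ j + sqrt_m3 * gamma_part g i j"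
    using z by (auto simp: algebra_simps)
  show "g \<in> lat_unitary" "det g = 1" "transpose (conj_mat g) ** herm_J ** g = herm_J"
    using assms unfolding Gamma_sqrt_m3_def Gamma1_def SU21_def lat_unitary_def by auto
qed

text \<open>\<open>l\<close> is the lattice vector by which \<open>g\<close> moves
  \<open>tors *s u\<close>; the argument of \<open>rho\<close> is its hermitian pairing with
  \<open>u\<close>.\<close>

definition gamma_char :: "complex^3^3 \<Rightarrow> complex^3 \<Rightarrow> complex" where
  "gamma_char g u = (let l = (\<lambda>i. gamma_part g i 1 * u $ 1 + gamma_part g i 2 * u $ 2 + gamma_part g i 3 * u $ 3)
     in rho (u $ 1 * cnj (l 3) + u $ 2 * cnj (l 2) + u $ 3 * cnj (l 1)))"

text \<open>Since \<open>g\<close> moves \<open>tors *s u\<close> by a lattice vector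
  \<open>l\<close>, \<open>theta3_lattice\<close> compares the two characteristics. Invariance of
  the hermitian form under \<open>g\<close> rewrites the part quadratic in \<open>l\<close> through
  \<open>A\<close>, and the exponent collapses to that of \<open>rho (- A)\<close>.\<close>

lemma theta_gamma:
  assumes g: "g \<in> Gamma_sqrt_m3"
  obtains k where "k \<noteq> 0" "\<And>u \<tau>. eis_vec u \<Longrightarrow> \<tau> \<in> siegel_domain \<Longrightarrow>
    theta_vec (tors *s u) (act g \<tau>) = k * gamma_char g u * jfac g \<tau> * theta_vec (tors *s u) \<tau>"
proof -
  obtain k where k: "k \<noteq> 0" "\<And>v \<tau>. \<tau> \<in> siegel_domain \<Longrightarrow> theta_vec (g *v v) (act g \<tau>) = k * jfac g \<tau> * theta_vec v \<tau>"
    using lat_unitary_covariant[OF gamma_partD(3)[OF g]] unfolding theta_covariant_def by blast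
  have "theta_vec (tors *s u) (act g \<tau>) = k * gamma_char g u * jfac g \<tau> * theta_vec (tors *s u) \<tau>"
    if u: "eis_vec u" and t: "\<tau> \<in> siegel_domain" for u \<tau>
  proof -
    define l where "l = (\<lambda>i. gamma_part g i 1 * u $ 1 + gamma_part g i 2 * u $ 2 + gamma_part g i 3 * u $ 3)"
    define v where "v = tors *s u"
    define A where "A = u $ 1 * cnj (l 3) + u $ 2 * cnj (l 2) + u $ 3 * cnj (l 1)"
    have v: "v $ i = tors * u $ i" for i by (simp add: v_def)
    have lO: "l i \<in> eisenstein" for i using u gamma_partD(1)[OF g] unfolding l_def eis_vec_def by auto
    have AO: "A \<in> eisenstein" using u lO unfolding A_def eis_vec_def by auto
    have gv: "(g *v v) $ i = v $ i + l i" for i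
    proof -
      have "(g *v v) $ i = (mat 1 *v v) $ i + sqrt_m3 * (gamma_part g i 1 * v $ 1 + gamma_part g i 2 * v $ 2 + gamma_part g i 3 * v $ 3)"
        unfolding mat3_vec gamma_partD(2)[OF g] by (simp add: algebra_simps)
      moreover have "sqrt_m3 * (gamma_part g i 1 * v $ 1 + gamma_part g i 2 * v $ 2 + gamma_part g i 3 * v $ 3) = l i"
        unfolding v l_def by (simp add: algebra_simps)
      ultimately show ?thesis by simp
    qed
    define E where "E = (sqrt_m3 / 2) * (l 1 * cnj (l 3) + l 2 * cnj (l 2) + l 3 * cnj (l 1)) +
      ((v $ 1 * cnj (l 3) + v $ 2 * cnj (l 2) + v $ 3 * cnj (l 1)) - (l 1 * cnj (v $ 3) + l 2 * cnj (v $ 2) + l 3 * cnj (v $ 1))) / 2"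
    have a: "v $ 1 * cnj (l 3) + v $ 2 * cnj (l 2) + v $ 3 * cnj (l 1) = tors * A"
      unfolding v A_def by (simp add: algebra_simps)
    have b: "l 1 * cnj (v $ 3) + l 2 * cnj (v $ 2) + l 3 * cnj (v $ 1) = - (tors * cnj A)"
      unfolding v A_def by (simp add: algebra_simps)
    have "(v $ 1 * cnj (l 3) + v $ 2 * cnj (l 2) + v $ 3 * cnj (l 1)) + (l 1 * cnj (v $ 3) + l 2 * cnj (v $ 2) + l 3 * cnj (v $ 1))
       + (l 1 * cnj (l 3) + l 2 * cnj (l 2) + l 3 * cnj (l 1)) = 0"
      using unitary_herm[OF gamma_partD(5)[OF g], of v] unfolding gv by (simp add: algebra_simps)
    hence c: "l 1 * cnj (l 3) + l 2 * cnj (l 2) + l 3 * cnj (l 1) = - (tors * A) - - (tors * cnj A)"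
      unfolding a b by (simp add: algebra_simps eq_neg_iff_add_eq_0)
    obtain p :: int where p: "(sqrt_m3 / 2) * (A + cnj A) + (A - cnj A) / 2 = sqrt_m3 * of_int p"
      using eis_pair_integral[OF AO] .
    have "E - tors * ((- A) + cnj (- A)) = - ((sqrt_m3 / 2) * (A + cnj A) + (A - cnj A) / 2)"
      unfolding E_def a b c by (simp add: field_simps)
    also have "\<dots> = sqrt_m3 * of_int (- p)" unfolding p by simp
    finally have E: "exp (cc * E) = rho (- A)" unfolding rho_def by (rule exp_cc_cong)
    have "theta_vec (g *v v) (act g \<tau>) = rho (- A) * theta_vec v (act g \<tau>)"
      unfolding theta_vec_def gv theta3_lattice[OF lO lO lO] E_def[symmetric] E ..
    hence "rho (- A) * theta_vec v (act g \<tau>) = k * jfac g \<tau> * theta_vec v \<tau>" using k(2)[OF t] by simp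
    hence "(rho (- A) * rho A) * theta_vec v (act g \<tau>) = rho A * (k * jfac g \<tau> * theta_vec v \<tau>)" by (simp add: mult_ac)
    moreover have "gamma_char g u = rho A" unfolding gamma_char_def A_def l_def Let_def ..
    ultimately show ?thesis unfolding rho_minus v_def by (simp add: mult_ac)
  qed
  thus ?thesis using that k(1) by blast
qed

lemma gamma_char_cube:
  assumes "g \<in> Gamma_sqrt_m3" "eis_vec u" shows "gamma_char g u ^ 3 = 1"
  unfolding gamma_char_def Let_def
  by (rule rho_values(1)) (use assms gamma_partD(1)[OF assms(1)] in \<open>auto simp: eis_vec_def\<close>)

text \<open>Write g = 1 + sqrt_m3 * y. The terms of first order in \<open>sqrt_m3\<close> of the
  unitarity equations make y symmetric about the antidiagonal up to conjugation, and those of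
  \<open>det g = 1\<close> make its trace vanish, both modulo \<open>sqrt_m3\<close>.\<close>

lemma gamma_symmetric:
  assumes g: "g \<in> Gamma_sqrt_m3"
  shows "tors * (gamma_part g 3 2 - cnj (gamma_part g 2 1)) \<in> eisenstein"
    "tors * (gamma_part g 3 3 - cnj (gamma_part g 1 1)) \<in> eisenstein"
    "tors * (gamma_part g 2 3 - cnj (gamma_part g 1 2)) \<in> eisenstein"
    "tors * (gamma_part g 1 1 + gamma_part g 2 2 + gamma_part g 3 3) \<in> eisenstein"
proof -
  define y where "y = gamma_part g"
  have yO: "y i j \<in> eisenstein" for i j unfolding y_def by (rule gamma_partD(1)[OF g])
  have gy: "g $ i $ j = mat 1 $ i $ j + sqrt_m3 * y i j" for i j unfolding y_def by (rule gamma_partD(2)[OF g])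
  have G: "g $ 1 $ 1 = 1 + sqrt_m3 * y 1 1" "g $ 1 $ 2 = sqrt_m3 * y 1 2" "g $ 1 $ 3 = sqrt_m3 * y 1 3"
    "g $ 2 $ 1 = sqrt_m3 * y 2 1" "g $ 2 $ 2 = 1 + sqrt_m3 * y 2 2" "g $ 2 $ 3 = sqrt_m3 * y 2 3"
    "g $ 3 $ 1 = sqrt_m3 * y 3 1" "g $ 3 $ 2 = sqrt_m3 * y 3 2" "g $ 3 $ 3 = 1 + sqrt_m3 * y 3 3"
    unfolding gy by (simp_all add: mat_def)
  have s: "cnj (sqrt_m3 * a) = - sqrt_m3 * cnj a" for a by simp
  note e = gamma_partD(5)[OF g, unfolded unitary_iff, rule_format]
  define Z where "Z = (\<lambda>i j. cnj (y 1 i) * y 3 j + cnj (y 2 i) * y 2 j + cnj (y 3 i) * y 1 j)"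
  have ZO: "Z i j \<in> eisenstein" for i j unfolding Z_def using yO by auto
  have "sqrt_m3 * (y 3 2 - cnj (y 2 1)) = - 3 * Z 1 2" "sqrt_m3 * (y 3 3 - cnj (y 1 1)) = - 3 * Z 1 3"
    "sqrt_m3 * (y 2 3 - cnj (y 1 2)) = - 3 * Z 2 3"
    using e[of 1 2] e[of 1 3] e[of 2 3] unfolding herm_J_entries G complex_cnj_add s Z_def
    by (simp_all add: algebra_simps)
  moreover have "tors * w \<in> eisenstein" if "sqrt_m3 * w = - 3 * z" "z \<in> eisenstein" for w z
  proof -
    have "tors * w = - (sqrt_m3 * w) / 3" unfolding tors_conv by simp
    thus ?thesis using that by simp
  qed
  ultimately show "tors * (gamma_part g 3 2 - cnj (gamma_part g 2 1)) \<in> eisenstein"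
    "tors * (gamma_part g 3 3 - cnj (gamma_part g 1 1)) \<in> eisenstein"
    "tors * (gamma_part g 2 3 - cnj (gamma_part g 1 2)) \<in> eisenstein"
    using ZO unfolding y_def[symmetric] by blast+
  define e2 where "e2 = y 1 1 * y 2 2 - y 1 2 * y 2 1 + y 1 1 * y 3 3 - y 1 3 * y 3 1 + y 2 2 * y 3 3 - y 2 3 * y 3 2"
  define e3 where "e3 = y 1 1 * y 2 2 * y 3 3 + y 1 2 * y 2 3 * y 3 1 + y 1 3 * y 2 1 * y 3 2
     - y 1 1 * y 2 3 * y 3 2 - y 1 2 * y 2 1 * y 3 3 - y 1 3 * y 2 2 * y 3 1"
  have "e2 \<in> eisenstein" "e3 \<in> eisenstein" unfolding e2_def e3_def using yO by auto
  have "sqrt_m3 * (y 1 1 + y 2 2 + y 3 3) = - 3 * (- e2 - sqrt_m3 * e3)"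
    using gamma_partD(4)[OF g] unfolding det_3 G e2_def e3_def by (simp add: algebra_simps)
  hence "tors * (y 1 1 + y 2 2 + y 3 3) = - e2 - sqrt_m3 * e3" unfolding tors_conv by (simp add: field_simps)
  thus "tors * (gamma_part g 1 1 + gamma_part g 2 2 + gamma_part g 3 3) \<in> eisenstein"
    using \<open>e2 \<in> eisenstein\<close> \<open>e3 \<in> eisenstein\<close> unfolding y_def[symmetric] by simp
qed

section \<open>Congruences modulo \<open>sqrt_m3\<close> and the characters on
  \<open>Upsilon\<close>\<close>

definition th_cong :: "complex \<Rightarrow> complex \<Rightarrow> bool" where
  "th_cong x y \<longleftrightarrow> tors * (x - y) \<in> eisenstein"

lemma th_cong_refl [simp]: "th_cong x x" by (simp add: th_cong_def)

lemma th_cong_sym: assumes "th_cong x y" shows "th_cong y x"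
proof -
  have "tors * (y - x) = - (tors * (x - y))" by (simp add: field_simps)
  thus ?thesis using assms unfolding th_cong_def by simp
qed

lemma th_cong_trans: assumes "th_cong x y" "th_cong y z" shows "th_cong x z"
proof -
  have "tors * (x - z) = tors * (x - y) + tors * (y - z)" by (simp add: field_simps)
  thus ?thesis using assms unfolding th_cong_def by auto
qed

lemma th_cong_add: assumes "th_cong x y" "th_cong x' y'" shows "th_cong (x + x') (y + y')"
proof -
  have "tors * (x + x' - (y + y')) = tors * (x - y) + tors * (x' - y')" by (simp add: field_simps)
  thus ?thesis using assms unfolding th_cong_def by auto
qed

lemma th_cong_mult: assumes "th_cong x y" "z \<in> eisenstein" shows "th_cong (z * x) (z * y)"
proof -
  have "tors * (z * x - z * y) = z * (tors * (x - y))" by (simp add: field_simps)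
  moreover have "z * (tors * (x - y)) \<in> eisenstein" by (rule eisenstein_closed(10)[OF assms(2) assms(1)[unfolded th_cong_def]])
  ultimately show ?thesis unfolding th_cong_def by (simp only:)
qed

lemma th_cong_cnj: assumes "x \<in> eisenstein" shows "th_cong (cnj x) x"
proof -
  obtain q :: int where "x - cnj x = sqrt_m3 * of_int q" using eis_diff_cnj[OF assms] .
  hence "tors * (x - cnj x) = of_int q" by simp
  hence "th_cong x (cnj x)" unfolding th_cong_def by simp
  thus ?thesis by (rule th_cong_sym)
qed

lemma th_cong_rho: "th_cong x y \<Longrightarrow> rho x = rho y"
  unfolding th_cong_def by (rule rho_residue)

text \<open>Conjugation is trivial on the residue field, the condition on the entry 11 together with
  the trace removes the diagonal of \<open>gamma_part\<close>, and symmetry about the antidiagonal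
  doubles two of the remaining entries. What is left involves just the four entries that occur in
  \<open>Upsilon_index3\<close>.\<close>

lemma gamma_char_Upsilon:
  assumes g: "g \<in> Upsilon" and u: "eis_vec u"
  shows "gamma_char g u = rho ((2 * u $ 2 * u $ 3) * gamma_part g 1 2 + (u $ 3 * u $ 3) * gamma_part g 1 3 +
     (2 * u $ 1 * u $ 2) * gamma_part g 2 1 + (u $ 1 * u $ 1) * gamma_part g 3 1)"
proof -
  have g': "g \<in> Gamma_sqrt_m3" using g unfolding Upsilon_def by auto
  define y where "y = gamma_part g"
  have yO: "y i j \<in> eisenstein" for i j unfolding y_def by (rule gamma_partD(1)[OF g'])
  have uO: "u $ 1 \<in> eisenstein" "u $ 2 \<in> eisenstein" "u $ 3 \<in> eisenstein" using u unfolding eis_vec_def by auto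
  obtain z where z: "z \<in> eisenstein" "g $ 1 $ 1 - 1 = 3 * z" using g unfolding Upsilon_def eis_cong_def by auto
  have "y 1 1 = tors * (g $ 1 $ 1 - 1)" unfolding y_def gamma_part_def by (simp add: mat_def)
  hence "tors * y 1 1 = - z" unfolding z(2) by simp
  hence y11: "th_cong (y 1 1) 0" unfolding th_cong_def using z(1) by simp
  note sym = gamma_symmetric[OF g', folded y_def]
  have s: "th_cong (y 3 2) (y 2 1)" "th_cong (y 3 3) (y 1 1)" "th_cong (y 2 3) (y 1 2)"
    using sym th_cong_cnj[OF yO] th_cong_trans unfolding th_cong_def by blast+
  have y33: "th_cong (y 3 3) 0" by (rule th_cong_trans[OF s(2) y11])
  have "th_cong (y 2 2) (y 1 1 + y 2 2 + y 3 3)"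
    using th_cong_add[OF th_cong_add[OF th_cong_sym[OF y11] th_cong_refl[of "y 2 2"]] th_cong_sym[OF y33]] by simp
  moreover have "th_cong (y 1 1 + y 2 2 + y 3 3) 0" using sym(4) unfolding th_cong_def by simp
  ultimately have y22: "th_cong (y 2 2) 0" by (rule th_cong_trans)
  define l where "l = (\<lambda>i. y i 1 * u $ 1 + y i 2 * u $ 2 + y i 3 * u $ 3)"
  have lO: "l i \<in> eisenstein" for i unfolding l_def using uO yO by auto
  have "th_cong (u $ 1 * cnj (l 3) + u $ 2 * cnj (l 2) + u $ 3 * cnj (l 1)) (u $ 1 * l 3 + u $ 2 * l 2 + u $ 3 * l 1)"
    by (intro th_cong_add th_cong_mult th_cong_cnj lO uO)
  also have "u $ 1 * l 3 + u $ 2 * l 2 + u $ 3 * l 1 =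
     (u $ 1 * u $ 2) * y 3 2 + (u $ 1 * u $ 3) * y 3 3 + (u $ 1 * u $ 3) * y 1 1 + (u $ 2 * u $ 2) * y 2 2 + (u $ 2 * u $ 3) * y 2 3 +
     ((u $ 2 * u $ 3) * y 1 2 + (u $ 3 * u $ 3) * y 1 3 + (u $ 1 * u $ 2) * y 2 1 + (u $ 1 * u $ 1) * y 3 1)"
    unfolding l_def by (simp add: algebra_simps)
  finally have 1: "th_cong (u $ 1 * cnj (l 3) + u $ 2 * cnj (l 2) + u $ 3 * cnj (l 1)) 
     ((u $ 1 * u $ 2) * y 3 2 + (u $ 1 * u $ 3) * y 3 3 + (u $ 1 * u $ 3) * y 1 1 + (u $ 2 * u $ 2) * y 2 2 + (u $ 2 * u $ 3) * y 2 3 +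
     ((u $ 2 * u $ 3) * y 1 2 + (u $ 3 * u $ 3) * y 1 3 + (u $ 1 * u $ 2) * y 2 1 + (u $ 1 * u $ 1) * y 3 1))" .
  have 2: "th_cong ((u $ 1 * u $ 2) * y 3 2 + (u $ 1 * u $ 3) * y 3 3 + (u $ 1 * u $ 3) * y 1 1 + (u $ 2 * u $ 2) * y 2 2 + (u $ 2 * u $ 3) * y 2 3 +
     ((u $ 2 * u $ 3) * y 1 2 + (u $ 3 * u $ 3) * y 1 3 + (u $ 1 * u $ 2) * y 2 1 + (u $ 1 * u $ 1) * y 3 1))
     ((u $ 1 * u $ 2) * y 2 1 + (u $ 1 * u $ 3) * 0 + (u $ 1 * u $ 3) * 0 + (u $ 2 * u $ 2) * 0 + (u $ 2 * u $ 3) * y 1 2 +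
     ((u $ 2 * u $ 3) * y 1 2 + (u $ 3 * u $ 3) * y 1 3 + (u $ 1 * u $ 2) * y 2 1 + (u $ 1 * u $ 1) * y 3 1))"
    by (intro th_cong_add th_cong_mult s y11 y22 y33 th_cong_refl; use uO in auto)
  have 3: "(u $ 1 * u $ 2) * y 2 1 + (u $ 1 * u $ 3) * 0 + (u $ 1 * u $ 3) * 0 + (u $ 2 * u $ 2) * 0 + (u $ 2 * u $ 3) * y 1 2 +
     ((u $ 2 * u $ 3) * y 1 2 + (u $ 3 * u $ 3) * y 1 3 + (u $ 1 * u $ 2) * y 2 1 + (u $ 1 * u $ 1) * y 3 1) =
     (2 * u $ 2 * u $ 3) * y 1 2 + (u $ 3 * u $ 3) * y 1 3 + (2 * u $ 1 * u $ 2) * y 2 1 + (u $ 1 * u $ 1) * y 3 1"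
    by (simp add: algebra_simps)
  have "gamma_char g u = rho (u $ 1 * cnj (l 3) + u $ 2 * cnj (l 2) + u $ 3 * cnj (l 1))"
    unfolding gamma_char_def Let_def l_def y_def ..
  thus ?thesis using th_cong_rho[OF th_cong_trans[OF 1 2[unfolded 3]]] unfolding y_def by simp
qed

text \<open>Dividing the congruence modulo 3 by \<open>sqrt_m3\<close> leaves a congruence modulo
  \<open>sqrt_m3\<close> for \<open>gamma_part\<close>; \<open>k\<close> times this congruence
  accounts for the difference of the two quadratic expressions.\<close>

lemma gamma_char_eq:
  assumes g: "g \<in> Upsilon_index3 a b c d" and u: "eis_vec u" "eis_vec u'" and k: "k \<in> eisenstein"
    and "th_cong (2 * u $ 2 * u $ 3) (2 * u' $ 2 * u' $ 3 + k * of_nat a)" "th_cong (u $ 3 * u $ 3) (u' $ 3 * u' $ 3 + k * of_nat b)"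
    "th_cong (2 * u $ 1 * u $ 2) (2 * u' $ 1 * u' $ 2 + k * of_nat c)" "th_cong (u $ 1 * u $ 1) (u' $ 1 * u' $ 1 + k * of_nat d)"
  shows "gamma_char g u = gamma_char g u'"
proof -
  have gU: "g \<in> Upsilon" and g': "g \<in> Gamma_sqrt_m3" using g unfolding Upsilon_index3_def Upsilon_def by auto
  define y where "y = gamma_part g"
  have yO: "y i j \<in> eisenstein" for i j unfolding y_def by (rule gamma_partD(1)[OF g'])
  have gy: "g $ i $ j = mat 1 $ i $ j + sqrt_m3 * y i j" for i j unfolding y_def by (rule gamma_partD(2)[OF g'])
  obtain z where z: "z \<in> eisenstein" "of_nat a * g $ 1 $ 2 + of_nat b * g $ 1 $ 3 + of_nat c * g $ 2 $ 1 + of_nat d * g $ 3 $ 1 = 3 * z"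
    using g unfolding Upsilon_index3_def eis_cong_def by auto
  define S where "S = of_nat a * y 1 2 + of_nat b * y 1 3 + of_nat c * y 2 1 + of_nat d * y 3 1"
  have "sqrt_m3 * S = 3 * z" unfolding z(2)[symmetric] gy S_def by (simp add: mat_def algebra_simps)
  hence "tors * S = - z" unfolding tors_conv by simp
  hence S: "th_cong S 0" unfolding th_cong_def using z(1) by simp
  have 1: "th_cong (y 1 2 * (2 * u $ 2 * u $ 3) + y 1 3 * (u $ 3 * u $ 3) + y 2 1 * (2 * u $ 1 * u $ 2) + y 3 1 * (u $ 1 * u $ 1))
     (y 1 2 * (2 * u' $ 2 * u' $ 3 + k * of_nat a) + y 1 3 * (u' $ 3 * u' $ 3 + k * of_nat b) +
      y 2 1 * (2 * u' $ 1 * u' $ 2 + k * of_nat c) + y 3 1 * (u' $ 1 * u' $ 1 + k * of_nat d))"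
    by (intro th_cong_add th_cong_mult yO assms(5-8))
  have 2: "th_cong ((y 1 2 * (2 * u' $ 2 * u' $ 3) + y 1 3 * (u' $ 3 * u' $ 3) + y 2 1 * (2 * u' $ 1 * u' $ 2) + y 3 1 * (u' $ 1 * u' $ 1)) + k * S)
     ((y 1 2 * (2 * u' $ 2 * u' $ 3) + y 1 3 * (u' $ 3 * u' $ 3) + y 2 1 * (2 * u' $ 1 * u' $ 2) + y 3 1 * (u' $ 1 * u' $ 1)) + k * 0)"
    by (intro th_cong_add th_cong_mult S k th_cong_refl)
  have 3: "y 1 2 * (2 * u' $ 2 * u' $ 3 + k * of_nat a) + y 1 3 * (u' $ 3 * u' $ 3 + k * of_nat b) +
      y 2 1 * (2 * u' $ 1 * u' $ 2 + k * of_nat c) + y 3 1 * (u' $ 1 * u' $ 1 + k * of_nat d) =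
      (y 1 2 * (2 * u' $ 2 * u' $ 3) + y 1 3 * (u' $ 3 * u' $ 3) + y 2 1 * (2 * u' $ 1 * u' $ 2) + y 3 1 * (u' $ 1 * u' $ 1)) + k * S"
    unfolding S_def by (simp add: algebra_simps)
  have 4: "(y 1 2 * (2 * u' $ 2 * u' $ 3) + y 1 3 * (u' $ 3 * u' $ 3) + y 2 1 * (2 * u' $ 1 * u' $ 2) + y 3 1 * (u' $ 1 * u' $ 1)) + k * 0 =
     y 1 2 * (2 * u' $ 2 * u' $ 3) + y 1 3 * (u' $ 3 * u' $ 3) + y 2 1 * (2 * u' $ 1 * u' $ 2) + y 3 1 * (u' $ 1 * u' $ 1)"
    by simp
  show ?thesis
    using th_cong_rho[OF th_cong_trans[OF 1[unfolded 3] 2[unfolded 4]]]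
    unfolding gamma_char_Upsilon[OF gU u(1)] gamma_char_Upsilon[OF gU u(2)] y_def by (simp only: mult.commute)
qed

section \<open>Theta values far up in the domain\<close>

text \<open>The norm of \<open>eis m n\<close> is 3 m^2 / 4 + (n - m/2)^2, and the inner sum over n,
  shifted by m/2, is at most the unshifted one by \<open>gauss_sum_le\<close>.\<close>

lemma eis_gauss_le:
  assumes a: "\<alpha> > 0"
  shows "(\<Sum>\<^sub>\<infinity>m\<in>eisenstein. exp (- \<alpha> * (cmod m)\<^sup>2)) \<le>
    (\<Sum>\<^sub>\<infinity>n::int. exp (- (3 * \<alpha> / 4) * (of_int n)\<^sup>2)) * (\<Sum>\<^sub>\<infinity>n::int. exp (- \<alpha> * (of_int n)\<^sup>2))"
proof -
  define f where "f = (\<lambda>(m::int) (n::int). exp (- (3 * \<alpha> / 4) * (of_int m)\<^sup>2) * exp (- \<alpha> * (of_int n + (- of_int m / 2))\<^sup>2))"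
  have f: "exp (- \<alpha> * (cmod (eis m n))\<^sup>2) = f m n" for m n
  proof -
    have "(cmod (eis m n))\<^sup>2 = 3 / 4 * (of_int m)\<^sup>2 + (of_int n + (- of_int m / 2))\<^sup>2"
      unfolding norm_eis by (simp add: power2_eq_square field_simps)
    thus ?thesis unfolding f_def exp_add[symmetric] by (simp add: algebra_simps)
  qed
  have "(\<lambda>m. exp (- \<alpha> * (cmod m)\<^sup>2)) summable_on eisenstein" using summable_eis_gauss[OF a, of 0] by simp
  hence s: "(\<lambda>(m, n). f m n) summable_on UNIV \<times> UNIV" unfolding summable_eis f .
  define g where "g = (\<lambda>m::int. exp (- (3 * \<alpha> / 4) * (of_int m)\<^sup>2))"
  have gs: "g summable_on UNIV" using summable_gauss_shift[of "3 * \<alpha> / 4" 0] a unfolding g_def by simp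
  define t where "t = (\<Sum>\<^sub>\<infinity>n::int. exp (- \<alpha> * (of_int n)\<^sup>2))"
  have "(\<Sum>\<^sub>\<infinity>m\<in>eisenstein. exp (- \<alpha> * (cmod m)\<^sup>2)) = (\<Sum>\<^sub>\<infinity>m. \<Sum>\<^sub>\<infinity>n. f m n)"
    unfolding infsum_eis f by (rule infsum_Sigma'_banach[OF s, symmetric])
  also have "\<dots> \<le> (\<Sum>\<^sub>\<infinity>m. g m * t)"
  proof (rule infsum_mono)
    show "(\<lambda>m. \<Sum>\<^sub>\<infinity>n. f m n) summable_on UNIV" by (rule summable_on_Sigma_banach[OF s])
    show "(\<lambda>m. g m * t) summable_on UNIV" by (rule summable_on_cmult_left[OF gs])
    fix m :: int
    show "(\<Sum>\<^sub>\<infinity>n. f m n) \<le> g m * t"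
      unfolding f_def g_def t_def infsum_cmult_right' by (intro mult_left_mono gauss_sum_le a) simp
  qed
  also have "\<dots> = infsum g UNIV * t" by (rule infsum_cmult_left')
  finally show ?thesis unfolding g_def t_def .
qed

lemma exp_ln5: "exp (- ln 5) = (1/5 :: real)" by (simp add: exp_minus)

text \<open>exp (- ln 5) = 1/5 is a rational upper bound for the weight of a unit at height 9/10,
  see \<open>ln5_le\<close>. The second sum concerns the multiples of \<open>sqrt_m3\<close>, whose
  norms are tripled.\<close>

lemma eis_gauss_sum_bounds:
  "(\<Sum>\<^sub>\<infinity>m\<in>eisenstein. exp (- ln 5 * (cmod m)\<^sup>2)) \<le> 228/100"
  "(\<Sum>\<^sub>\<infinity>m\<in>eisenstein. exp (- (3 * ln 5) * (cmod m)\<^sup>2)) \<le> 1072/1000"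
proof -
  have l: "ln (5::real) > 0" by simp
  have e: "exp (- (real n * ln 5)) = 1 / 5 ^ n" for n
    using exp_of_nat_mult[of n "- ln (5::real)"] unfolding exp_ln5 by (simp add: power_divide)
  have p4: "exp (- x) \<le> r" if "exp (- (4 * x)) \<le> r ^ 4" "r \<ge> 0" for x r :: real
  proof -
    have "exp (- x) ^ 4 \<le> r ^ 4" using that(1) exp_of_nat_mult[of 4 "- x"] by simp
    thus ?thesis by (rule power_le_imp_le_base[of _ 3, simplified]) (use that in auto)
  qed
  have t1: "(\<Sum>\<^sub>\<infinity>n::int. exp (- ln 5 * (of_int n)\<^sup>2)) \<le> (1404/1000 :: real)"
    by (rule order_trans[OF theta_null_le[of "1/5"]]) (use exp_ln5 l in \<open>simp_all add: power_divide\<close>)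
  have "exp (- (3 * ln 5 / 4)) \<le> (3/10::real)" by (rule p4) (use e[of 3] in \<open>simp_all add: power_divide\<close>)
  hence t2: "(\<Sum>\<^sub>\<infinity>n::int. exp (- (3 * ln 5 / 4) * (of_int n)\<^sup>2)) \<le> (16232/10000 :: real)"
    by (intro order_trans[OF theta_null_le[of "3/10"]]) (use l in \<open>simp_all add: power_divide\<close>)
  have t3: "(\<Sum>\<^sub>\<infinity>n::int. exp (- (3 * ln 5) * (of_int n)\<^sup>2)) \<le> (10161/10000 :: real)"
    by (rule order_trans[OF theta_null_le[of "1/125"]]) (use e[of 3] l in \<open>simp_all add: power_divide\<close>)
  have "exp (- (3 * (3 * ln 5) / 4)) \<le> (27/1000::real)" by (rule p4) (use e[of 9] in \<open>simp_all add: power_divide\<close>)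
  hence t4: "(\<Sum>\<^sub>\<infinity>n::int. exp (- (3 * (3 * ln 5) / 4) * (of_int n)\<^sup>2)) \<le> (10541/10000 :: real)"
    by (intro order_trans[OF theta_null_le[of "27/1000"]]) (use l in \<open>simp_all add: power_divide\<close>)
  have nn: "(\<Sum>\<^sub>\<infinity>n::int. exp (- a * (of_int n)\<^sup>2)) \<ge> 0" for a :: real by (rule infsum_nonneg) simp
  show "(\<Sum>\<^sub>\<infinity>m\<in>eisenstein. exp (- ln 5 * (cmod m)\<^sup>2)) \<le> 228/100"
    using eis_gauss_le[OF l] mult_mono[OF t2 t1 _ nn] by simp
  show "(\<Sum>\<^sub>\<infinity>m\<in>eisenstein. exp (- (3 * ln 5) * (cmod m)\<^sup>2)) \<le> 1072/1000"
    using eis_gauss_le[of "3 * ln 5"] l mult_mono[OF t4 t3 _ nn] by simp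
qed

lemma ln5_le: "ln 5 \<le> cr / 2 * (9/10)"
proof -
  have "(1107/1000::real) \<le> exp (102/1000)" using exp_lower_Taylor_quadratic[of "102/1000"] by (simp add: power2_eq_square)
  hence "(1107/1000::real) ^ 16 \<le> exp (102/1000) ^ 16" by (intro power_mono) auto
  moreover have "(5::real) \<le> (1107/1000) ^ 16" by (simp add: power_divide)
  moreover have "exp (102/1000::real) ^ 16 = exp (1632/1000)" unfolding exp_of_nat_mult[symmetric] by simp
  ultimately have "(5::real) \<le> exp (1632/1000)" by linarith
  hence "ln (5::real) \<le> ln (exp (1632/1000))" by (subst ln_le_cancel_iff) auto
  hence "ln (5::real) \<le> 1632/1000" by simp
  thus ?thesis using pi_sqrt3_bounds by simp
qed

section \<open>Theta series split by residue classes modulo \<open>sqrt_m3\<close>\<close>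

definition residue_class :: "complex \<Rightarrow> complex set" where
  "residue_class w = {m \<in> eisenstein. rho m = w}"

lemma residue_classes:
  "eisenstein = residue_class 1 \<union> (residue_class zeta3 \<union> residue_class (zeta3 * zeta3))"
  "residue_class 1 \<inter> (residue_class zeta3 \<union> residue_class (zeta3 * zeta3)) = {}"
  "residue_class zeta3 \<inter> residue_class (zeta3 * zeta3) = {}"
proof -
  have "rho m = 1 \<or> rho m = zeta3 \<or> rho m = zeta3 * zeta3" if m: "m \<in> eisenstein" for m
  proof -
    obtain j where "j \<in> {0, 1, -1}" "tors * (m - j) \<in> eisenstein" using eis_residue[OF m] by blast
    thus ?thesis using rho_residue[of m j] rho_1 rho_minus_1 by fastforce
  qed
  thus "eisenstein = residue_class 1 \<union> (residue_class zeta3 \<union> residue_class (zeta3 * zeta3))"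
    unfolding residue_class_def by auto
  have "zeta3 \<noteq> zeta3 * zeta3" using zeta3_ne_1 zeta3_cube by auto
  thus "residue_class 1 \<inter> (residue_class zeta3 \<union> residue_class (zeta3 * zeta3)) = {}"
    "residue_class zeta3 \<inter> residue_class (zeta3 * zeta3) = {}"
    using zeta3_ne_1 zeta3_sq_ne_1 unfolding residue_class_def by auto
qed

lemma infsum_residue_classes:
  fixes f :: "complex \<Rightarrow> 'a::banach"
  assumes "f summable_on eisenstein"
  shows "infsum f eisenstein = infsum f (residue_class 1) + (infsum f (residue_class zeta3) + infsum f (residue_class (zeta3 * zeta3)))"
proof -
  have s: "f summable_on residue_class w" for w by (rule summable_on_subset_banach[OF assms]) (auto simp: residue_class_def)
  have s': "f summable_on residue_class zeta3 \<union> residue_class (zeta3 * zeta3)"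
    by (rule summable_on_subset_banach[OF assms]) (auto simp: residue_class_def)
  have "infsum f eisenstein = infsum f (residue_class 1) + infsum f (residue_class zeta3 \<union> residue_class (zeta3 * zeta3))"
    unfolding residue_classes(1) by (rule infsum_Un_disjoint[OF s s' residue_classes(2)])
  thus ?thesis unfolding infsum_Un_disjoint[OF s s residue_classes(3)] .
qed

lemma residue_class_minus: "residue_class (zeta3 * zeta3) = uminus ` residue_class zeta3"
proof -
  have r: "rho (- m) = rho m * rho m" if "m \<in> eisenstein" for m
  proof -
    have "rho (- m) = rho (- m) * rho m ^ 3" using rho_values(1)[OF that] by simp
    also have "\<dots> = (rho (- m) * rho m) * (rho m * rho m)" by (simp only: power3_eq_cube mult_ac)
    finally show ?thesis unfolding rho_minus by simp
  qed
  have z: "zeta3 * zeta3 * (zeta3 * zeta3) = zeta3" using zeta3_cube by (simp add: power3_eq_cube mult_ac)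
  show ?thesis
  proof (intro equalityI subsetI)
    fix m assume m: "m \<in> residue_class (zeta3 * zeta3)"
    hence "- m \<in> residue_class zeta3" using r[of m] z unfolding residue_class_def by simp
    thus "m \<in> uminus ` residue_class zeta3" by (intro image_eqI[of _ _ "- m"]) auto
  next
    fix m assume "m \<in> uminus ` residue_class zeta3"
    then obtain n where "m = - n" "n \<in> residue_class zeta3" by blast
    thus "m \<in> residue_class (zeta3 * zeta3)" using r[of n] unfolding residue_class_def by simp
  qed
qed

definition ln5_weight :: "complex \<Rightarrow> real" where
  "ln5_weight m = exp (- ln 5 * (cmod m)\<^sup>2)"

lemma ln5_weight_summable: "A \<subseteq> eisenstein \<Longrightarrow> ln5_weight summable_on A"
  using summable_on_subset_banach[of ln5_weight eisenstein A] summable_eis_gauss[of "ln 5" 0] unfolding ln5_weight_def by simp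

text \<open>The class of 0 consists of the multiples of \<open>sqrt_m3\<close>. The other two
  classes are exchanged by the sign, so each has weight at most (2.28 - 1) / 2 = 0.64, of which
  three units of weight 1/5 take up 0.6.\<close>

lemma residue_class_weights:
  "infsum ln5_weight (residue_class 1 - {0}) \<le> 72/1000"
  "infsum ln5_weight (residue_class zeta3) \<le> 64/100"
  "infsum ln5_weight (residue_class zeta3 - {1, zeta3, zeta3 * zeta3}) \<le> 4/100"
proof -
  have sub: "residue_class w \<subseteq> eisenstein" for w unfolding residue_class_def by auto
  note s = ln5_weight_summable[OF sub] ln5_weight_summable[OF subset_trans[OF Diff_subset sub]]
  have z0: "0 \<in> residue_class 1" unfolding residue_class_def by simp
  have w0: "ln5_weight 0 = 1" unfolding ln5_weight_def by simp
  have split0: "infsum ln5_weight (residue_class 1) = 1 + infsum ln5_weight (residue_class 1 - {0})"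
  proof -
    have "residue_class 1 = {0} \<union> (residue_class 1 - {0})" using z0 by auto
    hence "infsum ln5_weight (residue_class 1) = infsum ln5_weight ({0} \<union> (residue_class 1 - {0}))" by simp
    also have "\<dots> = infsum ln5_weight {0} + infsum ln5_weight (residue_class 1 - {0})" by (rule infsum_Un_disjoint) (use s in auto)
    finally show ?thesis using w0 by simp
  qed
  have r1: "residue_class 1 = (\<lambda>m. sqrt_m3 * m) ` eisenstein"
  proof (intro equalityI subsetI)
    fix m assume "m \<in> residue_class 1"
    hence "tors * m \<in> eisenstein" using rho_values(2) unfolding residue_class_def by auto
    thus "m \<in> (\<lambda>m. sqrt_m3 * m) ` eisenstein" by (intro image_eqI[of _ _ "tors * m"]) auto
  next
    fix m assume "m \<in> (\<lambda>m. sqrt_m3 * m) ` eisenstein"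
    then obtain n where n: "m = sqrt_m3 * n" "n \<in> eisenstein" by blast
    have "tors * m = n" unfolding n by simp
    thus "m \<in> residue_class 1" using n rho_eq_1[of m] unfolding residue_class_def by auto
  qed
  have "infsum ln5_weight (residue_class 1) = (\<Sum>\<^sub>\<infinity>m\<in>eisenstein. ln5_weight (sqrt_m3 * m))"
    unfolding r1 by (subst infsum_reindex) (auto simp: inj_on_def o_def)
  also have "\<dots> = (\<Sum>\<^sub>\<infinity>m\<in>eisenstein. exp (- (3 * ln 5) * (cmod m)\<^sup>2))"
    by (intro infsum_cong) (simp add: ln5_weight_def norm_mult power_mult_distrib)
  also have "\<dots> \<le> 1072/1000" by (rule eis_gauss_sum_bounds(2))
  finally show "infsum ln5_weight (residue_class 1 - {0}) \<le> 72/1000" using split0 by simp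
  have "infsum ln5_weight (residue_class (zeta3 * zeta3)) = infsum ln5_weight (residue_class zeta3)"
  proof -
    have "ln5_weight (- m) = ln5_weight m" for m by (simp add: ln5_weight_def)
    thus ?thesis unfolding residue_class_minus by (subst infsum_reindex) (auto simp: inj_on_def o_def)
  qed
  moreover have "infsum ln5_weight (residue_class 1 - {0}) \<ge> 0" by (rule infsum_nonneg) (simp add: ln5_weight_def)
  moreover have "infsum ln5_weight eisenstein \<le> 228/100" using eis_gauss_sum_bounds(1) unfolding ln5_weight_def .
  ultimately show h1: "infsum ln5_weight (residue_class zeta3) \<le> 64/100"
    using infsum_residue_classes[OF ln5_weight_summable[OF order.refl]] split0 by linarith
  have zz: "rho (zeta3 * zeta3) = zeta3" "rho zeta3 = zeta3" using rho_zeta[of zeta3] rho_zeta[of 1] rho_1 by simp_all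
  have in1: "{1, zeta3, zeta3 * zeta3} \<subseteq> residue_class zeta3" unfolding residue_class_def using rho_1 zz by auto
  have d: "1 \<noteq> zeta3" "1 \<noteq> zeta3 * zeta3" "zeta3 \<noteq> zeta3 * zeta3" using zeta3_ne_1 zeta3_sq_ne_1 zeta3_cube by auto
  have w: "ln5_weight 1 = 1/5" "ln5_weight zeta3 = 1/5" "ln5_weight (zeta3 * zeta3) = 1/5"
    unfolding ln5_weight_def norm_mult cmod_zeta3 using exp_ln5 by simp_all
  have "infsum ln5_weight (residue_class zeta3) = infsum ln5_weight ({1, zeta3, zeta3 * zeta3} \<union> (residue_class zeta3 - {1, zeta3, zeta3 * zeta3}))"
    by (rule arg_cong[of _ _ "infsum ln5_weight"]) (use in1 in blast)
  also have "\<dots> = infsum ln5_weight {1, zeta3, zeta3 * zeta3} + infsum ln5_weight (residue_class zeta3 - {1, zeta3, zeta3 * zeta3})"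
    by (rule infsum_Un_disjoint) (use s in auto)
  also have "infsum ln5_weight {1, zeta3, zeta3 * zeta3} = 3/5" using d w by simp
  finally show "infsum ln5_weight (residue_class zeta3 - {1, zeta3, zeta3 * zeta3}) \<le> 4/100" using h1 by simp
qed

lemma norm_infsum_le:
  fixes f :: "'a \<Rightarrow> complex"
  assumes "g summable_on A" "\<And>x. x \<in> A \<Longrightarrow> cmod (f x) \<le> g x"
  shows "cmod (infsum f A) \<le> infsum g A"
proof -
  have s: "(\<lambda>x. cmod (f x)) summable_on A"
    using summable_on_dominated[OF assms] unfolding summable_on_iff_abs_summable_on_complex .
  have "cmod (infsum f A) \<le> (\<Sum>\<^sub>\<infinity>x\<in>A. cmod (f x))" by (rule norm_infsum_bound[OF s])
  also have "\<dots> \<le> infsum g A" by (rule infsum_mono[OF s assms])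
  finally show ?thesis .
qed

text \<open>The constants are 23/20, the bound for \<open>esigma_abs\<close>, times the weights of
  \<open>residue_class_weights\<close>. In the second claim invariance under \<open>zeta3\<close>
  makes the three units contribute equal terms, and the tail is measured against the same factor exp
  (- \<alpha>), so that the comparison works at every height.\<close>

lemma residue_class_theta:
  fixes t1 t2 :: complex
  defines "T \<equiv> \<lambda>v. theta_term 0 v 0 t1 t2"
  assumes h: "height t1 t2 \<ge> 9/10"
  shows "cmod (infsum (T v) (residue_class zeta3)) \<le> 736/1000"
    and "(\<And>w. dsig v (zeta3 * w) = dsig v w) \<Longrightarrow>
      cmod (infsum (T v) (residue_class zeta3)) \<ge> (3 * esigma_abs (t2 - v) - 23/100) * exp (- (cr / 2) * height t1 t2)"
    and "cmod (infsum (T v) (residue_class 1)) \<ge> esigma_abs v - 828/10000"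
proof -
  define \<alpha> where "\<alpha> = cr / 2 * height t1 t2"
  have "cr / 2 * (9/10) \<le> cr / 2 * height t1 t2" using h cr_pos by (intro mult_left_mono) auto
  hence al: "\<alpha> \<ge> ln 5" using ln5_le unfolding \<alpha>_def by linarith
  have hp: "height t1 t2 > 0" using h by simp
  have Ts: "T v summable_on A" if "A \<subseteq> eisenstein" for A v
    unfolding T_def by (rule summable_on_subset_banach[OF theta_summable[OF hp] that])
  have nT: "cmod (T v m) = exp (- \<alpha> * (cmod m)\<^sup>2) * esigma_abs (m * t2 - v)" for m v
    unfolding T_def norm_theta_term \<alpha>_def by simp
  have b: "cmod (T v m) \<le> 23/20 * exp (- \<alpha> * (cmod m)\<^sup>2)" for m v
    unfolding nT using mult_left_mono[OF esigma_abs_le[of "m * t2 - v"], of "exp (- \<alpha> * (cmod m)\<^sup>2)"] by simp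
  have b': "cmod (T v m) \<le> 23/20 * ln5_weight m" for m v
  proof -
    have "exp (- \<alpha> * (cmod m)\<^sup>2) \<le> ln5_weight m" unfolding ln5_weight_def using al by (simp add: mult_right_mono)
    thus ?thesis using b[of v m] by linarith
  qed
  have sub: "residue_class w \<subseteq> eisenstein" for w unfolding residue_class_def by auto
  note s = ln5_weight_summable[OF sub] ln5_weight_summable[OF subset_trans[OF Diff_subset sub]]
  have Tr: "T v summable_on residue_class w" "T v summable_on residue_class w - B" for v w B
    by (intro Ts; use sub[of w] in blast)+
  show "cmod (infsum (T v) (residue_class zeta3)) \<le> 736/1000"
  proof -
    have "cmod (infsum (T v) (residue_class zeta3)) \<le> 23/20 * infsum ln5_weight (residue_class zeta3)"
      using norm_infsum_le[OF summable_on_cmult_right[OF s(1)[of zeta3], of "23/20"] b'[of v]] by (simp only: infsum_cmult_right')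
    thus ?thesis using residue_class_weights(2) by linarith
  qed
  show "cmod (infsum (T v) (residue_class 1)) \<ge> esigma_abs v - 828/10000"
  proof -
    have z0: "0 \<in> residue_class 1" unfolding residue_class_def by simp
    have "residue_class 1 = {0} \<union> (residue_class 1 - {0})" using z0 by auto
    hence "infsum (T v) (residue_class 1) = infsum (T v) ({0} \<union> (residue_class 1 - {0}))" by simp
    also have "\<dots> = T v 0 + infsum (T v) (residue_class 1 - {0})"
      using infsum_Un_disjoint[of "T v" "{0}" "residue_class 1 - {0}"] Tr by simp
    finally have e: "infsum (T v) (residue_class 1) = T v 0 + infsum (T v) (residue_class 1 - {0})" .
    have "cmod (infsum (T v) (residue_class 1 - {0})) \<le> 23/20 * infsum ln5_weight (residue_class 1 - {0})"
      using norm_infsum_le[OF summable_on_cmult_right[OF s(2)[of 1 "{0}"], of "23/20"] b'[of v]] by (simp only: infsum_cmult_right')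
    hence "cmod (infsum (T v) (residue_class 1 - {0})) \<le> 828/10000" using residue_class_weights(1) by simp
    moreover have "cmod (T v 0) = esigma_abs v" unfolding nT using esigma_abs_minus[of v] by simp
    moreover have "cmod (T v 0) - cmod (infsum (T v) (residue_class 1 - {0})) \<le> cmod (infsum (T v) (residue_class 1))"
      unfolding e by (rule norm_diff_ineq)
    ultimately show ?thesis by linarith
  qed
  assume dz: "\<And>w. dsig v (zeta3 * w) = dsig v w"
  define D where "D = residue_class zeta3 - {1, zeta3, zeta3 * zeta3}"
  have zz: "rho (zeta3 * zeta3) = zeta3" "rho zeta3 = zeta3" using rho_zeta[of zeta3] rho_zeta[of 1] rho_1 by simp_all
  have in1: "{1, zeta3, zeta3 * zeta3} \<subseteq> residue_class zeta3" unfolding residue_class_def using rho_1 zz by auto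
  have d: "1 \<noteq> zeta3" "1 \<noteq> zeta3 * zeta3" "zeta3 \<noteq> zeta3 * zeta3" using zeta3_ne_1 zeta3_sq_ne_1 zeta3_cube by auto
  have Tz: "T v (zeta3 * m) = T v m" for m
  proof -
    have "zeta3 * m * cnj (zeta3 * m) = (zeta3 * cnj zeta3) * (m * cnj m)" by (simp only: complex_cnj_mult mult_ac)
    hence e: "zeta3 * m * cnj (zeta3 * m) = m * cnj m" unfolding zeta3_cnj by simp
    have Tf: "T v m = exp (cc * (t1 * (m * cnj m))) * dsig v (m * t2)" for m unfolding T_def theta_term_def by simp
    show ?thesis unfolding Tf e mult.assoc[of zeta3 m t2] dz ..
  qed
  have "infsum (T v) (residue_class zeta3) = infsum (T v) ({1, zeta3, zeta3 * zeta3} \<union> D)"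
    by (rule arg_cong[of _ _ "infsum (T v)"]) (use in1 in \<open>unfold D_def, blast\<close>)
  also have "\<dots> = infsum (T v) {1, zeta3, zeta3 * zeta3} + infsum (T v) D"
    by (rule infsum_Un_disjoint) (use Tr in \<open>auto simp: D_def\<close>)
  also have "infsum (T v) {1, zeta3, zeta3 * zeta3} = T v 1 + T v (zeta3 * 1) + T v (zeta3 * (zeta3 * 1))" using d by simp
  also have "\<dots> = 3 * T v 1" unfolding Tz by simp
  finally have e: "infsum (T v) (residue_class zeta3) = 3 * T v 1 + infsum (T v) D" .
  \<comment> \<open>Points of \<open>D\<close> have norm at least 1, so a factor exp (- \<alpha>)
    can be split off; the 5 is exp (ln 5) and compensates for keeping the full weight.\<close>
  have bD: "cmod (T v m) \<le> (23/20 * (5 * exp (- \<alpha>))) * ln5_weight m" if m: "m \<in> D" for m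
  proof -
    have mO: "m \<in> eisenstein" "m \<noteq> 0" using m zeta3_ne_1 unfolding D_def residue_class_def by auto
    obtain k :: int where k: "k \<ge> 0" "(cmod m)\<^sup>2 = of_int k" using eis_norm_int[OF mO(1)] by metis
    have "k \<noteq> 0" using k mO(2) by auto
    hence k1: "(cmod m)\<^sup>2 - 1 \<ge> 0" using k by simp
    have "ln 5 * ((cmod m)\<^sup>2 - 1) \<le> \<alpha> * ((cmod m)\<^sup>2 - 1)" using al k1 by (rule mult_right_mono)
    hence "- \<alpha> * (cmod m)\<^sup>2 \<le> ln 5 + (- \<alpha>) + (- ln 5 * (cmod m)\<^sup>2)" by (simp add: algebra_simps)
    hence "exp (- \<alpha> * (cmod m)\<^sup>2) \<le> exp (ln 5 + (- \<alpha>) + (- ln 5 * (cmod m)\<^sup>2))" by (simp only: exp_le_cancel_iff)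
    also have "\<dots> = 5 * exp (- \<alpha>) * ln5_weight m" unfolding exp_add ln5_weight_def by simp
    finally show ?thesis using b[of v m] by simp
  qed
  have Ds: "ln5_weight summable_on D" unfolding D_def by (rule s(2))
  have "cmod (infsum (T v) D) \<le> (23/20 * (5 * exp (- \<alpha>))) * infsum ln5_weight D"
    using norm_infsum_le[OF summable_on_cmult_right[OF Ds] bD] by (simp only: infsum_cmult_right')
  also have "\<dots> \<le> (23/20 * (5 * exp (- \<alpha>))) * (4/100)"
    using residue_class_weights(3) unfolding D_def by (intro mult_left_mono) auto
  finally have 1: "cmod (infsum (T v) D) \<le> 23/100 * exp (- \<alpha>)" by simp
  have "cmod (3 * T v 1) = 3 * esigma_abs (t2 - v) * exp (- \<alpha>)" unfolding norm_mult nT by simp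
  moreover have "cmod (3 * T v 1) - cmod (infsum (T v) D) \<le> cmod (infsum (T v) (residue_class zeta3))"
    unfolding e by (rule norm_diff_ineq)
  ultimately have "3 * esigma_abs (t2 - v) * exp (- \<alpha>) - 23/100 * exp (- \<alpha>) \<le> cmod (infsum (T v) (residue_class zeta3))"
    using 1 by linarith
  thus "cmod (infsum (T v) (residue_class zeta3)) \<ge> (3 * esigma_abs (t2 - v) - 23/100) * exp (- (cr / 2) * height t1 t2)"
    unfolding \<alpha>_def by (simp add: algebra_simps)
qed

text \<open>For \<open>v3 = 0\<close> the choices 0, \<open>- tors\<close>, \<open>tors\<close> of
  \<open>v1\<close> only multiply the three class sums by values of \<open>rho\<close> or of its
  square. The class of 0 dominates because 0.95 - 0.0828 > 0.736, and one of the others is nonzero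
  because the sigma function cannot be small at both \<open>t2 - tors\<close> and
  \<open>t2 + tors\<close>.\<close>

lemma high_theta_values:
  assumes h: "height t1 t2 \<ge> 9/10"
  obtains g0 g1 g2 where "theta3 0 tors 0 t1 t2 = g0 + (g1 + g2)"
    "theta3 (- tors) tors 0 t1 t2 = g0 + (zeta3 * g1 + zeta3 * zeta3 * g2)"
    "theta3 tors tors 0 t1 t2 = g0 + (zeta3 * zeta3 * g1 + zeta3 * g2)"
    "cmod g1 < cmod g0" "cmod g2 < cmod g0" "g1 \<noteq> 0 \<or> g2 \<noteq> 0"
proof -
  define T where "T = (\<lambda>v. theta_term 0 v 0 t1 t2)"
  note R = residue_class_theta[OF h]
  define g where "g = (\<lambda>w. infsum (T tors) (residue_class w))"
  have hp: "height t1 t2 > 0" using h by simp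
  have f: "theta3 v tors 0 t1 t2 = c 1 * g 1 + (c zeta3 * g zeta3 + c (zeta3 * zeta3) * g (zeta3 * zeta3))"
    if c: "\<And>m. m \<in> eisenstein \<Longrightarrow> exp (cc * (m * cnj v - cnj m * v)) = c (rho m)" for v c
  proof -
    have t: "theta_term v tors 0 t1 t2 m = c (rho m) * T tors m" if "m \<in> eisenstein" for m
      unfolding c[OF that, symmetric] T_def theta_term_def by (simp add: distrib_left exp_add)
    have "theta3 v tors 0 t1 t2 = infsum (theta_term v tors 0 t1 t2) (residue_class 1) +
        (infsum (theta_term v tors 0 t1 t2) (residue_class zeta3) + infsum (theta_term v tors 0 t1 t2) (residue_class (zeta3 * zeta3)))"
      unfolding theta3_def by (rule infsum_residue_classes[OF theta_summable[OF hp]])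
    moreover have "infsum (theta_term v tors 0 t1 t2) (residue_class w) = c w * g w" for w
      unfolding g_def infsum_cmult_right'[symmetric] by (rule infsum_cong) (use t in \<open>auto simp: residue_class_def\<close>)
    ultimately show ?thesis by simp
  qed
  have z4: "zeta3 * zeta3 * (zeta3 * zeta3) = zeta3" using zeta3_cube by (simp add: power3_eq_cube mult_ac)
  have c1: "exp (cc * (m * cnj (- tors) - cnj m * (- tors))) = rho m" for m
    unfolding rho_def by (simp add: field_simps)
  have c2: "exp (cc * (m * cnj tors - cnj m * tors)) = rho m * rho m" if "m \<in> eisenstein" for m
  proof -
    have "exp (cc * (m * cnj tors - cnj m * tors)) = rho (- m)" unfolding rho_def by (simp add: field_simps)
    also have "\<dots> = rho (- m) * rho m ^ 3" using rho_values(1)[OF that] by simp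
    also have "\<dots> = (rho (- m) * rho m) * (rho m * rho m)" by (simp only: power3_eq_cube mult_ac)
    finally show ?thesis unfolding rho_minus by simp
  qed
  have g2: "g (zeta3 * zeta3) = - infsum (T (- tors)) (residue_class zeta3)"
  proof -
    have "g (zeta3 * zeta3) = (\<Sum>\<^sub>\<infinity>m\<in>residue_class zeta3. T tors (- m))"
      unfolding g_def residue_class_minus by (subst infsum_reindex) (auto simp: inj_on_def o_def)
    also have "\<dots> = (\<Sum>\<^sub>\<infinity>m\<in>residue_class zeta3. - T (- tors) m)"
    proof (rule infsum_cong)
      fix m
      have "dsig tors (- m * t2) = - dsig (- tors) (m * t2)" using dsig_minus[of tors "- (m * t2)"] by simp
      thus "T tors (- m) = - T (- tors) m" unfolding T_def theta_term_def by simp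
    qed
    finally show ?thesis unfolding infsum_uminus .
  qed
  have dz: "dsig tors (zeta3 * w) = dsig tors w" "dsig (- tors) (zeta3 * w) = dsig (- tors) w" for w
    by (rule dsig_tors_zeta, rule dsig_minus_tors_zeta)
  have "cmod (g 1) \<ge> 867/1000" using R(3)[of tors] esigma_abs_torsion unfolding g_def T_def by linarith
  moreover have "cmod (g zeta3) \<le> 736/1000" unfolding g_def T_def by (rule R(1))
  moreover have "cmod (g (zeta3 * zeta3)) \<le> 736/1000" unfolding g2 norm_minus_cancel T_def by (rule R(1))
  ultimately have lt: "cmod (g zeta3) < cmod (g 1)" "cmod (g (zeta3 * zeta3)) < cmod (g 1)" by linarith+
  \<comment> \<open>The two translates shift the centre of the Gaussian by 2/3 and by -2/3. Whatever
    the fractional part \<open>y\<close> of \<open>x\<close>, one of the shifted values is within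
    1/3 of an integer.\<close>
  have "esigma_abs (t2 - tors) \<ge> 1/5 \<or> esigma_abs (t2 - - tors) \<ge> 1/5"
  proof -
    define x where "x = 1/2 + 2 * Im t2 / sqrt 3"
    have it: "Im tors = - (sqrt 3 / 3)" unfolding tors_conv by simp
    have e: "1/2 + 2 * Im (t2 - tors) / sqrt 3 = x + 2/3" "1/2 + 2 * Im (t2 - - tors) / sqrt 3 = x - 2/3"
      unfolding minus_complex.simps uminus_complex.simps it x_def by (simp_all add: field_simps)
    define n where "n = \<lfloor>x\<rfloor>"
    define y where "y = x - of_int n"
    have y: "0 \<le> y" "y < 1" unfolding y_def n_def by linarith+
    show ?thesis
    proof (cases "y \<le> 2/3")
      case True
      have "\<bar>of_int (- n - 1) + (1/2 + 2 * Im (t2 - tors) / sqrt 3)\<bar> \<le> 1/3"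
      proof -
        have "of_int (- n - 1) + (x + 2/3) = y - 1/3" unfolding y_def by simp
        thus ?thesis unfolding e using y True by (intro abs_leI) linarith+
      qed
      thus ?thesis using esigma_abs_ge_quarter by blast
    next
      case False
      have "\<bar>of_int (- n) + (1/2 + 2 * Im (t2 - - tors) / sqrt 3)\<bar> \<le> 1/3"
      proof -
        have "of_int (- n) + (x - 2/3) = y - 2/3" unfolding y_def by simp
        thus ?thesis unfolding e using y False by (intro abs_leI) linarith+
      qed
      thus ?thesis using esigma_abs_ge_quarter by blast
    qed
  qed
  moreover have pos: "(3 * r - 23/100) * exp (- (cr / 2) * height t1 t2) > 0" if "r \<ge> 1/5" for r
    using that by (intro mult_pos_pos) auto
  ultimately have nz: "g zeta3 \<noteq> 0 \<or> g (zeta3 * zeta3) \<noteq> 0"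
    using less_le_trans[OF pos R(2)[OF dz(1)]] less_le_trans[OF pos R(2)[OF dz(2)]]
    unfolding g2 unfolding g_def T_def by fastforce
  show ?thesis
    using that[of "g 1" "g zeta3" "g (zeta3 * zeta3)"] f[of 0 "\<lambda>_. 1"] f[of "- tors" "\<lambda>r. r"] f[of tors "\<lambda>r. r * r"] c1 c2 lt nz
    unfolding z4 by simp
qed

section \<open>Reduction theory\<close>

text \<open>The six units are 60 degrees apart, so one of them is within 30 degrees of
  \<open>w\<close>, whence the cosine sqrt 3 / 2.\<close>

lemma unit_direction:
  obtains b where "b \<in> eisenstein" "cmod b = 1" "sqrt 3 / 2 * cmod w \<le> Re (cnj b * w)"
proof -
  define x y where xy: "x = Re w" "y = Im w"
  have N: "(cmod w)\<^sup>2 = x\<^sup>2 + y\<^sup>2" unfolding xy by (rule cmod_power2)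
  have r3: "sqrt 3 * sqrt 3 = (3::real)" by simp
  have key: "sqrt 3 / 2 * cmod w \<le> a" if "3/4 * (x\<^sup>2 + y\<^sup>2) \<le> a\<^sup>2" "a \<ge> 0" for a
  proof (rule power2_le_imp_le)
    show "(sqrt 3 / 2 * cmod w)\<^sup>2 \<le> a\<^sup>2" using that(1) unfolding power_mult_distrib N by (simp add: power_divide)
  qed (rule that(2))
  have z: "cmod (1 + zeta3) = 1" "1 + zeta3 \<in> eisenstein"
  proof -
    have "1 + zeta3 = - (zeta3 * zeta3)" unfolding zeta3_sq by simp
    thus "cmod (1 + zeta3) = 1" by (simp only: norm_minus_cancel norm_mult cmod_zeta3)
  qed simp
  define b1 where "b1 = (if x \<ge> 0 then 1 else - 1 :: complex)"
  define b2 where "b2 = (if x * y \<ge> 0 then (if y \<ge> 0 then 1 + zeta3 else - (1 + zeta3)) else (if y \<ge> 0 then zeta3 else - zeta3))"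
  show ?thesis
  proof (cases "sqrt 3 * \<bar>y\<bar> \<le> \<bar>x\<bar>")
    case True
    have "(sqrt 3 * \<bar>y\<bar>)\<^sup>2 \<le> \<bar>x\<bar>\<^sup>2" using True by (intro power_mono) auto
    hence "3 * y\<^sup>2 \<le> x\<^sup>2" by (simp add: power_mult_distrib)
    hence "sqrt 3 / 2 * cmod w \<le> \<bar>x\<bar>" by (intro key) auto
    moreover have "Re (cnj b1 * w) = \<bar>x\<bar>" unfolding b1_def xy by simp
    ultimately show ?thesis using that[of b1] by (simp add: b1_def)
  next
    case False
    define a where "a = (\<bar>x\<bar> + sqrt 3 * \<bar>y\<bar>) / 2"
    have "\<bar>x\<bar> * \<bar>x\<bar> \<le> \<bar>x\<bar> * (sqrt 3 * \<bar>y\<bar>)" using False by (intro mult_left_mono) auto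
    hence "x\<^sup>2 \<le> sqrt 3 * (\<bar>x\<bar> * \<bar>y\<bar>)" by (simp add: power2_eq_square mult_ac)
    moreover have "a\<^sup>2 = (x\<^sup>2 + 3 * y\<^sup>2 + 2 * (sqrt 3 * (\<bar>x\<bar> * \<bar>y\<bar>))) / 4"
      unfolding a_def by (simp add: power2_eq_square field_simps)
    ultimately have "sqrt 3 / 2 * cmod w \<le> a" by (intro key) (auto simp: a_def)
    moreover have "Re (cnj b2 * w) = a"
    proof -
      have c: "Re (cnj (1 + zeta3) * w) = (x + sqrt 3 * y) / 2" "Re (cnj zeta3 * w) = (- x + sqrt 3 * y) / 2"
        "Re (cnj (- (1 + zeta3)) * w) = - ((x + sqrt 3 * y) / 2)" "Re (cnj (- zeta3) * w) = - ((- x + sqrt 3 * y) / 2)"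
        unfolding zeta3_eq xy by (simp_all add: field_simps)
      show ?thesis
      proof (cases "x * y \<ge> 0")
        case True
        hence "x \<ge> 0 \<and> y \<ge> 0 \<or> y < 0 \<and> x \<le> 0 \<or> x < 0 \<and> y = 0" by (auto simp: zero_le_mult_iff)
        moreover have "\<not> (x < 0 \<and> y = 0)" using False by auto
        ultimately consider "x \<ge> 0" "y \<ge> 0" | "y < 0" "x \<le> 0" by blast
        thus ?thesis
        proof cases
          case 1
          hence "b2 = 1 + zeta3" using True unfolding b2_def by simp
          thus ?thesis unfolding a_def using 1 by (simp only: c(1) abs_of_nonneg)
        next
          case 2
          hence "b2 = - (1 + zeta3)" using True unfolding b2_def by simp
          hence "Re (cnj b2 * w) = - ((x + sqrt 3 * y) / 2)" by (simp only: c(3))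
          thus ?thesis unfolding a_def using 2 by (simp add: field_simps)
        qed
      next
        case F: False
        then consider "x < 0" "y > 0" | "y < 0" "x > 0" by (auto simp: not_le mult_less_0_iff)
        thus ?thesis
        proof cases
          case 1
          hence "b2 = zeta3" using F unfolding b2_def by simp
          hence "Re (cnj b2 * w) = (- x + sqrt 3 * y) / 2" by (simp only: c(2))
          thus ?thesis unfolding a_def using 1 by simp
        next
          case 2
          hence "b2 = - zeta3" using F unfolding b2_def by simp
          hence "Re (cnj b2 * w) = - ((- x + sqrt 3 * y) / 2)" by (simp only: c(4))
          thus ?thesis unfolding a_def using 2 by (simp add: field_simps)
        qed
      qed
    qed
    moreover have "b2 \<in> eisenstein" "cmod b2 = 1"
      unfolding b2_def using z norm_minus_cancel[of "1 + zeta3"] by (auto simp del: minus_add_distrib)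
    ultimately show ?thesis using that[of b2] by simp
  qed
qed

definition raises :: "real \<Rightarrow> complex^2 \<Rightarrow> bool" where
  "raises k \<tau> \<longleftrightarrow> (\<exists>g\<in>lat_unitary. k * height (\<tau> $ 1) (\<tau> $ 2) \<le> height (act g \<tau> $ 1) (act g \<tau> $ 2))"

lemma lat_unitaryD: "g \<in> lat_unitary \<Longrightarrow> transpose (conj_mat g) ** herm_J ** g = herm_J"
  unfolding lat_unitary_def by simp

lemma raises_J:
  assumes \<tau>: "\<tau> \<in> siegel_domain" and le: "(cmod (\<tau> $ 1))\<^sup>2 \<le> 99/100"
  shows "raises (100/99) \<tau>"
proof -
  have h: "height (\<tau> $ 1) (\<tau> $ 2) > 0" using \<tau> by (simp add: siegel_height)
  have t0: "\<tau> $ 1 \<noteq> 0" by (rule height_pos_nz[OF h])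
  have "height (\<tau> $ 1) (\<tau> $ 2) / (99/100) \<le> height (\<tau> $ 1) (\<tau> $ 2) / (cmod (\<tau> $ 1))\<^sup>2"
    using h t0 le by (intro divide_left_mono) auto
  hence "100/99 * height (\<tau> $ 1) (\<tau> $ 2) \<le> height (act herm_J \<tau> $ 1) (act herm_J \<tau> $ 2)"
    unfolding herm_J_act height_J[OF t0] by simp
  thus ?thesis unfolding raises_def using herm_J_unitary by blast
qed

lemma raises_translate:
  assumes \<tau>: "\<tau> \<in> siegel_domain" and b: "\<beta> \<in> eisenstein" "\<gamma> \<in> eisenstein" "\<gamma> + cnj \<gamma> + \<beta> * cnj \<beta> = 0"
  shows "act (heis \<beta> \<gamma>) \<tau> \<in> siegel_domain"
    "height (act (heis \<beta> \<gamma>) \<tau> $ 1) (act (heis \<beta> \<gamma>) \<tau> $ 2) = height (\<tau> $ 1) (\<tau> $ 2)"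
    "raises k (act (heis \<beta> \<gamma>) \<tau>) \<Longrightarrow> raises k \<tau>"
proof -
  note u = unitary_height[OF lat_unitaryD[OF heis_unitary[OF b]] \<tau>]
  show 1: "act (heis \<beta> \<gamma>) \<tau> \<in> siegel_domain" by (rule u(3))
  show 2: "height (act (heis \<beta> \<gamma>) \<tau> $ 1) (act (heis \<beta> \<gamma>) \<tau> $ 2) = height (\<tau> $ 1) (\<tau> $ 2)"
    using u(2) unfolding heis_act(1) by simp
  assume "raises k (act (heis \<beta> \<gamma>) \<tau>)"
  then obtain g where g: "g \<in> lat_unitary"
    "k * height (\<tau> $ 1) (\<tau> $ 2) \<le> height (act g (act (heis \<beta> \<gamma>) \<tau>) $ 1) (act g (act (heis \<beta> \<gamma>) \<tau>) $ 2)"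
    unfolding raises_def 2 by blast
  have "act (g ** heis \<beta> \<gamma>) \<tau> = act g (act (heis \<beta> \<gamma>) \<tau>)"
    by (rule act_mult[OF u(1) unitary_height(1)[OF lat_unitaryD[OF g(1)] 1]])
  thus "raises k \<tau>" unfolding raises_def using g lat_unitary_mult[OF g(1) heis_unitary[OF b]] by metis
qed

text \<open>The remaining case of the reduction: height below 9/10, but first coordinate x + i y of
  squared modulus above 99/100. Then |y| is at least 0.73, and translating by minus a unit near the
  direction of the second coordinate moves y by sqrt 3 / 2 towards 0 while the real part stays
  within 0.8. In total 0.8^2 + 0.468^2 < 99/100. \<open>R\<close> and \<open>I\<close> are the two
  parts of the second coordinate in the frame of that unit.\<close>

lemma second_translation_bound:
  fixes h r x y R I s :: real
  assumes x: "2 * x = - (h + r\<^sup>2)" and r: "r\<^sup>2 \<le> 7/16" "r \<ge> 0" and y: "\<bar>y\<bar> \<le> sqrt 3 / 2" and n: "x\<^sup>2 + y\<^sup>2 > 99/100"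
    and h: "0 < h" "h < 9/10" and R: "sqrt 3 / 2 * r \<le> R" "R\<^sup>2 + I\<^sup>2 = r\<^sup>2"
    and s: "s = (if y > 0 then - (sqrt 3 / 2) else sqrt 3 / 2)"
  shows "(x + R - 1/2)\<^sup>2 + (y + I + s)\<^sup>2 \<le> 99/100"
proof -
  have s3: "1732/1000 \<le> sqrt (3::real)" "sqrt (3::real) \<le> 17321/10000"
    by (rule real_le_rsqrt, simp add: power2_eq_square) (rule real_le_lsqrt, simp_all add: power2_eq_square)
  have R0: "R \<ge> 0" using R(1) r(2) by (meson mult_nonneg_nonneg order_trans zero_le_divide_iff real_sqrt_ge_zero zero_le_numeral)
  have xa: "\<bar>x\<bar> \<le> 67/100" using x h r zero_le_power2[of r] by (intro abs_leI) linarith+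
  have x2: "x\<^sup>2 \<le> (67/100)\<^sup>2" using power_mono[OF xa, of 2] by simp
  have y2: "(73/100)\<^sup>2 \<le> \<bar>y\<bar>\<^sup>2" using n x2 by (simp add: power_divide)
  have y1: "73/100 \<le> \<bar>y\<bar>" by (rule power2_le_imp_le[OF y2]) simp
  have "(sqrt 3 / 2 * r)\<^sup>2 \<le> R\<^sup>2" using R(1) r(2) by (intro power_mono) auto
  hence "3/4 * r\<^sup>2 \<le> R\<^sup>2" by (simp add: power_mult_distrib power_divide)
  hence "\<bar>I\<bar>\<^sup>2 \<le> (331/1000)\<^sup>2" using R(2) r(1) by (simp add: power_divide)
  hence Ia: "\<bar>I\<bar> \<le> 331/1000" by (rule power2_le_imp_le) simp
  have "\<bar>y + s\<bar> \<le> 137/1000" using y y1 s3 unfolding s by (auto simp: abs_le_iff abs_if split: if_splits)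
  hence "\<bar>(y + s) + I\<bar> \<le> 468/1000" using Ia abs_triangle_ineq[of "y + s" I] by linarith
  moreover have "y + I + s = (y + s) + I" by simp
  ultimately have "\<bar>y + I + s\<bar> \<le> 468/1000" by (simp only:)
  hence im: "(y + I + s)\<^sup>2 \<le> (468/1000)\<^sup>2" using power_mono[of "\<bar>y + I + s\<bar>" "468/1000" 2] by simp
  have "\<bar>y\<bar>\<^sup>2 \<le> (sqrt 3 / 2)\<^sup>2" using y by (intro power_mono) auto
  hence "(48/100)\<^sup>2 \<le> \<bar>x\<bar>\<^sup>2" using n by (simp add: power_divide)
  hence "48/100 \<le> \<bar>x\<bar>" by (rule power2_le_imp_le) simp
  hence "96/100 \<le> h + r\<^sup>2" using x h zero_le_power2[of r] by (simp add: abs_if split: if_splits)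
  hence "(24/100)\<^sup>2 \<le> r\<^sup>2" using h(2) by (simp add: power_divide)
  hence r1: "24/100 \<le> r" by (rule power2_le_imp_le[OF _ r(2)])
  have r2: "r \<le> 662/1000" by (rule power2_le_imp_le) (use r in \<open>simp_all add: power_divide\<close>)
  \<comment> \<open>On the interval from 0.24 to 0.662 the square lies below its chord, which makes
    the required bound linear in \<open>r\<close>.\<close>
  have "0 \<le> (r - 24/100) * (662/1000 - r)" using r1 r2 by (intro mult_nonneg_nonneg) auto
  moreover have "(r - 24/100) * (662/1000 - r) = 902/1000 * r - 15888/100000 - r\<^sup>2"
    by (simp add: power2_eq_square field_simps)
  ultimately have q: "r\<^sup>2 \<le> 902/1000 * r - 15888/100000" by linarith
  have "1732/1000 * r \<le> sqrt 3 * r" using s3 r(2) by (intro mult_right_mono) auto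
  hence R1: "866/1000 * r \<le> R" using R(1) by linarith
  have re2: "2 * (x + R - 1/2) = - (h + r\<^sup>2 + 1 - 2 * R)" using x by (simp add: algebra_simps)
  have up: "h + r\<^sup>2 + 1 - 2 * R \<le> 16/10" using h(2) q R1 r1 by linarith
  have "R \<le> r" by (rule power2_le_imp_le) (use R(2) r(2) zero_le_power2[of I] in linarith)+
  moreover have "0 \<le> (1 - r)\<^sup>2" by simp
  ultimately have lo: "0 \<le> h + r\<^sup>2 + 1 - 2 * R" using h(1) by (simp add: power2_eq_square algebra_simps)
  have "\<bar>x + R - 1/2\<bar> \<le> 8/10" using re2 up lo by (simp add: abs_le_iff)
  hence "(x + R - 1/2)\<^sup>2 \<le> (8/10)\<^sup>2" using power_mono[of "\<bar>x + R - 1/2\<bar>" "8/10" 2] by simp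
  thus ?thesis using im by (simp add: power_divide)
qed

lemma raises_low:
  assumes \<tau>: "\<tau> \<in> siegel_domain" and h: "height (\<tau> $ 1) (\<tau> $ 2) < 9/10"
  shows "raises (100/99) \<tau>"
proof -
  obtain \<beta> \<gamma> where bg: "\<beta> \<in> eisenstein" "\<gamma> \<in> eisenstein" "\<gamma> + cnj \<gamma> + \<beta> * cnj \<beta> = 0"
    "(cmod (\<tau> $ 2 + \<beta>))\<^sup>2 \<le> 7/16" "\<bar>Im (\<tau> $ 1 - cnj \<beta> * \<tau> $ 2 + \<gamma>)\<bar> \<le> sqrt 3 / 2"
    using heis_reduce[of "\<tau> $ 2" "\<tau> $ 1"] .
  define \<sigma> where "\<sigma> = act (heis \<beta> \<gamma>) \<tau>"
  note tr = raises_translate[OF \<tau> bg(1-3), folded \<sigma>_def]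
  have s2: "(cmod (\<sigma> $ 2))\<^sup>2 \<le> 7/16" and s1: "\<bar>Im (\<sigma> $ 1)\<bar> \<le> sqrt 3 / 2" using bg(4,5) unfolding \<sigma>_def heis_act by simp_all
  have "raises (100/99) \<sigma>"
  proof (cases "(cmod (\<sigma> $ 1))\<^sup>2 \<le> 99/100")
    case False
    obtain b where b: "b \<in> eisenstein" "cmod b = 1" "sqrt 3 / 2 * cmod (\<sigma> $ 2) \<le> Re (cnj b * \<sigma> $ 2)" using unit_direction .
    define \<gamma>' where "\<gamma>' = (if Im (\<sigma> $ 1) > 0 then cnj zeta3 else zeta3)"
    have bb: "b * cnj b = 1" using b(2) complex_norm_square[of b] by simp
    have b': "- b \<in> eisenstein" "\<gamma>' \<in> eisenstein" "\<gamma>' + cnj \<gamma>' + - b * cnj (- b) = 0"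
      using b(1) bb unfolding \<gamma>'_def by (auto simp: cnj_zeta3)
    note tr' = raises_translate[OF tr(1) b']
    have hs: "0 < height (\<sigma> $ 1) (\<sigma> $ 2)" "height (\<sigma> $ 1) (\<sigma> $ 2) < 9/10"
      using h tr(1,2) by (simp_all add: siegel_height)
    have RI: "(Re (cnj b * \<sigma> $ 2))\<^sup>2 + (Im (cnj b * \<sigma> $ 2))\<^sup>2 = (cmod (\<sigma> $ 2))\<^sup>2"
      using cmod_power2[of "cnj b * \<sigma> $ 2"] b(2) by (simp add: norm_mult)
    define s where "s = (if Im (\<sigma> $ 1) > 0 then - (sqrt 3 / 2) else sqrt 3 / 2)"
    have g': "Re \<gamma>' = - (1/2)" "Im \<gamma>' = s" unfolding \<gamma>'_def s_def zeta3_eq by simp_all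
    have "(Re (\<sigma> $ 1) + Re (cnj b * \<sigma> $ 2) - 1/2)\<^sup>2 + (Im (\<sigma> $ 1) + Im (cnj b * \<sigma> $ 2) + s)\<^sup>2 \<le> 99/100"
      by (rule second_translation_bound[OF _ s2 norm_ge_zero s1 _ hs b(3) RI s_def])
         (use False in \<open>auto simp: height_def cmod_power2\<close>)
    hence "(cmod (act (heis (- b) \<gamma>') \<sigma> $ 1))\<^sup>2 \<le> 99/100"
      unfolding heis_act cmod_power2 using g' by (simp add: algebra_simps)
    thus ?thesis by (intro tr'(3) raises_J tr'(1))
  qed (rule raises_J[OF tr(1)])
  thus ?thesis by (rule tr(3))
qed

lemma mat_1_unitary: "mat 1 \<in> lat_unitary"
  using lat_unitary_mult[OF herm_J_unitary herm_J_unitary] unfolding herm_J_sq .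

lemma act_mat_1: "act (mat 1) \<tau> = \<tau>" "jfac (mat 1) \<tau> = 1"
proof -
  show j: "jfac (mat 1) \<tau> = 1" by (simp add: jfac_def mat_def)
  show "act (mat 1) \<tau> = \<tau>" unfolding vec_eq_iff forall_2 act_components j by (simp add: mat_def)
qed

text \<open>Each application of \<open>raises_low\<close> gains the fixed factor 100/99; the
  induction counts how many gains are still missing.\<close>

theorem reach_high:
  assumes "\<tau> \<in> siegel_domain"
  shows "\<exists>g\<in>lat_unitary. height (act g \<tau> $ 1) (act g \<tau> $ 2) \<ge> 9/10"
proof -
  have "\<forall>\<tau>\<in>siegel_domain. (99/100) ^ n * (9/10) \<le> height (\<tau> $ 1) (\<tau> $ 2) \<longrightarrow>
     (\<exists>g\<in>lat_unitary. height (act g \<tau> $ 1) (act g \<tau> $ 2) \<ge> 9/10)" for n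
  proof (induction n)
    case 0
    show ?case using mat_1_unitary act_mat_1 by (metis mult_1 power_0)
  next
    case (Suc n)
    show ?case
    proof (intro ballI impI)
      fix \<tau> assume \<tau>: "\<tau> \<in> siegel_domain" and h: "(99/100) ^ Suc n * (9/10) \<le> height (\<tau> $ 1) (\<tau> $ 2)"
      show "\<exists>g\<in>lat_unitary. height (act g \<tau> $ 1) (act g \<tau> $ 2) \<ge> 9/10"
      proof (cases "height (\<tau> $ 1) (\<tau> $ 2) < 9/10")
        case False
        thus ?thesis using mat_1_unitary act_mat_1 by (metis not_le)
      next
        case True
        obtain g where g: "g \<in> lat_unitary" "100/99 * height (\<tau> $ 1) (\<tau> $ 2) \<le> height (act g \<tau> $ 1) (act g \<tau> $ 2)"
          using raises_low[OF \<tau> True] unfolding raises_def by blast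
        note u = unitary_height[OF lat_unitaryD[OF g(1)] \<tau>]
        have "(99/100) ^ n * (9/10) \<le> height (act g \<tau> $ 1) (act g \<tau> $ 2)" using g(2) h by simp
        then obtain k where k: "k \<in> lat_unitary" "height (act k (act g \<tau>) $ 1) (act k (act g \<tau>) $ 2) \<ge> 9/10"
          using Suc.IH u(3) by blast
        have "act (k ** g) \<tau> = act k (act g \<tau>)" by (rule act_mult[OF u(1) unitary_height(1)[OF lat_unitaryD[OF k(1)] u(3)]])
        thus ?thesis using k lat_unitary_mult[OF k(1) g(1)] by metis
      qed
    qed
  qed
  moreover obtain n where "(99/100) ^ n * (9/10) \<le> height (\<tau> $ 1) (\<tau> $ 2)"
  proof -
    obtain n where "(99/100 :: real) ^ n < height (\<tau> $ 1) (\<tau> $ 2)"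
      using real_arch_pow_inv[of "height (\<tau> $ 1) (\<tau> $ 2)" "99/100"] assms by (auto simp: siegel_height)
    moreover have "(99/100 :: real) ^ n * (9/10) \<le> (99/100) ^ n" by simp
    ultimately show ?thesis using that[of n] by linarith
  qed
  ultimately show ?thesis using assms by blast
qed

section \<open>Cube roots over a convex domain\<close>

lemma cube_root_of_unity:
  assumes "(w::complex) ^ 3 = 1"
  shows "w = 1 \<or> w = zeta3 \<or> w = zeta3 * zeta3" "w * cnj w = 1" "w \<noteq> 0" "w * (w * w) = 1"
proof -
  show w3: "w * (w * w) = 1" using assms by (simp add: power3_eq_cube mult.assoc)
  have "(w - 1) * (w - zeta3) * (w - zeta3 * zeta3) = 0"
    using w3 zeta3_sq by algebra
  thus *: "w = 1 \<or> w = zeta3 \<or> w = zeta3 * zeta3" by auto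
  have "zeta3 * zeta3 * cnj (zeta3 * zeta3) = (zeta3 * cnj zeta3) * (zeta3 * cnj zeta3)" by (simp only: complex_cnj_mult mult_ac)
  thus "w * cnj w = 1" using * zeta3_cnj by auto
  show "w \<noteq> 0" using w3 by auto
qed

lemma cube_roots_apart:
  assumes "(w::complex) ^ 3 = 1" "w' ^ 3 = 1" "cmod (w - w') < 1" shows "w = w'"
proof -
  have 1: "cmod (1 - zeta3) = sqrt 3" "cmod (1 - zeta3 * zeta3) = sqrt 3" "cmod (zeta3 - zeta3 * zeta3) = sqrt 3"
  proof -
    have "zeta3 - zeta3 * zeta3 = sqrt_m3" unfolding zeta3_sq sqrt_m3_conv by simp
    thus 3: "cmod (zeta3 - zeta3 * zeta3) = sqrt 3" by simp
    have "zeta3 - zeta3 * zeta3 = zeta3 * (1 - zeta3)" by (simp add: algebra_simps)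
    thus "cmod (1 - zeta3) = sqrt 3" using 3 by (simp add: norm_mult)
    moreover have "1 - zeta3 * zeta3 = - (zeta3 * zeta3) * (1 - zeta3)" using zeta3_cube by (simp add: algebra_simps power3_eq_cube)
    ultimately show "cmod (1 - zeta3 * zeta3) = sqrt 3" by (simp add: norm_mult)
  qed
  have "\<not> sqrt 3 < (1::real)" by simp
  thus ?thesis
    using cube_root_of_unity(1)[OF assms(1)] cube_root_of_unity(1)[OF assms(2)] assms(3) 1
      norm_minus_commute[of zeta3 1] norm_minus_commute[of "zeta3 * zeta3" 1] norm_minus_commute[of "zeta3 * zeta3" zeta3] by auto
qed

text \<open>The fibre over \<open>(A, W, F)\<close> with \<open>A W = F^3\<close>: remembering both cube roots and their product keeps
  the fibre of size three where one of \<open>A\<close>, \<open>W\<close> vanishes.\<close>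

definition root_pair :: "complex \<Rightarrow> complex \<Rightarrow> complex \<Rightarrow> complex \<Rightarrow> complex \<Rightarrow> bool" where
  "root_pair A W F a b \<longleftrightarrow> a ^ 3 = A \<and> b ^ 3 = W \<and> a * b = F"

text \<open>The cube root of unity relating two points of a fibre, in a form that stays continuous
  where \<open>a\<close> or \<open>b\<close> vanishes: if a' = w a and b' = w^2 b, the quotient is
  w, because cnj (w^2) = w.\<close>

definition root_ratio :: "complex \<Rightarrow> complex \<Rightarrow> complex \<Rightarrow> complex \<Rightarrow> complex" where
  "root_ratio a b a' b' = (a' * cnj a + cnj b' * b) / (a * cnj a + b * cnj b)"

lemma root_ratio_denom: "a \<noteq> 0 \<or> b \<noteq> 0 \<Longrightarrow> a * cnj a + b * cnj b \<noteq> 0"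
proof
  assume ab: "a \<noteq> 0 \<or> b \<noteq> 0" and "a * cnj a + b * cnj b = 0"
  moreover have "complex_of_real ((cmod a)\<^sup>2 + (cmod b)\<^sup>2) = a * cnj a + b * cnj b"
    by (simp only: of_real_add complex_norm_square)
  ultimately have "complex_of_real ((cmod a)\<^sup>2 + (cmod b)\<^sup>2) = 0" by simp
  hence "(cmod a)\<^sup>2 + (cmod b)\<^sup>2 = 0" by (simp only: of_real_eq_0_iff)
  thus False using ab by (simp add: sum_power2_eq_zero_iff)
qed

lemma root_pair_rotate: "root_pair A W F a b \<Longrightarrow> w ^ 3 = 1 \<Longrightarrow> root_pair A W F (w * a) (w * w * b)"
  unfolding root_pair_def by (simp add: power_mult_distrib) (simp add: power3_eq_cube algebra_simps; metis mult.assoc mult_1)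

lemma root_pair_ratio:
  assumes "a \<noteq> 0 \<or> b \<noteq> 0" "w ^ 3 = 1"
  shows "root_ratio a b (w * a) (w * w * b) = w"
proof -
  note w = cube_root_of_unity(2,4)[OF assms(2)]
  have "cnj w * cnj w = w" using w by (metis complex_cnj_mult mult.commute mult.left_commute mult_1 mult.right_neutral)
  hence "w * a * cnj a + cnj (w * w * b) * b = w * (a * cnj a + b * cnj b)" by (simp add: algebra_simps)
  thus ?thesis unfolding root_ratio_def using root_ratio_denom[OF assms(1)] by simp
qed

lemma root_pair_unique:
  assumes ab: "a \<noteq> 0 \<or> b \<noteq> 0" and p: "root_pair A W F a b" and q: "root_pair A W F a' b'"
  obtains w where "w ^ 3 = 1" "a' = w * a" "b' = w * w * b"
proof (cases "a = 0")
  case False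
  define w where "w = a' / a"
  have w: "w ^ 3 = 1" "a' = w * a" using p q False unfolding w_def root_pair_def by (auto simp: power_divide)
  have "w * a * b' = a * b" using p q w(2) unfolding root_pair_def by simp
  hence "w * b' = b" using False by (simp add: mult_ac)
  hence "b' = w * w * b" using cube_root_of_unity(4)[OF w(1)] by (metis mult.assoc mult_1)
  thus ?thesis using that w by blast
next
  case True
  hence b: "b \<noteq> 0" using ab by simp
  define u where "u = b' / b"
  have u: "u ^ 3 = 1" "b' = u * b" using p q b unfolding u_def root_pair_def by (auto simp: power_divide)
  note u3 = cube_root_of_unity(4)[OF u(1)]
  have "a' * (u * b) = a * b" using p q u(2) unfolding root_pair_def by simp
  hence "a' * u = a" using b by (simp add: mult.assoc[symmetric])
  hence "a' = (u * u) * a" using u3 by (metis mult.assoc mult.commute mult_1)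
  moreover have "(u * u) ^ 3 = 1" using u(1) by (simp add: power_mult_distrib)
  moreover have "b' = (u * u) * (u * u) * b" using u(2) u3 by (metis mult.assoc mult_1)
  ultimately show ?thesis using that by blast
qed

section \<open>The threefold covering and its lift\<close>

lemma local_cube_root:
  fixes A W F :: "'a::real_normed_vector \<Rightarrow> complex"
  assumes S: "open S" "x \<in> S" and c: "continuous_on S A" "continuous_on S F"
    and AW: "\<And>t. t \<in> S \<Longrightarrow> A t * W t = F t ^ 3" and x: "A x \<noteq> 0"
  obtains T a b where "open T" "x \<in> T" "T \<subseteq> S" "continuous_on T a" "continuous_on T b"
    "\<And>t. t \<in> T \<Longrightarrow> root_pair (A t) (W t) (F t) (a t) (b t)" "\<And>t. t \<in> T \<Longrightarrow> a t \<noteq> 0"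
proof -
  define f where "f = (\<lambda>t. A t / A x)"
  define T where "T = S \<inter> f -` {z. Re z > 0}"
  have cf: "continuous_on S f" unfolding f_def by (intro continuous_intros c) (use x in auto)
  have oT: "open T" unfolding T_def by (rule continuous_open_preimage[OF cf S(1) open_halfspace_Re_gt])
  have TS: "T \<subseteq> S" unfolding T_def by auto
  have xT: "x \<in> T" unfolding T_def f_def using S(2) x by simp
  define a where "a = (\<lambda>t. exp (Ln (A x) / 3) * exp (Ln (f t) / 3))"
  define b where "b = (\<lambda>t. F t / a t)"
  have f0: "f t \<notin> \<real>\<^sub>\<le>\<^sub>0" "f t \<noteq> 0" if "t \<in> T" for t
    using that unfolding T_def by (auto simp: complex_nonpos_Reals_iff)
  have ca: "continuous_on T a" unfolding a_def
    by (intro continuous_intros continuous_on_subset[OF cf TS]) (use f0 in auto)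
  have a0: "a t \<noteq> 0" for t unfolding a_def by simp
  have cb: "continuous_on T b" unfolding b_def
    by (intro continuous_intros ca continuous_on_subset[OF c(2) TS]) (use a0 in auto)
  have e: "exp (Ln z / 3) ^ 3 = z" if "z \<noteq> 0" for z
    using that unfolding exp_of_nat_mult[symmetric] by simp
  have a3: "a t ^ 3 = A t" if t: "t \<in> T" for t
    unfolding a_def power_mult_distrib e[OF x] e[OF f0(2)[OF t]] unfolding f_def using x by simp
  have "root_pair (A t) (W t) (F t) (a t) (b t)" if t: "t \<in> T" for t
  proof -
    have "b t ^ 3 = F t ^ 3 / A t" unfolding b_def power_divide a3[OF t] ..
    also have "\<dots> = W t"
    proof -
      have "A t \<noteq> 0" using a3[OF t] a0[of t] by auto
      moreover have "A t * W t = F t ^ 3" using AW TS t by blast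
      ultimately show ?thesis by (metis nonzero_mult_div_cancel_left)
    qed
    finally show ?thesis unfolding root_pair_def using a3[OF t] a0[of t] by (simp add: b_def)
  qed
  thus ?thesis using that oT xT TS ca cb a0 by blast
qed

definition root_space :: "'a set \<Rightarrow> ('a \<Rightarrow> complex) \<Rightarrow> ('a \<Rightarrow> complex) \<Rightarrow> ('a \<Rightarrow> complex) \<Rightarrow> ('a \<times> complex \<times> complex) set" where
  "root_space S A W F = {(t, a, b). t \<in> S \<and> root_pair (A t) (W t) (F t) a b}"

lemma root_space_covering:
  fixes A W F :: "'a::real_normed_vector \<Rightarrow> complex"
  assumes S: "open S" and c: "continuous_on S A" "continuous_on S W" "continuous_on S F"
    and AW: "\<And>t. t \<in> S \<Longrightarrow> A t * W t = F t ^ 3" and nz: "\<And>t. t \<in> S \<Longrightarrow> A t \<noteq> 0 \<or> W t \<noteq> 0"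
  shows "covering_space (root_space S A W F) fst S"
proof -
  define C where "C = root_space S A W F"
  have loc: "\<exists>T a b. open T \<and> x \<in> T \<and> T \<subseteq> S \<and> continuous_on T a \<and> continuous_on T b \<and>
      (\<forall>t\<in>T. root_pair (A t) (W t) (F t) (a t) (b t) \<and> (a t \<noteq> 0 \<or> b t \<noteq> 0))" if x: "x \<in> S" for x
  proof (cases "A x = 0")
    case False
    show ?thesis by (rule local_cube_root[OF S x c(1,3) AW False]) blast+
  next
    case True
    hence W: "W x \<noteq> 0" using nz[OF x] by simp
    have WA: "W t * A t = F t ^ 3" if "t \<in> S" for t using AW[OF that] by (simp add: mult.commute)
    show ?thesis
    proof (rule local_cube_root[OF S x c(2,3) WA W])
      fix T a b assume *: "open T" "x \<in> T" "T \<subseteq> S" "continuous_on T a" "continuous_on T b"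
        "\<And>t. t \<in> T \<Longrightarrow> root_pair (W t) (A t) (F t) (a t) (b t)" "\<And>t. t \<in> T \<Longrightarrow> a t \<noteq> 0"
      have "root_pair (A t) (W t) (F t) (b t) (a t)" if "t \<in> T" for t
        using *(6)[OF that] unfolding root_pair_def by (simp add: mult.commute)
      thus ?thesis using * by blast
    qed
  qed
  show ?thesis unfolding covering_space_def C_def[symmetric]
  proof (intro conjI ballI)
    show "continuous_on C fst" by (intro continuous_intros)
    show "fst ` C = S"
    proof (intro equalityI subsetI)
      fix t assume t: "t \<in> S"
      obtain T a b where "t \<in> T" "\<forall>t\<in>T. root_pair (A t) (W t) (F t) (a t) (b t)" using loc[OF t] by blast
      hence "(t, a t, b t) \<in> C" unfolding C_def root_space_def using t by auto
      thus "t \<in> fst ` C" by force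
    qed (auto simp: C_def root_space_def)
    fix x assume x: "x \<in> S"
    obtain T a b where T: "open T" "x \<in> T" "T \<subseteq> S" and ca: "continuous_on T a" and cb: "continuous_on T b"
      and rp: "\<And>t. t \<in> T \<Longrightarrow> root_pair (A t) (W t) (F t) (a t) (b t)" and ab: "\<And>t. t \<in> T \<Longrightarrow> a t \<noteq> 0 \<or> b t \<noteq> 0"
      using loc[OF x] by blast
    define q where "q = (\<lambda>w t. (t, w * a t, w * w * b t))"
    define V where "V = (\<lambda>w. q w ` T)"
    define \<Omega> where "\<Omega> = {w::complex. w ^ 3 = 1}"
    define CT where "CT = C \<inter> fst -` T"
    have VC: "V w \<subseteq> CT" if "w \<in> \<Omega>" for w
      using that root_pair_rotate[OF rp] T(3) unfolding V_def q_def CT_def C_def root_space_def \<Omega>_def by auto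
    define R where "R = (\<lambda>y. root_ratio (a (fst y)) (b (fst y)) (fst (snd y)) (snd (snd y)))"
    have Rq: "R (q w t) = w" if "w \<in> \<Omega>" "t \<in> T" for w t
      unfolding R_def q_def using root_pair_ratio[OF ab[OF that(2)]] that(1) by (simp add: \<Omega>_def)
    have un: "\<exists>w\<in>\<Omega>. y = q w (fst y)" if y: "y \<in> CT" for y
    proof -
      obtain t a' b' where y': "y = (t, a', b')" by (cases y) auto
      have t: "t \<in> T" "root_pair (A t) (W t) (F t) a' b'" using y unfolding y' CT_def C_def root_space_def by auto
      show ?thesis by (rule root_pair_unique[OF ab[OF t(1)] rp[OF t(1)] t(2)]) (auto simp: y' q_def \<Omega>_def)
    qed
    have cR: "continuous_on CT R"
    proof -
      have fT: "fst ` CT \<subseteq> T" unfolding CT_def by auto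
      have c': "continuous_on CT (\<lambda>y. a (fst y))" "continuous_on CT (\<lambda>y. b (fst y))"
        by (rule continuous_on_compose2[OF ca _ fT] continuous_on_compose2[OF cb _ fT], intro continuous_intros)+
      have "a (fst y) * cnj (a (fst y)) + b (fst y) * cnj (b (fst y)) \<noteq> 0" if "y \<in> CT" for y
        using that fT by (intro root_ratio_denom ab) auto
      thus ?thesis unfolding R_def root_ratio_def by (intro continuous_intros c') auto
    qed
    have VR: "V w = CT \<inter> R -` ball w 1" if w: "w \<in> \<Omega>" for w
    proof (intro equalityI subsetI)
      fix y assume "y \<in> V w"
      thus "y \<in> CT \<inter> R -` ball w 1" using VC[OF w] Rq[OF w] unfolding V_def by auto
    next
      fix y assume y: "y \<in> CT \<inter> R -` ball w 1"
      obtain w' where w': "w' \<in> \<Omega>" "y = q w' (fst y)" using un y by blast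
      have fy: "fst y \<in> T" using y unfolding CT_def by auto
      have "R y = w'" using Rq[OF w'(1) fy] w'(2) by simp
      hence "cmod (w - w') < 1" using y by (simp add: dist_norm)
      hence "w = w'" using w w'(1) cube_roots_apart unfolding \<Omega>_def by blast
      thus "y \<in> V w" using w'(2) fy unfolding V_def by blast
    qed
    show "\<exists>T. x \<in> T \<and> openin (top_of_set S) T \<and>
             (\<exists>v. \<Union> v = C \<inter> fst -` T \<and> (\<forall>u\<in>v. openin (top_of_set C) u) \<and> pairwise disjnt v \<and> (\<forall>u\<in>v. \<exists>q. homeomorphism u T fst q))"
    proof (intro exI[of _ T] conjI exI[of _ "V ` \<Omega>"] ballI)
      show "x \<in> T" by (rule T(2))
      show "openin (top_of_set S) T" using T S by (simp add: openin_open_eq)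
      show "\<Union> (V ` \<Omega>) = C \<inter> fst -` T"
      proof (intro equalityI subsetI)
        fix y assume "y \<in> \<Union> (V ` \<Omega>)" thus "y \<in> C \<inter> fst -` T" using VC unfolding CT_def by blast
      next
        fix y assume "y \<in> C \<inter> fst -` T"
        hence y: "y \<in> CT" unfolding CT_def .
        obtain w where "w \<in> \<Omega>" "y = q w (fst y)" using un[OF y] by blast
        moreover have "fst y \<in> T" using y unfolding CT_def by auto
        ultimately show "y \<in> \<Union> (V ` \<Omega>)" unfolding V_def by blast
      qed
      show "pairwise disjnt (V ` \<Omega>)"
        unfolding pairwise_def disjnt_def
      proof (intro ballI impI)
        fix X Y assume "X \<in> V ` \<Omega>" "Y \<in> V ` \<Omega>" "X \<noteq> Y"
        then obtain w w' where w: "w \<in> \<Omega>" "w' \<in> \<Omega>" "X = V w" "Y = V w'" "w \<noteq> w'" by blast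
        show "X \<inter> Y = {}"
        proof (rule ccontr)
          assume "X \<inter> Y \<noteq> {}"
          then obtain y where "y \<in> V w" "y \<in> V w'" using w by blast
          then obtain t t' where "t \<in> T" "t' \<in> T" "y = q w t" "y = q w' t'" unfolding V_def by blast
          hence "w = w'" using Rq w(1,2) by metis
          thus False using w(5) by simp
        qed
      qed
      fix u assume "u \<in> V ` \<Omega>"
      then obtain w where w: "w \<in> \<Omega>" "u = V w" by blast
      have "openin (top_of_set CT) (V w)" unfolding VR[OF w(1)]
        by (rule continuous_openin_preimage_gen[OF cR open_ball])
      moreover have "openin (top_of_set C) CT"
        unfolding CT_def by (rule continuous_openin_preimage_gen[OF _ T(1)]) (intro continuous_intros)
      ultimately show "openin (top_of_set C) u" unfolding w(2) by (rule openin_trans)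
      have "homeomorphism (V w) T fst (q w)"
      proof (rule homeomorphismI)
        show "continuous_on (V w) fst" by (intro continuous_intros)
        show "continuous_on T (q w)" unfolding q_def by (intro continuous_intros ca cb)
      qed (auto simp: V_def q_def)
      thus "\<exists>q. homeomorphism u T fst q" using w(2) by blast
    qed
  qed
qed

text \<open>A convex set is simply connected, so the identity lifts to a section of the
  covering.\<close>

lemma global_cube_root:
  fixes A W F :: "'a::euclidean_space \<Rightarrow> complex"
  assumes S: "open S" "convex S" and c: "continuous_on S A" "continuous_on S W" "continuous_on S F"
    and AW: "\<And>t. t \<in> S \<Longrightarrow> A t * W t = F t ^ 3" and nz: "\<And>t. t \<in> S \<Longrightarrow> A t \<noteq> 0 \<or> W t \<noteq> 0"
  obtains a b where "continuous_on S a" "continuous_on S b" "\<And>t. t \<in> S \<Longrightarrow> root_pair (A t) (W t) (F t) (a t) (b t)"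
proof -
  have "continuous_on S id" "id \<in> S \<rightarrow> S" by auto
  from covering_space_lift[OF root_space_covering[OF S(1) c AW nz] convex_imp_simply_connected[OF S(2)]
      open_imp_locally_path_connected[OF S(1)] this]
  obtain g where g: "continuous_on S g" "g \<in> S \<rightarrow> root_space S A W F" "\<And>t. t \<in> S \<Longrightarrow> fst (g t) = id t" by blast
  have "root_pair (A t) (W t) (F t) (fst (snd (g t))) (snd (snd (g t)))" if t: "t \<in> S" for t
    using g(2,3) t unfolding root_space_def by (fastforce simp: Pi_iff)
  moreover have "continuous_on S (\<lambda>t. fst (snd (g t)))" "continuous_on S (\<lambda>t. snd (snd (g t)))"
    by (intro continuous_intros g(1))+
  ultimately show ?thesis using that[of "\<lambda>t. fst (snd (g t))" "\<lambda>t. snd (snd (g t))"] by simp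
qed

text \<open>The ratio of two sections is continuous and takes at most three values, so connectedness
  makes it constant.\<close>

lemma root_pairs_proportional:
  fixes A W F :: "'a::topological_space \<Rightarrow> complex"
  assumes S: "connected S" and c: "continuous_on S a" "continuous_on S b" "continuous_on S a'" "continuous_on S b'"
    and p: "\<And>t. t \<in> S \<Longrightarrow> root_pair (A t) (W t) (F t) (a t) (b t)" and q: "\<And>t. t \<in> S \<Longrightarrow> root_pair (A t) (W t) (F t) (a' t) (b' t)"
    and nz: "\<And>t. t \<in> S \<Longrightarrow> A t \<noteq> 0 \<or> W t \<noteq> 0"
  obtains w where "w ^ 3 = 1" "\<And>t. t \<in> S \<Longrightarrow> a' t = w * a t"
proof -
  have ab: "a t \<noteq> 0 \<or> b t \<noteq> 0" if "t \<in> S" for t using nz[OF that] p[OF that] unfolding root_pair_def by auto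
  define R where "R = (\<lambda>t. root_ratio (a t) (b t) (a' t) (b' t))"
  have R: "R t ^ 3 = 1 \<and> a' t = R t * a t" if t: "t \<in> S" for t
  proof (rule root_pair_unique[OF ab[OF t] p[OF t] q[OF t]])
    fix w assume w: "w ^ 3 = 1" "a' t = w * a t" "b' t = w * w * b t"
    hence "R t = w" unfolding R_def w using root_pair_ratio[OF ab[OF t] w(1)] by simp
    thus ?thesis using w by simp
  qed
  have cR: "continuous_on S R" unfolding R_def root_ratio_def
    by (intro continuous_intros c) (use root_ratio_denom[OF ab] in auto)
  have "R ` S \<subseteq> {1, zeta3, zeta3 * zeta3}" using R cube_root_of_unity(1) by blast
  hence "finite (R ` S)" by (rule finite_subset) simp
  hence "R constant_on S" by (rule continuous_finite_range_constant[OF S cR])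
  then obtain w where w: "\<And>t. t \<in> S \<Longrightarrow> R t = w" unfolding constant_on_def by blast
  show ?thesis
  proof (cases "S = {}")
    case True thus ?thesis using that[of 1] by simp
  next
    case False
    then obtain t where "t \<in> S" by blast
    thus ?thesis using that[of w] R w by metis
  qed
qed

section \<open>Holomorphy at a point, and of continuous cube roots\<close>

definition hol2_at :: "(complex^2 \<Rightarrow> complex) \<Rightarrow> complex^2 \<Rightarrow> bool" where
  "hol2_at f \<tau> \<longleftrightarrow> (\<exists>f'. (f has_derivative f') (at \<tau>) \<and> (\<forall>c v. f' (c *s v) = c * f' v))"

lemma holomorphic2_on_iff: "open S \<Longrightarrow> holomorphic2_on f S \<longleftrightarrow> (\<forall>\<tau>\<in>S. hol2_at f \<tau>)"
  unfolding holomorphic2_on_def hol2_at_def by (metis at_within_open)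

lemma hol2_at_compose:
  assumes "hol2_at f \<tau>" "(\<phi> has_field_derivative d) (at (f \<tau>))" shows "hol2_at (\<lambda>t. \<phi> (f t)) \<tau>"
proof -
  obtain f' where f': "(f has_derivative f') (at \<tau>)" "\<And>c v. f' (c *s v) = c * f' v" using assms(1) unfolding hol2_at_def by blast
  have "((\<lambda>t. \<phi> (f t)) has_derivative (\<lambda>v. d * f' v)) (at \<tau>)"
    using has_derivative_compose[OF f'(1) assms(2)[unfolded has_field_derivative_def]] .
  thus ?thesis unfolding hol2_at_def using f'(2) by (intro exI[of _ "\<lambda>v. d * f' v"]) (simp add: mult_ac)
qed

lemma hol2_at_mult:
  assumes "hol2_at f \<tau>" "hol2_at g \<tau>" shows "hol2_at (\<lambda>t. f t * g t) \<tau>"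
proof -
  obtain f' where f': "(f has_derivative f') (at \<tau>)" "\<And>c v. f' (c *s v) = c * f' v" using assms(1) unfolding hol2_at_def by blast
  obtain g' where g': "(g has_derivative g') (at \<tau>)" "\<And>c v. g' (c *s v) = c * g' v" using assms(2) unfolding hol2_at_def by blast
  show ?thesis unfolding hol2_at_def
    by (rule exI, rule conjI, rule has_derivative_mult[OF f'(1) g'(1)]) (simp add: f'(2) g'(2) algebra_simps)
qed

lemma hol2_at_cong:
  assumes "hol2_at f \<tau>" "\<forall>\<^sub>F t in nhds \<tau>. g t = f t" shows "hol2_at g \<tau>"
proof -
  obtain f' where f': "(f has_derivative f') (at \<tau>)" "\<And>c v. f' (c *s v) = c * f' v" using assms(1) unfolding hol2_at_def by blast
  have e: "\<forall>\<^sub>F t in at \<tau>. f t = g t" "f \<tau> = g \<tau>"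
    using assms(2) eventually_nhds_x_imp_x[OF assms(2)] unfolding eventually_at_filter by (auto elim: eventually_mono)
  have "(g has_derivative f') (at \<tau>)" by (rule has_derivative_transform_eventually[OF f'(1) e]) simp
  thus ?thesis unfolding hol2_at_def using f'(2) by blast
qed

lemma hol2_at_isCont: "hol2_at f \<tau> \<Longrightarrow> isCont f \<tau>"
  unfolding hol2_at_def using has_derivative_continuous by blast

text \<open>Near \<open>\<tau>\<close> the continuous root coincides with the branch
  \<open>\<psi>\<close> built from the logarithm: their quotient is a cube root of unity close to
  its value 1 at \<open>\<tau>\<close>.\<close>

lemma cube_root_hol2_at:
  assumes a: "isCont a \<tau>" and A: "hol2_at A \<tau>" and nz: "A \<tau> \<noteq> 0" and e: "\<forall>\<^sub>F t in nhds \<tau>. a t ^ 3 = A t"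
  shows "hol2_at a \<tau>"
proof -
  define \<psi> where "\<psi> = (\<lambda>z. a \<tau> * exp (Ln (z / A \<tau>) / 3))"
  have a3: "a \<tau> ^ 3 = A \<tau>" by (rule eventually_nhds_x_imp_x[OF e])
  hence a0: "a \<tau> \<noteq> 0" using nz by auto
  have p: "((\<lambda>z. \<psi> z) has_field_derivative (a \<tau> * (1 / 3 / A \<tau>))) (at (A \<tau>))"
    unfolding \<psi>_def by (auto intro!: derivative_eq_intros simp: nz)
  have h: "hol2_at (\<lambda>t. \<psi> (A t)) \<tau>" by (rule hol2_at_compose[OF A p])
  have \<psi>0: "\<psi> z \<noteq> 0" for z unfolding \<psi>_def using a0 by simp
  have \<psi>3: "\<psi> z ^ 3 = z" if "z \<noteq> 0" for z
  proof -
    have "exp (Ln (z / A \<tau>) / 3) ^ 3 = z / A \<tau>" using that nz unfolding exp_of_nat_mult[symmetric] by simp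
    thus ?thesis unfolding \<psi>_def power_mult_distrib a3 using nz by simp
  qed
  define c where "c = (\<lambda>t. a t / \<psi> (A t))"
  have "isCont c \<tau>" unfolding c_def by (intro continuous_intros a hol2_at_isCont[OF h]) (rule \<psi>0)
  moreover have c1: "c \<tau> = 1" unfolding c_def \<psi>_def using a0 nz by simp
  ultimately have "(c \<longlongrightarrow> 1) (nhds \<tau>)" unfolding isCont_def tendsto_at_iff_tendsto_nhds by simp
  hence 1: "\<forall>\<^sub>F t in nhds \<tau>. dist (c t) 1 < 1" by (rule tendstoD) simp
  have "(A \<longlongrightarrow> A \<tau>) (nhds \<tau>)" using hol2_at_isCont[OF A] unfolding isCont_def tendsto_at_iff_tendsto_nhds .
  hence 2: "\<forall>\<^sub>F t in nhds \<tau>. A t \<noteq> 0" using nz by (rule tendsto_imp_eventually_ne)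
  have "\<forall>\<^sub>F t in nhds \<tau>. a t = \<psi> (A t)"
    using 1 2 e
  proof eventually_elim
    case (elim t)
    have "c t ^ 3 = 1" unfolding c_def power_divide elim(3) \<psi>3[OF elim(2)] using elim(2) by simp
    hence "c t = 1" using cube_roots_apart[of "c t" 1] elim(1) by (simp add: dist_norm)
    thus "a t = \<psi> (A t)" unfolding c_def using \<psi>0 by simp
  qed
  thus ?thesis by (rule hol2_at_cong[OF h])
qed

lemma convex_siegel_domain: "convex siegel_domain"
  unfolding convex_def
proof (intro ballI allI impI)
  fix x y :: "complex^2" and u v :: real
  assume x: "x \<in> siegel_domain" and y: "y \<in> siegel_domain" and u: "0 \<le> u" and v: "0 \<le> v" and uv: "u + v = 1"
  define r s where rs: "r = cmod (x $ 2)" "s = cmod (y $ 2)"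
  have "cmod ((u *\<^sub>R x + v *\<^sub>R y) $ 2) \<le> u * r + v * s"
    unfolding rs using norm_triangle_ineq[of "u *\<^sub>R x $ 2" "v *\<^sub>R y $ 2"] u v by simp
  hence "(cmod ((u *\<^sub>R x + v *\<^sub>R y) $ 2))\<^sup>2 \<le> (u * r + v * s)\<^sup>2" by (intro power_mono) auto
  also have "\<dots> \<le> u * r\<^sup>2 + v * s\<^sup>2"
  proof -
    have "u * r\<^sup>2 + v * s\<^sup>2 - (u * r + v * s)\<^sup>2 = u * v * (r - s)\<^sup>2"
    proof -
      have v': "v = 1 - u" using uv by simp
      show ?thesis unfolding v' by (simp add: power2_eq_square algebra_simps)
    qed
    moreover have "u * v * (r - s)\<^sup>2 \<ge> 0" using u v by simp
    ultimately show ?thesis by linarith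
  qed
  finally have 1: "2 * Re ((u *\<^sub>R x + v *\<^sub>R y) $ 1) + (cmod ((u *\<^sub>R x + v *\<^sub>R y) $ 2))\<^sup>2 \<le>
     u * (2 * Re (x $ 1) + r\<^sup>2) + v * (2 * Re (y $ 1) + s\<^sup>2)" by (simp add: algebra_simps)
  have n: "2 * Re (x $ 1) + r\<^sup>2 < 0" "2 * Re (y $ 1) + s\<^sup>2 < 0" using x y unfolding siegel_domain_def rs by auto
  have "u * (2 * Re (x $ 1) + r\<^sup>2) + v * (2 * Re (y $ 1) + s\<^sup>2) < 0"
  proof (cases "u = 0")
    case True thus ?thesis using n uv by simp
  next
    case False
    hence "u * (2 * Re (x $ 1) + r\<^sup>2) < 0" using u n by (intro mult_pos_neg) auto
    moreover have "v * (2 * Re (y $ 1) + s\<^sup>2) \<le> 0" using v n by (intro mult_nonneg_nonpos) auto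
    ultimately show ?thesis by linarith
  qed
  thus "u *\<^sub>R x + v *\<^sub>R y \<in> siegel_domain" using 1 unfolding siegel_domain_def by auto
qed

lemma siegel_domain_nonempty: "siegel_domain \<noteq> {}"
proof -
  have "vector [- 1, 0] \<in> siegel_domain" unfolding siegel_domain_def by simp
  thus ?thesis by blast
qed

section \<open>Absence of common zeros\<close>

definition tval :: "complex^3 \<Rightarrow> complex^2 \<Rightarrow> complex" where
  "tval u \<tau> = theta_vec (tors *s u) \<tau>"

lemma tval_theta3: "tval u \<tau> = theta3 (tors * u $ 1) (tors * u $ 2) (tors * u $ 3) (\<tau> $ 1) (\<tau> $ 2)"
  unfolding tval_def theta_vec_def by simp

lemma tval_uminus: "tval (- u) \<tau> = - tval u \<tau>"
  using theta3_diag[of "-1" "-1" "tors * u $ 1" "tors * u $ 2" "tors * u $ 3" "\<tau> $ 1" "\<tau> $ 2"]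
  unfolding tval_theta3 by simp

lemma tval_cong_zero:
  assumes "eis_vec u" "eis_vec u'" "\<And>i. th_cong (u $ i) (u' $ i)"
  shows "tval u \<tau> = 0 \<longleftrightarrow> tval u' \<tau> = 0"
proof -
  define l where "l = (\<lambda>i. tors * (u $ i - u' $ i))"
  have l: "l i \<in> eisenstein" for i using assms(3)[of i] unfolding th_cong_def l_def .
  have e: "tors * u $ i = tors * u' $ i + l i" for i unfolding l_def by (simp add: field_simps)
  show ?thesis unfolding tval_theta3 e theta3_lattice[OF l l l] by simp
qed

lemma tval_covariant:
  assumes "g \<in> lat_unitary"
  obtains k where "k \<noteq> 0" "\<And>u \<tau>. \<tau> \<in> siegel_domain \<Longrightarrow> tval (g *v u) (act g \<tau>) = k * jfac g \<tau> * tval u \<tau>"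
proof -
  obtain k where k: "k \<noteq> 0" "\<And>v \<tau>. \<tau> \<in> siegel_domain \<Longrightarrow> theta_vec (g *v v) (act g \<tau>) = k * jfac g \<tau> * theta_vec v \<tau>"
    using lat_unitary_covariant[OF assms] unfolding theta_covariant_def by blast
  have "tors *s (g *v u) = g *v (tors *s u)" for u
    by (simp add: vec_eq_iff mat3_vec algebra_simps)
  thus ?thesis using that[of k] k unfolding tval_def by simp
qed

definition unitary_inv :: "complex^3^3 \<Rightarrow> complex^3^3" where
  "unitary_inv g = herm_J ** transpose (conj_mat g) ** herm_J"

lemma unitary_inv_entries:
  "unitary_inv g $ 1 $ 1 = cnj (g $ 3 $ 3)" "unitary_inv g $ 1 $ 2 = cnj (g $ 2 $ 3)" "unitary_inv g $ 1 $ 3 = cnj (g $ 1 $ 3)"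
  "unitary_inv g $ 2 $ 1 = cnj (g $ 3 $ 2)" "unitary_inv g $ 2 $ 2 = cnj (g $ 2 $ 2)" "unitary_inv g $ 2 $ 3 = cnj (g $ 1 $ 2)"
  "unitary_inv g $ 3 $ 1 = cnj (g $ 3 $ 1)" "unitary_inv g $ 3 $ 2 = cnj (g $ 2 $ 1)" "unitary_inv g $ 3 $ 3 = cnj (g $ 1 $ 1)"
  unfolding unitary_inv_def mat3_mult herm_J_entries by (simp_all add: transpose_def conj_mat_def)

lemma unitary_inv:
  assumes "g \<in> lat_unitary"
  shows "unitary_inv g ** g = mat 1" "g ** unitary_inv g = mat 1" "unitary_inv g \<in> lat_unitary"
proof -
  have u: "transpose (conj_mat g) ** herm_J ** g = herm_J" by (rule lat_unitaryD[OF assms])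
  have "unitary_inv g ** g = herm_J ** (transpose (conj_mat g) ** herm_J ** g)"
    unfolding unitary_inv_def by (simp only: matrix_mul_assoc)
  thus 1: "unitary_inv g ** g = mat 1" unfolding u herm_J_sq .
  thus 2: "g ** unitary_inv g = mat 1" by (rule matrix_left_right_inverse[THEN iffD1])
  have O: "cnj (g $ i $ j) \<in> eisenstein" for i j using assms unfolding lat_unitary_def by auto
  have "transpose (conj_mat (unitary_inv g)) = herm_J ** g ** herm_J"
    unfolding vec_eq_iff forall_3 mat3_mult herm_J_entries
    by (simp add: transpose_def conj_mat_def unitary_inv_entries[unfolded unitary_inv_def[symmetric]])
  hence "transpose (conj_mat (unitary_inv g)) ** herm_J ** unitary_inv g = herm_J ** g ** (herm_J ** herm_J) ** unitary_inv g"
    by (simp only: matrix_mul_assoc)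
  also have "\<dots> = herm_J ** (g ** unitary_inv g)" unfolding herm_J_sq by (simp add: matrix_mul_assoc)
  finally show "unitary_inv g \<in> lat_unitary"
    unfolding lat_unitary_def mem_Collect_eq 2 forall_3 unitary_inv_entries using O by simp
qed

lemma act_unitary_inv:
  assumes g: "g \<in> lat_unitary" and \<tau>: "\<tau> \<in> siegel_domain"
  shows "act (unitary_inv g) \<tau> \<in> siegel_domain" "act g (act (unitary_inv g) \<tau>) = \<tau>"
proof -
  note i = unitary_inv[OF g]
  note u = unitary_height[OF lat_unitaryD[OF i(3)] \<tau>]
  show "act (unitary_inv g) \<tau> \<in> siegel_domain" by (rule u(3))
  have "act (g ** unitary_inv g) \<tau> = act g (act (unitary_inv g) \<tau>)"
    by (rule act_mult[OF u(1) unitary_height(1)[OF lat_unitaryD[OF g] u(3)]])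
  thus "act g (act (unitary_inv g) \<tau>) = \<tau>" unfolding i(2) act_mat_1 by simp
qed

section \<open>The basic triple and its images modulo \<open>sqrt_m3\<close>\<close>

definition ua :: "complex^3" where "ua = vector [0, 1, 1]"

definition ub :: "complex^3" where "ub = vector [0, - 1, 1]"

definition uc :: "complex^3" where "uc = vector [1, 0, - 1]"

lemma u_entries: "ua $ 1 = 0" "ua $ 2 = 1" "ua $ 3 = 1" "ub $ 1 = 0" "ub $ 2 = - 1" "ub $ 3 = 1" "uc $ 1 = 1" "uc $ 2 = 0" "uc $ 3 = - 1"
  unfolding ua_def ub_def uc_def by simp_all

lemma tval_cubic: "\<tau> \<in> siegel_domain \<Longrightarrow> tval ua \<tau> ^ 3 + tval ub \<tau> ^ 3 + tval uc \<tau> ^ 3 = 0"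
proof -
  assume t: "\<tau> \<in> siegel_domain"
  have "tval uc \<tau> = - theta3 (- tors) 0 tors (\<tau> $ 1) (\<tau> $ 2)"
    using tval_uminus[of "- uc" \<tau>] unfolding tval_theta3 by (simp add: u_entries)
  moreover have "tval ua \<tau> = theta3 0 tors tors (\<tau> $ 1) (\<tau> $ 2)" "tval ub \<tau> = theta3 0 (- tors) tors (\<tau> $ 1) (\<tau> $ 2)"
    unfolding tval_theta3 by (simp_all add: u_entries)
  ultimately show ?thesis using cubic_relation[of "\<tau> $ 1" "\<tau> $ 2"] t unfolding siegel_height by simp
qed

lemma tval_cubic_transform:
  assumes g: "g \<in> lat_unitary" and \<tau>: "\<tau> \<in> siegel_domain"
  shows "tval (g *v ua) \<tau> ^ 3 + tval (g *v ub) \<tau> ^ 3 + tval (g *v uc) \<tau> ^ 3 = 0"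
proof -
  obtain k where k: "k \<noteq> 0" "\<And>u \<tau>. \<tau> \<in> siegel_domain \<Longrightarrow> tval (g *v u) (act g \<tau>) = k * jfac g \<tau> * tval u \<tau>"
    using tval_covariant[OF g] by blast
  define \<sigma> where "\<sigma> = act (unitary_inv g) \<tau>"
  have s: "\<sigma> \<in> siegel_domain" "act g \<sigma> = \<tau>" unfolding \<sigma>_def by (rule act_unitary_inv[OF g \<tau>])+
  have "tval (g *v u) \<tau> ^ 3 = (k * jfac g \<sigma>) ^ 3 * tval u \<sigma> ^ 3" for u
    using k(2)[OF s(1), of u] unfolding s(2) by (simp only: power_mult_distrib)
  hence "tval (g *v ua) \<tau> ^ 3 + tval (g *v ub) \<tau> ^ 3 + tval (g *v uc) \<tau> ^ 3 =
     (k * jfac g \<sigma>) ^ 3 * (tval ua \<sigma> ^ 3 + tval ub \<sigma> ^ 3 + tval uc \<sigma> ^ 3)" by (simp only: distrib_left)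
  thus ?thesis unfolding tval_cubic[OF s(1)] by simp
qed

lemma th_cong_int: "th_cong (of_int m) (of_int n) \<longleftrightarrow> 3 dvd m - n"
proof
  assume "3 dvd m - n"
  then obtain k where "m - n = 3 * k" by blast
  hence "tors * (of_int m - of_int n) = tors * of_int (3 * k)" by (metis of_int_diff)
  also have "\<dots> = - sqrt_m3 * of_int k" unfolding tors_conv by simp
  finally show "th_cong (of_int m) (of_int n)" unfolding th_cong_def by simp
next
  assume c: "th_cong (of_int m) (of_int n)"
  define d where "d = m - n"
  have d: "tors * of_int d \<in> eisenstein" using c unfolding th_cong_def d_def by simp
  obtain k :: int where k: "(cmod (tors * of_int d))\<^sup>2 = of_int k" using eis_norm_int[OF d] by metis
  have "(cmod (tors * of_int d))\<^sup>2 = (of_int d)\<^sup>2 / 3" unfolding norm_mult norm_divide by (simp add: power_mult_distrib power_divide)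
  hence "real_of_int (d * d) = of_int (3 * k)" using k by (simp add: power2_eq_square)
  hence "d * d = 3 * k" by (simp only: of_int_eq_iff)
  hence "3 dvd d * d" by simp
  moreover have "prime (3::int)" by simp
  ultimately have "3 dvd d" using prime_dvd_mult_iff by blast
  thus "3 dvd m - n" unfolding d_def .
qed

lemma eis_int_residue:
  assumes "x \<in> eisenstein" obtains i :: int where "i \<in> {0, 1, - 1}" "th_cong x (of_int i)"
proof -
  obtain j where "j \<in> {0, 1, -1}" "th_cong x j" using eis_residue[OF assms] unfolding th_cong_def by blast
  thus ?thesis using that[of 0] that[of 1] that[of "-1"] by auto
qed

lemma th_cong_mult2:
  assumes "th_cong x x'" "th_cong y y'" "x' \<in> eisenstein" "y \<in> eisenstein" shows "th_cong (x * y) (x' * y')"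
proof -
  have "th_cong (x * y) (x' * y)" using th_cong_mult[OF assms(1,4)] by (simp add: mult.commute)
  thus ?thesis using th_cong_mult[OF assms(2,3)] by (rule th_cong_trans)
qed

lemma th_cong_cnj_int: "x \<in> eisenstein \<Longrightarrow> th_cong x (of_int i) \<Longrightarrow> th_cong (cnj x) (of_int i)"
  using th_cong_trans[OF th_cong_cnj] .

definition hform :: "complex^3 \<Rightarrow> complex" where
  "hform u = u $ 1 * cnj (u $ 3) + u $ 2 * cnj (u $ 2) + u $ 3 * cnj (u $ 1)"

lemma hform_residue:
  assumes u: "eis_vec u" and c: "th_cong (u $ 1) (of_int i)" "th_cong (u $ 2) (of_int j)" "th_cong (u $ 3) (of_int k)"
  shows "th_cong (hform u) (of_int (2 * i * k + j * j))"
proof -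
  have uO: "u $ 1 \<in> eisenstein" "u $ 2 \<in> eisenstein" "u $ 3 \<in> eisenstein" using u unfolding eis_vec_def by auto
  have "th_cong (hform u) (of_int i * of_int k + of_int j * of_int j + of_int k * of_int i)"
    unfolding hform_def by (intro th_cong_add th_cong_mult2 th_cong_cnj_int c uO eisenstein_closed)
  thus ?thesis by (simp add: algebra_simps)
qed

text \<open>Modulo \<open>sqrt (-3)\<close> and up to sign, the vectors of hermitian norm one that are not orthogonal
  to the first basis vector are \<open>ua\<close>, \<open>ub\<close>, \<open>uc\<close>.\<close>

lemma common_zero_class:
  assumes z: "tval ua \<tau> = 0" "tval ub \<tau> = 0" "tval uc \<tau> = 0"
    and u: "eis_vec u" "th_cong (hform u) 1" "\<not> th_cong (u $ 3) 0"
  shows "tval u \<tau> = 0"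
proof -
  obtain i where i: "i \<in> {0, 1, - 1}" "th_cong (u $ 1) (of_int i)" using eis_int_residue[of "u $ 1"] u(1) unfolding eis_vec_def by metis
  obtain j where j: "j \<in> {0, 1, - 1}" "th_cong (u $ 2) (of_int j)" using eis_int_residue[of "u $ 2"] u(1) unfolding eis_vec_def by metis
  obtain k where k: "k \<in> {0, 1, - 1}" "th_cong (u $ 3) (of_int k)" using eis_int_residue[of "u $ 3"] u(1) unfolding eis_vec_def by metis
  have k0: "k \<noteq> 0" using k(2) u(3) by auto
  have "th_cong (of_int (2 * i * k + j * j)) (of_int 1)"
    using th_cong_trans[OF th_cong_sym[OF hform_residue[OF u(1) i(2) j(2) k(2)]] u(2)] by simp
  hence d: "3 dvd 2 * i * k + j * j - 1" unfolding th_cong_int .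
  have red: "tval u \<tau> = 0" if "tval v \<tau> = 0" "v $ 1 = of_int i" "v $ 2 = of_int j" "v $ 3 = of_int k" for v
  proof -
    have "\<forall>m. th_cong (u $ m) (v $ m)" unfolding forall_3 that(2-4) using i j k by simp
    moreover have "eis_vec v" unfolding eis_vec_def that(2-4) by simp
    ultimately show ?thesis using tval_cong_zero[OF u(1)] that(1) by blast
  qed
  have "(i = 0 \<and> j = 1 \<and> k = 1) \<or> (i = 0 \<and> j = -1 \<and> k = 1) \<or> (i = -1 \<and> j = 0 \<and> k = 1) \<or>
     (i = 0 \<and> j = -1 \<and> k = -1) \<or> (i = 0 \<and> j = 1 \<and> k = -1) \<or> (i = 1 \<and> j = 0 \<and> k = -1)"
    using i(1) j(1) k(1) k0 d by (elim insertE emptyE; simp)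
  thus ?thesis
    using red[of ua] red[of ub] red[of uc] red[of "- ua"] red[of "- ub"] red[of "- uc"] z tval_uminus
    by (auto simp: u_entries)
qed

text \<open>Pulling \<open>u\<close> back by \<open>g\<close> keeps its norm and turns its last
  coordinate into the hermitian pairing of \<open>u\<close> with the first column of
  \<open>g\<close>, so \<open>common_zero_class\<close> applies to the pulled back vector at
  \<open>\<tau>\<close>.\<close>

lemma common_zero_transport:
  assumes g: "g \<in> lat_unitary" and \<tau>: "\<tau> \<in> siegel_domain"
    and z: "tval ua \<tau> = 0" "tval ub \<tau> = 0" "tval uc \<tau> = 0"
    and u: "eis_vec u" "th_cong (hform u) 1"
      "\<not> th_cong (cnj (g $ 3 $ 1) * u $ 1 + cnj (g $ 2 $ 1) * u $ 2 + cnj (g $ 1 $ 1) * u $ 3) 0"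
  shows "tval u (act g \<tau>) = 0"
proof -
  define v where "v = unitary_inv g *v u"
  have gv: "g *v v = u" unfolding v_def matrix_vector_mul_assoc unitary_inv(2)[OF g] by simp
  have O: "unitary_inv g $ i $ j \<in> eisenstein" for i j using unitary_inv(3)[OF g] unfolding lat_unitary_def by auto
  have "eis_vec v" unfolding eis_vec_def v_def mat3_vec using O u(1) unfolding eis_vec_def by auto
  moreover have "hform v = hform u"
    using unitary_herm[OF lat_unitaryD[OF g], of v] unfolding gv hform_def by simp
  moreover have "v $ 3 = cnj (g $ 3 $ 1) * u $ 1 + cnj (g $ 2 $ 1) * u $ 2 + cnj (g $ 1 $ 1) * u $ 3"
    unfolding v_def mat3_vec unitary_inv_entries ..
  ultimately have "tval v \<tau> = 0" using common_zero_class[OF z, of v] u by simp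
  moreover obtain k where "tval (g *v v) (act g \<tau>) = k * jfac g \<tau> * tval v \<tau>"
    using tval_covariant[OF g] \<tau> by metis
  ultimately show ?thesis unfolding gv by simp
qed

definition uk :: "complex \<Rightarrow> complex^3" where "uk k = vector [k, 1, 0]"

lemma uk_entries: "uk k $ 1 = k" "uk k $ 2 = 1" "uk k $ 3 = 0" unfolding uk_def by simp_all

text \<open>Equal cubes make the values equal up to cube roots of unity, and g0, g1, g2 are
  recovered by the discrete Fourier transform of order three. In each of the nine cases g1 = g2 = 0,
  or g0 = 0, or one of |g1|, |g2| equals |g0|.\<close>

lemma three_values_contradiction:
  assumes e: "f0 = g0 + (g1 + g2)" "fm = g0 + (zeta3 * g1 + zeta3 * zeta3 * g2)" "fp = g0 + (zeta3 * zeta3 * g1 + zeta3 * g2)"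
    and lt: "cmod g1 < cmod g0" "cmod g2 < cmod g0" and nz: "g1 \<noteq> 0 \<or> g2 \<noteq> 0"
    and c: "f0 ^ 3 = fp ^ 3" "fm ^ 3 = fp ^ 3"
  shows False
proof -
  have s0: "3 * g0 = f0 + fm + fp" unfolding e zeta3_sq by (simp add: algebra_simps)
  have s1: "3 * g1 = f0 + zeta3 * zeta3 * fm + zeta3 * fp" unfolding e using zeta3_sq by algebra
  have s2: "3 * g2 = f0 + zeta3 * fm + zeta3 * zeta3 * fp" unfolding e using zeta3_sq by algebra
  have ne: "3 * g1 \<noteq> u * (3 * g0)" "3 * g2 \<noteq> u * (3 * g0)" if "cmod u = 1" for u
  proof -
    have "g1 \<noteq> u * g0" "g2 \<noteq> u * g0" using lt that by (auto simp: norm_mult)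
    thus "3 * g1 \<noteq> u * (3 * g0)" "3 * g2 \<noteq> u * (3 * g0)" by auto
  qed
  have g00: "g0 \<noteq> 0" using lt(1) by auto
  show False
  proof (cases "f0 = 0")
    case True
    hence "fp = 0" "fm = 0" using c by auto
    thus False using s0 True g00 by simp
  next
    case False
    define x y where xy: "x = fm / f0" "y = fp / f0"
    have f: "fm = x * f0" "fp = y * f0" using False unfolding xy by simp_all
    have "x ^ 3 = 1" "y ^ 3 = 1" using c False unfolding xy power_divide by auto
    hence x: "x = 1 \<or> x = zeta3 \<or> x = zeta3 * zeta3" and y: "y = 1 \<or> y = zeta3 \<or> y = zeta3 * zeta3"
      using cube_root_of_unity(1) by blast+
    note s = s0[unfolded f] s1[unfolded f] s2[unfolded f]
    have z: "cmod (zeta3 * zeta3) = 1" "cmod (1::complex) = 1" by (simp_all add: norm_mult)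
    consider "x = 1" "y = 1" | "x = 1" "y = zeta3" | "x = 1" "y = zeta3 * zeta3" | "x = zeta3" "y = 1" | "x = zeta3" "y = zeta3"
      | "x = zeta3" "y = zeta3 * zeta3" | "x = zeta3 * zeta3" "y = 1" | "x = zeta3 * zeta3" "y = zeta3" | "x = zeta3 * zeta3" "y = zeta3 * zeta3"
      using x y by blast
    thus False
    proof cases
      case 1
      have "3 * g1 = 0" "3 * g2 = 0" using s(2,3) unfolding 1 zeta3_sq by (simp_all add: algebra_simps)
      thus False using nz by simp
    next
      case 2
      have "3 * g2 = 1 * (3 * g0)" using s unfolding 2 using zeta3_sq by algebra
      thus False using ne(2)[OF z(2)] by blast
    next
      case 3
      have "3 * g1 = 1 * (3 * g0)" using s unfolding 3 using zeta3_sq by algebra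
      thus False using ne(1)[OF z(2)] by blast
    next
      case 4
      have "3 * g1 = 1 * (3 * g0)" using s unfolding 4 using zeta3_sq by algebra
      thus False using ne(1)[OF z(2)] by blast
    next
      case 5
      have "3 * g1 = (zeta3 * zeta3) * (3 * g0)" using s unfolding 5 using zeta3_sq by algebra
      thus False using ne(1)[OF z(1)] by blast
    next
      case 6
      have "3 * g0 = 0" using s unfolding 6 using zeta3_sq by algebra
      thus False using g00 by simp
    next
      case 7
      have "3 * g2 = 1 * (3 * g0)" using s unfolding 7 using zeta3_sq by algebra
      thus False using ne(2)[OF z(2)] by blast
    next
      case 8
      have "3 * g0 = 0" using s unfolding 8 using zeta3_sq by algebra
      thus False using g00 by simp
    next
      case 9
      have "3 * g1 = zeta3 * (3 * g0)" using s unfolding 9 using zeta3_sq by algebra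
      thus False using ne(1)[OF cmod_zeta3] by blast
    qed
  qed
qed

text \<open>If two of the values vanish, the third one determines 3 * g0 and 3 * g1 up to cube roots
  of unity, so |g0| = |g1|.\<close>

lemma two_values_contradiction:
  assumes e: "f0 = g0 + (g1 + g2)" "fm = g0 + (zeta3 * g1 + zeta3 * zeta3 * g2)" "fp = g0 + (zeta3 * zeta3 * g1 + zeta3 * g2)"
    and lt: "cmod g1 < cmod g0"
    and z: "f0 = 0 \<and> fm = 0 \<or> f0 = 0 \<and> fp = 0 \<or> fm = 0 \<and> fp = 0"
  shows False
proof -
  have s0: "3 * g0 = f0 + fm + fp" unfolding e zeta3_sq by (simp add: algebra_simps)
  have s1: "3 * g1 = f0 + zeta3 * zeta3 * fm + zeta3 * fp" unfolding e using zeta3_sq by algebra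
  have "cmod (3 * g1) = cmod (3 * g0)" unfolding s0 s1 using z by (auto simp: norm_mult)
  thus False using lt by (simp add: norm_mult)
qed

text \<open>A common zero is moved by some \<open>g\<close> to a point of height at least 9/10. The
  residues (i, j, k) of the first column of \<open>g\<close> decide which theta functions must
  vanish there. For k nonzero, two of the three values in \<open>high_theta_values\<close> vanish;
  for k = 0, the cubic relations of two other triples force the three cubes to be equal. Either
  outcome is impossible.\<close>

theorem no_common_zero:
  assumes \<tau>: "\<tau> \<in> siegel_domain" and z: "tval ua \<tau> = 0" "tval ub \<tau> = 0" "tval uc \<tau> = 0"
  shows False
proof -
  obtain g where g: "g \<in> lat_unitary" and high: "height (act g \<tau> $ 1) (act g \<tau> $ 2) \<ge> 9/10" using reach_high[OF \<tau>] by blast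
  define \<sigma> where "\<sigma> = act g \<tau>"
  have \<sigma>: "\<sigma> \<in> siegel_domain" unfolding \<sigma>_def by (rule unitary_height(3)[OF lat_unitaryD[OF g] \<tau>])
  obtain g0 g1 g2 where G: "theta3 0 tors 0 (\<sigma> $ 1) (\<sigma> $ 2) = g0 + (g1 + g2)"
    "theta3 (- tors) tors 0 (\<sigma> $ 1) (\<sigma> $ 2) = g0 + (zeta3 * g1 + zeta3 * zeta3 * g2)"
    "theta3 tors tors 0 (\<sigma> $ 1) (\<sigma> $ 2) = g0 + (zeta3 * zeta3 * g1 + zeta3 * g2)"
    "cmod g1 < cmod g0" "cmod g2 < cmod g0" "g1 \<noteq> 0 \<or> g2 \<noteq> 0"
    using high_theta_values[OF high[folded \<sigma>_def]] .
  have tk: "tval (uk 0) \<sigma> = theta3 0 tors 0 (\<sigma> $ 1) (\<sigma> $ 2)" "tval (uk (- 1)) \<sigma> = theta3 (- tors) tors 0 (\<sigma> $ 1) (\<sigma> $ 2)"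
    "tval (uk 1) \<sigma> = theta3 tors tors 0 (\<sigma> $ 1) (\<sigma> $ 2)"
    unfolding tval_theta3 by (simp_all add: uk_entries)
  note tr = common_zero_transport[OF g \<tau> z, folded \<sigma>_def]
  have O: "g $ i $ j \<in> eisenstein" for i j using g unfolding lat_unitary_def by auto
  obtain i where i: "i \<in> {0, 1, - 1}" "th_cong (g $ 1 $ 1) (of_int i)" using eis_int_residue[OF O] .
  obtain j where j: "j \<in> {0, 1, - 1}" "th_cong (g $ 2 $ 1) (of_int j)" using eis_int_residue[OF O] .
  obtain k where k: "k \<in> {0, 1, - 1}" "th_cong (g $ 3 $ 1) (of_int k)" using eis_int_residue[OF O] .
  have lin: "th_cong (cnj (g $ 3 $ 1) * of_int p + cnj (g $ 2 $ 1) * of_int q + cnj (g $ 1 $ 1) * of_int r) (of_int (k * p + j * q + i * r))" for p q r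
  proof -
    have "th_cong (cnj (g $ 3 $ 1) * of_int p + cnj (g $ 2 $ 1) * of_int q + cnj (g $ 1 $ 1) * of_int r) (of_int k * of_int p + of_int j * of_int q + of_int i * of_int r)"
      by (intro th_cong_add th_cong_mult2 th_cong_cnj_int th_cong_refl i(2) j(2) k(2) O eisenstein_closed)
    thus ?thesis by simp
  qed
  have nz: "\<not> th_cong (cnj (g $ 3 $ 1) * of_int p + cnj (g $ 2 $ 1) * of_int q + cnj (g $ 1 $ 1) * of_int r) 0" if "\<not> 3 dvd k * p + j * q + i * r" for p q r
    using that th_cong_trans[OF th_cong_sym[OF lin], of p q r 0] th_cong_int[of "k * p + j * q + i * r" 0] by auto
  have zero: "tval u \<sigma> = 0" if "u $ 1 = of_int p" "u $ 2 = of_int q" "u $ 3 = of_int r" "3 dvd 2 * p * r + q * q - 1" "\<not> 3 dvd k * p + j * q + i * r" for u p q r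
  proof (rule tr)
    show ev: "eis_vec u" unfolding eis_vec_def that(1-3) by simp
    have "th_cong (of_int (2 * p * r + q * q)) (of_int 1)" unfolding th_cong_int by (rule that(4))
    thus "th_cong (hform u) 1" unfolding hform_def that(1-3) by (simp add: algebra_simps)
    show "\<not> th_cong (cnj (g $ 3 $ 1) * u $ 1 + cnj (g $ 2 $ 1) * u $ 2 + cnj (g $ 1 $ 1) * u $ 3) 0"
      unfolding that(1-3) by (rule nz[OF that(5)])
  qed
  have zk: "tval (uk (of_int p)) \<sigma> = 0" if "\<not> 3 dvd k * p + j" for p
    using zero[of "uk (of_int p)" p 1 0] that by (simp add: uk_entries)
  show False
  proof (cases "k = 0")
    case False
    \<comment> \<open>For k nonzero, \<open>k * p + j\<close> is divisible by 3 for just one of p =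
      0, 1, -1; the other two values vanish.\<close>
    have "tval (uk 0) \<sigma> = 0 \<and> tval (uk (- 1)) \<sigma> = 0 \<or> tval (uk 0) \<sigma> = 0 \<and> tval (uk 1) \<sigma> = 0 \<or> tval (uk (- 1)) \<sigma> = 0 \<and> tval (uk 1) \<sigma> = 0"
      using False k(1) j(1) zk[of 0] zk[of 1] zk[of "-1"] by (elim insertE emptyE; simp)
    thus False unfolding tk by (rule two_values_contradiction[OF G(1-4)])
  next
    case k0: True
    \<comment> \<open>The first column is isotropic, so k = 0 gives j = 0, and its pairing with the
      third column is 1, so i is nonzero: modulo \<open>sqrt_m3\<close> the column is the first
      basis vector up to sign.\<close>
    define w where "w = (\<chi> m. g $ m $ 1)"
    have wO: "eis_vec w" unfolding eis_vec_def w_def using O by simp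
    have "cnj (g $ 1 $ 1) * g $ 3 $ 1 + cnj (g $ 2 $ 1) * g $ 2 $ 1 + cnj (g $ 3 $ 1) * g $ 1 $ 1 = 0"
      using lat_unitaryD[OF g] unfolding unitary_iff using herm_J_entries(1) by metis
    hence "hform w = 0" unfolding hform_def w_def by (simp add: algebra_simps)
    hence "th_cong (of_int (2 * i * k + j * j)) (of_int 0)"
      using th_cong_sym[OF hform_residue[OF wO, of i j k]] i(2) j(2) k(2) unfolding w_def by simp
    hence j0: "j = 0" using j(1) unfolding k0 th_cong_int by auto
    have "cnj (g $ 1 $ 1) * g $ 3 $ 3 + cnj (g $ 2 $ 1) * g $ 2 $ 3 + cnj (g $ 3 $ 1) * g $ 1 $ 3 = 1"
      using lat_unitaryD[OF g] unfolding unitary_iff using herm_J_entries(3) by metis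
    moreover have "th_cong (cnj (g $ 1 $ 1) * g $ 3 $ 3 + cnj (g $ 2 $ 1) * g $ 2 $ 3 + cnj (g $ 3 $ 1) * g $ 1 $ 3)
        (of_int i * g $ 3 $ 3 + of_int j * g $ 2 $ 3 + of_int k * g $ 1 $ 3)"
      by (intro th_cong_add th_cong_mult2 th_cong_cnj_int th_cong_refl i(2) j(2) k(2) O eisenstein_closed)
    ultimately have "i \<noteq> 0" using th_cong_int[of 1 0] unfolding j0 k0 by auto
    hence i1: "i = 1 \<or> i = - 1" using i(1) by auto
    have vz: "tval u \<sigma> = 0" if "eis_vec u" "th_cong (hform u) 1" "\<not> th_cong (u $ 3) 0" for u
    proof (rule tr[OF that(1,2)])
      have uO: "u $ m \<in> eisenstein" for m using that(1) exhaust_3[of m] unfolding eis_vec_def by auto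
      have "th_cong (cnj (g $ 3 $ 1) * u $ 1 + cnj (g $ 2 $ 1) * u $ 2 + cnj (g $ 1 $ 1) * u $ 3) (of_int k * u $ 1 + of_int j * u $ 2 + of_int i * u $ 3)"
        by (intro th_cong_add th_cong_mult2 th_cong_cnj_int th_cong_refl i(2) j(2) k(2) O uO eisenstein_closed)
      hence *: "th_cong (cnj (g $ 3 $ 1) * u $ 1 + cnj (g $ 2 $ 1) * u $ 2 + cnj (g $ 1 $ 1) * u $ 3) (of_int i * u $ 3)"
        unfolding j0 k0 by simp
      show "\<not> th_cong (cnj (g $ 3 $ 1) * u $ 1 + cnj (g $ 2 $ 1) * u $ 2 + cnj (g $ 1 $ 1) * u $ 3) 0"
      proof
        assume "th_cong (cnj (g $ 3 $ 1) * u $ 1 + cnj (g $ 2 $ 1) * u $ 2 + cnj (g $ 1 $ 1) * u $ 3) 0"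
        hence "th_cong (of_int i * u $ 3) 0" using th_cong_trans[OF th_cong_sym[OF *]] by blast
        hence "th_cong (of_int i * (of_int i * u $ 3)) (of_int i * 0)" by (rule th_cong_mult) simp
        thus False using i1 that(3) by auto
      qed
    qed
    have n10: "\<not> th_cong 1 0" "\<not> th_cong (- 1) 0" "th_cong (- 2) 1"
      using th_cong_int[of 1 0] th_cong_int[of "-1" 0] th_cong_int[of "-2" 1] by simp_all
    define n where "n = heis 1 zeta3"
    have nU: "n \<in> lat_unitary" unfolding n_def by (rule heis_unitary) (simp_all add: cnj_zeta3)
    have Ju: "(herm_J *v u) $ 1 = u $ 3" "(herm_J *v u) $ 2 = u $ 2" "(herm_J *v u) $ 3 = u $ 1" for u
      unfolding mat3_vec herm_J_entries by simp_all
    have nJu: "((n ** herm_J) *v u) $ 1 = u $ 3 - u $ 2 + zeta3 * u $ 1" "((n ** herm_J) *v u) $ 2 = u $ 2 + u $ 1" "((n ** herm_J) *v u) $ 3 = u $ 1" for u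
      unfolding matrix_vector_mul_assoc[symmetric] n_def unfolding mat3_vec[of "heis 1 zeta3"] heis_entries Ju by simp_all
    have J: "herm_J *v ua = uk 1" "herm_J *v ub = - uk (- 1)"
      unfolding vec_eq_iff forall_3 Ju by (simp_all add: uk_entries u_entries)
    have nJ: "(n ** herm_J) *v ua = uk 0"
      unfolding vec_eq_iff forall_3 nJu by (simp_all add: uk_entries u_entries)
    \<comment> \<open>In both transformed triples the image of \<open>uc\<close> is among the
      vectors with vanishing value by \<open>vz\<close>. The cubic relation therefore compares the
      cubes of two of the values at \<open>uk 0\<close>, \<open>uk 1\<close>,
      \<open>uk (- 1)\<close>, in the second triple up to a lattice translation.\<close>
    have "tval (herm_J *v uc) \<sigma> = 0"
      by (rule vz) (auto simp: eis_vec_def hform_def Ju u_entries n10)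
    hence 1: "tval (uk (- 1)) \<sigma> ^ 3 = tval (uk 1) \<sigma> ^ 3"
      using tval_cubic_transform[OF herm_J_unitary \<sigma>] unfolding J tval_uminus by simp
    have "tval ((n ** herm_J) *v uc) \<sigma> = 0"
    proof (rule vz)
      have "hform ((n ** herm_J) *v uc) = 1 + sqrt_m3 * (tors * ((- 1 + zeta3) + cnj (- 1 + zeta3)))"
        unfolding hform_def nJu by (simp add: u_entries)
      moreover have "tors * ((- 1 + zeta3) + cnj (- 1 + zeta3)) = sqrt_m3"
      proof -
        have "(- 1 + zeta3) + cnj (- 1 + zeta3) = - 3" by (simp add: cnj_zeta3)
        thus ?thesis by (simp only:) (simp add: tors_conv)
      qed
      ultimately have "hform ((n ** herm_J) *v uc) = 1 + sqrt_m3 * sqrt_m3" by (simp only:)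
      thus "th_cong (hform ((n ** herm_J) *v uc)) 1" unfolding th_cong_def tors_conv by simp
    qed (auto simp: eis_vec_def nJu u_entries n10)
    hence "tval (uk 0) \<sigma> ^ 3 + tval ((n ** herm_J) *v ub) \<sigma> ^ 3 = 0"
      using tval_cubic_transform[OF lat_unitary_mult[OF nU herm_J_unitary] \<sigma>] unfolding nJ by simp
    moreover have "tval ((n ** herm_J) *v ub) \<sigma> ^ 3 = - (tval (uk 1) \<sigma> ^ 3)"
    proof -
      have "tval ((n ** herm_J) *v ub) \<sigma> = - tval (- ((n ** herm_J) *v ub)) \<sigma>" unfolding tval_uminus by simp
      also have "tval (- ((n ** herm_J) *v ub)) \<sigma> = theta3 (tors + sqrt_m3) (tors + 0) (0 + 0) (\<sigma> $ 1) (\<sigma> $ 2)"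
      proof -
        have "tors * - 2 = tors + sqrt_m3" unfolding tors_conv by simp
        thus ?thesis unfolding tval_theta3 vector_uminus_component nJu by (simp add: u_entries)
      qed
      finally have "tval ((n ** herm_J) *v ub) \<sigma> ^ 3 = - (theta3 (tors + sqrt_m3) (tors + 0) (0 + 0) (\<sigma> $ 1) (\<sigma> $ 2) ^ 3)" by simp
      also have "theta3 (tors + sqrt_m3) (tors + 0) (0 + 0) (\<sigma> $ 1) (\<sigma> $ 2) ^ 3 = theta3 tors tors 0 (\<sigma> $ 1) (\<sigma> $ 2) ^ 3"
        by (rule theta3_lattice_cubed(1)[where k = 0]) simp_all
      finally show ?thesis unfolding tk .
    qed
    ultimately have 2: "tval (uk 0) \<sigma> ^ 3 = tval (uk 1) \<sigma> ^ 3" by simp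
    show False by (rule three_values_contradiction[OF G 2[unfolded tk] 1[unfolded tk]])
  qed
qed

section \<open>Multiplier systems of weight one third\<close>

lemma hol2_at_add:
  assumes "hol2_at f \<tau>" "hol2_at g \<tau>" shows "hol2_at (\<lambda>t. f t + g t) \<tau>"
proof -
  obtain f' where f': "(f has_derivative f') (at \<tau>)" "\<And>c v. f' (c *s v) = c * f' v" using assms(1) unfolding hol2_at_def by blast
  obtain g' where g': "(g has_derivative g') (at \<tau>)" "\<And>c v. g' (c *s v) = c * g' v" using assms(2) unfolding hol2_at_def by blast
  show ?thesis unfolding hol2_at_def
    by (rule exI, rule conjI, rule has_derivative_add[OF f'(1) g'(1)]) (simp add: f'(2) g'(2) algebra_simps)
qed

lemma hol2_at_cmult: "hol2_at f \<tau> \<Longrightarrow> hol2_at (\<lambda>t. c * f t) \<tau>"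
  by (rule hol2_at_compose[of f \<tau> "\<lambda>z. c * z" c]) (auto intro!: derivative_eq_intros)

lemma continuous_on_jfac: "continuous_on S (jfac g)"
  unfolding jfac_def by (intro continuous_intros)

lemma continuous_on_act:
  assumes "\<And>\<tau>. \<tau> \<in> S \<Longrightarrow> jfac g \<tau> \<noteq> 0" shows "continuous_on S (act g)"
proof -
  have "continuous_on S (\<lambda>\<tau>. \<chi> i. act g \<tau> $ i)"
  proof (rule continuous_on_vec_lambda)
    have "continuous_on S (\<lambda>\<tau>. act g \<tau> $ 1)" "continuous_on S (\<lambda>\<tau>. act g \<tau> $ 2)"
      unfolding act_components using assms by (auto intro!: continuous_intros continuous_on_jfac)
    thus "continuous_on S (\<lambda>\<tau>. act g \<tau> $ i)" for i using exhaust_2[of i] by auto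
  qed
  thus ?thesis by simp
qed

text \<open>\<open>F\<close> may have a constant \<open>\<kappa>'\<close> of its own:
  \<open>A * W = F ^ 3\<close> only determines its cube, and the resulting cube root of unity is
  absorbed into the second root \<open>b\<close> in \<open>automorphy_exists\<close>.\<close>

definition semi_invariant ::
  "(complex^2 \<Rightarrow> complex) \<Rightarrow> (complex^2 \<Rightarrow> complex) \<Rightarrow> (complex^2 \<Rightarrow> complex) \<Rightarrow> complex^3^3 \<Rightarrow> bool" where
  "semi_invariant A W F g \<longleftrightarrow> g \<in> lat_unitary \<and> (\<exists>\<kappa> \<kappa>'. \<kappa> \<noteq> 0 \<and> \<kappa>' ^ 3 = \<kappa> ^ 3 \<and> (\<forall>\<tau>\<in>siegel_domain.
     A (act g \<tau>) = \<kappa> * jfac g \<tau> * A \<tau> \<and> W (act g \<tau>) = (\<kappa> * jfac g \<tau>)\<^sup>2 * W \<tau> \<and> F (act g \<tau>) = \<kappa>' * jfac g \<tau> * F \<tau>))"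

lemma semi_invariant_mult:
  assumes "semi_invariant A W F g" "semi_invariant A W F h" shows "semi_invariant A W F (g ** h)"
proof -
  have U: "g \<in> lat_unitary" "h \<in> lat_unitary" using assms unfolding semi_invariant_def by auto
  obtain x x' where x: "x \<noteq> 0" "x' ^ 3 = x ^ 3" "\<And>\<tau>. \<tau> \<in> siegel_domain \<Longrightarrow>
     A (act g \<tau>) = x * jfac g \<tau> * A \<tau> \<and> W (act g \<tau>) = (x * jfac g \<tau>)\<^sup>2 * W \<tau> \<and> F (act g \<tau>) = x' * jfac g \<tau> * F \<tau>"
    using assms(1) unfolding semi_invariant_def by blast
  obtain y y' where y: "y \<noteq> 0" "y' ^ 3 = y ^ 3" "\<And>\<tau>. \<tau> \<in> siegel_domain \<Longrightarrow>
     A (act h \<tau>) = y * jfac h \<tau> * A \<tau> \<and> W (act h \<tau>) = (y * jfac h \<tau>)\<^sup>2 * W \<tau> \<and> F (act h \<tau>) = y' * jfac h \<tau> * F \<tau>"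
    using assms(2) unfolding semi_invariant_def by blast
  have "A (act (g ** h) \<tau>) = (x * y) * jfac (g ** h) \<tau> * A \<tau> \<and> W (act (g ** h) \<tau>) = ((x * y) * jfac (g ** h) \<tau>)\<^sup>2 * W \<tau> \<and>
     F (act (g ** h) \<tau>) = (x' * y') * jfac (g ** h) \<tau> * F \<tau>" if t: "\<tau> \<in> siegel_domain" for \<tau>
  proof -
    note h = unitary_height[OF lat_unitaryD[OF U(2)] t]
    note g = unitary_height[OF lat_unitaryD[OF U(1)] h(3)]
    show ?thesis unfolding act_mult[OF h(1) g(1)] jfac_mult[OF h(1)]
      using x(3)[OF h(3)] y(3)[OF t] by (simp add: power_mult_distrib mult_ac)
  qed
  moreover have "x * y \<noteq> 0" "(x' * y') ^ 3 = (x * y) ^ 3" using x y by (simp_all add: power_mult_distrib)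
  ultimately show ?thesis unfolding semi_invariant_def using lat_unitary_mult[OF U] by blast
qed

section \<open>The multiplier as a continuous cube root of the automorphy factor\<close>

definition automorphy :: "(complex^2 \<Rightarrow> complex) \<Rightarrow> complex^3^3 \<Rightarrow> (complex^2 \<Rightarrow> complex) \<Rightarrow> complex \<Rightarrow> bool" where
  "automorphy a g l \<kappa> \<longleftrightarrow> continuous_on siegel_domain l \<and> \<kappa> \<noteq> 0 \<and>
     (\<forall>\<tau>\<in>siegel_domain. l \<tau> \<noteq> 0 \<and> l \<tau> ^ 3 = \<kappa> * jfac g \<tau> \<and> a (act g \<tau>) = l \<tau> * a \<tau>)"

text \<open>A cube root \<open>q\<close> of \<open>\<kappa> j\<close> turns the translated root pair into a root pair for the same data, so
  the two differ by a constant cube root of unity.\<close>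

lemma automorphy_exists:
  assumes g: "semi_invariant A W F g"
    and c: "continuous_on siegel_domain a" "continuous_on siegel_domain b"
    and p: "\<And>\<tau>. \<tau> \<in> siegel_domain \<Longrightarrow> root_pair (A \<tau>) (W \<tau>) (F \<tau>) (a \<tau>) (b \<tau>)"
    and nz: "\<And>\<tau>. \<tau> \<in> siegel_domain \<Longrightarrow> A \<tau> \<noteq> 0 \<or> W \<tau> \<noteq> 0"
  shows "\<exists>l \<kappa>. automorphy a g l \<kappa>"
proof -
  have U: "g \<in> lat_unitary" using g unfolding semi_invariant_def by auto
  note u = unitary_height[OF lat_unitaryD[OF U]]
  obtain x x' where x: "x \<noteq> 0" "x' ^ 3 = x ^ 3" and inv: "\<And>\<tau>. \<tau> \<in> siegel_domain \<Longrightarrow>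
     A (act g \<tau>) = x * jfac g \<tau> * A \<tau> \<and> W (act g \<tau>) = (x * jfac g \<tau>)\<^sup>2 * W \<tau> \<and> F (act g \<tau>) = x' * jfac g \<tau> * F \<tau>"
    using g unfolding semi_invariant_def by blast
  have x'0: "x' \<noteq> 0" using x by auto
  have cj: "continuous_on siegel_domain (\<lambda>\<tau>. x * jfac g \<tau>)" by (intro continuous_intros continuous_on_jfac)
  have nj: "x * jfac g \<tau> \<noteq> 0" if "\<tau> \<in> siegel_domain" for \<tau> using u(1)[OF that] x(1) by simp
  have "\<exists>L. continuous_on siegel_domain L \<and> (\<forall>\<tau>\<in>siegel_domain. x * jfac g \<tau> = exp (L \<tau>))"
  proof (rule continuous_logarithm_on_contractible[OF cj convex_imp_contractible[OF convex_siegel_domain] nj])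
    fix L assume "continuous_on siegel_domain L" "\<And>\<tau>. \<tau> \<in> siegel_domain \<Longrightarrow> x * jfac g \<tau> = exp (L \<tau>)"
    thus ?thesis by blast
  qed
  then obtain L where L: "continuous_on siegel_domain L" "\<And>\<tau>. \<tau> \<in> siegel_domain \<Longrightarrow> x * jfac g \<tau> = exp (L \<tau>)" by blast
  define q where "q = (\<lambda>\<tau>. exp (L \<tau> / 3))"
  have q0: "q \<tau> \<noteq> 0" for \<tau> unfolding q_def by simp
  have q3: "q \<tau> ^ 3 = x * jfac g \<tau>" if "\<tau> \<in> siegel_domain" for \<tau>
    unfolding L(2)[OF that] q_def exp_of_nat_mult[symmetric] by simp
  have cq: "continuous_on siegel_domain q" unfolding q_def by (intro continuous_intros L(1)) auto
  have cg: "continuous_on siegel_domain (act g)" by (rule continuous_on_act[OF u(1)])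
  have im: "act g ` siegel_domain \<subseteq> siegel_domain" using u(3) by auto
  define a' where "a' = (\<lambda>\<tau>. a (act g \<tau>) / q \<tau>)"
  define b' where "b' = (\<lambda>\<tau>. x / x' * b (act g \<tau>) / (q \<tau>)\<^sup>2)"
  have ca: "continuous_on siegel_domain a'" "continuous_on siegel_domain b'"
    unfolding a'_def b'_def
    by (intro continuous_intros continuous_on_compose2[OF c(1) cg im] continuous_on_compose2[OF c(2) cg im] cq; simp add: q0 x'0)+
  have p': "root_pair (A \<tau>) (W \<tau>) (F \<tau>) (a' \<tau>) (b' \<tau>)" if t: "\<tau> \<in> siegel_domain" for \<tau>
  proof -
    have "root_pair (A (act g \<tau>)) (W (act g \<tau>)) (F (act g \<tau>)) (a (act g \<tau>)) (b (act g \<tau>))" by (rule p[OF u(3)[OF t]])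
    hence e: "a (act g \<tau>) ^ 3 = q \<tau> ^ 3 * A \<tau>" "b (act g \<tau>) ^ 3 = (q \<tau> ^ 3)\<^sup>2 * W \<tau>" "a (act g \<tau>) * b (act g \<tau>) = x' / x * q \<tau> ^ 3 * F \<tau>"
      using inv[OF t] x(1) unfolding root_pair_def q3[OF t] by auto
    have "a' \<tau> ^ 3 = A \<tau>" unfolding a'_def power_divide e(1) using q0[of \<tau>] by simp
    moreover have "b' \<tau> ^ 3 = W \<tau>"
    proof -
      have "((q \<tau>)\<^sup>2) ^ 3 = (q \<tau> ^ 3)\<^sup>2" by (simp add: power_mult[symmetric] mult.commute)
      moreover have "(x / x') ^ 3 = 1" unfolding power_divide x(2) using x(1) by simp
      ultimately show ?thesis unfolding b'_def power_divide power_mult_distrib e(2) using q0[of \<tau>] by (simp add: power_divide)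
    qed
    moreover have "a' \<tau> * b' \<tau> = F \<tau>"
    proof -
      have "a' \<tau> * b' \<tau> = x / x' * (a (act g \<tau>) * b (act g \<tau>)) / q \<tau> ^ 3"
        unfolding a'_def b'_def by (simp add: power2_eq_square power3_eq_cube mult_ac)
      also have "\<dots> = F \<tau>" unfolding e(3) using x(1) x'0 q0[of \<tau>] by simp
      finally show ?thesis .
    qed
    ultimately show ?thesis unfolding root_pair_def by blast
  qed
  obtain w where w: "w ^ 3 = 1" "\<And>\<tau>. \<tau> \<in> siegel_domain \<Longrightarrow> a' \<tau> = w * a \<tau>"
    using root_pairs_proportional[OF convex_connected[OF convex_siegel_domain] c ca p p' nz] by metis
  have "automorphy a g (\<lambda>\<tau>. w * q \<tau>) x"
    unfolding automorphy_def
  proof (intro conjI ballI)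
    show "continuous_on siegel_domain (\<lambda>\<tau>. w * q \<tau>)" by (intro continuous_intros cq)
    show "x \<noteq> 0" by (rule x(1))
    fix \<tau> assume t: "\<tau> \<in> siegel_domain"
    show "w * q \<tau> \<noteq> 0" using q0 cube_root_of_unity(3)[OF w(1)] by simp
    show "(w * q \<tau>) ^ 3 = x * jfac g \<tau>" unfolding power_mult_distrib w(1) q3[OF t] by simp
    show "a (act g \<tau>) = w * q \<tau> * a \<tau>" using w(2)[OF t] q0[of \<tau>] unfolding a'_def by (simp add: field_simps)
  qed
  thus ?thesis by blast
qed

text \<open>Where \<open>a\<close> is nonzero the relation follows by evaluating \<open>a\<close>.
  Since \<open>a\<close> may have zeros, the quotient \<open>r\<close> of both sides is considered:
  its cube is constant, so \<open>r\<close> is constant by connectedness and equals its value 1 at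
  \<open>t0\<close>.\<close>

lemma automorphy_cocycle:
  assumes g: "automorphy a g lg x" and h: "automorphy a h lh y" and gh: "automorphy a (g ** h) lgh z"
    and U: "g \<in> lat_unitary" "h \<in> lat_unitary" and t0: "t0 \<in> siegel_domain" "a t0 \<noteq> 0"
    and \<tau>: "\<tau> \<in> siegel_domain"
  shows "lgh \<tau> = lg (act h \<tau>) * lh \<tau>"
proof -
  note uh = unitary_height[OF lat_unitaryD[OF U(2)]]
  note ug = unitary_height[OF lat_unitaryD[OF U(1)]]
  have cont: "continuous_on siegel_domain lg" "continuous_on siegel_domain lh" "continuous_on siegel_domain lgh"
    using g h gh unfolding automorphy_def by auto
  have xyz: "x \<noteq> 0" "y \<noteq> 0" "z \<noteq> 0" using g h gh unfolding automorphy_def by auto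
  have G: "lg t \<noteq> 0" "lg t ^ 3 = x * jfac g t" "a (act g t) = lg t * a t" if "t \<in> siegel_domain" for t
    using g that unfolding automorphy_def by auto
  have H: "lh t \<noteq> 0" "lh t ^ 3 = y * jfac h t" "a (act h t) = lh t * a t" if "t \<in> siegel_domain" for t
    using h that unfolding automorphy_def by auto
  have GH: "lgh t \<noteq> 0" "lgh t ^ 3 = z * jfac (g ** h) t" "a (act (g ** h) t) = lgh t * a t" if "t \<in> siegel_domain" for t
    using gh that unfolding automorphy_def by auto
  define r where "r = (\<lambda>t. lgh t / (lg (act h t) * lh t))"
  have ch: "continuous_on siegel_domain (act h)" by (rule continuous_on_act[OF uh(1)])
  have im: "act h ` siegel_domain \<subseteq> siegel_domain" using uh(3) by auto
  have cr: "continuous_on siegel_domain r" unfolding r_def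
    by (intro continuous_intros cont continuous_on_compose2[OF cont(1) ch im]) (use G(1) H(1) uh(3) in auto)
  have r3: "r t ^ 3 = z / (x * y)" if t: "t \<in> siegel_domain" for t
  proof -
    have "jfac g (act h t) \<noteq> 0" "jfac h t \<noteq> 0" using ug(1)[OF uh(3)[OF t]] uh(1)[OF t] by auto
    thus ?thesis unfolding r_def power_divide power_mult_distrib G(2)[OF uh(3)[OF t]] H(2)[OF t] GH(2)[OF t] jfac_mult[OF uh(1)[OF t]]
      by (simp add: mult_ac)
  qed
  have "r ` siegel_domain \<subseteq> {w. w ^ 3 = z / (x * y)}" using r3 by auto
  hence "finite (r ` siegel_domain)" by (rule finite_subset) (simp add: finite_nth_roots)
  hence "r constant_on siegel_domain" by (rule continuous_finite_range_constant[OF convex_connected[OF convex_siegel_domain] cr])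
  hence "r \<tau> = r t0" unfolding constant_on_def using \<tau> t0(1) by metis
  also have "r t0 = 1"
  proof -
    have e: "act (g ** h) t0 = act g (act h t0)" by (rule act_mult[OF uh(1)[OF t0(1)] ug(1)[OF uh(3)[OF t0(1)]]])
    have "lgh t0 * a t0 = a (act g (act h t0))" unfolding e[symmetric] by (rule GH(3)[OF t0(1), symmetric])
    also have "\<dots> = lg (act h t0) * (lh t0 * a t0)" unfolding G(3)[OF uh(3)[OF t0(1)]] H(3)[OF t0(1)] ..
    finally have "lgh t0 * a t0 = lg (act h t0) * (lh t0 * a t0)" .
    hence "lgh t0 * a t0 = (lg (act h t0) * lh t0) * a t0" by (simp only: mult.assoc)
    hence "lgh t0 = lg (act h t0) * lh t0" by (simp only: mult_right_cancel[OF t0(2)])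
    thus ?thesis unfolding r_def using G(1)[OF uh(3)[OF t0(1)]] H(1)[OF t0(1)] by simp
  qed
  finally show ?thesis unfolding r_def using G(1)[OF uh(3)[OF \<tau>]] H(1)[OF \<tau>] by simp
qed

lemma multiplier_system_from_root:
  assumes \<Gamma>: "\<And>g. g \<in> \<Gamma> \<Longrightarrow> semi_invariant A W F g"
    and c: "continuous_on siegel_domain a" "continuous_on siegel_domain b"
    and p: "\<And>\<tau>. \<tau> \<in> siegel_domain \<Longrightarrow> root_pair (A \<tau>) (W \<tau>) (F \<tau>) (a \<tau>) (b \<tau>)"
    and nz: "\<And>\<tau>. \<tau> \<in> siegel_domain \<Longrightarrow> A \<tau> \<noteq> 0 \<or> W \<tau> \<noteq> 0"
    and t0: "t0 \<in> siegel_domain" "a t0 \<noteq> 0"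
  obtains l where "multiplier_system 1 3 \<Gamma> l" "\<And>g \<tau>. g \<in> \<Gamma> \<Longrightarrow> \<tau> \<in> siegel_domain \<Longrightarrow> a (act g \<tau>) = l g \<tau> * a \<tau>"
proof -
  have "\<forall>g. \<exists>l \<kappa>. semi_invariant A W F g \<longrightarrow> automorphy a g l \<kappa>"
    using automorphy_exists[OF _ c p nz] by blast
  then obtain l \<kappa> where l: "\<And>g. semi_invariant A W F g \<Longrightarrow> automorphy a g (l g) (\<kappa> g)" by metis
  have U: "g \<in> lat_unitary" if "g \<in> \<Gamma>" for g using \<Gamma>[OF that] unfolding semi_invariant_def by blast
  have coc: "l (g ** h) \<tau> = l g (act h \<tau>) * l h \<tau>" if "g \<in> \<Gamma>" "h \<in> \<Gamma>" "\<tau> \<in> siegel_domain" for g h \<tau>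
    by (rule automorphy_cocycle[OF l[OF \<Gamma>[OF that(1)]] l[OF \<Gamma>[OF that(2)]] l[OF semi_invariant_mult[OF \<Gamma>[OF that(1)] \<Gamma>[OF that(2)]]]
       U[OF that(1)] U[OF that(2)] t0 that(3)])
  have aut: "automorphy a g (l g) (\<kappa> g)" if "g \<in> \<Gamma>" for g by (rule l[OF \<Gamma>[OF that]])
  have "multiplier_system 1 3 \<Gamma> l"
    unfolding multiplier_system_def
    using aut coc unfolding automorphy_def by (intro conjI ballI exI[of _ \<kappa>]) auto
  moreover have "a (act g \<tau>) = l g \<tau> * a \<tau>" if "g \<in> \<Gamma>" "\<tau> \<in> siegel_domain" for g \<tau>
    using aut[OF that(1)] that(2) unfolding automorphy_def by blast
  ultimately show ?thesis using that by blast
qed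

text \<open>Where \<open>A\<close> is nonzero, \<open>a\<close> is a holomorphic branch of its cube
  root. At a zero of \<open>A\<close> the function \<open>W\<close> is nonzero, so \<open>b\<close>
  is holomorphic and nonzero nearby, and \<open>a = F / b\<close>.\<close>

lemma root_hol2_at:
  assumes c: "continuous_on siegel_domain a" "continuous_on siegel_domain b"
    and h: "\<And>\<tau>. \<tau> \<in> siegel_domain \<Longrightarrow> hol2_at A \<tau>" "\<And>\<tau>. \<tau> \<in> siegel_domain \<Longrightarrow> hol2_at W \<tau>" "\<And>\<tau>. \<tau> \<in> siegel_domain \<Longrightarrow> hol2_at F \<tau>"
    and p: "\<And>\<tau>. \<tau> \<in> siegel_domain \<Longrightarrow> root_pair (A \<tau>) (W \<tau>) (F \<tau>) (a \<tau>) (b \<tau>)"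
    and nz: "\<And>\<tau>. \<tau> \<in> siegel_domain \<Longrightarrow> A \<tau> \<noteq> 0 \<or> W \<tau> \<noteq> 0"
    and \<tau>: "\<tau> \<in> siegel_domain"
  shows "hol2_at a \<tau>"
proof -
  have ev: "\<forall>\<^sub>F t in nhds \<tau>. t \<in> siegel_domain" by (rule eventually_nhds_in_open[OF open_siegel_domain \<tau>])
  have ic: "isCont a \<tau>" "isCont b \<tau>" using c \<tau> open_siegel_domain by (auto simp: continuous_on_eq_continuous_at)
  show ?thesis
  proof (cases "A \<tau> = 0")
    case False
    have "\<forall>\<^sub>F t in nhds \<tau>. a t ^ 3 = A t" using ev by (rule eventually_mono) (use p in \<open>auto simp: root_pair_def\<close>)
    thus ?thesis by (rule cube_root_hol2_at[OF ic(1) h(1)[OF \<tau>] False])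
  next
    case True
    hence W: "W \<tau> \<noteq> 0" using nz[OF \<tau>] by simp
    have "\<forall>\<^sub>F t in nhds \<tau>. b t ^ 3 = W t" using ev by (rule eventually_mono) (use p in \<open>auto simp: root_pair_def\<close>)
    hence hb: "hol2_at b \<tau>" by (rule cube_root_hol2_at[OF ic(2) h(2)[OF \<tau>] W])
    have b0: "b \<tau> \<noteq> 0" using p[OF \<tau>] W unfolding root_pair_def by auto
    have "hol2_at (\<lambda>t. inverse (b t)) \<tau>"
      by (rule hol2_at_compose[OF hb DERIV_inverse[OF b0]])
    hence q: "hol2_at (\<lambda>t. F t * inverse (b t)) \<tau>" by (rule hol2_at_mult[OF h(3)[OF \<tau>]])
    have "(b \<longlongrightarrow> b \<tau>) (nhds \<tau>)" using ic(2) unfolding isCont_def tendsto_at_iff_tendsto_nhds .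
    hence "\<forall>\<^sub>F t in nhds \<tau>. b t \<noteq> 0" using b0 by (rule tendsto_imp_eventually_ne)
    hence "\<forall>\<^sub>F t in nhds \<tau>. a t = F t * inverse (b t)"
      using ev
    proof eventually_elim
      case (elim t)
      have "a t * b t = F t" using p[OF elim(2)] unfolding root_pair_def by simp
      thus ?case using elim(1) by (simp add: field_simps)
    qed
    thus ?thesis by (rule hol2_at_cong[OF q])
  qed
qed

theorem modular_form_from_triple:
  assumes h: "\<And>\<tau>. \<tau> \<in> siegel_domain \<Longrightarrow> hol2_at F1 \<tau>" "\<And>\<tau>. \<tau> \<in> siegel_domain \<Longrightarrow> hol2_at F2 \<tau>" "\<And>\<tau>. \<tau> \<in> siegel_domain \<Longrightarrow> hol2_at F3 \<tau>"
    and cub: "\<And>\<tau>. \<tau> \<in> siegel_domain \<Longrightarrow> F1 \<tau> ^ 3 + F2 \<tau> ^ 3 + F3 \<tau> ^ 3 = 0"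
    and ncz: "\<And>\<tau>. \<tau> \<in> siegel_domain \<Longrightarrow> F1 \<tau> \<noteq> 0 \<or> F2 \<tau> \<noteq> 0 \<or> F3 \<tau> \<noteq> 0"
    and \<Gamma>: "\<And>g. g \<in> \<Gamma> \<Longrightarrow> g \<in> lat_unitary \<and> (\<exists>\<kappa> \<kappa>'. \<kappa> \<noteq> 0 \<and> \<kappa>' ^ 3 = \<kappa> ^ 3 \<and> (\<forall>\<tau>\<in>siegel_domain.
       F1 (act g \<tau>) = \<kappa> * jfac g \<tau> * F1 \<tau> \<and> F2 (act g \<tau>) = \<kappa> * jfac g \<tau> * F2 \<tau> \<and> F3 (act g \<tau>) = \<kappa>' * jfac g \<tau> * F3 \<tau>))"
  shows "\<exists>f. holomorphic_modular_form 1 3 \<Gamma> f \<and> (\<exists>\<tau>\<in>siegel_domain. f \<tau> \<noteq> 0)"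
proof -
  \<comment> \<open>\<open>w\<close> is chosen so that the form does not vanish identically: if both
    w = 1 and w = zeta3 failed at a point, all three functions would vanish there.\<close>
  obtain w t0 where w: "w ^ 3 = 1" and t0: "t0 \<in> siegel_domain" "F1 t0 + w * F2 t0 \<noteq> 0"
  proof -
    obtain t where t: "t \<in> siegel_domain" using siegel_domain_nonempty by blast
    have "F1 t + 1 * F2 t \<noteq> 0 \<or> F1 t + zeta3 * F2 t \<noteq> 0"
    proof (rule ccontr)
      assume "\<not> ?thesis"
      hence 0: "F1 t + F2 t = 0" "F1 t + zeta3 * F2 t = 0" by auto
      hence "(1 - zeta3) * F2 t = 0" by algebra
      hence "F2 t = 0" using zeta3_ne_1 by auto
      thus False using 0 cub[OF t] ncz[OF t] by auto
    qed
    thus ?thesis using that[of 1 t] that[of zeta3 t] t zeta3_cube by auto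
  qed
  define A where "A = (\<lambda>t. F1 t + w * F2 t)"
  define W where "W = (\<lambda>t. (F1 t + (w * zeta3) * F2 t) * (F1 t + (w * (zeta3 * zeta3)) * F2 t))"
  define F where "F = (\<lambda>t. (- 1) * F3 t)"
  have w3: "w * (w * w) = 1" by (rule cube_root_of_unity(4)[OF w])
  have AW: "A t * W t = F t ^ 3" if t: "t \<in> siegel_domain" for t
  proof -
    have "A t * W t = F1 t ^ 3 + F2 t ^ 3" unfolding A_def W_def using w3 zeta3_sq by algebra
    also have "\<dots> = F t ^ 3" using cub[OF t] unfolding F_def by (simp add: eq_neg_iff_add_eq_0)
    finally show ?thesis .
  qed
  have hA: "hol2_at A t" "hol2_at W t" "hol2_at F t" if t: "t \<in> siegel_domain" for t
    unfolding A_def W_def F_def by (intro hol2_at_add hol2_at_mult hol2_at_cmult h t)+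
  have cA: "continuous_on siegel_domain A" "continuous_on siegel_domain W" "continuous_on siegel_domain F"
    using hA hol2_at_isCont by (auto intro!: continuous_at_imp_continuous_on)
  have nz: "A t \<noteq> 0 \<or> W t \<noteq> 0" if t: "t \<in> siegel_domain" for t
  proof (rule ccontr)
    assume "\<not> ?thesis"
    hence z: "F1 t + w * F2 t = 0" "F1 t + (w * zeta3) * F2 t = 0 \<or> F1 t + (w * (zeta3 * zeta3)) * F2 t = 0"
      unfolding A_def W_def by auto
    have "w * (1 - zeta3) * F2 t = 0 \<or> w * (1 - zeta3 * zeta3) * F2 t = 0"
      using z by (elim disjE) (rule disjI1, algebra, rule disjI2, algebra)
    hence "F2 t = 0" using zeta3_ne_1 zeta3_sq_ne_1 cube_root_of_unity(3)[OF w] by auto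
    thus False using z(1) cub[OF t] ncz[OF t] by auto
  qed
  obtain a b where ab: "continuous_on siegel_domain a" "continuous_on siegel_domain b"
    "\<And>t. t \<in> siegel_domain \<Longrightarrow> root_pair (A t) (W t) (F t) (a t) (b t)"
    using global_cube_root[OF open_siegel_domain convex_siegel_domain cA AW nz] by blast
  have a0: "a t0 \<noteq> 0" using ab(3)[OF t0(1)] t0(2) unfolding root_pair_def A_def by auto
  have "semi_invariant A W F g" if g: "g \<in> \<Gamma>" for g
  proof -
    obtain x x' where x: "x \<noteq> 0" "x' ^ 3 = x ^ 3" "\<And>\<tau>. \<tau> \<in> siegel_domain \<Longrightarrow>
       F1 (act g \<tau>) = x * jfac g \<tau> * F1 \<tau> \<and> F2 (act g \<tau>) = x * jfac g \<tau> * F2 \<tau> \<and> F3 (act g \<tau>) = x' * jfac g \<tau> * F3 \<tau>"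
      using \<Gamma>[OF g] by blast
    have "A (act g \<tau>) = x * jfac g \<tau> * A \<tau> \<and> W (act g \<tau>) = (x * jfac g \<tau>)\<^sup>2 * W \<tau> \<and> F (act g \<tau>) = x' * jfac g \<tau> * F \<tau>"
      if t: "\<tau> \<in> siegel_domain" for \<tau>
    proof -
      define k where "k = x * jfac g \<tau>"
      have e: "F1 (act g \<tau>) = k * F1 \<tau>" "F2 (act g \<tau>) = k * F2 \<tau>" "F3 (act g \<tau>) = x' * jfac g \<tau> * F3 \<tau>"
        using x(3)[OF t] unfolding k_def by auto
      show ?thesis unfolding A_def W_def F_def e k_def[symmetric] by (simp add: power2_eq_square algebra_simps)
    qed
    thus ?thesis unfolding semi_invariant_def using \<Gamma>[OF g] x(1,2) by blast
  qed
  from multiplier_system_from_root[OF this ab nz t0(1) a0]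
  obtain l where "multiplier_system 1 3 \<Gamma> l" "\<And>g \<tau>. g \<in> \<Gamma> \<Longrightarrow> \<tau> \<in> siegel_domain \<Longrightarrow> a (act g \<tau>) = l g \<tau> * a \<tau>" by blast
  moreover have "holomorphic2_on a siegel_domain"
    unfolding holomorphic2_on_iff[OF open_siegel_domain] using root_hol2_at[OF ab(1,2) hA ab(3) nz] by blast
  ultimately show ?thesis unfolding holomorphic_modular_form_def using t0(1) a0 by blast
qed

section \<open>The twelve subgroups\<close>

lemma tval_hol2_at: "\<tau> \<in> siegel_domain \<Longrightarrow> hol2_at (tval u) \<tau>"
proof -
  have "holomorphic2_on (tval u) siegel_domain" using theta3_holomorphic2 unfolding tval_theta3 .
  thus "\<tau> \<in> siegel_domain \<Longrightarrow> hol2_at (tval u) \<tau>" unfolding holomorphic2_on_iff[OF open_siegel_domain] by blast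
qed

text \<open>Only the characters of \<open>u1\<close> and \<open>u2\<close> have to agree, because
  these two functions are added. The third function enters through its cube, so its character, of
  order dividing 3, is harmless.\<close>

lemma modular_form_from_vectors:
  assumes u: "eis_vec u1" "eis_vec u2" "eis_vec u3"
    and cub: "\<And>\<tau>. \<tau> \<in> siegel_domain \<Longrightarrow> tval u1 \<tau> ^ 3 + tval u2 \<tau> ^ 3 + tval u3 \<tau> ^ 3 = 0"
    and ncz: "\<And>\<tau>. \<tau> \<in> siegel_domain \<Longrightarrow> tval u1 \<tau> \<noteq> 0 \<or> tval u2 \<tau> \<noteq> 0 \<or> tval u3 \<tau> \<noteq> 0"
    and \<Gamma>: "\<Gamma> \<subseteq> Gamma_sqrt_m3" "\<And>g. g \<in> \<Gamma> \<Longrightarrow> gamma_char g u1 = gamma_char g u2"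
  shows "\<exists>f. holomorphic_modular_form 1 3 \<Gamma> f \<and> (\<exists>\<tau>\<in>siegel_domain. f \<tau> \<noteq> 0)"
proof (rule modular_form_from_triple[OF tval_hol2_at tval_hol2_at tval_hol2_at cub ncz])
  fix g assume "g \<in> \<Gamma>"
  hence g: "g \<in> Gamma_sqrt_m3" and eq: "gamma_char g u1 = gamma_char g u2" using \<Gamma> by auto
  obtain k where k: "k \<noteq> 0" "\<And>u \<tau>. eis_vec u \<Longrightarrow> \<tau> \<in> siegel_domain \<Longrightarrow> tval u (act g \<tau>) = k * gamma_char g u * jfac g \<tau> * tval u \<tau>"
    using theta_gamma[OF g] unfolding tval_def by blast
  have c: "gamma_char g u1 ^ 3 = 1" "gamma_char g u3 ^ 3 = 1" by (rule gamma_char_cube[OF g u(1)], rule gamma_char_cube[OF g u(3)])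
  have 1: "k * gamma_char g u1 \<noteq> 0" using k(1) c(1) by auto
  have 2: "(k * gamma_char g u3) ^ 3 = (k * gamma_char g u1) ^ 3" unfolding power_mult_distrib c ..
  show "g \<in> lat_unitary \<and> (\<exists>\<kappa> \<kappa>'. \<kappa> \<noteq> 0 \<and> \<kappa>' ^ 3 = \<kappa> ^ 3 \<and> (\<forall>\<tau>\<in>siegel_domain.
       tval u1 (act g \<tau>) = \<kappa> * jfac g \<tau> * tval u1 \<tau> \<and> tval u2 (act g \<tau>) = \<kappa> * jfac g \<tau> * tval u2 \<tau> \<and>
       tval u3 (act g \<tau>) = \<kappa>' * jfac g \<tau> * tval u3 \<tau>))"
    by (intro conjI ballI exI[of _ "k * gamma_char g u1"] exI[of _ "k * gamma_char g u3"] gamma_partD(3)[OF g] 1 2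
        k(2)[OF u(1)] k(2)[OF u(2), folded eq] k(2)[OF u(3)])
qed

definition vec_residue :: "complex^3 \<Rightarrow> int \<Rightarrow> int \<Rightarrow> int \<Rightarrow> bool" where
  "vec_residue u p q r \<longleftrightarrow> eis_vec u \<and> th_cong (u $ 1) (of_int p) \<and> th_cong (u $ 2) (of_int q) \<and> th_cong (u $ 3) (of_int r)"

lemma gamma_char_eq_int:
  assumes g: "g \<in> Upsilon_index3 a b c d" and u: "vec_residue u p q r" and u': "vec_residue u' p' q' r'"
    and d: "3 dvd 2 * q * r - (2 * q' * r' + k * int a)" "3 dvd r * r - (r' * r' + k * int b)"
      "3 dvd 2 * p * q - (2 * p' * q' + k * int c)" "3 dvd p * p - (p' * p' + k * int d)"
  shows "gamma_char g u = gamma_char g u'"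
proof -
  have e: "eis_vec u" "eis_vec u'" using u u' unfolding vec_residue_def by auto
  have O: "u $ 1 \<in> eisenstein" "u $ 2 \<in> eisenstein" "u $ 3 \<in> eisenstein" "u' $ 1 \<in> eisenstein" "u' $ 2 \<in> eisenstein" "u' $ 3 \<in> eisenstein"
    using e unfolding eis_vec_def by auto
  have R: "th_cong (u $ 1) (of_int p)" "th_cong (u $ 2) (of_int q)" "th_cong (u $ 3) (of_int r)"
    "th_cong (u' $ 1) (of_int p')" "th_cong (u' $ 2) (of_int q')" "th_cong (u' $ 3) (of_int r')"
    using u u' unfolding vec_residue_def by auto
  have sq: "th_cong (x * y) (of_int (m * n))" if "th_cong x (of_int m)" "th_cong y (of_int n)" "y \<in> eisenstein" for x y m n
    using th_cong_mult2[OF that(1,2) _ that(3)] by simp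
  have dq: "th_cong (2 * x * y) (of_int (2 * m * n))" if "th_cong x (of_int m)" "th_cong y (of_int n)" "y \<in> eisenstein" for x y m n
    using th_cong_mult[OF sq[OF that], of 2] by (simp add: mult.assoc)
  have main: "th_cong x (y + of_int k * of_nat s)" if "th_cong x (of_int m)" "th_cong y (of_int n)" "3 dvd m - (n + k * int s)" for x y m n s
  proof -
    have "th_cong (of_int m) (of_int (n + k * int s))" unfolding th_cong_int by (rule that(3))
    moreover have "th_cong (of_int (n + k * int s)) (y + of_int k * of_nat s)"
      using th_cong_add[OF th_cong_sym[OF that(2)] th_cong_refl[of "of_int k * of_nat s"]] by simp
    ultimately show ?thesis using th_cong_trans that(1) by blast
  qed
  show ?thesis
    by (rule gamma_char_eq[OF g e eisenstein_closed(5)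
      main[OF dq[OF R(2) R(3) O(3)] dq[OF R(5) R(6) O(6)] d(1)] main[OF sq[OF R(3) R(3) O(3)] sq[OF R(6) R(6) O(6)] d(2)]
      main[OF dq[OF R(1) R(2) O(2)] dq[OF R(4) R(5) O(5)] d(3)] main[OF sq[OF R(1) R(1) O(1)] sq[OF R(4) R(4) O(4)] d(4)]])
qed

lemma vec_residue_u: "vec_residue ua 0 1 1" "vec_residue ub 0 (- 1) 1" "vec_residue uc 1 0 (- 1)"
  unfolding vec_residue_def eis_vec_def u_entries by simp_all

lemma vec_residue_J: "vec_residue u p q r \<Longrightarrow> vec_residue (herm_J *v u) r q p"
  unfolding vec_residue_def eis_vec_def mat3_vec herm_J_entries by simp

lemma vec_residue_heis:
  assumes "vec_residue u p q r" shows "vec_residue (heis (of_int e) zeta3 *v u) (p - e * q + r) (q + e * r) r"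
proof -
  have O: "u $ 1 \<in> eisenstein" "u $ 2 \<in> eisenstein" "u $ 3 \<in> eisenstein" using assms unfolding vec_residue_def eis_vec_def by auto
  have R: "th_cong (u $ 1) (of_int p)" "th_cong (u $ 2) (of_int q)" "th_cong (u $ 3) (of_int r)" using assms unfolding vec_residue_def by auto
  have z: "th_cong zeta3 1" unfolding th_cong_def using zeta_tors by (simp add: mult.commute)
  have n: "(heis (of_int e) zeta3 *v u) $ 1 = u $ 1 + of_int (- e) * u $ 2 + zeta3 * u $ 3"
    "(heis (of_int e) zeta3 *v u) $ 2 = u $ 2 + of_int e * u $ 3" "(heis (of_int e) zeta3 *v u) $ 3 = u $ 3"
    unfolding mat3_vec heis_entries by simp_all
  have "th_cong (u $ 1 + of_int (- e) * u $ 2 + zeta3 * u $ 3) (of_int p + of_int (- e) * of_int q + 1 * of_int r)"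
    by (intro th_cong_add th_cong_mult th_cong_mult2 R z O eisenstein_closed)
  moreover have "th_cong (u $ 2 + of_int e * u $ 3) (of_int q + of_int e * of_int r)"
    by (intro th_cong_add th_cong_mult R eisenstein_closed)
  ultimately show ?thesis unfolding vec_residue_def eis_vec_def n using O R by simp
qed

text \<open>The parts correspond to the three ways of choosing two vectors of a triple. The
  divisibility conditions concern the quadratic map (p, q, r) -> (2qr, r^2, 2pq, p^2), whose values
  at the two vectors must differ by \<open>k\<close> times (a, b, c, d) modulo 3.\<close>

lemma modular_form_from_pair:
  assumes g: "g \<in> lat_unitary" and u: "vec_residue (g *v ua) p1 q1 r1" "vec_residue (g *v ub) p2 q2 r2" "vec_residue (g *v uc) p3 q3 r3"
  shows "3 dvd 2 * q1 * r1 - (2 * q2 * r2 + k * int a) \<Longrightarrow> 3 dvd r1 * r1 - (r2 * r2 + k * int b) \<Longrightarrow>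
      3 dvd 2 * p1 * q1 - (2 * p2 * q2 + k * int c) \<Longrightarrow> 3 dvd p1 * p1 - (p2 * p2 + k * int d) \<Longrightarrow>
      \<exists>f. holomorphic_modular_form 1 3 (Upsilon_index3 a b c d) f \<and> (\<exists>\<tau>\<in>siegel_domain. f \<tau> \<noteq> 0)" (is "PROP ?ab")
    and "3 dvd 2 * q1 * r1 - (2 * q3 * r3 + k * int a) \<Longrightarrow> 3 dvd r1 * r1 - (r3 * r3 + k * int b) \<Longrightarrow>
      3 dvd 2 * p1 * q1 - (2 * p3 * q3 + k * int c) \<Longrightarrow> 3 dvd p1 * p1 - (p3 * p3 + k * int d) \<Longrightarrow>
      \<exists>f. holomorphic_modular_form 1 3 (Upsilon_index3 a b c d) f \<and> (\<exists>\<tau>\<in>siegel_domain. f \<tau> \<noteq> 0)" (is "PROP ?ac")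
    and "3 dvd 2 * q2 * r2 - (2 * q3 * r3 + k * int a) \<Longrightarrow> 3 dvd r2 * r2 - (r3 * r3 + k * int b) \<Longrightarrow>
      3 dvd 2 * p2 * q2 - (2 * p3 * q3 + k * int c) \<Longrightarrow> 3 dvd p2 * p2 - (p3 * p3 + k * int d) \<Longrightarrow>
      \<exists>f. holomorphic_modular_form 1 3 (Upsilon_index3 a b c d) f \<and> (\<exists>\<tau>\<in>siegel_domain. f \<tau> \<noteq> 0)" (is "PROP ?bc")
proof -
  have e: "eis_vec (g *v ua)" "eis_vec (g *v ub)" "eis_vec (g *v uc)" using u unfolding vec_residue_def by auto
  have cub: "tval (g *v ua) \<tau> ^ 3 + tval (g *v ub) \<tau> ^ 3 + tval (g *v uc) \<tau> ^ 3 = 0" if "\<tau> \<in> siegel_domain" for \<tau>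
    by (rule tval_cubic_transform[OF g that])
  have ncz: "tval (g *v ua) \<tau> \<noteq> 0 \<or> tval (g *v ub) \<tau> \<noteq> 0 \<or> tval (g *v uc) \<tau> \<noteq> 0" if t: "\<tau> \<in> siegel_domain" for \<tau>
  proof (rule ccontr)
    assume z: "\<not> ?thesis"
    obtain k where k: "k \<noteq> 0" "\<And>u \<tau>. \<tau> \<in> siegel_domain \<Longrightarrow> tval (g *v u) (act g \<tau>) = k * jfac g \<tau> * tval u \<tau>"
      using tval_covariant[OF g] by blast
    define \<sigma> where "\<sigma> = act (unitary_inv g) \<tau>"
    have s: "\<sigma> \<in> siegel_domain" "act g \<sigma> = \<tau>" unfolding \<sigma>_def by (rule act_unitary_inv[OF g t])+
    have "k * jfac g \<sigma> \<noteq> 0" using k(1) unitary_height(1)[OF lat_unitaryD[OF g] s(1)] by simp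
    hence "tval v \<sigma> = 0" if "tval (g *v v) \<tau> = 0" for v using k(2)[OF s(1), of v] that unfolding s(2) by auto
    thus False using no_common_zero[OF s(1)] z by blast
  qed
  have sub: "Upsilon_index3 a b c d \<subseteq> Gamma_sqrt_m3" unfolding Upsilon_index3_def Upsilon_def by auto
  show "PROP ?ab"
    by (rule modular_form_from_vectors[OF e cub ncz sub gamma_char_eq_int[OF _ u(1) u(2)]])
  have cub': "tval (g *v ua) \<tau> ^ 3 + tval (g *v uc) \<tau> ^ 3 + tval (g *v ub) \<tau> ^ 3 = 0"
    "tval (g *v ub) \<tau> ^ 3 + tval (g *v uc) \<tau> ^ 3 + tval (g *v ua) \<tau> ^ 3 = 0" if "\<tau> \<in> siegel_domain" for \<tau>
    using cub[OF that] by (simp_all only: add_ac)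
  have ncz': "tval (g *v ua) \<tau> \<noteq> 0 \<or> tval (g *v uc) \<tau> \<noteq> 0 \<or> tval (g *v ub) \<tau> \<noteq> 0"
    "tval (g *v ub) \<tau> \<noteq> 0 \<or> tval (g *v uc) \<tau> \<noteq> 0 \<or> tval (g *v ua) \<tau> \<noteq> 0" if "\<tau> \<in> siegel_domain" for \<tau>
    using ncz[OF that] by blast+
  show "PROP ?ac"
    by (rule modular_form_from_vectors[OF e(1) e(3) e(2) cub'(1) ncz'(1) sub gamma_char_eq_int[OF _ u(1) u(3)]])
  show "PROP ?bc"
    by (rule modular_form_from_vectors[OF e(2) e(3) e(1) cub'(2) ncz'(2) sub gamma_char_eq_int[OF _ u(2) u(3)]])
qed

theorem theorem3:
  fixes a b c d :: nat
  assumes "(a, b, c, d) \<in>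
    {(0,0,1,0), (0,0,1,1), (0,0,1,2), (0,1,1,0), (0,1,2,0), (1,0,0,0),
     (1,0,0,1), (1,0,0,2), (1,1,0,0), (1,1,2,2), (1,2,0,0), (1,2,2,1)}"
  shows "\<exists>f. holomorphic_modular_form 1 3 (Upsilon_index3 a b c d) f \<and>
             (\<exists>\<tau>\<in>siegel_domain. f \<tau> \<noteq> 0)"
proof -
  \<comment> \<open>The elements \<open>mat 1\<close>, \<open>herm_J\<close>, \<open>n 1\<close>,
    \<open>n (- 1)\<close> send the first basis vector to (1,0,0), (0,0,1), (1,1,1), (1,-1,1) modulo
    \<open>sqrt_m3\<close>, which represent the four isotropic lines.\<close>
  define n where "n = (\<lambda>e::int. heis (of_int e) zeta3 ** herm_J)"
  have nU: "n e \<in> lat_unitary" if "e * e = 1" for e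
  proof -
    have "complex_of_int e * cnj (of_int e) = 1" using that by (metis complex_cnj_of_int of_int_1 of_int_mult)
    thus ?thesis unfolding n_def by (intro lat_unitary_mult herm_J_unitary heis_unitary) (simp_all add: cnj_zeta3)
  qed
  have r1: "vec_residue (mat 1 *v ua) 0 1 1" "vec_residue (mat 1 *v ub) 0 (- 1) 1" "vec_residue (mat 1 *v uc) 1 0 (- 1)"
    using vec_residue_u by simp_all
  note rJ = vec_residue_J[OF vec_residue_u(1)] vec_residue_J[OF vec_residue_u(2)] vec_residue_J[OF vec_residue_u(3)]
  have rn: "vec_residue (n e *v ua) (1 - e * 1 + 0) (1 + e * 0) 0" "vec_residue (n e *v ub) (1 - e * - 1 + 0) (- 1 + e * 0) 0"
    "vec_residue (n e *v uc) (- 1 - e * 0 + 1) (0 + e * 1) 1" for e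
    unfolding n_def matrix_vector_mul_assoc[symmetric] by (rule vec_residue_heis[OF rJ(1)] vec_residue_heis[OF rJ(2)] vec_residue_heis[OF rJ(3)])+
  note f1 = modular_form_from_pair[OF mat_1_unitary r1]
  note fJ = modular_form_from_pair[OF herm_J_unitary rJ]
  note fp = modular_form_from_pair[OF nU[of 1] rn[of 1]]
  note fm = modular_form_from_pair[OF nU[of "-1"] rn[of "-1"]]
  let ?P = "\<lambda>a b c d. \<exists>f. holomorphic_modular_form 1 3 (Upsilon_index3 a b c d) f \<and> (\<exists>\<tau>\<in>siegel_domain. f \<tau> \<noteq> 0)"
  \<comment> \<open>In each case \<open>k\<close> is the sign with which the difference of the two
    quadratic vectors is the prescribed one; 2 stands for -1.\<close>
  have "?P 1 0 0 0" by (rule f1(1)[where k = 1]) simp_all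
  moreover have "?P 1 0 0 1" by (rule f1(2)[where k = 2]) simp_all
  moreover have "?P 1 0 0 2" by (rule f1(3)[where k = 1]) simp_all
  moreover have "?P 0 0 1 0" by (rule fJ(1)[where k = 1]) simp_all
  moreover have "?P 0 1 1 0" by (rule fJ(2)[where k = 2]) simp_all
  moreover have "?P 0 1 2 0" by (rule fJ(3)[where k = 2]) simp_all
  moreover have "?P 0 0 1 2" by (rule fp(1)[where k = 1]) simp_all
  moreover have "?P 1 2 0 0" by (rule fp(2)[where k = 1]) simp_all
  moreover have "?P 1 2 2 1" by (rule fp(3)[where k = 1]) simp_all
  moreover have "?P 0 0 1 1" by (rule fm(1)[where k = 1]) simp_all
  moreover have "?P 1 1 2 2" by (rule fm(2)[where k = 2]) simp_all
  moreover have "?P 1 1 0 0" by (rule fm(3)[where k = 2]) simp_all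
  ultimately show ?thesis using assms unfolding insert_iff empty_iff prod.inject by metis
qed

end
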